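(* Let $A\in\mathbb{R}^{N\times N}$ be a constant symmetric matrix such that, for some $a_1>0$, $A\xi\cdot\xi\ge a_1|\xi|^2$ for every $\xi\in\mathbb{R}^N$. Let $\Omega_0,\Omega_1\subset\mathbb{R}^N$ be non-empty open convex sets and, for every $r\in[0,1]$, set $$\Omega_r:=(1-r)\Omega_0+r\Omega_1=\{(1-r)x+ry:\ x\in\Omega_0,\ y\in\Omega_1\}.$$ Let $V:\bigcup_{r\in[0,1]}\Omega_r\to\mathbb{R}$ be a function such that: (i) $V$ is convex in $\bigcup_{r\in[0,1]}\Omega_r$; (ii) for every $r\in[0,1]$, $V$ is Kato decomposable in $\Omega_r$, i.e. $V^+\in L^1_{\rm loc}(\Omega_r)$ and $V^-\in\mathcal{K}(\Omega_r)$; (iii) for every $r\in[0,1]$ and every $t>0$, $e^{-tV}\in L^1(\Omega_r)$. Then, for every $r\in[0,1]$, $$\lambda_{1,V}(\Omega_r)\le(1-r)\,\lambda_{1,V}(\Omega_0)+r\,\lambda_{1,V}(\Omega_1),$$ where $\lambda_{1,V}(\Omega)$ denotes the first Dirichlet eigenvalue in $\Omega$ of the operator $\mathcal{H}_V=-\operatorname{div}(A\nabla)+V$.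
   Context: Notation: $k^+:=\max\{k,0\}$ and $k^-:=\max\{-k,0\}$ for $k\in\mathbb{R}$, applied pointwise to functions. Kato class: let $D\subseteq\mathbb{R}^N$ be a non-empty open set. If $N\ge2$, a function $W$ belongs to $\mathcal{K}(D)$ if $$\lim_{r\to0^+}\sup_{x\in D}\int_{B_r(x)\cap D}|W(y)|\,\mathbb{G}_N(x-y)\,dy=0,$$ where $\mathbb{G}_N$ is the Green function (fundamental solution) of the Laplacian in $\mathbb{R}^N$. If $N=1$, $W\in\mathcal{K}(D)$ if $\sup_{x\in D}\int_{B_1(x)\cap D}|W(y)|\,dy<\infty$. First eigenvalue: for an open convex set $\Omega$ on which $V$ is convex, Kato decomposable, and satisfies $e^{-tV}\in L^1(\Omega)$ for all $t>0$, the potential $V$ is bounded below on $\Omega$. Set $$\mathcal{Q}_V(u):=\int_\Omega A\nabla u\cdot\nabla u\,dx+\int_\Omega Vu^2\,dx,\qquad D(\mathcal{Q}_V):=H^1_0(\Omega)\cap L^2_V(\Omega),$$ where $L^2_V(\Omega):=\{w\in L^2(\Omega):\sqrt{V^+}\,w\in L^2(\Omega)\}$. The self-adjoint operator in $L^2(\Omega)$ associated with this form is the realization of $\mathcal{H}_V$ with homogeneous Dirichlet boundary conditions in $\Omega$; its spectrum is discrete, and its smallest eigenvalue (possibly negative) is $$\lambda_{1,V}(\Omega)=\inf_{u\in D(\mathcal{Q}_V)\setminus\{0\}}\frac{\mathcal{Q}_V(u)}{\|u\|_{L^2(\Omega)}^2}.$$ *)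

theory Defs
  imports "HOL-Analysis.Analysis"
begin

definition pos_part :: "('a \<Rightarrow> real) \<Rightarrow> 'a \<Rightarrow> real"
  where "pos_part f x = max (f x) 0"

definition neg_part :: "('a \<Rightarrow> real) \<Rightarrow> 'a \<Rightarrow> real"
  where "neg_part f x = max (- f x) 0"

section \<open>Kato class\<close>

text \<open>
  Fundamental solution of the negative Laplacian in dimension at least 2. In dimension 2 it is
  negative for norm greater than 1, which is irrelevant for the limit of small radii in the Kato
  condition. The value at 0 is arbitrary (a null set).
\<close>

definition green_fun :: "real^'n \<Rightarrow> real"
  where "green_fun x =
    (if CARD('n) = 2 then ln (1 / norm x) / (2 * pi)
     else 1 / (real CARD('n) * (real CARD('n) - 2) * unit_ball_vol (real CARD('n))
               * norm x ^ (CARD('n) - 2)))"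

definition kato_class :: "(real^'n) set \<Rightarrow> (real^'n \<Rightarrow> real) set"
  where "kato_class D = {W. W \<in> borel_measurable (lebesgue_on D) \<and>
    (if CARD('n) = 1
     then (SUP x\<in>D. \<integral>\<^sup>+ y. ennreal \<bar>W y\<bar> \<partial>lebesgue_on (ball x 1 \<inter> D)) < \<infinity>
     else ((\<lambda>r. SUP x\<in>D. \<integral>\<^sup>+ y. ennreal (\<bar>W y\<bar> * green_fun (x - y))
                              \<partial>lebesgue_on (ball x r \<inter> D)) \<longlongrightarrow> 0) (at_right 0))}"

definition L1_loc :: "(real^'n) set \<Rightarrow> (real^'n \<Rightarrow> real) set"
  where "L1_loc D = {f. \<forall>K. compact K \<and> K \<subseteq> D \<longrightarrow> integrable (lebesgue_on K) f}"

definition kato_decomposable :: "(real^'n) set \<Rightarrow> (real^'n \<Rightarrow> real) \<Rightarrow> bool"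
  where "kato_decomposable D V \<longleftrightarrow> pos_part V \<in> L1_loc D \<and> neg_part V \<in> kato_class D"

section \<open>Sobolev spaces\<close>

text \<open>
  Elements of Lebesgue and Sobolev spaces on an open set are represented by functions on the
  whole space, whose values outside the set are irrelevant; functions that agree almost
  everywhere on the set represent the same element.
\<close>

definition partial :: "'n \<Rightarrow> (real^'n \<Rightarrow> real) \<Rightarrow> real^'n \<Rightarrow> real"
  where "partial i f x = frechet_derivative f (at x) (axis i 1)"

primrec Ck :: "nat \<Rightarrow> (real^'n \<Rightarrow> real) \<Rightarrow> bool"
  where
    "Ck 0 f \<longleftrightarrow> continuous_on UNIV f"
  | "Ck (Suc k) f \<longleftrightarrow> (\<forall>x. f differentiable (at x)) \<and> (\<forall>i. Ck k (partial i f))"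

definition test_functions :: "(real^'n) set \<Rightarrow> (real^'n \<Rightarrow> real) set"
  where "test_functions \<Omega> = {\<phi>. (\<forall>k. Ck k \<phi>) \<and>
    compact (closure {x. \<phi> x \<noteq> 0}) \<and> closure {x. \<phi> x \<noteq> 0} \<subseteq> \<Omega>}"

definition L2 :: "(real^'n) set \<Rightarrow> (real^'n \<Rightarrow> real) set"
  where "L2 \<Omega> = {u. u \<in> borel_measurable (lebesgue_on \<Omega>) \<and>
                       integrable (lebesgue_on \<Omega>) (\<lambda>x. (u x)\<^sup>2)}"

definition L2_norm :: "(real^'n) set \<Rightarrow> (real^'n \<Rightarrow> real) \<Rightarrow> real"
  where "L2_norm \<Omega> u = sqrt (\<integral>x. (u x)\<^sup>2 \<partial>lebesgue_on \<Omega>)"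

definition is_weak_gradient ::
    "(real^'n) set \<Rightarrow> (real^'n \<Rightarrow> real) \<Rightarrow> (real^'n \<Rightarrow> real^'n) \<Rightarrow> bool"
  where "is_weak_gradient \<Omega> u G \<longleftrightarrow> (\<forall>i. (\<lambda>x. G x $ i) \<in> L2 \<Omega>) \<and>
    (\<forall>\<phi>\<in>test_functions \<Omega>. \<forall>i.
       (\<integral>x. u x * partial i \<phi> x \<partial>lebesgue_on \<Omega>) =
       - (\<integral>x. (G x $ i) * \<phi> x \<partial>lebesgue_on \<Omega>))"

definition H1 :: "(real^'n) set \<Rightarrow> (real^'n \<Rightarrow> real) set"
  where "H1 \<Omega> = {u \<in> L2 \<Omega>. \<exists>G. is_weak_gradient \<Omega> u G}"

text \<open>The weak gradient is unique up to a null set, so this picks a representative.\<close>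

definition weak_gradient ::
    "(real^'n) set \<Rightarrow> (real^'n \<Rightarrow> real) \<Rightarrow> real^'n \<Rightarrow> real^'n"
  where "weak_gradient \<Omega> u = (SOME G. is_weak_gradient \<Omega> u G)"

definition H1_norm :: "(real^'n) set \<Rightarrow> (real^'n \<Rightarrow> real) \<Rightarrow> real"
  where "H1_norm \<Omega> u = sqrt ((\<integral>x. (u x)\<^sup>2 \<partial>lebesgue_on \<Omega>) +
                              (\<integral>x. (norm (weak_gradient \<Omega> u x))\<^sup>2 \<partial>lebesgue_on \<Omega>))"

text \<open>The closure of the test functions in the Sobolev norm.\<close>

definition H1_0 :: "(real^'n) set \<Rightarrow> (real^'n \<Rightarrow> real) set"
  where "H1_0 \<Omega> = {u \<in> H1 \<Omega>. \<forall>\<epsilon>>0. \<exists>\<phi>\<in>test_functions \<Omega>. H1_norm \<Omega> (\<lambda>x. u x - \<phi> x) < \<epsilon>}"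

section \<open>The quadratic form and the first Dirichlet eigenvalue\<close>

definition L2_weighted :: "(real^'n \<Rightarrow> real) \<Rightarrow> (real^'n) set \<Rightarrow> (real^'n \<Rightarrow> real) set"
  where "L2_weighted V \<Omega> = {w \<in> L2 \<Omega>. (\<lambda>x. sqrt (pos_part V x) * w x) \<in> L2 \<Omega>}"

definition form_domain :: "(real^'n \<Rightarrow> real) \<Rightarrow> (real^'n) set \<Rightarrow> (real^'n \<Rightarrow> real) set"
  where "form_domain V \<Omega> = H1_0 \<Omega> \<inter> L2_weighted V \<Omega>"

definition quad_form ::
    "real^'n^'n \<Rightarrow> (real^'n \<Rightarrow> real) \<Rightarrow> (real^'n) set \<Rightarrow> (real^'n \<Rightarrow> real) \<Rightarrow> real"
  where "quad_form A V \<Omega> u =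
    (\<integral>x. (A *v weak_gradient \<Omega> u x) \<bullet> weak_gradient \<Omega> u x \<partial>lebesgue_on \<Omega>) +
    (\<integral>x. V x * (u x)\<^sup>2 \<partial>lebesgue_on \<Omega>)"

text \<open>
  The smallest eigenvalue of the self-adjoint operator associated with the form, given by its
  Rayleigh quotient. For potentials that are convex and Kato decomposable on an open convex set
  and whose exponentials \<open>exp (- t * V)\<close> are integrable there for all positive \<open>t\<close>, the potential
  is bounded below, so the infimum is that of a non-empty set of reals that is bounded below.
\<close>

definition first_eigenvalue ::
    "real^'n^'n \<Rightarrow> (real^'n \<Rightarrow> real) \<Rightarrow> (real^'n) set \<Rightarrow> real"
  where "first_eigenvalue A V \<Omega> =
    Inf {quad_form A V \<Omega> u / (L2_norm \<Omega> u)\<^sup>2 | u.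
           u \<in> form_domain V \<Omega> \<and> \<not> (AE x in lebesgue_on \<Omega>. u x = 0)}"

definition minkowski_interp ::
    "(real^'n) set \<Rightarrow> (real^'n) set \<Rightarrow> real \<Rightarrow> (real^'n) set"
  where "minkowski_interp \<Omega>0 \<Omega>1 r = {(1 - r) *\<^sub>R x + r *\<^sub>R y | x y. x \<in> \<Omega>0 \<and> y \<in> \<Omega>1}"

end

theory Submission
  imports Defs "HOL-Probability.Probability"
begin

text \<open>
  The proof follows the idea of Brascamp and Lieb. Call functions \<open>f\<close>, \<open>g\<close>, \<open>h\<close> log-concavely related if
  \<open>f(x)\<^sup>1\<^sup>-\<^sup>r g(y)\<^sup>r \<le> h((1 - r) x + r y)\<close> for all \<open>x\<close>, \<open>y\<close>. By the Prekopa-Leindler inequality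
  the relation survives convolution with a Gaussian, and it survives multiplication by
  \<open>exp (- t V)\<close> when \<open>V\<close> is convex; a Dirichlet condition is multiplication by an indicator function,
  and indicator functions of sets \<open>K0\<close>, \<open>K1\<close>, \<open>(1 - r) K0 + r K1\<close> are related. By the Trotter formula the
  semigroups of the operator on the three domains therefore preserve the relation. Their total masses
  decay like \<open>exp (- n t \<lambda>)\<close> with the respective first eigenvalues \<open>\<lambda>\<close>, and one more application of
  Prekopa-Leindler, to these masses, compares the three rates.

  The semigroup of the operator is not constructed. The limit in the number of steps is taken for a fixed
  time step \<open>t = 1 / 2 ^ k\<close>, with the operator \<open>step\<close>: multiply by \<open>exp (- t V / 2)\<close> on a compact subset \<open>K\<close>
  of the domain (and by \<open>0\<close> outside), convolve with the Gaussian \<open>N t\<close> of second moment \<open>2 t A\<close>, multiply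
  again. All that is needed about it are two estimates that are exact to first order in \<open>t\<close>: its norm on
  the interpolated domain is at most \<open>exp (- t (\<lambda> - \<epsilon>))\<close> (\<open>step_upper\<close>), and on the two given
  domains its quadratic form at a suitable nonnegative function is at least
  \<open>exp (- t (\<lambda> + \<epsilon>))\<close> times the squared norm (\<open>step_lower\<close>). The comparison is \<open>nonlocal_brunn_minkowski\<close>.

  The Dirichlet integral enters through the increment energy \<open>E t f = \<langle>f, f - P t f\<rangle>\<close>, which is half the
  mean of \<open>\<integral> (f (x + z) - f x)\<^sup>2 dx\<close> over \<open>z\<close> distributed by \<open>N t\<close>. The quotient \<open>E t f / t\<close> increases when \<open>t\<close> is
  halved, and for a test function it converges to the Dirichlet integral. So a bounded function \<open>w\<close>
  with compact support and \<open>E (1 / 2 ^ j) w \<le> c / 2 ^ j\<close> for all large \<open>j\<close> takes the place of a Sobolev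
  function of energy at most \<open>c\<close>, and no weak derivatives of such functions are used.
  Mollification extends the Rayleigh bound from test functions to them
  (\<open>rayleigh_bound_extend\<close>). Conversely, an almost optimal element of the form domain is turned into such a
  function in \<open>trial_function\<close>: it is replaced by its minimum with an approximating test function, whose
  energy is controlled by the submodularity of \<open>E t\<close>.

  The potential may be shifted to be nonnegative, since a convex function with integrable
  \<open>exp (- V)\<close> is bounded below (\<open>convex_bounded_below_if_exp_integrable\<close>).
\<close>

section \<open>The Prekopa-Leindler inequality\<close>

text \<open>
  Translate \<open>A\<close> by the minimum of \<open>B\<close> and \<open>B\<close> by the maximum of \<open>A\<close>: both translates lie in \<open>C\<close>, one to the
  left and one to the right of the only point that they share.
\<close>

lemma brunn_minkowski_real_compact:
  fixes A B C :: "real set"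
  assumes A: "compact A" "A \<noteq> {}" and B: "compact B" "B \<noteq> {}" and C: "C \<in> sets borel"
    and AB: "\<And>a b. a \<in> A \<Longrightarrow> b \<in> B \<Longrightarrow> a + b \<in> C"
  shows "emeasure lborel A + emeasure lborel B \<le> emeasure lborel C"
proof -
  obtain a0 where a0: "a0 \<in> A" "\<And>a. a \<in> A \<Longrightarrow> a \<le> a0"
    using compact_attains_sup[OF A] by auto
  obtain b0 where b0: "b0 \<in> B" "\<And>b. b \<in> B \<Longrightarrow> b0 \<le> b"
    using compact_attains_inf[OF B] by auto
  have [measurable]: "A \<in> sets borel" "B \<in> sets borel" using A B by (auto simp: borel_compact)
  note C[measurable]
  define X where "X = (+) (- b0) -` A"
  define Y where "Y = (+) (- a0) -` B"
  have X[measurable]: "X \<in> sets borel" unfolding X_def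
    by (rule measurable_sets_borel[of _ borel]) auto
  have Y[measurable]: "Y \<in> sets borel" unfolding Y_def
    by (rule measurable_sets_borel[of _ borel]) auto
  have tr: "emeasure lborel ((+) c -` S) = emeasure lborel S" if "S \<in> sets borel" for c :: real and S
    using that by (subst (2) lborel_distr_plus[of c, symmetric]) (simp add: emeasure_distr)
  have eX: "emeasure lborel X = emeasure lborel A" unfolding X_def by (rule tr) auto
  have eY: "emeasure lborel Y = emeasure lborel B" unfolding Y_def by (rule tr) auto
  (* Removing the common point makes the translates disjoint. *)
  have eY': "emeasure lborel (Y - {a0 + b0}) = emeasure lborel Y"
    by (rule emeasure_Diff_null_set) auto
  have disj: "X \<inter> (Y - {a0 + b0}) = {}"
    using a0 b0 by (force simp: X_def Y_def)
  have sub: "X \<union> (Y - {a0 + b0}) \<subseteq> C"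
  proof
    fix x assume "x \<in> X \<union> (Y - {a0 + b0})"
    then show "x \<in> C" using AB[of "x - b0" b0] AB[of a0 "x - a0"] a0 b0 by (auto simp: X_def Y_def)
  qed
  have "emeasure lborel A + emeasure lborel B = emeasure lborel (X \<union> (Y - {a0 + b0}))"
    using disj eX eY eY' by (subst plus_emeasure[symmetric]) auto
  also have "\<dots> \<le> emeasure lborel C" using sub by (intro emeasure_mono) auto
  finally show ?thesis .
qed

text \<open>
  Inner regularity holds for finite Borel measures, and Lebesgue measure restricted to \<open>A\<close> is one.
\<close>

lemma emeasure_lborel_inner_compact:
  fixes A :: "'a::euclidean_space set"
  assumes A[measurable]: "A \<in> sets borel" and fin: "emeasure lborel A < \<infinity>"
  shows "emeasure lborel A = (SUP K\<in>{K. K \<subseteq> A \<and> compact K}. emeasure lborel K)"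
proof -
  define M where "M = density lborel (indicator A :: 'a \<Rightarrow> ennreal)"
  have eM: "emeasure M S = emeasure lborel (A \<inter> S)" if [measurable]: "S \<in> sets borel" for S
    unfolding M_def by (subst emeasure_density) (auto simp: indicator_inter_arith[symmetric] )
  have sM: "sets M = sets borel" by (simp add: M_def)
  have "emeasure M A = (SUP K\<in>{K. K \<subseteq> A \<and> compact K}. emeasure M K)"
    by (rule inner_regular[OF sM]) (use fin eM[of UNIV] eM[of A] in \<open>auto simp: space_borel M_def\<close>)
  moreover have "emeasure M K = emeasure lborel K" if "K \<subseteq> A" "compact K" for K
    using that eM[of K] by (simp add: borel_compact Int_absorb1)
  ultimately show ?thesis using eM[of A] by (auto cong: SUP_cong_simp)
qed

lemma brunn_minkowski_real:
  fixes A B C :: "real set"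
  assumes A: "A \<in> sets borel" "A \<noteq> {}" "emeasure lborel A < \<infinity>"
    and B: "B \<in> sets borel" "B \<noteq> {}" "emeasure lborel B < \<infinity>"
    and C: "C \<in> sets borel"
    and AB: "\<And>a b. a \<in> A \<Longrightarrow> b \<in> B \<Longrightarrow> a + b \<in> C"
  shows "emeasure lborel A + emeasure lborel B \<le> emeasure lborel C"
proof -
  obtain a b where ab: "a \<in> A" "b \<in> B" using A B by auto
  have cp: "emeasure lborel K + emeasure lborel L \<le> emeasure lborel C"
    if "K \<subseteq> A" "compact K" "L \<subseteq> B" "compact L" for K L
  proof -
    have "emeasure lborel K + emeasure lborel L
        \<le> emeasure lborel (insert a K) + emeasure lborel (insert b L)"
      using that by (intro add_mono emeasure_mono) (auto simp: borel_compact)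
    also have "\<dots> \<le> emeasure lborel C"
      using that ab by (intro brunn_minkowski_real_compact C) (auto intro!: AB)
    finally show ?thesis .
  qed
  have "emeasure lborel A + emeasure lborel L \<le> emeasure lborel C" if "L \<subseteq> B" "compact L" for L
    unfolding emeasure_lborel_inner_compact[OF A(1,3)]
    by (subst ennreal_SUP_add_left[symmetric]) (use that cp in \<open>auto intro!: SUP_least\<close>)
  then show ?thesis
    unfolding emeasure_lborel_inner_compact[OF B(1,3)]
    by (subst ennreal_SUP_add_right) (auto intro!: SUP_least)
qed

text \<open>
  Fubini, applied to \<open>f x = \<integral> 1\<^bsub>0 < t < f x\<^esub> dt\<close>.
\<close>

lemma nn_integral_layer_cake:
  fixes f :: "real \<Rightarrow> real"
  assumes [measurable]: "f \<in> borel_measurable borel" and nn: "\<And>x. 0 \<le> f x"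
  shows "(\<integral>\<^sup>+ x. ennreal (f x) \<partial>lborel)
    = (\<integral>\<^sup>+ t. indicator {0<..} t * emeasure lborel {x. t < f x} \<partial>lborel)"
proof -
  have "(\<integral>\<^sup>+ x. ennreal (f x) \<partial>lborel)
      = (\<integral>\<^sup>+ x. (\<integral>\<^sup>+ t. indicator {0<..} t * indicator {t. t < f x} t \<partial>lborel) \<partial>lborel)"
  proof (rule nn_integral_cong)
    fix x
    have "(\<integral>\<^sup>+ t. indicator {0<..} t * indicator {t. t < f x} t \<partial>lborel)
        = (\<integral>\<^sup>+ t. indicator {0<..<f x} t \<partial>lborel)"
      by (intro nn_integral_cong) (auto simp: indicator_def)
    also have "\<dots> = ennreal (f x)" using nn[of x] by simp
    finally show "ennreal (f x) = (\<integral>\<^sup>+ t. indicator {0<..} t * indicator {t. t < f x} t \<partial>lborel)"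
      by simp
  qed
  also have "\<dots> = (\<integral>\<^sup>+ t. (\<integral>\<^sup>+ x. indicator {0<..} t * indicator {t. t < f x} t \<partial>lborel) \<partial>lborel)"
    by (rule lborel_pair.Fubini') measurable
  also have "\<dots> = (\<integral>\<^sup>+ t. indicator {0<..} t * emeasure lborel {x. t < f x} \<partial>lborel)"
  proof (rule nn_integral_cong)
    fix t :: real
    have "(\<integral>\<^sup>+ x. indicator {0<..} t * indicator {t. t < f x} t \<partial>lborel)
       = indicator {0<..} t * (\<integral>\<^sup>+ x. indicator {x. t < f x} x \<partial>lborel)"
      by (subst nn_integral_cmult[symmetric]) (auto simp: indicator_def intro!: nn_integral_cong)
    also have "(\<integral>\<^sup>+ x. indicator {x. t < f x} x \<partial>lborel) = emeasure lborel {x. t < f x}"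
      by (intro nn_integral_indicator) auto
    finally show "(\<integral>\<^sup>+ x. indicator {0<..} t * indicator {t. t < f x} t \<partial>lborel)
      = indicator {0<..} t * emeasure lborel {x. t < f x}" .
  qed
  finally show ?thesis .
qed

lemma emeasure_lborel_scale_real:
  fixes c :: real
  assumes [measurable]: "A \<in> sets borel" and c: "c > 0"
  shows "emeasure lborel {x. x / c \<in> A} = ennreal c * emeasure lborel A"
proof -
  have m[measurable]: "{x. x / c \<in> A} \<in> sets borel" by measurable
  have "emeasure lborel {x. x / c \<in> A} = (\<integral>\<^sup>+x. indicator {x. x / c \<in> A} x \<partial>lborel)" by simp
  also have "\<dots> = ennreal \<bar>c\<bar> * (\<integral>\<^sup>+x. indicator {x. x / c \<in> A} (0 + c * x) \<partial>lborel)"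
    using c by (intro nn_integral_real_affine) auto
  also have "(\<integral>\<^sup>+x. indicator {x. x / c \<in> A} (0 + c * x) \<partial>lborel) = (\<integral>\<^sup>+x. indicator A x \<partial>lborel)"
    using c by (intro nn_integral_cong) (auto simp: indicator_def)
  finally show ?thesis using c by simp
qed

lemma emeasure_superlevel_finite:
  fixes f :: "'a \<Rightarrow> real"
  assumes f: "integrable M f" "\<And>x. 0 \<le> f x" and t: "t > 0"
  shows "emeasure M {x\<in>space M. t < f x} < \<infinity>"
proof -
  have [measurable]: "f \<in> borel_measurable M" using assms by auto
  have "emeasure M {x\<in>space M. t < f x} \<le> emeasure M {x\<in>space M. t \<le> f x}"
    by (intro emeasure_mono) auto
  also have "\<dots> \<le> ennreal ((1 / t) * (\<integral>x. f x \<partial>M))"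
    using f t by (intro integral_Markov_inequality) auto
  also have "\<dots> < \<infinity>" by simp
  finally show ?thesis .
qed

text \<open>
  When both suprema are \<open>1\<close>, the superlevel sets of \<open>f\<close> and \<open>g\<close> at every level below \<open>1\<close> are non-empty, and the
  corresponding superlevel set of \<open>h\<close> contains their combination. Integrating the one-dimensional
  Brunn-Minkowski inequality over the levels gives a bound by the arithmetic mean.
\<close>

lemma prekopa_leindler_real_normalized:
  fixes f g h :: "real \<Rightarrow> real"
  assumes r: "0 < r" "r < 1"
    and [measurable]: "f \<in> borel_measurable borel" "g \<in> borel_measurable borel" "h \<in> borel_measurable borel"
    and f: "\<And>x. 0 \<le> f x" "\<And>x. f x \<le> 1" "\<And>t. t < 1 \<Longrightarrow> \<exists>x. t < f x" "integrable lborel f"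
    and g: "\<And>x. 0 \<le> g x" "\<And>x. g x \<le> 1" "\<And>t. t < 1 \<Longrightarrow> \<exists>x. t < g x" "integrable lborel g"
    and h: "\<And>x. 0 \<le> h x" "integrable lborel h"
    and rel: "\<And>x y. f x powr (1 - r) * g y powr r \<le> h ((1 - r) * x + r * y)"
  shows "(1 - r) * integral\<^sup>L lborel f + r * integral\<^sup>L lborel g \<le> integral\<^sup>L lborel h"
proof -
  have lev: "ennreal (1 - r) * emeasure lborel {x. t < f x} + ennreal r * emeasure lborel {x. t < g x}
      \<le> emeasure lborel {x. t < h x}" if t: "t > 0" for t
  proof (cases "t < 1")
    case True
    let ?A = "{x. x / (1 - r) \<in> {x. t < f x}}" and ?B = "{x. x / r \<in> {x. t < g x}}"
    have eA: "emeasure lborel ?A = ennreal (1 - r) * emeasure lborel {x. t < f x}"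
      using r by (intro emeasure_lborel_scale_real) auto
    have eB: "emeasure lborel ?B = ennreal r * emeasure lborel {x. t < g x}"
      using r by (intro emeasure_lborel_scale_real) auto
    have "emeasure lborel ?A + emeasure lborel ?B \<le> emeasure lborel {x. t < h x}"
    proof (rule brunn_minkowski_real)
      show "?A \<in> sets borel" "?B \<in> sets borel" "{x. t < h x} \<in> sets borel" by measurable
      obtain x y where xy: "t < f x" "t < g y" using f(3) g(3) True by blast
      have "(1 - r) * x \<in> ?A" "r * y \<in> ?B" using xy r by auto
      then show "?A \<noteq> {}" "?B \<noteq> {}" by blast+
      show "emeasure lborel ?A < \<infinity>" "emeasure lborel ?B < \<infinity>"
        unfolding eA eB using emeasure_superlevel_finite[OF f(4,1) t] emeasure_superlevel_finite[OF g(4,1) t]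
        by (auto simp: ennreal_mult_less_top)
      fix a b assume "a \<in> ?A" "b \<in> ?B"
      then have ab: "t < f (a / (1 - r))" "t < g (b / r)" by auto
      have "t = t powr (1 - r) * t powr r" using t by (simp add: powr_add[symmetric])
      also have "\<dots> < f (a / (1 - r)) powr (1 - r) * g (b / r) powr r"
        using ab t r by (intro mult_strict_mono powr_less_mono2) auto
      also have "\<dots> \<le> h ((1 - r) * (a / (1 - r)) + r * (b / r))" by (rule rel)
      also have "\<dots> = h (a + b)" using r by simp
      finally show "a + b \<in> {x. t < h x}" by simp
    qed
    then show ?thesis unfolding eA eB .
  next
    case False
    then have "{x. t < f x} = {}" "{x. t < g x} = {}" using f(2) g(2)
      by (auto simp: not_less intro: order_trans)
    then show ?thesis by simp
  qed
  have i: "(\<integral>\<^sup>+x. ennreal (u x) \<partial>lborel) = ennreal (integral\<^sup>L lborel u)"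
    if "integrable lborel u" "\<And>x. 0 \<le> u x" for u :: "real \<Rightarrow> real"
    using that by (intro nn_integral_eq_integral) auto
  have "ennreal ((1 - r) * integral\<^sup>L lborel f + r * integral\<^sup>L lborel g)
      = ennreal (1 - r) * (\<integral>\<^sup>+x. ennreal (f x) \<partial>lborel) + ennreal r * (\<integral>\<^sup>+x. ennreal (g x) \<partial>lborel)"
    using r f g by (simp add: i ennreal_plus ennreal_mult integral_nonneg_AE)
  also have "\<dots> = (\<integral>\<^sup>+t. ennreal (1 - r) * (indicator {0<..} t * emeasure lborel {x. t < f x})
        + ennreal r * (indicator {0<..} t * emeasure lborel {x. t < g x}) \<partial>lborel)"
    using f(1) g(1) by (simp add: nn_integral_layer_cake nn_integral_add nn_integral_cmult)
  also have "\<dots> \<le> (\<integral>\<^sup>+t. indicator {0<..} t * emeasure lborel {x. t < h x} \<partial>lborel)"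
    using lev by (intro nn_integral_mono) (auto simp: indicator_def)
  also have "\<dots> = ennreal (integral\<^sup>L lborel h)"
    using h by (simp add: nn_integral_layer_cake[symmetric] i)
  finally show ?thesis using h by (simp add: ennreal_le_iff integral_nonneg_AE)
qed

text \<open>
  Division by the suprema reduces to the normalized case, and the weighted inequality of arithmetic and
  geometric means makes the bound homogeneous.
\<close>

lemma prekopa_leindler_real:
  fixes f g h :: "real \<Rightarrow> real"
  assumes r: "0 < r" "r < 1"
    and m[measurable]: "f \<in> borel_measurable borel" "g \<in> borel_measurable borel" "h \<in> borel_measurable borel"
    and f: "\<And>x. 0 \<le> f x" "\<And>x. f x \<le> C" "integrable lborel f"
    and g: "\<And>x. 0 \<le> g x" "\<And>x. g x \<le> C" "integrable lborel g"
    and h: "\<And>x. 0 \<le> h x" "integrable lborel h"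
    and rel: "\<And>x y. f x powr (1 - r) * g y powr r \<le> h ((1 - r) * x + r * y)"
  shows "integral\<^sup>L lborel f powr (1 - r) * integral\<^sup>L lborel g powr r \<le> integral\<^sup>L lborel h"
proof -
  define F where "F = (SUP x. f x)"
  define G where "G = (SUP x. g x)"
  have bF: "bdd_above (range f)" and bG: "bdd_above (range g)" using f g by (auto intro!: bdd_aboveI)
  have Fu: "f x \<le> F" and Gu: "g x \<le> G" for x
    unfolding F_def G_def using bF bG by (auto intro!: cSUP_upper)
  have hn: "0 \<le> integral\<^sup>L lborel h" using h by (intro integral_nonneg_AE) auto
  show ?thesis
  proof (cases "F > 0 \<and> G > 0")
    case False
    then have "(\<forall>x. f x = 0) \<or> (\<forall>x. g x = 0)" using Fu Gu f(1) g(1)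
      by (meson antisym not_less order_trans)
    then have "f = (\<lambda>_. 0) \<or> g = (\<lambda>_. 0)" by (auto simp: fun_eq_iff)
    then have "integral\<^sup>L lborel f = 0 \<or> integral\<^sup>L lborel g = 0" by auto
    then show ?thesis using hn by auto
  next
    case True
    then have FG: "F > 0" "G > 0" by auto
    let ?H = "F powr (1 - r) * G powr r"
    have H: "?H > 0" using FG by auto
    let ?f = "\<lambda>x. f x / F" and ?g = "\<lambda>x. g x / G" and ?h = "\<lambda>x. h x / ?H"
    have "(1 - r) * integral\<^sup>L lborel ?f + r * integral\<^sup>L lborel ?g \<le> integral\<^sup>L lborel ?h"
    proof (rule prekopa_leindler_real_normalized[OF r])
      show "\<exists>x. t < ?f x" if "t < 1" for t
      proof -
        have "t * F < F" using that FG by simp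
        then obtain x where "t * F < f x" unfolding F_def using less_cSUP_iff[OF _ bF] by auto
        then show ?thesis using FG by (auto simp: field_simps)
      qed
      show "\<exists>x. t < ?g x" if "t < 1" for t
      proof -
        have "t * G < G" using that FG by simp
        then obtain x where "t * G < g x" unfolding G_def using less_cSUP_iff[OF _ bG] by auto
        then show ?thesis using FG by (auto simp: field_simps)
      qed
      fix x y
      have "?f x powr (1 - r) * ?g y powr r = (f x powr (1 - r) * g y powr r) / ?H"
        using f(1)[of x] g(1)[of y] FG by (simp add: powr_divide)
      also have "\<dots> \<le> ?h ((1 - r) * x + r * y)"
        using rel[of x y] H by (intro divide_right_mono) auto
      finally show "?f x powr (1 - r) * ?g y powr r \<le> ?h ((1 - r) * x + r * y)" .
    qed (use f g h FG H Fu Gu in \<open>auto simp: divide_le_eq\<close>)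
    then have 1: "(1 - r) * (integral\<^sup>L lborel f / F) + r * (integral\<^sup>L lborel g / G) \<le> integral\<^sup>L lborel h / ?H"
      by simp
    have fn: "0 \<le> integral\<^sup>L lborel f" "0 \<le> integral\<^sup>L lborel g" using f g
      by (auto intro!: integral_nonneg_AE)
    have "(integral\<^sup>L lborel f / F) powr (1 - r) * (integral\<^sup>L lborel g / G) powr r
        \<le> (1 - r) * (integral\<^sup>L lborel f / F) + r * (integral\<^sup>L lborel g / G)"
    proof (cases "integral\<^sup>L lborel f = 0 \<or> integral\<^sup>L lborel g = 0")
      case True
      then show ?thesis using r fn FG by auto
    next
      case False
      then have "integral\<^sup>L lborel f > 0" "integral\<^sup>L lborel g > 0" using fn by auto
      then show ?thesis using r FG by (intro Youngs_inequality_0) auto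
    qed
    with 1 have "(integral\<^sup>L lborel f / F) powr (1 - r) * (integral\<^sup>L lborel g / G) powr r
       \<le> integral\<^sup>L lborel h / ?H" by linarith
    then have "(integral\<^sup>L lborel f powr (1 - r) * integral\<^sup>L lborel g powr r) / ?H \<le> integral\<^sup>L lborel h / ?H"
      using fn FG by (simp add: powr_divide)
    then show ?thesis using H by (simp add: divide_le_cancel)
  qed
qed

text \<open>
  Bounded nonnegative functions supported in a box form a class that is closed under partial
  integration and on which Fubini's theorem applies. The values are constrained at extensional
  functions only, since these are the points of the product space.
\<close>

definition boxed :: "'i set \<Rightarrow> (('i \<Rightarrow> real) \<Rightarrow> real) \<Rightarrow> real \<Rightarrow> real \<Rightarrow> bool" where
  "boxed I f C R \<longleftrightarrow> f \<in> borel_measurable (\<Pi>\<^sub>M i\<in>I. lborel) \<and>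
     (\<forall>x\<in>extensional I. 0 \<le> f x \<and> f x \<le> C \<and> (f x \<noteq> 0 \<longrightarrow> (\<forall>i\<in>I. \<bar>x i\<bar> \<le> R)))"

lemma space_PiM_lborel: "space (\<Pi>\<^sub>M i\<in>I. (lborel :: real measure)) = extensional I"
  by (simp add: space_PiM PiE_def)

lemma boxed_integrable:
  assumes "finite I" "boxed I f C R"
  shows "integrable (\<Pi>\<^sub>M i\<in>I. lborel) f"
proof -
  interpret product_sigma_finite "\<lambda>_. lborel :: real measure" ..
  let ?B = "\<Pi>\<^sub>E i\<in>I. {-R..R}"
  have m[measurable]: "?B \<in> sets (\<Pi>\<^sub>M i\<in>I. lborel)" using assms(1) by (intro sets_PiM_I_finite) auto
  have "emeasure (\<Pi>\<^sub>M i\<in>I. lborel) ?B = (\<Prod>i\<in>I. emeasure lborel {-R..R})"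
    using assms(1) by (intro emeasure_PiM) auto
  also have "\<dots> < \<infinity>" by (simp add: power_less_top_ennreal emeasure_lborel_Icc_eq)
  finally have "integrable (\<Pi>\<^sub>M i\<in>I. lborel) (\<lambda>x. C * indicator ?B x :: real)"
    by (intro integrable_mult_right integrable_real_indicator m)
  then show ?thesis
  proof (rule Bochner_Integration.integrable_bound)
    show "f \<in> borel_measurable (Pi\<^sub>M I (\<lambda>i. lborel))" using assms(2) by (auto simp: boxed_def)
    show "AE x in Pi\<^sub>M I (\<lambda>i. lborel). norm (f x) \<le> norm (C * indicator ?B x :: real)"
    proof (rule AE_I2)
      fix x assume "x \<in> space (Pi\<^sub>M I (\<lambda>i. lborel :: real measure))"
      then have x: "x \<in> extensional I" by (simp add: space_PiM_lborel)
      show "norm (f x) \<le> norm (C * indicator ?B x :: real)"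
      proof (cases "f x = 0")
        case False
        then have "\<forall>i\<in>I. \<bar>x i\<bar> \<le> R" using x assms(2) by (auto simp: boxed_def)
        then have "x \<in> ?B" using x by (auto simp: PiE_def Pi_def abs_le_iff minus_le_iff)
        then show ?thesis using x assms(2) by (auto simp: boxed_def)
      qed simp
    qed
  qed
qed

lemma boxed_slice:
  assumes "i \<notin> I" "boxed (insert i I) f C R" "x \<in> extensional I"
  shows "(\<lambda>s. f (x(i := s))) \<in> borel_measurable borel" "integrable lborel (\<lambda>s. f (x(i := s)))"
    "0 \<le> f (x(i := s))" "f (x(i := s)) \<le> C" "f (x(i := s)) \<noteq> 0 \<Longrightarrow> \<bar>s\<bar> \<le> R"
    "f (x(i := s)) \<noteq> 0 \<Longrightarrow> j \<in> I \<Longrightarrow> \<bar>x j\<bar> \<le> R"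
proof -
  have ext: "x(i := s) \<in> extensional (insert i I)" for s using assms(3) by (auto simp: extensional_def)
  have "(\<lambda>s. x(i := s)) \<in> measurable lborel (Pi\<^sub>M (insert i I) (\<lambda>_. lborel))"
    using assms(3) by (intro measurable_PiM_single') (auto simp: extensional_def PiE_def)
  moreover have "f \<in> borel_measurable (Pi\<^sub>M (insert i I) (\<lambda>_. lborel))" using assms(2) by (simp add: boxed_def)
  ultimately show m: "(\<lambda>s. f (x(i := s))) \<in> borel_measurable borel"
    using measurable_compose[of "\<lambda>s. x(i := s)" lborel "Pi\<^sub>M (insert i I) (\<lambda>_. lborel)" f borel] by simp
  show *: "0 \<le> f (x(i := s))" "f (x(i := s)) \<le> C" for s using assms(2) ext by (auto simp: boxed_def)
  have R: "\<bar>s\<bar> \<le> R" if "f (x(i := s)) \<noteq> 0" for s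
    using assms(2) ext[of s] that by (auto simp: boxed_def)
  show "f (x(i := s)) \<noteq> 0 \<Longrightarrow> \<bar>s\<bar> \<le> R" by (rule R)
  show "\<bar>x j\<bar> \<le> R" if "f (x(i := s)) \<noteq> 0" "j \<in> I"
  proof -
    have "\<forall>k\<in>insert i I. \<bar>(x(i := s)) k\<bar> \<le> R" using assms(2) ext[of s] that(1) unfolding boxed_def by blast
    then show ?thesis using that(2) assms(1) by (auto dest!: bspec[of _ _ j] split: if_splits)
  qed
  have "integrable lborel (\<lambda>s. C * indicator {-R..R} s :: real)"
    by (intro integrable_mult_right integrable_real_indicator) (auto simp: emeasure_lborel_Icc_eq)
  then show "integrable lborel (\<lambda>s. f (x(i := s)))"
  proof (rule Bochner_Integration.integrable_bound)
    show "AE s in lborel. norm (f (x(i := s))) \<le> norm (C * indicator {-R..R} s :: real)"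
    proof (rule AE_I2)
      fix s :: real
      show "norm (f (x(i := s))) \<le> norm (C * indicator {-R..R} s :: real)"
      proof (cases "f (x(i := s)) = 0")
        case False
        then have "s \<in> {-R..R}" using R[of s] by auto
        then show ?thesis using *[of s] by simp
      qed simp
    qed
  qed (use m in auto)
qed

lemma boxed_partial_integral:
  assumes "i \<notin> I" "finite I" "boxed (insert i I) f C R" 
  shows "boxed I (\<lambda>x. \<integral>s. f (x(i := s)) \<partial>lborel) (C * (2 * \<bar>R\<bar>)) R"
proof -
  interpret product_sigma_finite "\<lambda>_. lborel :: real measure" ..
  have [measurable]: "f \<in> borel_measurable (Pi\<^sub>M (insert i I) (\<lambda>_. lborel))" using assms(3) by (simp add: boxed_def)
  have m: "(\<lambda>x. \<integral>s. f (x(i := s)) \<partial>lborel) \<in> borel_measurable (Pi\<^sub>M I (\<lambda>_. lborel))"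
    by measurable
  note sl = boxed_slice[OF assms(1,3)]
  have "(\<integral>s. f (x(i := s)) \<partial>lborel) \<le> C * (2 * \<bar>R\<bar>)" if x: "x \<in> extensional I" for x
  proof -
    have C: "C \<ge> 0" using sl(3,4)[OF x, of 0] by linarith
    have "(\<integral>s. f (x(i := s)) \<partial>lborel) \<le> (\<integral>s. C * indicator {-\<bar>R\<bar>..\<bar>R\<bar>} s \<partial>lborel)"
    proof (rule integral_mono)
      show "integrable lborel (\<lambda>s. f (x(i := s)))" by (rule sl(2)[OF x])
      show "integrable lborel (\<lambda>s. C * indicator {-\<bar>R\<bar>..\<bar>R\<bar>} s)"
        by (intro integrable_mult_right integrable_real_indicator) (auto simp: emeasure_lborel_Icc_eq)
      fix s show "f (x(i := s)) \<le> C * indicator {-\<bar>R\<bar>..\<bar>R\<bar>} s"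
        using sl(4,5)[OF x, of s] C by (force simp: indicator_def)
    qed
    also have "\<dots> = C * (2 * \<bar>R\<bar>)" by simp
    finally show ?thesis .
  qed
  moreover have "\<forall>j\<in>I. \<bar>x j\<bar> \<le> R" if x: "x \<in> extensional I" "(\<integral>s. f (x(i := s)) \<partial>lborel) \<noteq> 0" for x
  proof -
    obtain s where "f (x(i := s)) \<noteq> 0" using x(2)
      by (metis (mono_tags, lifting) Bochner_Integration.integral_cong integral_zero)
    then show ?thesis using sl(6)[OF x(1)] by blast
  qed
  ultimately show ?thesis unfolding boxed_def using m sl(3)
    by (auto intro!: integral_nonneg_AE)
qed

text \<open>
  Induction on the set of coordinates: by the one-dimensional inequality in one coordinate, the partial
  integrals satisfy the hypothesis in the remaining ones.
\<close>

lemma prekopa_leindler_PiM: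
  assumes r: "0 < r" "r < 1" and I: "finite I"
  shows "boxed I f C R \<Longrightarrow> boxed I g C R \<Longrightarrow> boxed I h C R \<Longrightarrow>
    (\<And>x y. x \<in> extensional I \<Longrightarrow> y \<in> extensional I \<Longrightarrow>
        f x powr (1 - r) * g y powr r \<le> h (\<lambda>i\<in>I. (1 - r) * x i + r * y i)) \<Longrightarrow>
    integral\<^sup>L (\<Pi>\<^sub>M i\<in>I. lborel) f powr (1 - r) * integral\<^sup>L (\<Pi>\<^sub>M i\<in>I. lborel) g powr r
      \<le> integral\<^sup>L (\<Pi>\<^sub>M i\<in>I. lborel) h"
  using I
proof (induction I arbitrary: f g h C rule: finite_induct)
  case empty
  interpret product_sigma_finite "\<lambda>_. lborel :: real measure" ..
  show ?case using empty(4)[of "\<lambda>_. undefined" "\<lambda>_. undefined"]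
    by (simp add: PiM_empty lebesgue_integral_count_space_finite restrict_def)
next
  case (insert i I)
  interpret product_sigma_finite "\<lambda>_. lborel :: real measure" ..
  let ?S = "\<lambda>f x. \<integral>s. f (x(i := s)) \<partial>lborel"
  note ff = insert(4) and gg = insert(5) and hh = insert(6)
  have fin: "finite (insert i I)" using insert by auto
  have eq: "integral\<^sup>L (Pi\<^sub>M (insert i I) (\<lambda>_. lborel)) f = integral\<^sup>L (Pi\<^sub>M I (\<lambda>_. lborel)) (?S f)"
    if "boxed (insert i I) f C R" for f
    using boxed_integrable[OF fin that] insert(1,2) by (intro product_integral_insert)
  have "integral\<^sup>L (\<Pi>\<^sub>M i\<in>I. lborel) (?S f) powr (1 - r) * integral\<^sup>L (\<Pi>\<^sub>M i\<in>I. lborel) (?S g) powr r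
      \<le> integral\<^sup>L (\<Pi>\<^sub>M i\<in>I. lborel) (?S h)"
  proof (rule insert.IH)
    fix x y :: "'a \<Rightarrow> real" assume x: "x \<in> extensional I" and y: "y \<in> extensional I"
    let ?z = "\<lambda>i\<in>I. (1 - r) * x i + r * y i"
    have z: "?z \<in> extensional I" by auto
    show "?S f x powr (1 - r) * ?S g y powr r \<le> ?S h ?z"
    proof (rule prekopa_leindler_real[OF r])
      fix s t
      have "f (x(i := s)) powr (1 - r) * g (y(i := t)) powr r
          \<le> h (\<lambda>j\<in>insert i I. (1 - r) * (x(i := s)) j + r * (y(i := t)) j)"
        using x y by (intro insert.prems) (auto simp: extensional_def)
      also have "(\<lambda>j\<in>insert i I. (1 - r) * (x(i := s)) j + r * (y(i := t)) j)
          = ?z(i := (1 - r) * s + r * t)" using insert(2) by (auto simp: fun_eq_iff)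
      finally show "f (x(i := s)) powr (1 - r) * g (y(i := t)) powr r \<le> h (?z(i := (1 - r) * s + r * t))" .
    qed (rule boxed_slice[OF insert(2) ff x] boxed_slice[OF insert(2) gg y] boxed_slice[OF insert(2) hh z])+
  qed (rule boxed_partial_integral[OF insert(2,1) ff] boxed_partial_integral[OF insert(2,1) gg]
      boxed_partial_integral[OF insert(2,1) hh])+
  then show ?case by (simp add: eq ff gg hh)
qed

lemma prekopa_leindler:
  fixes f g h :: "'a::euclidean_space \<Rightarrow> real"
  assumes r: "0 < r" "r < 1"
    and m[measurable]: "f \<in> borel_measurable borel" "g \<in> borel_measurable borel" "h \<in> borel_measurable borel"
    and f: "\<And>x. 0 \<le> f x" "\<And>x. f x \<le> C" "\<And>x. f x \<noteq> 0 \<Longrightarrow> norm x \<le> R"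
    and g: "\<And>x. 0 \<le> g x" "\<And>x. g x \<le> C" "\<And>x. g x \<noteq> 0 \<Longrightarrow> norm x \<le> R"
    and h: "\<And>x. 0 \<le> h x" "\<And>x. h x \<le> C" "\<And>x. h x \<noteq> 0 \<Longrightarrow> norm x \<le> R"
    and rel: "\<And>x y. f x powr (1 - r) * g y powr r \<le> h ((1 - r) *\<^sub>R x + r *\<^sub>R y)"
  shows "integral\<^sup>L lborel f powr (1 - r) * integral\<^sup>L lborel g powr r \<le> integral\<^sup>L lborel h"
proof -
  let ?v = "\<lambda>x. \<Sum>b\<in>Basis. x b *\<^sub>R (b::'a)"
  have mv[measurable]: "?v \<in> measurable (\<Pi>\<^sub>M b\<in>Basis. lborel) borel" by measurable
  have eq: "integral\<^sup>L lborel u = integral\<^sup>L (\<Pi>\<^sub>M b\<in>Basis. lborel) (\<lambda>x. u (?v x))"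
    if [measurable]: "u \<in> borel_measurable borel" for u :: "'a \<Rightarrow> real"
    by (subst lborel_eq) (simp add: integral_distr)
  have bx: "boxed Basis (\<lambda>x. u (?v x)) C R"
    if [measurable]: "u \<in> borel_measurable borel" and "\<And>x. 0 \<le> u x" "\<And>x. u x \<le> C"
      "\<And>x. u x \<noteq> 0 \<Longrightarrow> norm x \<le> R" for u :: "'a \<Rightarrow> real"
  proof -
    have "\<bar>x b\<bar> \<le> R" if "b \<in> Basis" "u (?v x) \<noteq> 0" for x b
    proof -
      have "\<bar>x b\<bar> = \<bar>?v x \<bullet> b\<bar>" using that(1) by simp
      also have "\<dots> \<le> norm (?v x)" using that(1) by (rule Basis_le_norm)
      finally show ?thesis using that(2) \<open>\<And>x. u x \<noteq> 0 \<Longrightarrow> norm x \<le> R\<close>[of "?v x"] by linarith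
    qed
    then show ?thesis using that by (auto simp: boxed_def)
  qed
  show ?thesis unfolding eq[OF m(1)] eq[OF m(2)] eq[OF m(3)]
  proof (rule prekopa_leindler_PiM[OF r finite_Basis])
    fix x y :: "'a \<Rightarrow> real"
    have "?v (\<lambda>i\<in>Basis. (1 - r) * x i + r * y i) = (1 - r) *\<^sub>R ?v x + r *\<^sub>R ?v y"
      by (simp add: scaleR_sum_right sum.distrib[symmetric] scaleR_add_left cong: sum.cong)
    then show "f (?v x) powr (1 - r) * g (?v y) powr r \<le> h (?v (\<lambda>i\<in>Basis. (1 - r) * x i + r * y i))"
      using rel by simp
  qed (rule bx[of f] bx[of g] bx[of h]; (rule m f g h; assumption)?)+
qed

section \<open>Gaussian measures\<close>

abbreviation std_gauss :: "real measure" where "std_gauss \<equiv> density lborel (\<lambda>x. ennreal (std_normal_density x))"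

text \<open>
  The law of \<open>\<Sum> s\<^sub>i v\<^sub>i\<close> with independent standard normal \<open>s\<^sub>i\<close>, that is, the centred Gaussian measure with
  covariance \<open>\<Sum> v\<^sub>i v\<^sub>i\<^sup>T\<close>. Adding one direction at a time reduces its properties to one dimension by induction on
  the list; the vectors may be linearly dependent.
\<close>

primrec gauss :: "'a::euclidean_space list \<Rightarrow> 'a measure" where
  "gauss [] = return borel 0"
| "gauss (v # vs) = distr (std_gauss \<Otimes>\<^sub>M gauss vs) borel (\<lambda>(s, z). s *\<^sub>R v + z)"

lemma sets_gauss[simp, measurable_cong]: "sets (gauss vs) = sets borel"
  by (cases vs) auto

lemma space_gauss[simp]: "space (gauss vs) = UNIV"
  using sets_eq_imp_space_eq[OF sets_gauss] by simp

lemma prob_space_gauss: "prob_space (gauss vs)"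
proof (induction vs)
  case Nil
  then show ?case by (auto intro!: prob_space_return)
next
  case (Cons v vs)
  interpret g: prob_space "gauss vs" by fact
  interpret s: prob_space std_gauss by (rule prob_space_normal_density) simp
  interpret p: pair_prob_space std_gauss "gauss vs" ..
  show ?case unfolding gauss.simps by (rule p.prob_space_distr) measurable
qed

lemma nn_integral_gauss_Cons:
  assumes [measurable]: "f \<in> borel_measurable borel"
  shows "(\<integral>\<^sup>+x. f x \<partial>gauss (v # vs)) = (\<integral>\<^sup>+s. (\<integral>\<^sup>+z. f (s *\<^sub>R v + z) \<partial>gauss vs) \<partial>std_gauss)"
proof -
  interpret g: prob_space "gauss vs" by (rule prob_space_gauss)
  show ?thesis
    by (simp add: nn_integral_distr g.nn_integral_fst[symmetric] split_beta')
qed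

lemma integral_gauss_Cons:
  fixes f :: "'a::euclidean_space \<Rightarrow> real"
  assumes [measurable]: "f \<in> borel_measurable borel" and b: "\<And>x. \<bar>f x\<bar> \<le> C"
  shows "(\<integral>x. f x \<partial>gauss (v # vs)) = (\<integral>s. (\<integral>z. f (s *\<^sub>R v + z) \<partial>gauss vs) \<partial>std_gauss)"
proof -
  interpret g: prob_space "gauss vs" by (rule prob_space_gauss)
  interpret s: prob_space std_gauss by (rule prob_space_normal_density) simp
  interpret p: pair_prob_space std_gauss "gauss vs" ..
  have "integrable (std_gauss \<Otimes>\<^sub>M gauss vs) (\<lambda>(s, z). f (s *\<^sub>R v + z))"
    by (rule p.integrable_const_bound[where B=C]) (use b in \<open>auto simp: split_beta'\<close>)
  from p.integral_fst[OF this] show ?thesis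
    by (simp add: integral_distr split_beta')
qed

lemma nn_integral_std_gauss_uminus:
  assumes [measurable]: "f \<in> borel_measurable borel"
  shows "(\<integral>\<^sup>+s. f (- s) \<partial>std_gauss) = (\<integral>\<^sup>+s. f s \<partial>std_gauss)"
proof -
  have "(\<integral>\<^sup>+s. f s \<partial>std_gauss) = (\<integral>\<^sup>+s. ennreal (std_normal_density s) * f s \<partial>lborel)"
    by (simp add: nn_integral_density)
  also have "\<dots> = ennreal \<bar>-1\<bar> * (\<integral>\<^sup>+s. ennreal (std_normal_density (0 + (-1) * s)) * f (0 + (-1) * s) \<partial>lborel)"
    by (rule nn_integral_real_affine) auto
  also have "\<dots> = (\<integral>\<^sup>+s. ennreal (std_normal_density s) * f (- s) \<partial>lborel)"
    by (simp add: std_normal_density_def)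
  also have "\<dots> = (\<integral>\<^sup>+s. f (- s) \<partial>std_gauss)" by (simp add: nn_integral_density)
  finally show ?thesis by simp
qed

lemma nn_integral_gauss_uminus:
  assumes "f \<in> borel_measurable borel"
  shows "(\<integral>\<^sup>+z. f (- z) \<partial>gauss vs) = (\<integral>\<^sup>+z. f z \<partial>gauss vs)"
  using assms
proof (induction vs arbitrary: f)
  case Nil
  then show ?case by (simp add: nn_integral_return)
next
  case (Cons v vs)
  note [measurable] = Cons.prems
  interpret g: prob_space "gauss vs" by (rule prob_space_gauss)
  have "(\<integral>\<^sup>+z. f (- z) \<partial>gauss (v # vs)) = (\<integral>\<^sup>+s. (\<integral>\<^sup>+z. f ((- s) *\<^sub>R v + (- z)) \<partial>gauss vs) \<partial>std_gauss)"
    by (subst nn_integral_gauss_Cons) simp_all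
  also have "\<dots> = (\<integral>\<^sup>+s. (\<integral>\<^sup>+z. f ((- s) *\<^sub>R v + z) \<partial>gauss vs) \<partial>std_gauss)"
  proof (rule nn_integral_cong)
    fix s
    show "(\<integral>\<^sup>+z. f ((- s) *\<^sub>R v + (- z)) \<partial>gauss vs) = (\<integral>\<^sup>+z. f ((- s) *\<^sub>R v + z) \<partial>gauss vs)"
      by (rule Cons.IH[of "\<lambda>z. f ((- s) *\<^sub>R v + z)"]) measurable
  qed
  also have "\<dots> = (\<integral>\<^sup>+s. (\<integral>\<^sup>+z. f (s *\<^sub>R v + z) \<partial>gauss vs) \<partial>std_gauss)"
    by (rule nn_integral_std_gauss_uminus) measurable
  finally show ?case unfolding nn_integral_gauss_Cons[OF Cons.prems] .
qed

lemma nn_integral_std_gauss_scale: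
  assumes [measurable]: "f \<in> borel_measurable borel" and \<sigma>: "\<sigma> > 0"
  shows "(\<integral>\<^sup>+s. f (\<sigma> * s) \<partial>std_gauss) = (\<integral>\<^sup>+x. ennreal (normal_density 0 \<sigma> x) * f x \<partial>lborel)"
proof -
  have eq: "\<sigma> * normal_density 0 \<sigma> (\<sigma> * s) = std_normal_density s" for s
    using \<sigma> by (simp add: normal_density_def real_sqrt_mult power_mult_distrib)
  have "(\<integral>\<^sup>+x. ennreal (normal_density 0 \<sigma> x) * f x \<partial>lborel)
     = ennreal \<bar>\<sigma>\<bar> * (\<integral>\<^sup>+s. ennreal (normal_density 0 \<sigma> (0 + \<sigma> * s)) * f (0 + \<sigma> * s) \<partial>lborel)"
    using \<sigma> by (intro nn_integral_real_affine) auto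
  also have "\<dots> = (\<integral>\<^sup>+s. ennreal (std_normal_density s) * f (\<sigma> * s) \<partial>lborel)"
    using \<sigma> by (subst nn_integral_cmult[symmetric])
      (auto simp: eq[symmetric] ennreal_mult mult.assoc intro!: nn_integral_cong)
  finally show ?thesis by (simp add: nn_integral_density)
qed

lemma nn_integral_std_gauss_add:
  assumes [measurable]: "f \<in> borel_measurable borel" and ab: "0 \<le> a" "0 \<le> b"
  shows "(\<integral>\<^sup>+s. \<integral>\<^sup>+t. f (sqrt a * s + sqrt b * t) \<partial>std_gauss \<partial>std_gauss) = (\<integral>\<^sup>+s. f (sqrt (a + b) * s) \<partial>std_gauss)"
proof -
  interpret s: prob_space std_gauss by (rule prob_space_normal_density) simp
  consider "a = 0" | "b = 0" | "a > 0" "b > 0" using ab by linarith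
  then show ?thesis
  proof cases
    case 3
    let ?na = "normal_density 0 (sqrt a)" and ?nb = "normal_density 0 (sqrt b)"
    have "(\<integral>\<^sup>+s. \<integral>\<^sup>+t. f (sqrt a * s + sqrt b * t) \<partial>std_gauss \<partial>std_gauss)
        = (\<integral>\<^sup>+s. (\<integral>\<^sup>+y. ennreal (?nb y) * f (sqrt a * s + y) \<partial>lborel) \<partial>std_gauss)"
      using 3 by (intro nn_integral_cong nn_integral_std_gauss_scale) auto
    also have "\<dots> = (\<integral>\<^sup>+x. ennreal (?na x) * (\<integral>\<^sup>+y. ennreal (?nb y) * f (x + y) \<partial>lborel) \<partial>lborel)"
      using 3 by (intro nn_integral_std_gauss_scale) auto
    also have "\<dots> = (\<integral>\<^sup>+x. ennreal (?na x) * (\<integral>\<^sup>+u. ennreal (?nb (u - x)) * f u \<partial>lborel) \<partial>lborel)"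
    proof (rule nn_integral_cong, rule arg_cong2[where f="(*)", OF refl])
      fix x :: real
      show "(\<integral>\<^sup>+y. ennreal (?nb y) * f (x + y) \<partial>lborel) = (\<integral>\<^sup>+u. ennreal (?nb (u - x)) * f u \<partial>lborel)"
        by (subst (2) lborel_distr_plus[of x, symmetric]) (simp add: nn_integral_distr)
    qed
    also have "\<dots> = (\<integral>\<^sup>+x. (\<integral>\<^sup>+u. ennreal (?nb (u - x) * ?na x) * f u \<partial>lborel) \<partial>lborel)"
      by (subst nn_integral_cmult[symmetric])
        (auto intro!: nn_integral_cong simp: ennreal_mult mult_ac)
    also have "\<dots> = (\<integral>\<^sup>+u. (\<integral>\<^sup>+x. ennreal (?nb (u - x) * ?na x) * f u \<partial>lborel) \<partial>lborel)"
      by (rule lborel_pair.Fubini') measurable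
    also have "\<dots> = (\<integral>\<^sup>+u. (\<integral>\<^sup>+x. ennreal (?nb (u - x) * ?na x) \<partial>lborel) * f u \<partial>lborel)"
      by (intro nn_integral_cong nn_integral_multc) measurable
    also have "\<dots> = (\<integral>\<^sup>+u. ennreal (normal_density 0 (sqrt (a + b)) u) * f u \<partial>lborel)"
    proof (rule nn_integral_cong, rule arg_cong2[where f="(*)", OF _ refl])
      fix u
      show "(\<integral>\<^sup>+x. ennreal (?nb (u - x) * ?na x) \<partial>lborel) = ennreal (normal_density 0 (sqrt (a + b)) u)"
        using fun_cong[OF conv_normal_density_zero_mean[of "sqrt b" "sqrt a"], of u] 3
        by (simp add: add.commute)
    qed
    also have "\<dots> = (\<integral>\<^sup>+s. f (sqrt (a + b) * s) \<partial>std_gauss)"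
      using 3 by (intro nn_integral_std_gauss_scale[symmetric]) auto
    finally show ?thesis .
  qed (simp_all add: s.emeasure_space_1[simplified])
qed

text \<open>
  Gaussian measures are stable under convolution; this is the semigroup law of the heat flow.
\<close>

lemma nn_integral_gauss_add:
  assumes "f \<in> borel_measurable borel" and ab: "0 \<le> a" "0 \<le> b"
  shows "(\<integral>\<^sup>+z. \<integral>\<^sup>+w. f (sqrt a *\<^sub>R z + sqrt b *\<^sub>R w) \<partial>gauss vs \<partial>gauss vs) = (\<integral>\<^sup>+z. f (sqrt (a + b) *\<^sub>R z) \<partial>gauss vs)"
  using assms(1)
proof (induction vs arbitrary: f)
  case Nil
  then show ?case by (simp add: nn_integral_return)
next
  case (Cons v vs)
  note [measurable] = Cons.prems
  interpret g: prob_space "gauss vs" by (rule prob_space_gauss)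
  interpret s: prob_space std_gauss by (rule prob_space_normal_density) simp
  interpret p: pair_prob_space std_gauss "gauss vs" ..
  have "(\<integral>\<^sup>+z. \<integral>\<^sup>+w. f (sqrt a *\<^sub>R z + sqrt b *\<^sub>R w) \<partial>gauss (v # vs) \<partial>gauss (v # vs))
    = (\<integral>\<^sup>+s. \<integral>\<^sup>+z. \<integral>\<^sup>+t. \<integral>\<^sup>+w. f (sqrt a *\<^sub>R (s *\<^sub>R v + z) + sqrt b *\<^sub>R (t *\<^sub>R v + w)) \<partial>gauss vs \<partial>std_gauss \<partial>gauss vs \<partial>std_gauss)"
    by (simp add: nn_integral_gauss_Cons del: gauss.simps)
  also have "\<dots> = (\<integral>\<^sup>+s. \<integral>\<^sup>+t. \<integral>\<^sup>+z. \<integral>\<^sup>+w. f (sqrt a *\<^sub>R (s *\<^sub>R v + z) + sqrt b *\<^sub>R (t *\<^sub>R v + w)) \<partial>gauss vs \<partial>gauss vs \<partial>std_gauss \<partial>std_gauss)"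
    by (intro nn_integral_cong p.Fubini') measurable
  also have "\<dots> = (\<integral>\<^sup>+s. \<integral>\<^sup>+t. \<integral>\<^sup>+z. f ((sqrt a * s + sqrt b * t) *\<^sub>R v + sqrt (a + b) *\<^sub>R z) \<partial>gauss vs \<partial>std_gauss \<partial>std_gauss)"
  proof (rule nn_integral_cong, rule nn_integral_cong)
    fix s t
    have "(\<integral>\<^sup>+z. \<integral>\<^sup>+w. f (sqrt a *\<^sub>R (s *\<^sub>R v + z) + sqrt b *\<^sub>R (t *\<^sub>R v + w)) \<partial>gauss vs \<partial>gauss vs)
      = (\<integral>\<^sup>+z. \<integral>\<^sup>+w. (\<lambda>x. f ((sqrt a * s + sqrt b * t) *\<^sub>R v + x)) (sqrt a *\<^sub>R z + sqrt b *\<^sub>R w) \<partial>gauss vs \<partial>gauss vs)"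
      by (simp add: algebra_simps)
    also have "\<dots> = (\<integral>\<^sup>+z. f ((sqrt a * s + sqrt b * t) *\<^sub>R v + sqrt (a + b) *\<^sub>R z) \<partial>gauss vs)"
      by (rule Cons.IH) measurable
    finally show "(\<integral>\<^sup>+z. \<integral>\<^sup>+w. f (sqrt a *\<^sub>R (s *\<^sub>R v + z) + sqrt b *\<^sub>R (t *\<^sub>R v + w)) \<partial>gauss vs \<partial>gauss vs)
      = (\<integral>\<^sup>+z. f ((sqrt a * s + sqrt b * t) *\<^sub>R v + sqrt (a + b) *\<^sub>R z) \<partial>gauss vs)" .
  qed
  also have "\<dots> = (\<integral>\<^sup>+s. \<integral>\<^sup>+z. f ((sqrt (a + b) * s) *\<^sub>R v + sqrt (a + b) *\<^sub>R z) \<partial>gauss vs \<partial>std_gauss)"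
    using nn_integral_std_gauss_add[OF _ ab, of "\<lambda>s. \<integral>\<^sup>+z. f (s *\<^sub>R v + sqrt (a + b) *\<^sub>R z) \<partial>gauss vs"]
    by simp
  also have "\<dots> = (\<integral>\<^sup>+z. f (sqrt (a + b) *\<^sub>R z) \<partial>gauss (v # vs))"
    by (subst nn_integral_gauss_Cons) (auto simp: algebra_simps)
  finally show ?case .
qed

text \<open>
  Averaging over \<open>z\<close> and \<open>-z\<close> removes the product of the new coordinate with the old ones.
\<close>

lemma nn_integral_gauss_inner_sq:
  "(\<integral>\<^sup>+z. ennreal ((z \<bullet> \<xi>)\<^sup>2) \<partial>gauss vs) = ennreal (\<Sum>v\<leftarrow>vs. (v \<bullet> \<xi>)\<^sup>2)"
proof (induction vs)
  case Nil
  then show ?case by (simp add: nn_integral_return)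
next
  case (Cons v vs)
  interpret g: prob_space "gauss vs" by (rule prob_space_gauss)
  interpret s: prob_space std_gauss by (rule prob_space_normal_density) simp
  let ?S = "\<Sum>v\<leftarrow>vs. (v \<bullet> \<xi>)\<^sup>2"
  have S: "?S \<ge> 0" by (induction vs) auto
  have 1: "(\<integral>\<^sup>+z. ennreal (((s *\<^sub>R v + z) \<bullet> \<xi>)\<^sup>2) \<partial>gauss vs) = ennreal (s\<^sup>2 * (v \<bullet> \<xi>)\<^sup>2 + ?S)" for s
  proof -
    let ?F = "\<lambda>z. ennreal (((s *\<^sub>R v + z) \<bullet> \<xi>)\<^sup>2)"
    have "2 * (\<integral>\<^sup>+z. ?F z \<partial>gauss vs) = (\<integral>\<^sup>+z. ?F z \<partial>gauss vs) + (\<integral>\<^sup>+z. ?F (- z) \<partial>gauss vs)"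
      by (subst nn_integral_gauss_uminus[of ?F]) (auto simp: mult_2)
    also have "\<dots> = (\<integral>\<^sup>+z. ?F z + ?F (- z) \<partial>gauss vs)" by (rule nn_integral_add[symmetric]) auto
    also have "\<dots> = (\<integral>\<^sup>+z. 2 * (ennreal (s\<^sup>2 * (v \<bullet> \<xi>)\<^sup>2) + ennreal ((z \<bullet> \<xi>)\<^sup>2)) \<partial>gauss vs)"
    proof (rule nn_integral_cong)
      fix z :: 'a
      have "((s *\<^sub>R v + z) \<bullet> \<xi>)\<^sup>2 + ((s *\<^sub>R v + - z) \<bullet> \<xi>)\<^sup>2 = 2 * (s\<^sup>2 * (v \<bullet> \<xi>)\<^sup>2 + (z \<bullet> \<xi>)\<^sup>2)"
        by (simp add: inner_add_left inner_diff_left power2_eq_square algebra_simps)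
      then have "?F z + ?F (- z) = ennreal (2 * (s\<^sup>2 * (v \<bullet> \<xi>)\<^sup>2 + (z \<bullet> \<xi>)\<^sup>2))"
        by (simp only: ennreal_plus[OF zero_le_power2 zero_le_power2, symmetric])
      then show "?F z + ?F (- z) = 2 * (ennreal (s\<^sup>2 * (v \<bullet> \<xi>)\<^sup>2) + ennreal ((z \<bullet> \<xi>)\<^sup>2))"
        by (simp add: ennreal_mult' del: distrib_left_numeral)
    qed
    also have "\<dots> = 2 * (ennreal (s\<^sup>2 * (v \<bullet> \<xi>)\<^sup>2) + ennreal ?S)"
      by (simp add: nn_integral_cmult nn_integral_add Cons.IH g.emeasure_space_1[simplified])
    finally have "(\<integral>\<^sup>+z. ?F z \<partial>gauss vs) = ennreal (s\<^sup>2 * (v \<bullet> \<xi>)\<^sup>2) + ennreal ?S"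
      by (simp add: ennreal_mult_cancel_left del: distrib_left_numeral)
    then show ?thesis using S by simp
  qed
  have "has_bochner_integral lborel (\<lambda>x. std_normal_density x * x ^ (2 * 1)) (fact (2 * 1) / (2 ^ 1 * fact 1))"
    by (rule std_normal_moment_even)
  then have "(\<integral>\<^sup>+s. ennreal (std_normal_density s * s\<^sup>2) \<partial>lborel) = ennreal 1"
    by (subst nn_integral_eq_integral) (auto simp: has_bochner_integral_iff)
  then have 2: "(\<integral>\<^sup>+s. ennreal (s\<^sup>2) \<partial>std_gauss) = 1"
    by (simp add: nn_integral_density ennreal_mult[symmetric])
  have "(\<integral>\<^sup>+z. ennreal ((z \<bullet> \<xi>)\<^sup>2) \<partial>gauss (v # vs)) = (\<integral>\<^sup>+s. ennreal (s\<^sup>2 * (v \<bullet> \<xi>)\<^sup>2 + ?S) \<partial>std_gauss)"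
    by (subst nn_integral_gauss_Cons) (simp_all add: 1)
  also have "\<dots> = (\<integral>\<^sup>+s. ennreal ((v \<bullet> \<xi>)\<^sup>2) * ennreal (s\<^sup>2) + ennreal ?S \<partial>std_gauss)"
    using S by (intro nn_integral_cong) (simp add: ennreal_mult mult.commute)
  also have "\<dots> = ennreal ((v \<bullet> \<xi>)\<^sup>2) + ennreal ?S"
    by (simp add: nn_integral_add nn_integral_cmult 2 s.emeasure_space_1[simplified])
  finally show ?case using S by simp
qed

text \<open>
  The hypothesis of the Prekopa-Leindler inequality.
\<close>

definition log_conc :: "real \<Rightarrow> ('a::real_vector \<Rightarrow> real) \<Rightarrow> ('a \<Rightarrow> real) \<Rightarrow> ('a \<Rightarrow> real) \<Rightarrow> bool" where
  "log_conc r f g h \<longleftrightarrow> (\<forall>x y. f x powr (1 - r) * g y powr r \<le> h ((1 - r) *\<^sub>R x + r *\<^sub>R y))"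

lemma std_normal_density_log_concave:
  assumes "0 < r" "r < 1"
  shows "std_normal_density s powr (1 - r) * std_normal_density t powr r \<le> std_normal_density ((1 - r) * s + r * t)"
proof -
  have c: "1 / sqrt (2 * pi) > 0" by simp
  have cv: "((1 - r) * s + r * t)\<^sup>2 \<le> (1 - r) * s\<^sup>2 + r * t\<^sup>2"
  proof -
    have "(1 - r) * s\<^sup>2 + r * t\<^sup>2 - ((1 - r) * s + r * t)\<^sup>2 = r * (1 - r) * (s - t)\<^sup>2"
      by (simp add: power2_eq_square algebra_simps)
    moreover have "0 \<le> r * (1 - r) * (s - t)\<^sup>2" using assms by simp
    ultimately show ?thesis by linarith
  qed
  have "std_normal_density s powr (1 - r) * std_normal_density t powr r
     = (1 / sqrt (2 * pi)) powr (1 - r) * (1 / sqrt (2 * pi)) powr r * exp ((1 - r) * (- s\<^sup>2 / 2) + r * (- t\<^sup>2 / 2))"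
  proof -
    have e: "(c * exp a) powr b = c powr b * exp (b * a)" if "c > 0" for a b c :: real
      using that by (simp add: powr_mult powr_def[of "exp a"])
    show ?thesis unfolding std_normal_density_def e[OF c] exp_add by (simp add: mult_ac)
  qed
  also have "\<dots> = 1 / sqrt (2 * pi) * exp ((1 - r) * (- s\<^sup>2 / 2) + r * (- t\<^sup>2 / 2))"
    using c by (simp add: powr_add[symmetric])
  also have "\<dots> \<le> std_normal_density ((1 - r) * s + r * t)"
    unfolding std_normal_density_def using c cv
    by (intro mult_left_mono) (auto simp: field_simps)
  finally show ?thesis .
qed

text \<open>
  The average in one direction is an integral against a log-concave density, so the one-dimensional
  Prekopa-Leindler inequality applies to one direction at a time.
\<close>

lemma log_conc_gauss:
  fixes f g h :: "'a::euclidean_space \<Rightarrow> real"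
  assumes r: "0 < r" "r < 1"
    and m: "f \<in> borel_measurable borel" "g \<in> borel_measurable borel" "h \<in> borel_measurable borel"
    and f: "\<And>x. 0 \<le> f x" "\<And>x. f x \<le> C" and g: "\<And>x. 0 \<le> g x" "\<And>x. g x \<le> C"
    and h: "\<And>x. 0 \<le> h x" "\<And>x. h x \<le> C" and rel: "log_conc r f g h"
  shows "log_conc r (\<lambda>x. \<integral>z. f (x + c *\<^sub>R z) \<partial>gauss vs) (\<lambda>x. \<integral>z. g (x + c *\<^sub>R z) \<partial>gauss vs)
     (\<lambda>x. \<integral>z. h (x + c *\<^sub>R z) \<partial>gauss vs)"
proof (induction vs)
  case Nil
  then show ?case using rel m by (simp add: integral_return)
next
  case (Cons v vs)
  note [measurable] = m
  interpret gv: prob_space "gauss vs" by (rule prob_space_gauss)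
  interpret s: prob_space std_gauss by (rule prob_space_normal_density) simp
  define I where "I u x = (\<integral>z. u (x + c *\<^sub>R z) \<partial>gauss vs)" for u :: "'a \<Rightarrow> real" and x
  define J where "J u x = (\<integral>s. I u (x + s *\<^sub>R (c *\<^sub>R v)) * std_normal_density s \<partial>lborel)" for u :: "'a \<Rightarrow> real" and x
  have Im[measurable]: "I u \<in> borel_measurable borel" if [measurable]: "u \<in> borel_measurable borel" for u
    unfolding I_def by measurable
  have Ib: "0 \<le> I u x \<and> I u x \<le> C" if [measurable]: "u \<in> borel_measurable borel" and "\<And>x. 0 \<le> u x" "\<And>x. u x \<le> C" for u x
  proof -
    have "integrable (gauss vs) (\<lambda>z. u (x + c *\<^sub>R z))"
      by (rule gv.integrable_const_bound[where B=C]) (use that in auto)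
    then have "I u x \<le> (\<integral>z. C \<partial>gauss vs)" unfolding I_def using that by (intro integral_mono) auto
    moreover have "0 \<le> I u x" unfolding I_def using that by (intro integral_nonneg_AE) auto
    ultimately show ?thesis by (simp add: gv.prob_space[simplified])
  qed
  have eq: "(\<integral>z. u (x + c *\<^sub>R z) \<partial>gauss (v # vs)) = J u x"
    if [measurable]: "u \<in> borel_measurable borel" and "\<And>x. 0 \<le> u x" "\<And>x. u x \<le> C" for u x
  proof -
    have "(\<integral>z. u (x + c *\<^sub>R z) \<partial>gauss (v # vs)) = (\<integral>s. \<integral>z. u (x + c *\<^sub>R (s *\<^sub>R v + z)) \<partial>gauss vs \<partial>std_gauss)"
      using that by (intro integral_gauss_Cons[where C=C]) (auto simp: abs_le_iff intro: order_trans[of _ 0])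
    also have "\<dots> = (\<integral>s. I u (x + s *\<^sub>R (c *\<^sub>R v)) \<partial>std_gauss)"
      by (simp add: I_def algebra_simps)
    also have "\<dots> = J u x" unfolding J_def
      by (subst integral_density) (auto simp: mult.commute)
    finally show ?thesis .
  qed
  have int: "integrable lborel (\<lambda>s. I u (x + s *\<^sub>R (c *\<^sub>R v)) * std_normal_density s)"
    if u[measurable]: "u \<in> borel_measurable borel" and u2: "\<And>x. 0 \<le> u x" "\<And>x. u x \<le> C" for u x
  proof -
    have ab: "\<bar>I u y\<bar> \<le> \<bar>C\<bar>" for y using Ib[OF u u2, of y] by linarith
    have "integrable lborel (\<lambda>s. C * std_normal_density s)" by simp
    then show ?thesis
      by (rule Bochner_Integration.integrable_bound) (auto simp: abs_mult intro!: mult_right_mono ab)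
  qed
  have bd: "0 \<le> I u x * std_normal_density s" "I u x * std_normal_density s \<le> C"
    if u: "u \<in> borel_measurable borel" "\<And>x. 0 \<le> u x" "\<And>x. u x \<le> C" for u x s
  proof -
    have "std_normal_density s \<le> 1 / sqrt (2 * pi) * 1"
      unfolding std_normal_density_def by (intro mult_left_mono) auto
    also have "\<dots> \<le> 1" using pi_gt3 by (simp add: real_le_rsqrt)
    finally have "std_normal_density s \<le> 1" .
    then have "I u x * std_normal_density s \<le> C * 1" using Ib[OF u] order_trans[OF u(2,3)]
      by (intro mult_mono) auto
    then show "I u x * std_normal_density s \<le> C" by simp
    show "0 \<le> I u x * std_normal_density s" using Ib[OF u] by simp
  qed
  show ?case unfolding log_conc_def
  proof (intro allI)
    fix x y :: 'a
    let ?z = "(1 - r) *\<^sub>R x + r *\<^sub>R y"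
    have "J f x powr (1 - r) * J g y powr r \<le> J h ?z" unfolding J_def
    proof (rule prekopa_leindler_real[OF r, where C=C])
      fix s t
      let ?w = "(1 - r) * s + r * t"
      have "(I f (x + s *\<^sub>R (c *\<^sub>R v)) * std_normal_density s) powr (1 - r) *
            (I g (y + t *\<^sub>R (c *\<^sub>R v)) * std_normal_density t) powr r
         = (I f (x + s *\<^sub>R (c *\<^sub>R v)) powr (1 - r) * I g (y + t *\<^sub>R (c *\<^sub>R v)) powr r)
            * (std_normal_density s powr (1 - r) * std_normal_density t powr r)"
        using Ib m f g by (simp add: powr_mult)
      also have "\<dots> \<le> I h ((1 - r) *\<^sub>R (x + s *\<^sub>R (c *\<^sub>R v)) + r *\<^sub>R (y + t *\<^sub>R (c *\<^sub>R v))) * std_normal_density ?w"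
        using Cons.IH Ib[OF m(3) h] std_normal_density_log_concave[OF r]
        by (intro mult_mono) (auto simp: log_conc_def I_def)
      also have "(1 - r) *\<^sub>R (x + s *\<^sub>R (c *\<^sub>R v)) + r *\<^sub>R (y + t *\<^sub>R (c *\<^sub>R v)) = ?z + ?w *\<^sub>R (c *\<^sub>R v)"
        by (simp add: algebra_simps)
      finally show "(I f (x + s *\<^sub>R (c *\<^sub>R v)) * std_normal_density s) powr (1 - r) *
            (I g (y + t *\<^sub>R (c *\<^sub>R v)) * std_normal_density t) powr r
         \<le> I h (?z + ?w *\<^sub>R (c *\<^sub>R v)) * std_normal_density ?w" .
    qed (use bd[OF m(1) f] bd[OF m(2) g] bd[OF m(3) h] int[OF m(1) f] int[OF m(2) g] int[OF m(3) h] in measurable)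
    then show "(\<integral>z. f (x + c *\<^sub>R z) \<partial>gauss (v # vs)) powr (1 - r) * (\<integral>z. g (y + c *\<^sub>R z) \<partial>gauss (v # vs)) powr r
      \<le> (\<integral>z. h (?z + c *\<^sub>R z) \<partial>gauss (v # vs))"
      using eq[OF m(1) f] eq[OF m(2) g] eq[OF m(3) h] by simp
  qed
qed

section \<open>Bounded square integrable functions\<close>

text \<open>
  Actual functions instead of classes modulo null sets, with a bound, so that averages over arbitrary probability measures
  are defined at every point.
\<close>

definition bL2 :: "('a::euclidean_space \<Rightarrow> real) \<Rightarrow> bool" where
  "bL2 f \<longleftrightarrow> f \<in> borel_measurable borel \<and> (\<exists>C. \<forall>x. \<bar>f x\<bar> \<le> C) \<and> integrable lborel (\<lambda>x. (f x)\<^sup>2)"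

definition ip :: "('a::euclidean_space \<Rightarrow> real) \<Rightarrow> ('a \<Rightarrow> real) \<Rightarrow> real" where
  "ip f g = (\<integral>x. f x * g x \<partial>lborel)"

lemma bL2_measurable[measurable_dest]: "bL2 f \<Longrightarrow> f \<in> borel_measurable borel" by (simp add: bL2_def)

lemma bL2_bounded: assumes "bL2 f" obtains C where "C > 0" "\<And>x. \<bar>f x\<bar> \<le> C"
proof -
  obtain C where "\<And>x. \<bar>f x\<bar> \<le> C" using assms by (auto simp: bL2_def)
  then have "\<And>x. \<bar>f x\<bar> \<le> \<bar>C\<bar> + 1" by (meson abs_ge_self add_increasing2 order_trans zero_le_one)
  then show ?thesis by (intro that[of "\<bar>C\<bar> + 1"]) auto
qed

lemma bL2_sq: "bL2 f \<Longrightarrow> integrable lborel (\<lambda>x. (f x)\<^sup>2)" by (simp add: bL2_def)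

lemma abs_mult_le_sum_squares: "\<bar>a * b\<bar> \<le> a\<^sup>2 + (b::real)\<^sup>2"
proof -
  have "2 * \<bar>a * b\<bar> \<le> a\<^sup>2 + b\<^sup>2" 
    using sum_squares_ge_zero[of "\<bar>a\<bar>" "\<bar>b\<bar>"] sum_squares_bound[of "\<bar>a\<bar>" "\<bar>b\<bar>"] by (simp add: abs_mult)
  then show ?thesis using abs_ge_zero[of "a * b"] by linarith
qed

lemma bL2_integrable_mult:
  assumes "bL2 f" "bL2 g" shows "integrable lborel (\<lambda>x. f x * g x)"
proof (rule Bochner_Integration.integrable_bound)
  show "integrable lborel (\<lambda>x. (f x)\<^sup>2 + (g x)\<^sup>2)" using assms by (auto intro: bL2_sq)
  show "(\<lambda>x. f x * g x) \<in> borel_measurable lborel" using assms by (auto dest: bL2_measurable)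
qed (auto intro!: AE_I2 order_trans[OF abs_mult_le_sum_squares])

lemma bL2_bound:
  assumes "bL2 f" "g \<in> borel_measurable borel" "\<And>x. \<bar>g x\<bar> \<le> c * \<bar>f x\<bar>" "c \<ge> 0"
  shows "bL2 g"
proof -
  obtain C where C: "C > 0" "\<And>x. \<bar>f x\<bar> \<le> C" using bL2_bounded[OF assms(1)] by blast
  have "\<bar>g x\<bar> \<le> c * C" for x using assms(3)[of x] C(2)[of x] assms(4) by (meson mult_left_mono order_trans)
  moreover have "integrable lborel (\<lambda>x. (g x)\<^sup>2)"
  proof (rule Bochner_Integration.integrable_bound)
    show "integrable lborel (\<lambda>x. c\<^sup>2 * (f x)\<^sup>2)" using assms by (auto intro: bL2_sq)
    show "(\<lambda>x. (g x)\<^sup>2) \<in> borel_measurable lborel" using assms by auto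
    have "(g x)\<^sup>2 \<le> c\<^sup>2 * (f x)\<^sup>2" for x
      using power_mono[OF assms(3)[of x], of 2] by (simp add: power_mult_distrib)
    then show "AE x in lborel. norm ((g x)\<^sup>2) \<le> norm (c\<^sup>2 * (f x)\<^sup>2)" by auto
  qed
  ultimately show ?thesis using assms(2) by (auto simp: bL2_def)
qed

lemma bL2_add: assumes "bL2 f" "bL2 g" shows "bL2 (\<lambda>x. f x + g x)"
proof -
  have [measurable]: "f \<in> borel_measurable borel" "g \<in> borel_measurable borel" using assms by (auto dest: bL2_measurable)
  obtain C where C: "\<And>x. \<bar>f x\<bar> \<le> C" using bL2_bounded[OF assms(1)] by blast
  obtain D where D: "\<And>x. \<bar>g x\<bar> \<le> D" using bL2_bounded[OF assms(2)] by blast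
  have "\<bar>f x + g x\<bar> \<le> C + D" for x using C[of x] D[of x] by linarith
  moreover have "integrable lborel (\<lambda>x. (f x)\<^sup>2 + 2 * (f x * g x) + (g x)\<^sup>2)"
    by (intro Bochner_Integration.integrable_add integrable_mult_right bL2_sq bL2_integrable_mult assms)
  then have "integrable lborel (\<lambda>x. (f x + g x)\<^sup>2)" by (simp add: power2_sum algebra_simps)
  ultimately show ?thesis unfolding bL2_def by auto
qed

lemma bL2_cmult: "bL2 f \<Longrightarrow> bL2 (\<lambda>x. c * f x)"
  by (rule bL2_bound[of f _ "\<bar>c\<bar>"]) (auto dest: bL2_measurable simp: abs_mult)

lemma bL2_mult_bounded:
  assumes "bL2 f" "e \<in> borel_measurable borel" "\<And>x. \<bar>e x\<bar> \<le> c"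
  shows "bL2 (\<lambda>x. e x * f x)"
proof (rule bL2_bound[OF assms(1), of _ c])
  show "c \<ge> 0" using assms(3)[of undefined] by linarith
qed (use assms in \<open>auto simp: abs_mult intro!: mult_right_mono dest: bL2_measurable\<close>)

lemma bL2_diff: "bL2 f \<Longrightarrow> bL2 g \<Longrightarrow> bL2 (\<lambda>x. f x - g x)"
  using bL2_add[of f "\<lambda>x. -1 * g x"] bL2_cmult[of g "-1"] by simp

lemma bL2_min: "bL2 f \<Longrightarrow> bL2 g \<Longrightarrow> bL2 (\<lambda>x. min (f x) (g x))"
  and bL2_max: "bL2 f \<Longrightarrow> bL2 g \<Longrightarrow> bL2 (\<lambda>x. max (f x) (g x))"
proof -
  assume f: "bL2 f" and g: "bL2 g"
  have a: "bL2 (\<lambda>x. \<bar>u x\<bar>)" if u: "bL2 u" for u :: "'a \<Rightarrow> real"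
  proof -
    have [measurable]: "u \<in> borel_measurable borel" using u by (rule bL2_measurable)
    show ?thesis by (rule bL2_bound[OF u, of _ 1]) auto
  qed
  have [measurable]: "f \<in> borel_measurable borel" "g \<in> borel_measurable borel" using f g by (auto dest: bL2_measurable)
  note s = bL2_add[OF a[OF f] a[OF g]]
  have "\<bar>min (f x) (g x)\<bar> \<le> 1 * \<bar>\<bar>f x\<bar> + \<bar>g x\<bar>\<bar>" "\<bar>max (f x) (g x)\<bar> \<le> 1 * \<bar>\<bar>f x\<bar> + \<bar>g x\<bar>\<bar>" for x
    by (auto simp: min_def max_def)
  then show "bL2 (\<lambda>x. min (f x) (g x))" "bL2 (\<lambda>x. max (f x) (g x))"
    by (auto intro!: bL2_bound[OF s, of _ 1])
qed

lemma ip_commute: "ip f g = ip g f" by (simp add: ip_def mult.commute)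
lemma ip_nonneg: "0 \<le> ip f f" by (simp add: ip_def integral_nonneg_AE)
lemma ip_self: "ip f f = (\<integral>x. (f x)\<^sup>2 \<partial>lborel)" by (simp add: ip_def power2_eq_square)
lemma ip_add_right: "bL2 f \<Longrightarrow> bL2 g \<Longrightarrow> bL2 h \<Longrightarrow> ip f (\<lambda>x. g x + h x) = ip f g + ip f h"
  unfolding ip_def by (simp add: distrib_left bL2_integrable_mult)
lemma ip_diff_right: "bL2 f \<Longrightarrow> bL2 g \<Longrightarrow> bL2 h \<Longrightarrow> ip f (\<lambda>x. g x - h x) = ip f g - ip f h"
  unfolding ip_def by (simp add: right_diff_distrib bL2_integrable_mult)
lemma ip_cmult_right: "ip f (\<lambda>x. c * g x) = c * ip f g"
  unfolding ip_def by (simp add: mult.left_commute)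
lemma ip_add_left: "bL2 f \<Longrightarrow> bL2 g \<Longrightarrow> bL2 h \<Longrightarrow> ip (\<lambda>x. g x + h x) f = ip g f + ip h f"
  using ip_add_right[of f g h] by (simp add: ip_commute)
lemma ip_diff_left: "bL2 f \<Longrightarrow> bL2 g \<Longrightarrow> bL2 h \<Longrightarrow> ip (\<lambda>x. g x - h x) f = ip g f - ip h f"
  using ip_diff_right[of f g h] by (simp add: ip_commute)
lemma ip_cmult_left: "ip (\<lambda>x. c * g x) f = c * ip g f"
  using ip_cmult_right[of f c g] by (simp add: ip_commute)

lemma ip_diff_self:
  assumes "bL2 f" "bL2 g"
  shows "ip (\<lambda>x. f x - g x) (\<lambda>x. f x - g x) = ip f f - 2 * ip f g + ip g g"
  using assms by (simp add: ip_diff_left ip_diff_right bL2_diff ip_commute[of g f])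

lemma ip_amgm: assumes "bL2 f" "bL2 g" "c > 0" shows "2 * ip f g \<le> c * ip f f + ip g g / c"
proof -
  have "0 \<le> ip (\<lambda>x. c * f x - g x) (\<lambda>x. c * f x - g x)" by (rule ip_nonneg)
  also have "\<dots> = c * (c * ip f f - 2 * ip f g + ip g g / c)"
    using assms by (simp add: ip_diff_self bL2_cmult ip_cmult_left ip_cmult_right field_simps)
  finally show ?thesis using assms(3) by (simp add: zero_le_mult_iff)
qed

lemma ip_cauchy_schwarz: assumes "bL2 f" "bL2 g" shows "(ip f g)\<^sup>2 \<le> ip f f * ip g g"
proof (cases "ip f f = 0")
  case True
  have "ip f g = 0"
  proof -
    have *: "2 * s \<le> ip g g / c" if "c > 0" "s = ip f g \<or> s = - ip f g" for c s
      using ip_amgm[OF assms that(1)] ip_amgm[OF bL2_cmult[OF assms(1), of "-1"] assms(2) that(1)] that True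
      unfolding ip_cmult_left ip_cmult_right by auto
    have "\<not> 0 < s" if "s = ip f g \<or> s = - ip f g" for s
    proof
      assume "0 < s"
      then have "2 * s \<le> ip g g / ((ip g g + 1) / s)" using that ip_nonneg[of g] by (intro *) auto
      then have "2 * s \<le> s * (ip g g / (ip g g + 1))" by (simp add: mult.commute)
      also have "\<dots> \<le> s * 1" using \<open>0 < s\<close> ip_nonneg[of g] by (intro mult_left_mono) auto
      finally show False using \<open>0 < s\<close> by simp
    qed
    from this[of "ip f g"] this[of "- ip f g"] show ?thesis by linarith
  qed
  then show ?thesis using True by simp
next
  case False
  then have p: "ip f f > 0" using ip_nonneg[of f] by simp
  let ?a = "ip f g / ip f f"
  have q: "ip (\<lambda>x. a * f x - g x) (\<lambda>x. a * f x - g x) = a * (a * ip f f) - 2 * (a * ip f g) + ip g g" for a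
    using assms by (simp add: ip_diff_self bL2_cmult ip_cmult_left ip_cmult_right)
  have "0 \<le> ip (\<lambda>x. ?a * f x - g x) (\<lambda>x. ?a * f x - g x)" by (rule ip_nonneg)
  also have "\<dots> = ip g g - (ip f g)\<^sup>2 / ip f f"
    unfolding q using p by (simp add: power2_eq_square field_simps)
  finally show ?thesis using p by (simp add: field_simps)
qed

lemma ip_abs_le: assumes "bL2 f" "bL2 g" shows "\<bar>ip f g\<bar> \<le> sqrt (ip f f) * sqrt (ip g g)"
  using real_sqrt_le_mono[OF ip_cauchy_schwarz[OF assms]] by (simp add: real_sqrt_mult)

lemma nn_integral_lborel_shift:
  fixes z :: "'a::euclidean_space"
  assumes [measurable]: "f \<in> borel_measurable borel"
  shows "(\<integral>\<^sup>+x. f (x + z) \<partial>lborel) = (\<integral>\<^sup>+x. f x \<partial>lborel)"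
  by (subst (2) lborel_distr_plus[of z, symmetric]) (simp add: nn_integral_distr add.commute)

lemma integral_lborel_shift:
  fixes z :: "'a::euclidean_space" and f :: "'a \<Rightarrow> real"
  assumes [measurable]: "f \<in> borel_measurable borel"
  shows "(\<integral>x. f (x + z) \<partial>lborel) = (\<integral>x. f x \<partial>lborel)"
  by (subst (2) lborel_distr_plus[of z, symmetric]) (simp add: integral_distr add.commute)

lemma integrable_lborel_shift:
  fixes z :: "'a::euclidean_space" and f :: "'a \<Rightarrow> real"
  assumes [measurable]: "f \<in> borel_measurable borel" and "integrable lborel f"
  shows "integrable lborel (\<lambda>x. f (x + z))"
  using assms by (subst (asm) lborel_distr_plus[of z, symmetric]) (simp add: integrable_distr_eq add.commute)

lemma nn_integral_ip: "bL2 f \<Longrightarrow> (\<integral>\<^sup>+x. ennreal ((f x)\<^sup>2) \<partial>lborel) = ennreal (ip f f)"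
  by (subst nn_integral_eq_integral) (auto simp: ip_self bL2_sq)

section \<open>The Gaussian semigroup and its increment energy\<close>

text \<open>
  The list \<open>vs\<close> encodes the generator \<open>(1/2) \<Sum> (v \<bullet> \<nabla>)\<^sup>2\<close> of the Gaussian semigroup.
\<close>

locale heat = fixes vs :: "'a::euclidean_space list"
begin

definition N :: "real \<Rightarrow> 'a measure" where "N t = distr (gauss vs) borel (\<lambda>z. sqrt t *\<^sub>R z)"

lemma sets_N[simp, measurable_cong]: "sets (N t) = sets borel" by (simp add: N_def)
lemma space_N[simp]: "space (N t) = UNIV" by (simp add: N_def)

lemma prob_space_N: "prob_space (N t)"
  unfolding N_def by (rule prob_space.prob_space_distr[OF prob_space_gauss]) measurable

sublocale gauss: prob_space "gauss vs" by (rule prob_space_gauss)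
sublocale N: prob_space "N t" for t by (rule prob_space_N)
sublocale LN: pair_sigma_finite "lborel :: 'a measure" "N t" for t ..
sublocale NN: pair_prob_space "N s" "N t" for s t ..

lemma nn_integral_N: "f \<in> borel_measurable borel \<Longrightarrow> (\<integral>\<^sup>+z. f z \<partial>N t) = (\<integral>\<^sup>+z. f (sqrt t *\<^sub>R z) \<partial>gauss vs)"
  unfolding N_def by (simp add: nn_integral_distr)

lemma distr_N_uminus: "distr (N t) borel uminus = N t"
proof (rule measure_eqI)
  fix A :: "'a set" assume "A \<in> sets (distr (N t) borel uminus)"
  then have [measurable]: "A \<in> sets borel" by simp
  have "emeasure (distr (N t) borel uminus) A = (\<integral>\<^sup>+z. indicator A z \<partial>distr (N t) borel uminus)" by simp
  also have "\<dots> = (\<integral>\<^sup>+z. indicator A (sqrt t *\<^sub>R (- z)) \<partial>gauss vs)"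
    by (simp add: nn_integral_distr nn_integral_N del: nn_integral_indicator)
  also have "\<dots> = (\<integral>\<^sup>+z. indicator A (sqrt t *\<^sub>R z) \<partial>gauss vs)"
    by (rule nn_integral_gauss_uminus) measurable
  also have "\<dots> = (\<integral>\<^sup>+z. indicator A z \<partial>N t)" by (rule nn_integral_N[symmetric]) measurable
  finally show "emeasure (distr (N t) borel uminus) A = emeasure (N t) A" by simp
qed simp

lemma distr_N_add:
  assumes "0 \<le> a" "0 \<le> b" shows "distr (N a \<Otimes>\<^sub>M N b) borel (\<lambda>(z, w). z + w) = N (a + b)"
proof (rule measure_eqI)
  fix A :: "'a set" assume "A \<in> sets (distr (N a \<Otimes>\<^sub>M N b) borel (\<lambda>(z, w). z + w))"
  then have [measurable]: "A \<in> sets borel" by simp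
  have "emeasure (distr (N a \<Otimes>\<^sub>M N b) borel (\<lambda>(z, w). z + w)) A
     = (\<integral>\<^sup>+z. indicator A z \<partial>distr (N a \<Otimes>\<^sub>M N b) borel (\<lambda>(z, w). z + w))" by simp
  also have "\<dots> = (\<integral>\<^sup>+z. \<integral>\<^sup>+w. indicator A (z + w) \<partial>N b \<partial>N a)"
    by (simp add: nn_integral_distr split_beta' N.nn_integral_fst[symmetric] del: nn_integral_indicator)
  also have "\<dots> = (\<integral>\<^sup>+z. \<integral>\<^sup>+w. indicator A (z + sqrt b *\<^sub>R w) \<partial>gauss vs \<partial>N a)"
    by (rule nn_integral_cong, rule nn_integral_N) measurable
  also have "\<dots> = (\<integral>\<^sup>+z. \<integral>\<^sup>+w. indicator A (sqrt a *\<^sub>R z + sqrt b *\<^sub>R w) \<partial>gauss vs \<partial>gauss vs)"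
    by (rule nn_integral_N) measurable
  also have "\<dots> = (\<integral>\<^sup>+z. indicator A (sqrt (a + b) *\<^sub>R z) \<partial>gauss vs)"
    using assms by (intro nn_integral_gauss_add) measurable
  also have "\<dots> = (\<integral>\<^sup>+z. indicator A z \<partial>N (a + b))" by (rule nn_integral_N[symmetric]) measurable
  finally show "emeasure (distr (N a \<Otimes>\<^sub>M N b) borel (\<lambda>(z, w). z + w)) A = emeasure (N (a + b)) A" by simp
qed simp

definition P :: "real \<Rightarrow> ('a \<Rightarrow> real) \<Rightarrow> 'a \<Rightarrow> real" where "P t f x = (\<integral>z. f (x + z) \<partial>N t)"

lemma P_measurable[measurable]:
  assumes [measurable]: "f \<in> borel_measurable borel" shows "P t f \<in> borel_measurable borel"
  unfolding P_def[abs_def] by measurable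

lemma integrable_N_shift:
  fixes f :: "'a \<Rightarrow> real"
  assumes "f \<in> borel_measurable borel" "\<And>x. \<bar>f x\<bar> \<le> C"
  shows "integrable (N t) (\<lambda>z. f (x + z))"
  by (rule N.integrable_const_bound[where B=C]) (use assms in auto)

lemma bL2_integrable_N: assumes "bL2 f" shows "integrable (N t) (\<lambda>z. f (x + z))"
  using bL2_bounded[OF assms] integrable_N_shift[OF bL2_measurable[OF assms]] by metis

lemma P_bounds:
  assumes [measurable]: "f \<in> borel_measurable borel" and "\<And>x. a \<le> f x" "\<And>x. f x \<le> b"
  shows "a \<le> P t f x" "P t f x \<le> b"
proof -
  have i: "integrable (N t) (\<lambda>z. f (x + z))"
    by (rule integrable_N_shift[of _ "\<bar>a\<bar> + \<bar>b\<bar>"])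
      (use assms in \<open>auto simp: abs_le_iff intro: order_trans[of _ b] order_trans[of _ "- a"]\<close>)
  show "a \<le> P t f x" "P t f x \<le> b" unfolding P_def
    using N.integral_ge_const[OF i, of a] N.integral_le_const[OF i, of b] assms by auto
qed

lemma P_add: "bL2 f \<Longrightarrow> bL2 g \<Longrightarrow> P t (\<lambda>x. f x + g x) = (\<lambda>x. P t f x + P t g x)"
  unfolding P_def[abs_def] by (auto simp: bL2_integrable_N fun_eq_iff)

lemma P_cmult: "P t (\<lambda>x. c * f x) = (\<lambda>x. c * P t f x)"
  unfolding P_def[abs_def] by simp

lemma P_jensen:
  assumes "bL2 f" shows "ennreal ((P t f x)\<^sup>2) \<le> (\<integral>\<^sup>+z. ennreal ((f (x + z))\<^sup>2) \<partial>N t)"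
proof -
  have [measurable]: "f \<in> borel_measurable borel" using assms by (rule bL2_measurable)
  obtain C where C: "\<And>x. \<bar>f x\<bar> \<le> C" using bL2_bounded[OF assms] by blast
  have i2: "integrable (N t) (\<lambda>z. (f (x + z))\<^sup>2)"
    by (rule N.integrable_const_bound[where B="C\<^sup>2"]) (use C in \<open>auto simp: abs_le_square_iff[symmetric] intro: order_trans[OF _ abs_ge_self]\<close>)
  have "0 \<le> N.variance t (\<lambda>z. f (x + z))" by (rule N.variance_positive)
  also have "\<dots> = N.expectation t (\<lambda>z. (f (x + z))\<^sup>2) - (P t f x)\<^sup>2"
    using bL2_integrable_N[OF assms] i2 by (simp add: N.variance_eq P_def)
  finally have "(P t f x)\<^sup>2 \<le> N.expectation t (\<lambda>z. (f (x + z))\<^sup>2)" by simp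
  then show ?thesis using i2 by (subst nn_integral_eq_integral) (auto intro: ennreal_leI)
qed

lemma nn_integral_shift_sq:
  assumes "bL2 f"
  shows "(\<integral>\<^sup>+z. \<integral>\<^sup>+x. ennreal ((f (x + z))\<^sup>2) \<partial>lborel \<partial>N t) = ennreal (ip f f)"
proof -
  have [measurable]: "f \<in> borel_measurable borel" using assms by (rule bL2_measurable)
  have "(\<integral>\<^sup>+x. ennreal ((f (x + z))\<^sup>2) \<partial>lborel) = ennreal (ip f f)" for z
    using nn_integral_lborel_shift[of "\<lambda>x. ennreal ((f x)\<^sup>2)" z] nn_integral_ip[OF assms] by simp
  then show ?thesis by (simp add: N.emeasure_space_1[simplified])
qed

lemma assumes "bL2 f" shows bL2_P: "bL2 (P t f)" and ip_P_P_le: "ip (P t f) (P t f) \<le> ip f f"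
proof -
  have [measurable]: "f \<in> borel_measurable borel" using assms by (rule bL2_measurable)
  obtain C where C: "\<And>x. \<bar>f x\<bar> \<le> C" using bL2_bounded[OF assms] by blast
  have b: "\<bar>P t f x\<bar> \<le> C" for x
    using P_bounds[of f "-C" C t x] C by (simp add: abs_le_iff minus_le_iff)
  have "(\<integral>\<^sup>+x. ennreal ((P t f x)\<^sup>2) \<partial>lborel) \<le> (\<integral>\<^sup>+x. \<integral>\<^sup>+z. ennreal ((f (x + z))\<^sup>2) \<partial>N t \<partial>lborel)"
    by (intro nn_integral_mono P_jensen assms)
  also have "\<dots> = (\<integral>\<^sup>+z. \<integral>\<^sup>+x. ennreal ((f (x + z))\<^sup>2) \<partial>lborel \<partial>N t)"
    by (rule LN.Fubini'[symmetric]) measurable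
  finally have le: "(\<integral>\<^sup>+x. ennreal ((P t f x)\<^sup>2) \<partial>lborel) \<le> ennreal (ip f f)"
    using nn_integral_shift_sq[OF assms] by simp
  then have "integrable lborel (\<lambda>x. (P t f x)\<^sup>2)"
    by (intro integrableI_bounded) (auto simp: less_top[symmetric] top_unique intro: le_less_trans)
  then show "bL2 (P t f)" unfolding bL2_def using b by auto
  from nn_integral_ip[OF this] le show "ip (P t f) (P t f) \<le> ip f f"
    by (simp add: ennreal_le_iff ip_nonneg)
qed

lemma
  assumes "bL2 f" "bL2 g"
  shows integrable_LN_shift: "integrable (lborel \<Otimes>\<^sub>M N t) (\<lambda>(x, z). f x * g (x + z))"
    and integrable_LN_fst: "integrable (lborel \<Otimes>\<^sub>M N t) (\<lambda>(x, z). (f x)\<^sup>2)"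
    and integrable_LN_sum: "integrable (lborel \<Otimes>\<^sub>M N t) (\<lambda>(x, z). (g (x + z))\<^sup>2)"
proof -
  have [measurable]: "f \<in> borel_measurable borel" "g \<in> borel_measurable borel" using assms by (auto dest: bL2_measurable)
  show 1: "integrable (lborel \<Otimes>\<^sub>M N t) (\<lambda>(x, z). (f x)\<^sup>2)"
  proof (rule integrableI_bounded)
    have "(\<integral>\<^sup>+x. ennreal (norm (case x of (x, z) \<Rightarrow> (f x)\<^sup>2)) \<partial>(lborel \<Otimes>\<^sub>M N t)) = ennreal (ip f f)"
      using nn_integral_ip[OF assms(1)]
      by (simp add: N.nn_integral_fst[symmetric] split_beta' N.emeasure_space_1[simplified])
    then show "(\<integral>\<^sup>+x. ennreal (norm (case x of (x, z) \<Rightarrow> (f x)\<^sup>2)) \<partial>(lborel \<Otimes>\<^sub>M N t)) < \<infinity>" by simp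
  qed measurable
  show 2: "integrable (lborel \<Otimes>\<^sub>M N t) (\<lambda>(x, z). (g (x + z))\<^sup>2)"
  proof (rule integrableI_bounded)
    have "(\<integral>\<^sup>+x. ennreal (norm (case x of (x, z) \<Rightarrow> (g (x + z))\<^sup>2)) \<partial>(lborel \<Otimes>\<^sub>M N t)) = ennreal (ip g g)"
      using nn_integral_shift_sq[OF assms(2)]
      by (simp add: LN.nn_integral_snd[symmetric] split_beta')
    then show "(\<integral>\<^sup>+x. ennreal (norm (case x of (x, z) \<Rightarrow> (g (x + z))\<^sup>2)) \<partial>(lborel \<Otimes>\<^sub>M N t)) < \<infinity>" by simp
  qed measurable
  show "integrable (lborel \<Otimes>\<^sub>M N t) (\<lambda>(x, z). f x * g (x + z))"
  proof (rule Bochner_Integration.integrable_bound[OF Bochner_Integration.integrable_add[OF 1 2]])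
    show "AE x in lborel \<Otimes>\<^sub>M N t. norm (case x of (x, z) \<Rightarrow> f x * g (x + z))
      \<le> norm ((case x of (x, z) \<Rightarrow> (f x)\<^sup>2) + (case x of (x, z) \<Rightarrow> (g (x + z))\<^sup>2))"
      by (auto intro!: AE_I2 order_trans[OF abs_mult_le_sum_squares])
  qed measurable
qed

lemma ip_P_eq: assumes "bL2 f" "bL2 g"
  shows "ip f (P t g) = (\<integral>(x, z). f x * g (x + z) \<partial>(lborel \<Otimes>\<^sub>M N t))"
  using LN.integral_fst[OF integrable_LN_shift[OF assms, of t]]
  by (simp add: ip_def P_def)

lemma ip_P_eq': assumes "bL2 f" "bL2 g"
  shows "ip f (P t g) = (\<integral>z. \<integral>x. f x * g (x + z) \<partial>lborel \<partial>N t)"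
  unfolding ip_P_eq[OF assms] using LN.integral_snd[OF integrable_LN_shift[OF assms, of t]] by simp

lemma ip_P_sym: assumes "bL2 f" "bL2 g" shows "ip f (P t g) = ip (P t f) g"
proof -
  have [measurable]: "f \<in> borel_measurable borel" "g \<in> borel_measurable borel" using assms by (auto dest: bL2_measurable)
  let ?c = "\<lambda>z. \<integral>x. g x * f (x + z) \<partial>lborel"
  have eq: "(\<integral>x. f x * g (x + z) \<partial>lborel) = ?c (- z)" for z
    using integral_lborel_shift[of "\<lambda>x. g x * f (x + - z)" z] by (simp add: mult.commute)
  have "ip f (P t g) = (\<integral>z. ?c (- z) \<partial>N t)" unfolding ip_P_eq'[OF assms] eq ..
  also have "\<dots> = (\<integral>z. ?c z \<partial>distr (N t) borel uminus)" by (subst integral_distr) auto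
  also have "\<dots> = ip g (P t f)" unfolding distr_N_uminus ip_P_eq'[OF assms(2,1)] ..
  finally show ?thesis by (simp add: ip_commute)
qed

lemma P_P: assumes "bL2 f" "0 \<le> a" "0 \<le> b" shows "P a (P b f) = P (a + b) f"
proof
  fix x
  have [measurable]: "f \<in> borel_measurable borel" using assms by (auto dest: bL2_measurable)
  obtain C where C: "\<And>x. \<bar>f x\<bar> \<le> C" using bL2_bounded[OF assms(1)] by blast
  have i: "integrable (N a \<Otimes>\<^sub>M N b) (\<lambda>(z, w). f (x + (z + w)))"
    by (rule NN.integrable_const_bound[where B=C]) (use C in \<open>auto simp: split_beta'\<close>)
  have "P (a + b) f x = (\<integral>(z, w). f (x + (z + w)) \<partial>(N a \<Otimes>\<^sub>M N b))"
    unfolding P_def distr_N_add[OF assms(2,3), symmetric] by (simp add: integral_distr split_beta')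
  also have "\<dots> = P a (P b f) x"
    using NN.integral_fst[OF i] by (simp add: P_def add.assoc)
  finally show "P a (P b f) x = P (a + b) f x" by simp
qed

lemma P_0: "f \<in> borel_measurable borel \<Longrightarrow> P 0 f = f"
proof
  fix x assume [measurable]: "f \<in> borel_measurable borel"
  show "P 0 f x = f x" unfolding P_def N_def by (simp add: integral_distr gauss.prob_space[simplified])
qed

text \<open>
  The function \<open>s \<mapsto> \<langle>g, P s g\<rangle>\<close> is convex, because
  \<open>\<langle>P a g, P b g\<rangle>\<close> depends on \<open>a + b\<close> only and squared norms of differences are nonnegative. The doubling
  and smoothing estimates for the energy rest on it.
\<close>

lemma ip_P_midpoint: assumes "bL2 g" "0 \<le> a" "0 \<le> d"
  shows "2 * ip g (P (a + d) g) \<le> ip g (P a g) + ip g (P (a + 2 * d) g)"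
proof -
  let ?u = "P (a / 2) g" and ?v = "P (a / 2 + d) g"
  have b: "bL2 ?u" "bL2 ?v" using assms bL2_P by auto
  have e: "ip (P s g) (P t g) = ip g (P (s + t) g)" if "s \<ge> 0" "t \<ge> 0" for s t
    using assms that by (simp add: ip_P_sym[symmetric] bL2_P P_P)
  have "0 \<le> ip (\<lambda>x. ?u x - ?v x) (\<lambda>x. ?u x - ?v x)" by (rule ip_nonneg)
  also have "\<dots> = ip ?u ?u - 2 * ip ?u ?v + ip ?v ?v" using b by (rule ip_diff_self)
  also have "\<dots> = ip g (P a g) - 2 * ip g (P (a + d) g) + ip g (P (a + 2 * d) g)"
    using assms by (simp add: e algebra_simps)
  finally show ?thesis by simp
qed

lemma ip_P_half: assumes "bL2 g" "0 \<le> t" shows "ip (P (t / 2) g) (P (t / 2) g) = ip g (P t g)"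
  using assms by (simp add: ip_P_sym[symmetric] bL2_P P_P)

definition E :: "real \<Rightarrow> ('a \<Rightarrow> real) \<Rightarrow> real" where "E t f = ip f f - ip f (P t f)"

text \<open>
  The representation by squared increments makes it visible that the energy depends on pairwise differences of values only.
\<close>

lemma nn_integral_E:
  assumes "bL2 f"
  shows "(\<integral>\<^sup>+z. \<integral>\<^sup>+x. ennreal ((f (x + z) - f x)\<^sup>2) \<partial>lborel \<partial>N t) = ennreal (2 * E t f)"
proof -
  have [measurable]: "f \<in> borel_measurable borel" using assms by (auto dest: bL2_measurable)
  let ?M = "lborel \<Otimes>\<^sub>M N t"
  note i1 = integrable_LN_fst[OF assms assms, of t] and i2 = integrable_LN_sum[OF assms assms, of t]
    and i3 = integrable_LN_shift[OF assms assms, of t]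
  have eq: "(\<lambda>(x, z). (f (x + z) - f x)\<^sup>2)
      = (\<lambda>p. (case p of (x, z) \<Rightarrow> (f x)\<^sup>2) + (case p of (x, z) \<Rightarrow> (f (x + z))\<^sup>2) - 2 * (case p of (x, z) \<Rightarrow> f x * f (x + z)))"
    by (auto simp: fun_eq_iff power2_diff algebra_simps)
  have i: "integrable ?M (\<lambda>(x, z). (f (x + z) - f x)\<^sup>2)" unfolding eq using i1 i2 i3 by auto
  have "(\<integral>(x, z). (f x)\<^sup>2 \<partial>?M) = ip f f"
    using LN.integral_fst[OF i1] by (simp add: ip_self N.prob_space[simplified])
  moreover have "(\<integral>(x, z). (f (x + z))\<^sup>2 \<partial>?M) = ip f f"
    using LN.integral_snd[OF i2] integral_lborel_shift[of "\<lambda>x. (f x)\<^sup>2"]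
    by (simp add: ip_self N.prob_space[simplified])
  ultimately have int: "(\<integral>(x, z). (f (x + z) - f x)\<^sup>2 \<partial>?M) = 2 * E t f"
    unfolding eq using i1 i2 i3 by (simp add: E_def ip_P_eq[OF assms assms])
  have "(\<integral>\<^sup>+z. \<integral>\<^sup>+x. ennreal ((f (x + z) - f x)\<^sup>2) \<partial>lborel \<partial>N t)
      = (\<integral>\<^sup>+p. ennreal (case p of (x, z) \<Rightarrow> (f (x + z) - f x)\<^sup>2) \<partial>?M)"
    by (subst LN.nn_integral_snd[symmetric]) (auto simp: split_beta')
  also have "\<dots> = ennreal (2 * E t f)"
    using i int by (subst nn_integral_eq_integral) (auto simp: split_beta')
  finally show ?thesis .
qed

lemma E_nonneg: assumes "bL2 f" shows "0 \<le> E t f"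
proof -
  have 1: "ip (\<lambda>x. f x - P t f x) (\<lambda>x. f x - P t f x) \<ge> 0" by (rule ip_nonneg)
  have "2 * ip f (P t f) \<le> 1 * ip f f + ip (P t f) (P t f) / 1" using assms bL2_P by (intro ip_amgm) auto
  then show ?thesis using ip_P_P_le[OF assms, of t] by (simp add: E_def)
qed

lemma E_le_2: assumes "bL2 f" shows "E t f \<le> 2 * ip f f"
proof -
  have "2 * ip (\<lambda>x. -1 * f x) (P t f) \<le> 1 * ip (\<lambda>x. -1 * f x) (\<lambda>x. -1 * f x) + ip (P t f) (P t f) / 1"
    by (intro ip_amgm bL2_P bL2_cmult assms) simp
  then show ?thesis using ip_P_P_le[OF assms, of t] unfolding ip_cmult_left ip_cmult_right by (simp add: E_def)
qed

text \<open>
  The energy is a nonnegative quadratic form; the mixed term is absorbed with weight \<open>c\<close>.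
\<close>

lemma E_add_le: assumes f: "bL2 f" and g: "bL2 g" and c: "c > 0"
  shows "E t (\<lambda>x. f x + g x) \<le> (1 + c) * E t f + (1 + 1 / c) * E t g"
proof -
  have b: "bL2 (P t f)" "bL2 (P t g)" using f g bL2_P by auto
  define B where "B = ip f g - ip f (P t g)"
  have s: "ip g (P t f) = ip f (P t g)" using ip_P_sym[OF g f] by (simp add: ip_commute)
  (* Applied at a = - c for the bound on B and at a = 1 for the conclusion. *)
  have eq: "E t (\<lambda>x. a * f x + g x) = a\<^sup>2 * E t f + 2 * a * B + E t g" for a
    using f g b unfolding E_def B_def
    by (simp add: P_add P_cmult bL2_cmult bL2_add ip_add_left ip_add_right ip_cmult_left ip_cmult_right
      s ip_commute[of g f] power2_eq_square algebra_simps)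
  have "0 \<le> E t (\<lambda>x. (- c) * f x + g x)" using f g by (intro E_nonneg bL2_add bL2_cmult)
  moreover have "c * (c * E t f - 2 * B + E t g / c) = (- c)\<^sup>2 * E t f + 2 * (- c) * B + E t g"
    using c by (simp add: power2_eq_square algebra_simps)
  ultimately have "0 \<le> c * (c * E t f - 2 * B + E t g / c)" unfolding eq by simp
  then have "2 * B \<le> c * E t f + E t g / c" using c by (simp add: zero_le_mult_iff)
  moreover have "E t (\<lambda>x. f x + g x) = E t f + 2 * B + E t g" using eq[of 1] by simp
  ultimately show ?thesis by (simp add: algebra_simps)
qed

text \<open>
  Equivalently, \<open>E t f / t\<close> does not decrease when \<open>t\<close> is halved.
\<close>

lemma E_double_le: assumes "bL2 f" "0 \<le> t" shows "E (2 * t) f \<le> 2 * E t f"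
  using ip_P_midpoint[OF assms(1) order_refl assms(2)] P_0[OF bL2_measurable[OF assms(1)]] by (simp add: E_def)

lemma E_half_le: assumes "bL2 f" "0 \<le> t" shows "E (t / 2) f \<le> E t f"
proof -
  have "ip f (P t f) = ip (P (t/4) (P (t/4) f)) (P (t/4) (P (t/4) f))"
    using assms ip_P_half[OF assms] by (simp add: P_P)
  also have "\<dots> \<le> ip (P (t/4) f) (P (t/4) f)" using assms by (intro ip_P_P_le bL2_P)
  also have "\<dots> = ip f (P (t/2) f)" using ip_P_half[of f "t/2"] assms by simp
  finally show ?thesis by (simp add: E_def)
qed

lemma ip_diff_P_le: assumes "bL2 f" "0 \<le> t"
  shows "ip (\<lambda>x. f x - P t f x) (\<lambda>x. f x - P t f x) \<le> 2 * E t f"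
  using ip_P_P_le[OF assms(1), of t] assms by (simp add: ip_diff_self bL2_P E_def)

text \<open>
  By convexity of \<open>s \<mapsto> \<langle>g, P s g\<rangle>\<close>, its decrease over the interval from \<open>t\<close> to
  \<open>t + t / 2 ^ j\<close> is at most the \<open>2 ^ j\<close>-th part of its decrease over the interval from \<open>0\<close> to \<open>t\<close>. Thus
  the energy of \<open>P (t / 2) g\<close> per unit of time is bounded, at all smaller scales, by that of \<open>g\<close> at scale \<open>t\<close>.
\<close>

lemma E_smoothing: assumes g: "bL2 g" and t: "0 \<le> t"
  shows "E (t / 2 ^ j) (P (t / 2) g) \<le> E t g / 2 ^ j"
proof -
  let ?m = "\<lambda>s. ip g (P s g)"
  have conv: "2 ^ j * (?m (t - t / 2 ^ j) - ?m t) \<le> E t g" for j :: nat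
  proof (induction j)
    case 0
    then show ?case using P_0[OF bL2_measurable[OF g]] by (simp add: E_def)
  next
    case (Suc j)
    have p: "t / 2 ^ j \<le> t" using t by (simp add: divide_le_eq mult_le_cancel_left1)
    have "2 * ?m (t - t / 2 ^ j + t / 2 ^ Suc j) \<le> ?m (t - t / 2 ^ j) + ?m (t - t / 2 ^ j + 2 * (t / 2 ^ Suc j))"
      using g p t by (intro ip_P_midpoint) auto
    moreover have "t - t / 2 ^ j + t / 2 ^ Suc j = t - t / 2 ^ Suc j" by (simp add: field_simps)
    moreover have "t - t / 2 ^ j + 2 * (t / 2 ^ Suc j) = t" by (simp add: field_simps)
    ultimately have "2 * (?m (t - t / 2 ^ Suc j) - ?m t) \<le> ?m (t - t / 2 ^ j) - ?m t" by simp
    then have "2 ^ j * (2 * (?m (t - t / 2 ^ Suc j) - ?m t)) \<le> 2 ^ j * (?m (t - t / 2 ^ j) - ?m t)"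
      by (intro mult_left_mono) auto
    moreover have "2 ^ Suc j * (?m (t - t / 2 ^ Suc j) - ?m t) = 2 ^ j * (2 * (?m (t - t / 2 ^ Suc j) - ?m t))"
      by (simp only: power_Suc mult_ac)
    ultimately show ?case using Suc by linarith
  qed
  have p: "t / 2 ^ j \<le> t" using t by (simp add: divide_le_eq mult_le_cancel_left1)
  have "2 * ?m (t - t / 2 ^ j + t / 2 ^ j) \<le> ?m (t - t / 2 ^ j) + ?m (t - t / 2 ^ j + 2 * (t / 2 ^ j))"
    using g p t by (intro ip_P_midpoint) auto
  then have "?m t - ?m (t + t / 2 ^ j) \<le> ?m (t - t / 2 ^ j) - ?m t" by (simp add: add.commute)
  then have "2 ^ j * (?m t - ?m (t + t / 2 ^ j)) \<le> E t g"
    using conv[of j] mult_left_mono[of _ _ "2 ^ j :: real"] by (meson order_trans zero_le_numeral zero_le_power)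
  moreover have "E (t / 2 ^ j) (P (t / 2) g) = ?m t - ?m (t + t / 2 ^ j)"
    unfolding E_def using g t
    by (simp add: P_P ip_P_half ip_P_sym[symmetric] bL2_P)
  ultimately have "2 ^ j * E (t / 2 ^ j) (P (t / 2) g) \<le> E t g" by simp
  then show ?thesis by (simp add: le_divide_eq mult.commute)
qed

lemma E_contraction:
  assumes "bL2 f" "bL2 g" "\<And>x y. \<bar>g x - g y\<bar> \<le> \<bar>f x - f y\<bar>"
  shows "E t g \<le> E t f"
proof -
  have "ennreal (2 * E t g) \<le> ennreal (2 * E t f)"
    unfolding nn_integral_E[OF assms(1), symmetric] nn_integral_E[OF assms(2), symmetric]
    using assms(3) by (intro nn_integral_mono ennreal_leI) (simp add: abs_le_square_iff[symmetric])
  then show ?thesis using E_nonneg[OF assms(1)] by (simp add: ennreal_le_iff)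
qed

text \<open>
  Submodularity. Minimum and maximum keep the sum of the squares and, by the rearrangement inequality at the two points
  \<open>x\<close> and \<open>x + z\<close>, do not decrease the mixed products.
\<close>

lemma E_min_max: assumes a: "bL2 a" and b: "bL2 b"
  shows "E t (\<lambda>x. min (a x) (b x)) + E t (\<lambda>x. max (a x) (b x)) \<le> E t a + E t b"
proof -
  let ?mn = "\<lambda>x. min (a x) (b x)" and ?mx = "\<lambda>x. max (a x) (b x)"
  have m: "bL2 ?mn" "bL2 ?mx" using a b by (auto intro: bL2_min bL2_max)
  have "ip ?mn ?mn + ip ?mx ?mx = ip a a + ip b b"
    unfolding ip_def using bL2_integrable_mult a b m
    by (subst (1 2) Bochner_Integration.integral_add[symmetric]) (auto intro!: Bochner_Integration.integral_cong simp: min_def max_def)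
  moreover have "ip a (P t a) + ip b (P t b) \<le> ip ?mn (P t ?mn) + ip ?mx (P t ?mx)"
    unfolding ip_P_eq[OF a a] ip_P_eq[OF b b] ip_P_eq[OF m(1) m(1)] ip_P_eq[OF m(2) m(2)]
    unfolding Bochner_Integration.integral_add[OF integrable_LN_shift[OF a a] integrable_LN_shift[OF b b], symmetric]
      Bochner_Integration.integral_add[OF integrable_LN_shift[OF m(1) m(1)] integrable_LN_shift[OF m(2) m(2)], symmetric]
  proof (rule integral_mono)
    (* The rearrangement inequality for two pairs. *)
    have re: "p * q + p' * q' \<le> min p p' * min q q' + max p p' * max q q'" for p q p' q' :: real
    proof -
      have "p * q' + p' * q \<le> p * q + p' * q'" if "p \<le> p'" "q \<le> q'" for p q p' q' :: real
        using mult_nonneg_nonneg[of "p' - p" "q' - q"] that by (simp add: algebra_simps)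
      from this[of p p' q' q] this[of p' p q q'] show ?thesis
        by (auto simp: min_def max_def)
    qed
    fix p :: "'a \<times> 'a" assume "p \<in> space (lborel \<Otimes>\<^sub>M N t)"
    show "(case p of (x, z) \<Rightarrow> a x * a (x + z)) + (case p of (x, z) \<Rightarrow> b x * b (x + z))
      \<le> (case p of (x, z) \<Rightarrow> ?mn x * ?mn (x + z)) + (case p of (x, z) \<Rightarrow> ?mx x * ?mx (x + z))"
      by (cases p) (simp add: re)
  qed (intro Bochner_Integration.integrable_add integrable_LN_shift a b m)+
  ultimately show ?thesis by (simp add: E_def)
qed

lemma log_conc_P:
  assumes r: "0 < r" "r < 1"
    and m: "f \<in> borel_measurable borel" "g \<in> borel_measurable borel" "h \<in> borel_measurable borel"
    and f: "\<And>x. 0 \<le> f x" "\<And>x. f x \<le> C" and g: "\<And>x. 0 \<le> g x" "\<And>x. g x \<le> C"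
    and h: "\<And>x. 0 \<le> h x" "\<And>x. h x \<le> C" and rel: "log_conc r f g h"
  shows "log_conc r (P t f) (P t g) (P t h)"
proof -
  have "P t u = (\<lambda>x. \<integral>z. u (x + sqrt t *\<^sub>R z) \<partial>gauss vs)" if [measurable]: "u \<in> borel_measurable borel" for u
    unfolding P_def[abs_def] N_def by (simp add: integral_distr)
  then show ?thesis using log_conc_gauss[OF assms] m by simp
qed

lemma nn_integral_N_inner_sq:
  assumes "t \<ge> 0" shows "(\<integral>\<^sup>+z. ennreal ((z \<bullet> \<xi>)\<^sup>2) \<partial>N t) = ennreal (t * (\<Sum>v\<leftarrow>vs. (v \<bullet> \<xi>)\<^sup>2))"
  using assms nn_integral_gauss_inner_sq[of vs \<xi>] 
  by (simp add: nn_integral_N power_mult_distrib ennreal_mult' nn_integral_cmult)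

text \<open>
  The trace of the covariance of \<open>gauss vs\<close>.
\<close>

definition m2 :: real where "m2 = (\<Sum>b\<in>Basis. \<Sum>v\<leftarrow>vs. (v \<bullet> b)\<^sup>2)"

lemma m2_nonneg: "m2 \<ge> 0" unfolding m2_def by (intro sum_nonneg sum_list_nonneg) auto

lemma nn_integral_gauss_norm_sq: "(\<integral>\<^sup>+z. ennreal ((norm z)\<^sup>2) \<partial>gauss vs) = ennreal m2"
proof -
  have n: "0 \<le> (\<Sum>v\<leftarrow>vs. (v \<bullet> b)\<^sup>2)" for b by (intro sum_list_nonneg) auto
  have "(\<integral>\<^sup>+z. ennreal ((norm z)\<^sup>2) \<partial>gauss vs) = (\<integral>\<^sup>+z. (\<Sum>b\<in>Basis. ennreal ((z \<bullet> b)\<^sup>2)) \<partial>gauss vs)"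
    by (intro nn_integral_cong) (simp add: norm_eq_sqrt_inner euclidean_inner[of z z for z] power2_eq_square sum_nonneg)
  also have "\<dots> = (\<Sum>b\<in>Basis. ennreal (\<Sum>v\<leftarrow>vs. (v \<bullet> b)\<^sup>2))"
    by (subst nn_integral_sum) (auto simp: nn_integral_gauss_inner_sq)
  also have "\<dots> = ennreal m2" unfolding m2_def using n by (simp add: sum_ennreal)
  finally show ?thesis .
qed

lemma nn_integral_N_norm_sq: "t \<ge> 0 \<Longrightarrow> (\<integral>\<^sup>+z. ennreal ((norm z)\<^sup>2) \<partial>N t) = ennreal (t * m2)"
  using nn_integral_gauss_norm_sq m2_nonneg
  by (simp add: nn_integral_N power_mult_distrib ennreal_mult' nn_integral_cmult)

text \<open>
  By scaling, jumps longer than \<open>\<delta>\<close> contribute \<open>o(t)\<close> to the second moment.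
\<close>

lemma N_tail:
  assumes "\<delta> > 0" "\<epsilon> > 0"
  obtains T where "T > 0"
    "\<And>t. 0 < t \<Longrightarrow> t \<le> T \<Longrightarrow> (\<integral>\<^sup>+z. ennreal ((norm z)\<^sup>2) * indicator {z. norm z > \<delta>} z \<partial>N t) \<le> ennreal (t * \<epsilon>)"
proof -
  let ?u = "\<lambda>n::nat. \<lambda>z::'a. ennreal ((norm z)\<^sup>2) * indicator {z. norm z > real n} z"
  have "(\<lambda>n. \<integral>\<^sup>+z. ?u n z \<partial>gauss vs) \<longlonglongrightarrow> (\<integral>\<^sup>+z. 0 \<partial>gauss vs)"
  proof (rule nn_integral_dominated_convergence[where w="\<lambda>z. ennreal ((norm z)\<^sup>2)"])
    show "AE z in gauss vs. (\<lambda>n. ?u n z) \<longlonglongrightarrow> 0"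
    proof (rule AE_I2)
      fix z :: 'a
      obtain m :: nat where m: "norm z \<le> real m" using real_arch_simple by blast
      have "\<forall>\<^sub>F n in sequentially. ?u n z = 0"
        using eventually_ge_at_top[of m] by eventually_elim (use m in \<open>auto simp: indicator_def\<close>)
      then show "(\<lambda>n. ?u n z) \<longlonglongrightarrow> 0" by (rule tendsto_eventually)
    qed
  qed (auto simp: nn_integral_gauss_norm_sq indicator_def)
  then have "\<forall>\<^sub>F n in sequentially. (\<integral>\<^sup>+z. ?u n z \<partial>gauss vs) < ennreal \<epsilon>"
    using assms by (intro order_tendstoD) auto
  then obtain n where n: "(\<integral>\<^sup>+z. ?u n z \<partial>gauss vs) < ennreal \<epsilon>" by (auto simp: eventually_sequentially)
  let ?T = "(\<delta> / (real n + 1))\<^sup>2"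
  show ?thesis
  proof (rule that[of ?T])
    show "?T > 0" using assms by simp
    fix t :: real assume t: "0 < t" "t \<le> ?T"
    have "sqrt t \<le> \<delta> / (real n + 1)" using real_sqrt_le_mono[OF t(2)] assms by simp
    then have st: "sqrt t * (real n + 1) \<le> \<delta>" by (simp add: field_simps)
    have "(\<integral>\<^sup>+z. ennreal ((norm z)\<^sup>2) * indicator {z. norm z > \<delta>} z \<partial>N t)
       = (\<integral>\<^sup>+z. ennreal ((norm (sqrt t *\<^sub>R z))\<^sup>2) * indicator {z. norm z > \<delta>} (sqrt t *\<^sub>R z) \<partial>gauss vs)"
      by (rule nn_integral_N) measurable
    also have "\<dots> \<le> (\<integral>\<^sup>+z. ennreal t * ?u n z \<partial>gauss vs)"
    proof (rule nn_integral_mono)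
      fix z :: 'a
      have "real n < norm z" if "\<delta> < sqrt t * norm z"
      proof (rule ccontr)
        assume "\<not> real n < norm z"
        then have "sqrt t * norm z \<le> sqrt t * (real n + 1)" using t by (intro mult_left_mono) auto
        then show False using st that by linarith
      qed
      then show "ennreal ((norm (sqrt t *\<^sub>R z))\<^sup>2) * indicator {z. norm z > \<delta>} (sqrt t *\<^sub>R z) \<le> ennreal t * ?u n z"
        using t by (auto simp: indicator_def power_mult_distrib ennreal_mult')
    qed
    also have "\<dots> = ennreal t * (\<integral>\<^sup>+z. ?u n z \<partial>gauss vs)" by (rule nn_integral_cmult) measurable
    also have "\<dots> \<le> ennreal t * ennreal \<epsilon>" using n by (intro mult_left_mono) auto
    finally show "(\<integral>\<^sup>+z. ennreal ((norm z)\<^sup>2) * indicator {z. norm z > \<delta>} z \<partial>N t) \<le> ennreal (t * \<epsilon>)"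
      using t assms by (simp add: ennreal_mult)
  qed
qed

end

section \<open>Test functions\<close>

text \<open>
  The powers in the denominator make this family of flat functions closed under differentiation up to linear
  combinations.
\<close>

definition theta :: "nat \<Rightarrow> real \<Rightarrow> real" where
  "theta m s = (if s \<le> 0 then 0 else exp (- (1 / s)) / s ^ m)"

lemma theta_tendsto_0: "(theta m \<longlongrightarrow> 0) (at 0)"
proof (rule filterlim_split_at)
  show "(theta m \<longlongrightarrow> 0) (at_left 0)"
    by (rule tendsto_eventually) (auto simp: eventually_at_left_field theta_def intro: exI[of _ "-1"])
  have "((\<lambda>u::real. u ^ m / exp u) \<longlongrightarrow> 0) at_top" by (rule tendsto_power_div_exp_0)
  then have "((\<lambda>s::real. (inverse s) ^ m / exp (inverse s)) \<longlongrightarrow> 0) (at_right 0)"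
    by (rule filterlim_compose) (rule filterlim_inverse_at_top_right)
  then show "(theta m \<longlongrightarrow> 0) (at_right 0)"
  proof (rule Lim_transform_eventually)
    show "\<forall>\<^sub>F s in at_right 0. (inverse s) ^ m / exp (inverse s) = theta m s"
      using eventually_at_right_less[of "0::real"]
      by eventually_elim (simp add: theta_def exp_minus field_simps power_divide)
  qed
qed

lemma theta_deriv: "(theta m has_real_derivative (theta (m + 2) s - real m * theta (m + 1) s)) (at s)"
proof -
  consider "s < 0" | "s = 0" | "s > 0" by linarith
  then show ?thesis
  proof cases
    case 1
    have "((\<lambda>_. 0) has_real_derivative 0) (at s)" by simp
    then have "(theta m has_real_derivative 0) (at s)"
      by (rule has_field_derivative_transform_within_open[of _ _ _ "{..<0}"]) (use 1 in \<open>auto simp: theta_def\<close>)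
    then show ?thesis using 1 by (simp add: theta_def)
  next
    case 2
    have "((\<lambda>h. (theta m (0 + h) - theta m 0) / h) \<longlongrightarrow> 0) (at 0)"
    proof (rule Lim_transform_eventually[OF theta_tendsto_0[of "m + 1"]])
      show "\<forall>\<^sub>F h in at 0. theta (m + 1) h = (theta m (0 + h) - theta m 0) / h"
        by (auto simp: eventually_at_filter theta_def)
    qed
    then show ?thesis using 2 by (simp add: DERIV_def theta_def)
  next
    case 3
    have "((\<lambda>s. exp (- (1 / s)) / s ^ m) has_real_derivative
       (exp (- (1 / s)) * (1 / (s * s)) * s ^ m - exp (- (1 / s)) * (real m * s ^ (m - 1))) / (s ^ m * s ^ m)) (at s)"
      using 3 by (auto intro!: derivative_eq_intros)
    also have "(exp (- (1 / s)) * (1 / (s * s)) * s ^ m - exp (- (1 / s)) * (real m * s ^ (m - 1))) / (s ^ m * s ^ m)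
      = theta (m + 2) s - real m * theta (m + 1) s"
      using 3 by (cases m) (simp_all add: theta_def field_simps power2_eq_square)
    finally have "((\<lambda>s. exp (- (1 / s)) / s ^ m) has_real_derivative (theta (m + 2) s - real m * theta (m + 1) s)) (at s)" .
    then show ?thesis
      by (rule has_field_derivative_transform_within_open[of _ _ _ "{0<..}"]) (use 3 in \<open>auto simp: theta_def\<close>)
  qed
qed

lemma partial_eq: "(f has_derivative f') (at x) \<Longrightarrow> partial i f x = f' (axis i 1)"
  unfolding partial_def by (metis frechet_derivative_at)

text \<open>
  Coinduction for smoothness: a set of differentiable functions that is closed under partial
  derivatives consists of smooth functions.
\<close>

lemma Ck_closed:
  assumes "\<And>f. f \<in> F \<Longrightarrow> (\<forall>x. f differentiable (at x)) \<and> (\<forall>i. partial i f \<in> F)"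
  shows "f \<in> F \<Longrightarrow> Ck k f"
proof (induction k arbitrary: f)
  case 0
  then show ?case using assms[of f]
    by (auto intro!: continuous_at_imp_continuous_on differentiable_imp_continuous_within)
next
  case (Suc k)
  then show ?case using assms[of f] by auto
qed

text \<open>
  An algebra that contains the standard bump functions and is closed under partial derivatives.
\<close>

inductive smooth_alg :: "(real^'n \<Rightarrow> real) \<Rightarrow> bool" where
  const: "smooth_alg (\<lambda>x. c)"
| coord: "smooth_alg (\<lambda>x. x $ i)"
| theta: "smooth_alg (\<lambda>x. theta m (e - (x - x0) \<bullet> (x - x0)))"
| add: "smooth_alg f \<Longrightarrow> smooth_alg g \<Longrightarrow> smooth_alg (\<lambda>x. f x + g x)"
| mult: "smooth_alg f \<Longrightarrow> smooth_alg g \<Longrightarrow> smooth_alg (\<lambda>x. f x * g x)"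

lemma differentiable_has_frechet:
  "f differentiable (at x) \<Longrightarrow> (f has_derivative frechet_derivative f (at x)) (at x)"
  by (simp add: frechet_derivative_works)

lemma partial_add: "f differentiable (at x) \<Longrightarrow> g differentiable (at x) \<Longrightarrow>
    partial i (\<lambda>x. f x + g x) x = partial i f x + partial i g x"
  by (subst partial_eq[OF has_derivative_add[OF differentiable_has_frechet differentiable_has_frechet]])
    (auto simp: partial_def)

lemma partial_mult: "f differentiable (at x) \<Longrightarrow> g differentiable (at x) \<Longrightarrow>
    partial i (\<lambda>x. f x * g x) x = f x * partial i g x + partial i f x * g x"
  by (subst partial_eq[OF has_derivative_mult[OF differentiable_has_frechet differentiable_has_frechet]])
    (auto simp: partial_def)

lemma smooth_alg_diff: "smooth_alg f \<Longrightarrow> (\<forall>x. f differentiable (at x)) \<and> (\<forall>i. smooth_alg (partial i f))"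
proof (induction rule: smooth_alg.induct)
  case (const c)
  have "partial i (\<lambda>x::real^'a. c) = (\<lambda>x. 0)" for i
    by (rule ext) (simp add: partial_eq[OF has_derivative_const])
  then show ?case by (auto intro: smooth_alg.const)
next
  case (coord j)
  have d: "((\<lambda>x::real^'a. x $ j) has_derivative (\<lambda>v. v $ j)) (at x)" for x
    by (rule bounded_linear_imp_has_derivative[OF bounded_linear_vec_nth])
  have "partial i (\<lambda>x::real^'a. x $ j) = (\<lambda>x. (axis i 1 :: real^'a) $ j)" for i
    by (rule ext) (rule partial_eq[OF d])
  then show ?case using d by (auto simp: differentiable_def intro!: smooth_alg.const)
next
  case (theta m e x0)
  let ?q = "\<lambda>x. e - (x - x0) \<bullet> (x - x0)"
  have d: "((\<lambda>x. theta m (?q x)) has_derivative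
     (\<lambda>v. (theta (m + 2) (?q x) - real m * theta (m + 1) (?q x)) * (- (2 * ((x - x0) \<bullet> v))))) (at x)" for x
  proof -
    have "(?q has_derivative (\<lambda>v. - (2 * ((x - x0) \<bullet> v)))) (at x)"
      by (auto intro!: derivative_eq_intros simp: inner_commute fun_eq_iff)
    from DERIV_compose_FDERIV[OF theta_deriv this] show ?thesis
      by (simp add: mult.commute)
  qed
  have eq: "partial i (\<lambda>x. theta m (?q x)) = (\<lambda>x. (theta (m + 2) (?q x) + (- real m) * theta (m + 1) (?q x))
      * ((- 2) * x $ i + 2 * x0 $ i))" for i
    by (rule ext) (subst partial_eq[OF d], simp add: inner_axis algebra_simps)
  have "smooth_alg (partial i (\<lambda>x. theta m (?q x)))" for i
    unfolding eq by (intro smooth_alg.intros)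
  then show ?case using d by (auto simp: differentiable_def)
next
  case (add f g)
  have "partial i (\<lambda>x. f x + g x) = (\<lambda>x. partial i f x + partial i g x)" for i
    using add by (intro ext partial_add) auto
  then show ?case using add by (auto intro!: smooth_alg.add derivative_intros)
next
  case (mult f g)
  have "partial i (\<lambda>x. f x * g x) = (\<lambda>x. f x * partial i g x + partial i f x * g x)" for i
    using mult by (intro ext partial_mult) auto
  then show ?case using mult by (auto intro!: smooth_alg.add smooth_alg.mult derivative_intros)
qed

lemma smooth_alg_Ck: "smooth_alg f \<Longrightarrow> Ck k f"
  using Ck_closed[of "Collect smooth_alg" f k] smooth_alg_diff by auto

lemma Ck_Suc_imp: "Ck (Suc k) f \<Longrightarrow> Ck k f"
proof (induction k arbitrary: f)
  case 0
  then show ?case by (auto intro!: continuous_at_imp_continuous_on differentiable_imp_continuous_within)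
next
  case (Suc k)
  then show ?case by (metis Ck.simps(2))
qed

lemma Ck_add: "Ck k f \<Longrightarrow> Ck k g \<Longrightarrow> Ck k (\<lambda>x. f x + g x)"
proof (induction k arbitrary: f g)
  case 0
  then show ?case by (auto intro: continuous_intros)
next
  case (Suc k)
  have "partial i (\<lambda>x. f x + g x) = (\<lambda>x. partial i f x + partial i g x)" for i
    using Suc.prems by (intro ext partial_add) auto
  then show ?case using Suc by (auto intro!: derivative_intros)
qed

lemma Ck_mult: "Ck k f \<Longrightarrow> Ck k g \<Longrightarrow> Ck k (\<lambda>x. f x * g x)"
proof (induction k arbitrary: f g)
  case 0
  then show ?case by (auto intro: continuous_intros)
next
  case (Suc k)
  have "partial i (\<lambda>x. f x * g x) = (\<lambda>x. f x * partial i g x + partial i f x * g x)" for i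
    using Suc.prems by (intro ext partial_mult) auto
  moreover have "Ck k f" "Ck k g" using Suc.prems by (auto intro: Ck_Suc_imp)
  ultimately show ?case using Suc by (auto intro!: derivative_intros Ck_add)
qed

lemma Ck_const: "Ck k (\<lambda>x. c)" by (rule smooth_alg_Ck[OF smooth_alg.const])

abbreviation supp :: "(real^'n \<Rightarrow> real) \<Rightarrow> (real^'n) set" where "supp f \<equiv> closure {x. f x \<noteq> 0}"

lemma test_functionsI:
  assumes "\<And>k. Ck k f" "compact K" "K \<subseteq> \<Omega>" "\<And>x. x \<notin> K \<Longrightarrow> f x = 0"
  shows "f \<in> test_functions \<Omega>"
proof -
  have s: "supp f \<subseteq> K" using assms(2,4) by (intro closure_minimal) (auto intro: compact_imp_closed)
  moreover have "compact (supp f)" using compact_Int_closed[OF assms(2) closed_closure] s by (metis inf.absorb2)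
  ultimately show ?thesis using assms unfolding test_functions_def by auto
qed

lemma test_functions_supp:
  assumes "f \<in> test_functions \<Omega>"
  shows "compact (supp f)" "supp f \<subseteq> \<Omega>" "x \<notin> supp f \<Longrightarrow> f x = 0"
  using assms closure_subset[of "{x. f x \<noteq> 0}"] by (auto simp: test_functions_def)

lemma test_functions_differentiable: "f \<in> test_functions \<Omega> \<Longrightarrow> f differentiable (at x)"
  unfolding test_functions_def using Ck.simps(2)[of 0 f] by blast

lemma test_functions_continuous: "f \<in> test_functions \<Omega> \<Longrightarrow> continuous_on S f"
  using test_functions_differentiable[of f \<Omega>]
  by (auto intro!: continuous_at_imp_continuous_on differentiable_imp_continuous_within)

lemma test_functions_borel[measurable_dest]: "f \<in> test_functions \<Omega> \<Longrightarrow> f \<in> borel_measurable borel"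
  by (intro borel_measurable_continuous_onI test_functions_continuous)

lemma partial_outside_supp: assumes "x \<notin> supp f" shows "partial i f x = 0"
proof -
  have "((\<lambda>_. 0) has_derivative (\<lambda>_. 0)) (at x)" by simp
  then have "(f has_derivative (\<lambda>_. 0)) (at x)"
    by (rule has_derivative_transform_within_open[of _ _ _ _ "- supp f"])
      (use assms closure_subset[of "{x. f x \<noteq> 0}"] in auto)
  then show ?thesis by (rule partial_eq)
qed

lemma test_functions_partial:
  assumes "f \<in> test_functions \<Omega>" shows "partial i f \<in> test_functions \<Omega>"
proof (rule test_functionsI[OF _ test_functions_supp(1,2)[OF assms] partial_outside_supp])
  show "Ck k (partial i f)" for k using assms Ck.simps(2)[of k f] by (auto simp: test_functions_def)
qed

lemma test_functions_mult: assumes "f \<in> test_functions \<Omega>" "g \<in> test_functions \<Omega>"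
  shows "(\<lambda>x. f x * g x) \<in> test_functions \<Omega>"
proof (rule test_functionsI[OF _ test_functions_supp(1,2)[OF assms(1)]])
  show "Ck k (\<lambda>x. f x * g x)" for k using assms by (intro Ck_mult) (simp_all add: test_functions_def)
  show "f x * g x = 0" if "x \<notin> supp f" for x using test_functions_supp(3)[OF assms(1) that] by simp
qed

lemma test_functions_cmult: assumes "f \<in> test_functions \<Omega>" shows "(\<lambda>x. c * f x) \<in> test_functions \<Omega>"
proof (rule test_functionsI[OF _ test_functions_supp(1,2)[OF assms]])
  show "Ck k (\<lambda>x. c * f x)" for k using assms by (intro Ck_mult Ck_const) (simp add: test_functions_def)
  show "c * f x = 0" if "x \<notin> supp f" for x using test_functions_supp(3)[OF assms that] by simp
qed

lemma test_functions_bounded: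
  assumes "f \<in> test_functions \<Omega>" obtains C where "C > 0" "\<And>x. \<bar>f x\<bar> \<le> C"
proof -
  have "compact (f ` supp f)"
    by (intro compact_continuous_image test_functions_continuous[OF assms] test_functions_supp(1)[OF assms])
  then obtain C where C: "\<And>x. x \<in> supp f \<Longrightarrow> \<bar>f x\<bar> \<le> C"
    using compact_imp_bounded[of "f ` supp f"] unfolding bounded_iff by auto
  have "\<bar>f x\<bar> \<le> \<bar>C\<bar> + 1" for x
    using C[of x] test_functions_supp(3)[OF assms, of x] by (cases "x \<in> supp f") auto
  then show ?thesis by (intro that[of "\<bar>C\<bar> + 1"]) auto
qed

definition grad :: "(real^'n \<Rightarrow> real) \<Rightarrow> real^'n \<Rightarrow> real^'n" where "grad f x = (\<chi> i. partial i f x)"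

lemma grad_has_derivative:
  assumes "f differentiable (at x)" shows "(f has_derivative (\<lambda>v. grad f x \<bullet> v)) (at x)"
proof -
  let ?D = "frechet_derivative f (at x)"
  have d: "(f has_derivative ?D) (at x)" using assms by (rule differentiable_has_frechet)
  then interpret D: bounded_linear ?D by (rule has_derivative_bounded_linear)
  have "?D v = grad f x \<bullet> v" for v
  proof -
    have "?D v = ?D (\<Sum>i\<in>UNIV. v $ i *\<^sub>R axis i 1)"
      using basis_expansion[of v] by (simp add: scalar_mult_eq_scaleR)
    also have "\<dots> = (\<Sum>i\<in>UNIV. v $ i * partial i f x)"
      by (simp add: D.sum D.scaleR partial_def)
    also have "\<dots> = grad f x \<bullet> v" by (simp add: inner_vec_def grad_def mult.commute)
    finally show ?thesis .
  qed
  then have "?D = (\<lambda>v. grad f x \<bullet> v)" by (rule ext)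
  then show ?thesis using d by simp
qed

lemma test_functions_grad_bounded:
  assumes "f \<in> test_functions \<Omega>" obtains L where "L > 0" "\<And>x. norm (grad f x) \<le> L"
proof -
  have "\<exists>C>0. \<forall>x. \<bar>partial i f x\<bar> \<le> C" for i
    using test_functions_bounded[OF test_functions_partial[OF assms, of i]] by blast
  then obtain C where C: "\<And>i. C i > 0" "\<And>i x. \<bar>partial i f x\<bar> \<le> C i" by metis
  have "norm (grad f x) \<le> (\<Sum>i\<in>UNIV. C i)" for x
  proof -
    have "norm (grad f x) \<le> (\<Sum>i\<in>UNIV. \<bar>grad f x $ i\<bar>)" by (rule norm_le_l1_cart)
    also have "\<dots> \<le> (\<Sum>i\<in>UNIV. C i)" by (intro sum_mono) (simp add: grad_def C)
    finally show ?thesis .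
  qed
  moreover have "(\<Sum>i\<in>UNIV. C i) > 0" using C(1) by (intro sum_pos) auto
  ultimately show ?thesis by (rule that[rotated])
qed

lemma onorm_inner_le:
  fixes a :: "'a::real_inner" assumes "norm a \<le> b" shows "onorm (\<lambda>v. a \<bullet> v) \<le> b"
proof (rule onorm_bound)
  show "0 \<le> b" using norm_ge_zero[of a] assms by linarith
  show "norm (a \<bullet> v) \<le> b * norm v" for v
    using Cauchy_Schwarz_ineq2[of a v] mult_right_mono[OF assms norm_ge_zero[of v]] by simp
qed

lemma test_functions_lipschitz:
  assumes "f \<in> test_functions \<Omega>" obtains L where "L > 0" "\<And>x y. \<bar>f x - f y\<bar> \<le> L * norm (x - y)"
proof -
  obtain L where L: "L > 0" "\<And>x. norm (grad f x) \<le> L" using test_functions_grad_bounded[OF assms] by blast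
  have "norm (f x - f y) \<le> L * norm (x - y)" for x y
  proof (rule differentiable_bound[of UNIV f "\<lambda>x v. grad f x \<bullet> v"])
    fix x show "(f has_derivative (\<lambda>v. grad f x \<bullet> v)) (at x within UNIV)"
      using grad_has_derivative[OF test_functions_differentiable[OF assms]] by simp
    show "onorm (\<lambda>v. grad f x \<bullet> v) \<le> L"
      by (rule onorm_inner_le[OF L(2)])
  qed auto
  then show ?thesis using L(1) by (intro that) auto
qed

text \<open>
  A quadratic remainder that is uniform in \<open>x\<close>; it allows differentiation under integrals without dominated convergence.
\<close>

lemma test_functions_taylor:
  assumes "f \<in> test_functions \<Omega>"
  obtains L where "L > 0" "\<And>x v. \<bar>f (x + v) - f x - grad f x \<bullet> v\<bar> \<le> L * (norm v)\<^sup>2"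
proof -
  have "\<exists>C>0. \<forall>x y. \<bar>partial i f x - partial i f y\<bar> \<le> C * norm (x - y)" for i
    using test_functions_lipschitz[OF test_functions_partial[OF assms, of i]] by metis
  then obtain C where C: "\<And>i. C i > 0" "\<And>i x y. \<bar>partial i f x - partial i f y\<bar> \<le> C i * norm (x - y)" by metis
  let ?L = "\<Sum>i\<in>UNIV. C i"
  have g: "norm (grad f x - grad f y) \<le> ?L * norm (x - y)" for x y
  proof -
    have "norm (grad f x - grad f y) \<le> (\<Sum>i\<in>UNIV. \<bar>(grad f x - grad f y) $ i\<bar>)" by (rule norm_le_l1_cart)
    also have "\<dots> \<le> (\<Sum>i\<in>UNIV. C i * norm (x - y))" by (intro sum_mono) (simp add: grad_def C)
    finally show ?thesis by (simp add: sum_distrib_right)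
  qed
  have L: "?L > 0" using C(1) by (intro sum_pos) auto
  have "\<bar>f (x + v) - f x - grad f x \<bullet> v\<bar> \<le> ?L * (norm v)\<^sup>2" for x v
  proof -
    have "norm (f (x + v) - f x - (\<lambda>v. grad f x \<bullet> v) (x + v - x)) \<le> norm (x + v - x) * (?L * norm v)"
    proof (rule differentiable_bound_linearization[of x "x + v" "cball x (norm v)" f "\<lambda>x v. grad f x \<bullet> v"])
      fix y assume y: "y \<in> cball x (norm v)"
      show "(f has_derivative (\<lambda>v. grad f y \<bullet> v)) (at y within cball x (norm v))"
        using grad_has_derivative[OF test_functions_differentiable[OF assms]] by (rule has_derivative_at_withinI)
      have "norm (grad f y - grad f x) \<le> ?L * norm v"
        using g[of y x] y L by (auto simp: dist_norm norm_minus_commute intro: order_trans mult_left_mono)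
      then show "onorm ((\<lambda>v. grad f y \<bullet> v) - (\<lambda>v. grad f x \<bullet> v)) \<le> ?L * norm v"
        unfolding fun_diff_def inner_diff_left[symmetric] by (rule onorm_inner_le)
    qed (auto simp: dist_norm mult_le_cancel_right1 mult_le_one intro: mult_left_le_one_le)
    then show ?thesis by (simp add: power2_eq_square mult_ac)
  qed
  then show ?thesis using L by (rule that[rotated])
qed

lemma integrable_bounded_compact:
  fixes f :: "'a::euclidean_space \<Rightarrow> real"
  assumes "f \<in> borel_measurable borel" "\<And>x. \<bar>f x\<bar> \<le> C" "compact K" "\<And>x. x \<notin> K \<Longrightarrow> f x = 0"
  shows "integrable lborel f"
proof (rule Bochner_Integration.integrable_bound)
  show "integrable lborel (\<lambda>x. C * indicator K x :: real)"
    using emeasure_compact_finite[OF assms(3)] assms(3)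
    by (intro integrable_mult_right integrable_real_indicator) (auto simp: borel_compact)
  show "AE x in lborel. norm (f x) \<le> norm (C * indicator K x :: real)"
    using assms(2,4) by (intro AE_I2) (auto simp: indicator_def intro: order_trans[OF _ abs_ge_self])
qed (use assms in auto)

lemma test_functions_integrable: assumes "f \<in> test_functions \<Omega>" shows "integrable lborel f"
proof -
  obtain C where "\<And>x. \<bar>f x\<bar> \<le> C" using test_functions_bounded[OF assms] by blast
  then show ?thesis
    by (rule integrable_bounded_compact[OF test_functions_borel[OF assms] _
          test_functions_supp(1)[OF assms] test_functions_supp(3)[OF assms]])
qed

text \<open>
  Translations do not change the integral of \<open>f\<close>, so the difference quotients of \<open>f\<close> have integral zero.
\<close>

lemma integral_partial_test: assumes f: "f \<in> test_functions \<Omega>" shows "(\<integral>x. partial i f x \<partial>lborel) = 0"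
proof -
  obtain L where L: "L > 0" "\<And>x v. \<bar>f (x + v) - f x - grad f x \<bullet> v\<bar> \<le> L * (norm v)\<^sup>2"
    using test_functions_taylor[OF f] by blast
  have fm[measurable]: "f \<in> borel_measurable borel" using f by (rule test_functions_borel)
  note pf = test_functions_partial[OF f, of i]
  obtain R where R: "R > 0" "supp f \<subseteq> ball 0 R"
    using compact_imp_bounded[OF test_functions_supp(1)[OF f]] bounded_subset_ballD by blast
  have out: "y \<notin> supp f" if "norm y > R" for y
  proof
    assume "y \<in> supp f"
    then have "y \<in> ball 0 R" using R(2) by (rule subsetD[rotated])
    then show False using that by simp
  qed
  let ?B = "cball (0::real^'a) (R + 1)"
  let ?V = "measure lborel ?B"
  have sh: "integrable lborel (\<lambda>x. f (x + v))" for v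
    using test_functions_integrable[OF f]
    by (subst (asm) lborel_distr_plus[of v, symmetric]) (simp add: integrable_distr_eq add.commute)
  have sh': "(\<integral>x. f (x + v) \<partial>lborel) = (\<integral>x. f x \<partial>lborel)" for v
    by (subst (2) lborel_distr_plus[of v, symmetric]) (simp add: integral_distr add.commute)
  have "\<bar>\<integral>x. partial i f x \<partial>lborel\<bar> \<le> h * (L * ?V)" if h: "0 < h" "h < 1" for h
  proof -
    let ?v = "h *\<^sub>R axis i 1 :: real^'a"
    let ?r = "\<lambda>x. f (x + ?v) - f x - h * partial i f x"
    have gv: "grad f x \<bullet> ?v = h * partial i f x" for x by (simp add: grad_def inner_axis)
    have nv: "norm ?v = h" using h by (simp add: norm_axis_1)
    have ir: "integrable lborel ?r"
      using sh test_functions_integrable[OF f] test_functions_integrable[OF pf] by auto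
    have "(\<integral>x. ?r x \<partial>lborel) = - (h * (\<integral>x. partial i f x \<partial>lborel))"
      using sh test_functions_integrable[OF f] test_functions_integrable[OF pf] by (simp add: sh')
    then have "h * \<bar>\<integral>x. partial i f x \<partial>lborel\<bar> = \<bar>\<integral>x. ?r x \<partial>lborel\<bar>" using h by (simp add: abs_mult)
    also have "\<dots> \<le> (\<integral>x. \<bar>?r x\<bar> \<partial>lborel)" by (rule integral_abs_bound)
    also have "\<dots> \<le> (\<integral>x. L * h\<^sup>2 * indicator ?B x \<partial>lborel)"
    proof (rule integral_mono)
      show "integrable lborel (\<lambda>x. \<bar>?r x\<bar>)" using ir by simp
      show "integrable lborel (\<lambda>x. L * h\<^sup>2 * indicator ?B x)"
        by (intro integrable_mult_right integrable_real_indicator) (use emeasure_compact_finite[OF compact_cball] in auto)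
      fix x :: "real^'a"
      show "\<bar>?r x\<bar> \<le> L * h\<^sup>2 * indicator ?B x"
      proof (cases "x \<in> ?B")
        case True
        then show ?thesis using L(2)[of x ?v] unfolding gv nv by simp
      next
        case False
        then have x: "norm x > R + 1" by simp
        have "norm (x + ?v) > R" using norm_triangle_ineq2[of x "- ?v"] nv h x by simp
        then have o1: "x + ?v \<notin> supp f" by (rule out)
        have o2: "x \<notin> supp f" using x R(1) by (intro out) linarith
        have "f x = 0" "f (x + ?v) = 0" "partial i f x = 0"
          by (rule test_functions_supp(3)[OF f o2] test_functions_supp(3)[OF f o1] partial_outside_supp[OF o2])+
        then show ?thesis using False by simp
      qed
    qed
    also have "\<dots> = h * (h * (L * ?V))" by (simp add: power2_eq_square)
    finally show ?thesis using h by simp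
  qed
  then have "\<forall>\<^sub>F h in at_right 0. \<bar>\<integral>x. partial i f x \<partial>lborel\<bar> \<le> h * (L * ?V)"
    by (intro eventually_at_rightI[of 0 1]) auto
  moreover have "((\<lambda>h. h * (L * ?V)) \<longlongrightarrow> 0 * (L * ?V)) (at_right 0)" by (intro tendsto_intros)
  ultimately have "\<bar>\<integral>x. partial i f x \<partial>lborel\<bar> \<le> 0 * (L * ?V)"
    by (intro tendsto_lowerbound) auto
  then show ?thesis by simp
qed

lemma integration_by_parts_test:
  assumes "f \<in> test_functions \<Omega>" "g \<in> test_functions \<Omega>"
  shows "(\<integral>x. f x * partial i g x \<partial>lborel) = - (\<integral>x. partial i f x * g x \<partial>lborel)"
proof -
  have eq: "partial i (\<lambda>x. f x * g x) = (\<lambda>x. f x * partial i g x + partial i f x * g x)"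
    using assms by (intro ext partial_mult test_functions_differentiable)
  have "integrable lborel (\<lambda>x. f x * partial i g x)" "integrable lborel (\<lambda>x. partial i f x * g x)"
    using assms by (auto intro: test_functions_integrable test_functions_mult test_functions_partial)
  then show ?thesis using integral_partial_test[OF test_functions_mult[OF assms], of i] unfolding eq by simp
qed

section \<open>Mollification\<close>

definition bump :: "real \<Rightarrow> real^'n \<Rightarrow> real^'n \<Rightarrow> real" where
  "bump e x0 x = theta 0 (e\<^sup>2 - (x - x0) \<bullet> (x - x0))"

lemma bump_nonneg: "0 \<le> bump e x0 x" by (simp add: bump_def theta_def)

lemma bump_pos_iff: assumes "e > 0" shows "bump e x0 x \<noteq> 0 \<longleftrightarrow> norm (x - x0) < e"
proof -
  have "bump e x0 x \<noteq> 0 \<longleftrightarrow> (norm (x - x0))\<^sup>2 < e\<^sup>2"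
    unfolding bump_def theta_def power2_norm_eq_inner by simp
  also have "\<dots> \<longleftrightarrow> norm (x - x0) < e"
    using assms by (meson less_imp_le norm_ge_zero power2_less_imp_less power_strict_mono zero_less_numeral)
  finally show ?thesis .
qed

lemma bump_shift: "bump e x0 x = bump e 0 (x - x0)" by (simp add: bump_def)
lemma bump_uminus: "bump e 0 (- x) = bump e 0 x" by (simp add: bump_def)

lemma bump_test: assumes "e > 0" "cball x0 e \<subseteq> \<Omega>" shows "bump e x0 \<in> test_functions \<Omega>"
proof (rule test_functionsI[of _ "cball x0 e"])
  show "Ck k (bump e x0)" for k unfolding bump_def[abs_def] by (intro smooth_alg_Ck smooth_alg.theta)
  show "bump e x0 x = 0" if "x \<notin> cball x0 e" for x
    using bump_pos_iff[OF assms(1), of x0 x] that by (auto simp: dist_norm norm_minus_commute)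
qed (use assms in auto)

lemma bump_test_UNIV: "e > 0 \<Longrightarrow> bump e x0 \<in> test_functions UNIV" by (rule bump_test) auto

definition bump_mass :: "'n::finite itself \<Rightarrow> real \<Rightarrow> real" where
  "bump_mass _ e = (\<integral>x. bump e (0 :: real^'n) x \<partial>lborel)"

lemma bump_mass_pos: assumes "e > 0" shows "bump_mass TYPE('n::finite) e > 0"
proof -
  let ?b = "bump e (0 :: real^'n)"
  have i: "integrable lborel ?b" by (rule test_functions_integrable[OF bump_test_UNIV[OF assms]])
  have "(\<integral>x. ?b x \<partial>lborel) \<noteq> 0"
  proof
    assume "(\<integral>x. ?b x \<partial>lborel) = 0"
    then have "AE x in lborel. ?b x = 0"
      using integral_nonneg_eq_0_iff_AE[OF i] bump_nonneg by auto
    then have "AE x in lborel. x \<notin> ball (0 :: real^'n) e"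
      by eventually_elim (use bump_pos_iff[OF assms, of 0] in auto)
    then have "ball (0 :: real^'n) e \<in> null_sets lborel"
      by (subst AE_iff_null_sets) auto
    then have "negligible (ball (0 :: real^'n) e)" by (simp add: negligible_iff_null_sets null_sets_completionI)
    then show False using open_not_negligible[of "ball (0 :: real^'n) e"] assms by auto
  qed
  moreover have "(\<integral>x. ?b x \<partial>lborel) \<ge> 0" using bump_nonneg by (intro integral_nonneg_AE) auto
  ultimately show ?thesis by (simp add: bump_mass_def)
qed

definition moll :: "real \<Rightarrow> real^'n \<Rightarrow> real" where
  "moll e x = (1 / bump_mass TYPE('n) e) * bump e 0 x"

lemma moll_props: fixes x :: "real^'n" assumes "e > 0"
  shows moll_test: "(moll e :: real^'n \<Rightarrow> real) \<in> test_functions UNIV"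
    and moll_nonneg: "0 \<le> moll e x"
    and moll_supp: "moll e x \<noteq> 0 \<Longrightarrow> norm x < e"
    and moll_uminus: "moll e (- x) = moll e x"
    and moll_integral: "(\<integral>x. moll e (x :: real^'n) \<partial>lborel) = 1"
proof -
  have Z: "bump_mass TYPE('n) e > 0" by (rule bump_mass_pos[OF assms])
  show "(moll e :: real^'n \<Rightarrow> real) \<in> test_functions UNIV"
    unfolding moll_def[abs_def] by (intro test_functions_cmult bump_test_UNIV assms)
  show "0 \<le> moll e x" using Z by (simp add: moll_def bump_nonneg)
  show "moll e x \<noteq> 0 \<Longrightarrow> norm x < e" using bump_pos_iff[OF assms, of 0 x] by (simp add: moll_def)
  show "moll e (- x) = moll e x" by (simp add: moll_def bump_uminus)
  show "(\<integral>x. moll e (x :: real^'n) \<partial>lborel) = 1"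
    using Z unfolding moll_def by (simp add: bump_mass_def)
qed

definition conv :: "(real^'n \<Rightarrow> real) \<Rightarrow> (real^'n \<Rightarrow> real) \<Rightarrow> real^'n \<Rightarrow> real" where
  "conv f w x = (\<integral>y. f (x - y) * w y \<partial>lborel)"

lemma integrable_mult_bounded:
  fixes f w :: "'a::euclidean_space \<Rightarrow> real"
  assumes "integrable lborel w" "f \<in> borel_measurable borel" "\<And>x. \<bar>f x\<bar> \<le> C"
  shows "integrable lborel (\<lambda>x. f x * w x)"
proof (rule Bochner_Integration.integrable_bound)
  show "integrable lborel (\<lambda>x. C * w x)" using assms(1) by simp
  show "AE x in lborel. norm (f x * w x) \<le> norm (C * w x)"
    using assms(3) by (intro AE_I2) (auto simp: abs_mult intro!: mult_right_mono intro: order_trans[OF _ abs_ge_self])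
qed (use assms in auto)

lemma conv_integrable:
  fixes w :: "real^'n \<Rightarrow> real"
  assumes w: "integrable lborel w" and f: "f \<in> test_functions \<Omega>"
  shows "integrable lborel (\<lambda>y. f (x - y) * w y)"
proof -
  have [measurable]: "f \<in> borel_measurable borel" using f by (rule test_functions_borel)
  obtain C where "\<And>x. \<bar>f x\<bar> \<le> C" using test_functions_bounded[OF f] by blast
  then show ?thesis by (intro integrable_mult_bounded[OF w, of _ C]) auto
qed

lemma has_derivative_quadratic:
  fixes f :: "'a::real_normed_vector \<Rightarrow> real"
  assumes "bounded_linear f'" "\<And>v. \<bar>f (x + v) - f x - f' v\<bar> \<le> C * (norm v)\<^sup>2"
  shows "(f has_derivative f') (at x)"
  unfolding has_derivative_at
proof (intro conjI assms(1))
  have "((\<lambda>v::'a. \<bar>C\<bar> * norm v) \<longlongrightarrow> \<bar>C\<bar> * 0) (at 0)" by (intro tendsto_intros tendsto_norm_zero tendsto_ident_at)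
  then have lim: "((\<lambda>v::'a. \<bar>C\<bar> * norm v) \<longlongrightarrow> 0) (at 0)" by simp
  show "((\<lambda>v. norm (f (x + v) - f x - f' v) / norm v) \<longlongrightarrow> 0) (at 0)"
  proof (rule tendsto_sandwich[OF _ _ tendsto_const lim])
    show "\<forall>\<^sub>F v in at 0. norm (f (x + v) - f x - f' v) / norm v \<le> \<bar>C\<bar> * norm v"
    proof (rule always_eventually, rule allI)
      fix v :: 'a
      have "norm (f (x + v) - f x - f' v) \<le> \<bar>C\<bar> * (norm v)\<^sup>2"
        using assms(2)[of v] mult_right_mono[OF abs_ge_self[of C], of "(norm v)\<^sup>2"] by simp
      then show "norm (f (x + v) - f x - f' v) / norm v \<le> \<bar>C\<bar> * norm v"
        by (cases "v = 0") (simp_all add: divide_le_eq power2_eq_square mult.assoc)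
    qed
  qed auto
qed

text \<open>
  The uniform quadratic remainder of \<open>f\<close> is integrated against \<open>w\<close>.
\<close>

lemma conv_has_derivative:
  fixes w :: "real^'n \<Rightarrow> real"
  assumes w: "integrable lborel w" and f: "f \<in> test_functions \<Omega>"
  shows "(conv f w has_derivative (\<lambda>v. (\<chi> i. conv (partial i f) w x) \<bullet> v)) (at x)"
proof -
  obtain L where L: "L > 0" "\<And>x v. \<bar>f (x + v) - f x - grad f x \<bullet> v\<bar> \<le> L * (norm v)\<^sup>2"
    using test_functions_taylor[OF f] by blast
  have [measurable]: "f \<in> borel_measurable borel" using f by (rule test_functions_borel)
  have [measurable]: "partial i f \<in> borel_measurable borel" for i
    using test_functions_partial[OF f] by (rule test_functions_borel)
  note ig = conv_integrable[OF w f] conv_integrable[OF w test_functions_partial[OF f]]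
  show ?thesis
  proof (rule has_derivative_quadratic[where C="L * (\<integral>y. \<bar>w y\<bar> \<partial>lborel)"])
    show "bounded_linear (\<lambda>v. (\<chi> i. conv (partial i f) w x) \<bullet> v)" by (rule bounded_linear_inner_right)
    fix v
    let ?r = "\<lambda>y. (f (x - y + v) - f (x - y) - grad f (x - y) \<bullet> v) * w y"
    have g: "grad f (x - y) \<bullet> v * w y = (\<Sum>i\<in>UNIV. v $ i * (partial i f (x - y) * w y))" for y
      by (simp add: grad_def inner_vec_def sum_distrib_left mult_ac)
    have gi: "integrable lborel (\<lambda>y. grad f (x - y) \<bullet> v * w y)" unfolding g using ig by auto
    have gI: "(\<integral>y. grad f (x - y) \<bullet> v * w y \<partial>lborel) = (\<chi> i. conv (partial i f) w x) \<bullet> v"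
      unfolding g using ig by (simp add: conv_def inner_vec_def mult.commute)
    have a: "integrable lborel (\<lambda>y. f (x - y + v) * w y)" using ig(1)[of "x + v"] by (simp add: algebra_simps)
    have req: "?r = (\<lambda>y. f (x - y + v) * w y - f (x - y) * w y - grad f (x - y) \<bullet> v * w y)"
      by (simp add: left_diff_distrib)
    have ri: "integrable lborel ?r" unfolding req using a ig(1) gi by auto
    have eq: "conv f w (x + v) - conv f w x - (\<chi> i. conv (partial i f) w x) \<bullet> v = (\<integral>y. ?r y \<partial>lborel)"
      unfolding req gI[symmetric] using a ig(1)[of x] gi by (simp add: conv_def algebra_simps)
    have "\<bar>conv f w (x + v) - conv f w x - (\<chi> i. conv (partial i f) w x) \<bullet> v\<bar> \<le> (\<integral>y. \<bar>?r y\<bar> \<partial>lborel)"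
      unfolding eq by (rule integral_abs_bound)
    also have "\<dots> \<le> (\<integral>y. L * (norm v)\<^sup>2 * \<bar>w y\<bar> \<partial>lborel)"
    proof -
      have i1: "integrable lborel (\<lambda>y. \<bar>?r y\<bar>)" by (rule integrable_abs[OF ri])
      have i2: "integrable lborel (\<lambda>y. L * (norm v)\<^sup>2 * \<bar>w y\<bar>)"
        by (rule integrable_mult_right[OF integrable_abs[OF w]])
      have le: "\<bar>?r y\<bar> \<le> L * (norm v)\<^sup>2 * \<bar>w y\<bar>" for y
        unfolding abs_mult by (rule mult_right_mono[OF L(2)[of "x - y" v] abs_ge_zero])
      show ?thesis by (rule integral_mono[OF i1 i2 le])
    qed
    also have "\<dots> = L * (\<integral>y. \<bar>w y\<bar> \<partial>lborel) * (norm v)\<^sup>2" by simp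
    finally show "\<bar>conv f w (x + v) - conv f w x - (\<chi> i. conv (partial i f) w x) \<bullet> v\<bar>
        \<le> L * (\<integral>y. \<bar>w y\<bar> \<partial>lborel) * (norm v)\<^sup>2" .
  qed
qed

lemma conv_Ck:
  assumes w: "integrable lborel w" and f: "f \<in> test_functions UNIV"
  shows "Ck k (conv f w)"
proof -
  let ?F = "{conv f w | f. f \<in> test_functions UNIV}"
  show ?thesis
  proof (rule Ck_closed[of ?F])
    fix h assume "h \<in> ?F"
    then obtain g where g: "h = conv g w" "g \<in> test_functions UNIV" by auto
    have "partial i h = conv (partial i g) w" for i
      unfolding g(1) by (rule ext) (subst partial_eq[OF conv_has_derivative[OF w g(2)]], simp add: inner_axis)
    then show "(\<forall>x. h differentiable at x) \<and> (\<forall>i. partial i h \<in> ?F)"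
      using conv_has_derivative[OF w g(2)] test_functions_partial[OF g(2)] g(1)
      by (auto simp: differentiable_def)
  qed (use f in auto)
qed

lemma conv_test:
  fixes w :: "real^'n \<Rightarrow> real"
  assumes w: "integrable lborel w" "compact K" "\<And>x. x \<notin> K \<Longrightarrow> w x = 0" and e: "e > 0"
    and K: "\<And>x y. x \<in> K \<Longrightarrow> norm (y - x) \<le> e \<Longrightarrow> y \<in> \<Omega>"
  shows "conv (moll e) w \<in> test_functions \<Omega>"
proof -
  let ?K = "(\<lambda>(x, y). x + y) ` (K \<times> cball 0 e)"
  have 1: "Ck k (conv (moll e) w)" for k by (rule conv_Ck[OF w(1) moll_test[OF e]])
  have 2: "compact ?K"
    by (rule compact_continuous_image[OF _ compact_Times[OF w(2) compact_cball]])
      (simp add: split_beta' continuous_on_add continuous_on_fst continuous_on_snd)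
  have 3: "?K \<subseteq> \<Omega>" using K by auto
  have 4: "conv (moll e) w x = 0" if x: "x \<notin> ?K" for x
  proof -
  have "moll e (x - y) * w y = 0" for y
  proof (rule ccontr)
    assume "\<not> ?thesis"
    then have "y \<in> K" "norm (x - y) < e" using w(3) moll_supp[OF e] by auto
    then have "(\<lambda>(x, y). x + y) (y, x - y) \<in> ?K" by (intro imageI) auto
    then show False using x by simp
  qed
  then have "(\<lambda>y. moll e (x - y) * w y) = (\<lambda>_. 0)" by (rule ext)
  then show ?thesis by (simp only: conv_def integral_zero)
  qed
  show ?thesis by (rule test_functionsI[OF 1 2 3 4])
qed

section \<open>Mollification in L1 and the fundamental lemma\<close>

text \<open>
  Choose a compact set and an open set with \<open>K \<subseteq> A\<close> and \<open>K \<subseteq> U\<close>, both close to \<open>A\<close> in measure. A small translation moves \<open>K\<close> inside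
  \<open>U\<close>, so membership in \<open>A\<close> can change only at points where \<open>x\<close> or \<open>x + y\<close> is in \<open>A - K\<close> or \<open>U - K\<close>.
\<close>

lemma L1_shift_continuous_indicator:
  fixes A :: "'a::euclidean_space set"
  assumes A[measurable]: "A \<in> sets borel" and fin: "emeasure lborel A < \<infinity>" and e: "e > 0"
  shows "\<exists>d>0. \<forall>y. norm y < d \<longrightarrow> (\<integral>\<^sup>+x. ennreal \<bar>indicator A (x + y) - indicator A x\<bar> \<partial>lborel) \<le> ennreal e"
proof -
  obtain K where K: "K \<subseteq> A" "compact K" "emeasure lborel A < emeasure lborel K + ennreal (e / 4)"
  proof -
    obtain a where a: "emeasure lborel A = ennreal a" "a \<ge> 0" using fin by (cases "emeasure lborel A") auto
    have "emeasure lborel A < emeasure lborel A + ennreal (e / 4)" using e a(2) unfolding a(1)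
      by (simp add: ennreal_plus[symmetric] ennreal_less_iff del: ennreal_plus)
    also have "\<dots> = (SUP K\<in>{K. K \<subseteq> A \<and> compact K}. emeasure lborel K + ennreal (e / 4))"
      by (subst emeasure_lborel_inner_compact[OF A fin], subst ennreal_SUP_add_left) auto
    finally show ?thesis using that by (auto simp: less_SUP_iff)
  qed
  have [measurable]: "K \<in> sets borel" using K by (auto simp: borel_compact)
  have finK: "emeasure lborel K < \<infinity>" using emeasure_compact_finite[OF K(2)] by simp
  have AK: "emeasure lborel (A - K) \<le> ennreal (e / 4)"
  proof -
    have "emeasure lborel K + emeasure lborel (A - K) = emeasure lborel A"
      using K(1) by (subst plus_emeasure) (auto simp: Un_absorb1)
    then have "emeasure lborel K + emeasure lborel (A - K) \<le> emeasure lborel K + ennreal (e / 4)" using K(3) by simp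
    then show ?thesis using finK by (auto simp: ennreal_add_left_cancel_le)
  qed
  obtain U where U: "open U" "K \<subseteq> U" "emeasure lebesgue (U - K) < ennreal (e / 4)"
    using sets_lebesgue_outer_open[of K "e / 4"] e by (metis \<open>K \<in> sets borel\<close> divide_pos_pos sets_completionI_sets sets_lborel zero_less_numeral)
  have [measurable]: "U \<in> sets borel" using U by auto
  have UK: "emeasure lborel (U - K) \<le> ennreal (e / 4)" using U(3) by (simp add: less_imp_le)
  obtain d where d: "d > 0" "(\<Union>x\<in>K. ball x d) \<subseteq> U"
    using compact_subset_open_imp_ball_epsilon_subset[OF K(2) U(1,2)] by metis
  have "(\<integral>\<^sup>+x. ennreal \<bar>indicator A (x + y) - indicator A x\<bar> \<partial>lborel) \<le> ennreal e" if y: "norm y < d" for y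
  proof -
    let ?g = "\<lambda>x. indicator (A - K) x + indicator (U - K) x :: ennreal"
    have pt: "ennreal \<bar>indicator A (x + y) - indicator A x\<bar> \<le> ?g (x + y) + ?g x" for x
    proof -
      have "x + y \<in> U" if "x \<in> K" 
      proof -
        have "x + y \<in> ball x d" using y by (simp add: dist_norm)
        then show ?thesis using d(2) that by blast
      qed
      moreover have "x \<in> U" if "x + y \<in> K"
      proof -
        have "x \<in> ball (x + y) d" using y by (simp add: dist_norm)
        then show ?thesis using d(2) that by blast
      qed
      ultimately show ?thesis using K(1) by (auto simp: indicator_def)
    qed
    have g1: "(\<integral>\<^sup>+x. ?g (x + y) \<partial>lborel) = (\<integral>\<^sup>+x. ?g x \<partial>lborel)"
      by (rule nn_integral_lborel_shift) auto
    have g2: "(\<integral>\<^sup>+x. ?g x \<partial>lborel) = emeasure lborel (A - K) + emeasure lborel (U - K)"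
      by (subst nn_integral_add) auto
    have g3: "(\<integral>\<^sup>+x. ?g (x + y) + ?g x \<partial>lborel) = (\<integral>\<^sup>+x. ?g (x + y) \<partial>lborel) + (\<integral>\<^sup>+x. ?g x \<partial>lborel)"
      by (rule nn_integral_add) auto
    have "(\<integral>\<^sup>+x. ennreal \<bar>indicator A (x + y) - indicator A x\<bar> \<partial>lborel) \<le> (\<integral>\<^sup>+x. ?g (x + y) + ?g x \<partial>lborel)"
      by (intro nn_integral_mono pt)
    also have "\<dots> \<le> (ennreal (e/4) + ennreal (e/4)) + (ennreal (e/4) + ennreal (e/4))"
      unfolding g3 g1 g2 by (intro add_mono AK UK)
    also have "\<dots> = ennreal e" using e by (simp add: ennreal_plus[symmetric] del: ennreal_plus)
    finally show ?thesis .
  qed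
  then show ?thesis using d(1) by blast
qed

text \<open>
  Integrable functions are limits in \<open>L\<^sup>1\<close> of simple functions, and translation is an isometry.
\<close>

lemma L1_shift_continuous:
  fixes f :: "'a::euclidean_space \<Rightarrow> real"
  assumes "integrable lborel f"
  shows "e > 0 \<Longrightarrow> \<exists>d>0. \<forall>y. norm y < d \<longrightarrow> (\<integral>\<^sup>+x. ennreal \<bar>f (x + y) - f x\<bar> \<partial>lborel) \<le> ennreal e"
  using assms
proof (induction arbitrary: e rule: integrable_induct)
  case (base A c)
  have A[measurable]: "A \<in> sets borel" using base by simp
  obtain d where d: "d > 0" "\<And>y. norm y < d \<Longrightarrow>
      (\<integral>\<^sup>+x. ennreal \<bar>indicator A (x + y) - indicator A x\<bar> \<partial>lborel) \<le> ennreal (e / (\<bar>c\<bar> + 1))"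
    using L1_shift_continuous_indicator[OF A, of "e / (\<bar>c\<bar> + 1)"] base by auto
  have "(\<integral>\<^sup>+x. ennreal \<bar>indicator A (x + y) *\<^sub>R c - indicator A x *\<^sub>R c\<bar> \<partial>lborel) \<le> ennreal e" if y: "norm y < d" for y
  proof -
    have "(\<integral>\<^sup>+x. ennreal \<bar>indicator A (x + y) *\<^sub>R c - indicator A x *\<^sub>R c\<bar> \<partial>lborel)
       = (\<integral>\<^sup>+x. ennreal \<bar>c\<bar> * ennreal \<bar>indicator A (x + y) - indicator A x\<bar> \<partial>lborel)"
      by (intro nn_integral_cong) (simp add: ennreal_mult'[symmetric] abs_mult[symmetric] right_diff_distrib mult.commute)
    also have "\<dots> = ennreal \<bar>c\<bar> * (\<integral>\<^sup>+x. ennreal \<bar>indicator A (x + y) - indicator A x\<bar> \<partial>lborel)"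
      by (rule nn_integral_cmult) auto
    also have "\<dots> \<le> ennreal \<bar>c\<bar> * ennreal (e / (\<bar>c\<bar> + 1))" by (intro mult_left_mono d y) auto
    also have "\<dots> \<le> ennreal e"
    proof -
      have "\<bar>c\<bar> * (e / (\<bar>c\<bar> + 1)) \<le> e" using base by (simp add: field_simps)
      then show ?thesis using base by (simp add: ennreal_mult[symmetric])
    qed
    finally show ?thesis .
  qed
  then show ?case using d(1) by blast
next
  case (add f g)
  have [measurable]: "f \<in> borel_measurable borel" "g \<in> borel_measurable borel" using add by auto
  obtain d where d: "d > 0" "\<And>y. norm y < d \<Longrightarrow> (\<integral>\<^sup>+x. ennreal \<bar>f (x + y) - f x\<bar> \<partial>lborel) \<le> ennreal (e / 2)"
    using add.IH(1)[of "e / 2"] add.prems by auto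
  obtain d' where d': "d' > 0" "\<And>y. norm y < d' \<Longrightarrow> (\<integral>\<^sup>+x. ennreal \<bar>g (x + y) - g x\<bar> \<partial>lborel) \<le> ennreal (e / 2)"
    using add.IH(2)[of "e / 2"] add.prems by auto
  have "(\<integral>\<^sup>+x. ennreal \<bar>f (x + y) + g (x + y) - (f x + g x)\<bar> \<partial>lborel) \<le> ennreal e" if y: "norm y < min d d'" for y
  proof -
    have "(\<integral>\<^sup>+x. ennreal \<bar>f (x + y) + g (x + y) - (f x + g x)\<bar> \<partial>lborel)
      \<le> (\<integral>\<^sup>+x. ennreal \<bar>f (x + y) - f x\<bar> + ennreal \<bar>g (x + y) - g x\<bar> \<partial>lborel)"
      by (intro nn_integral_mono) (simp add: ennreal_plus[symmetric] del: ennreal_plus)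
    also have "\<dots> = (\<integral>\<^sup>+x. ennreal \<bar>f (x + y) - f x\<bar> \<partial>lborel) + (\<integral>\<^sup>+x. ennreal \<bar>g (x + y) - g x\<bar> \<partial>lborel)"
      by (rule nn_integral_add) auto
    also have "\<dots> \<le> ennreal (e / 2) + ennreal (e / 2)" using y by (intro add_mono d d') auto
    also have "\<dots> = ennreal e" using add.prems by (simp add: ennreal_plus[symmetric] del: ennreal_plus)
    finally show ?thesis .
  qed
  then show ?case using d(1) d'(1) by (intro exI[of _ "min d d'"]) auto
next
  case (lim f s)
  have [measurable]: "f \<in> borel_measurable borel" "\<And>i. s i \<in> borel_measurable borel" using lim by auto
  have "(\<lambda>i. \<integral>\<^sup>+x. norm (f x - s i x) \<partial>lborel) \<longlonglongrightarrow> 0"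
  proof (rule nn_integral_dominated_convergence_norm[where w="\<lambda>x. 2 * norm (f x)"])
    show "(\<integral>\<^sup>+ x. ennreal (2 * norm (f x)) \<partial>lborel) < \<infinity>"
      using integrable_norm[OF lim.hyps(4), THEN integrable_mult_right[of 2]] unfolding integrable_iff_bounded by simp
  qed (use lim in auto)
  then have "\<forall>\<^sub>F i in sequentially. (\<integral>\<^sup>+x. norm (f x - s i x) \<partial>lborel) < ennreal (e / 4)"
    using lim.prems by (intro order_tendstoD) auto
  then obtain i where i: "(\<integral>\<^sup>+x. ennreal \<bar>f x - s i x\<bar> \<partial>lborel) \<le> ennreal (e / 4)"
    by (auto simp: eventually_sequentially intro: less_imp_le)
  obtain d where d: "d > 0" "\<And>y. norm y < d \<Longrightarrow> (\<integral>\<^sup>+x. ennreal \<bar>s i (x + y) - s i x\<bar> \<partial>lborel) \<le> ennreal (e / 2)"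
    using lim.IH[of "e / 2" i] lim.prems by auto
  have "(\<integral>\<^sup>+x. ennreal \<bar>f (x + y) - f x\<bar> \<partial>lborel) \<le> ennreal e" if y: "norm y < d" for y
  proof -
    have sh: "(\<integral>\<^sup>+x. ennreal \<bar>f (x + y) - s i (x + y)\<bar> \<partial>lborel) = (\<integral>\<^sup>+x. ennreal \<bar>f x - s i x\<bar> \<partial>lborel)"
      using nn_integral_lborel_shift[of "\<lambda>x. ennreal \<bar>f x - s i x\<bar>" y] by simp
    have "(\<integral>\<^sup>+x. ennreal \<bar>f (x + y) - f x\<bar> \<partial>lborel)
      \<le> (\<integral>\<^sup>+x. ennreal \<bar>f (x + y) - s i (x + y)\<bar> + (ennreal \<bar>s i (x + y) - s i x\<bar> + ennreal \<bar>f x - s i x\<bar>) \<partial>lborel)"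
      by (intro nn_integral_mono) (simp add: ennreal_plus[symmetric] del: ennreal_plus)
    also have "\<dots> = (\<integral>\<^sup>+x. ennreal \<bar>f (x + y) - s i (x + y)\<bar> \<partial>lborel)
       + ((\<integral>\<^sup>+x. ennreal \<bar>s i (x + y) - s i x\<bar> \<partial>lborel) + (\<integral>\<^sup>+x. ennreal \<bar>f x - s i x\<bar> \<partial>lborel))"
      by (simp add: nn_integral_add)
    also have "\<dots> \<le> ennreal (e / 4) + (ennreal (e / 2) + ennreal (e / 4))"
      unfolding sh by (intro add_mono i d y)
    also have "\<dots> = ennreal e" using lim.prems by (simp add: ennreal_plus[symmetric] del: ennreal_plus)
    finally show ?thesis .
  qed
  then show ?case using d(1) by blast
qed

lemma conv_moll_eq:
  fixes w :: "real^'n \<Rightarrow> real"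
  assumes [measurable]: "w \<in> borel_measurable borel" and e: "e > 0"
  shows "conv (moll e) w x = (\<integral>y. moll e y * w (x + y) \<partial>lborel)"
proof -
  have [measurable]: "(moll e :: real^'n \<Rightarrow> real) \<in> borel_measurable borel"
    using moll_test[OF e] by (rule test_functions_borel)
  have "conv (moll e) w x = (\<integral>y. moll e (x - (y + x)) * w (y + x) \<partial>lborel)"
    unfolding conv_def by (rule integral_lborel_shift[symmetric]) measurable
  also have "\<dots> = (\<integral>y. moll e y * w (x + y) \<partial>lborel)"
    by (simp add: moll_uminus[OF e] add.commute)
  finally show ?thesis .
qed

text \<open>
  A mollification is an average of translates over small shifts.
\<close>

lemma mollify_L1:
  fixes w :: "real^'n \<Rightarrow> real"
  assumes w: "integrable lborel w" and e: "e > 0"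
  shows "\<exists>d>0. \<forall>\<eta>. 0 < \<eta> \<longrightarrow> \<eta> < d \<longrightarrow> (\<integral>\<^sup>+x. ennreal \<bar>conv (moll \<eta>) w x - w x\<bar> \<partial>lborel) \<le> ennreal e"
proof -
  have [measurable]: "w \<in> borel_measurable borel" using w by auto
  obtain d where d: "d > 0" "\<And>y. norm y < d \<Longrightarrow> (\<integral>\<^sup>+x. ennreal \<bar>w (x + y) - w x\<bar> \<partial>lborel) \<le> ennreal e"
    using L1_shift_continuous[OF w e] by blast
  have "(\<integral>\<^sup>+x. ennreal \<bar>conv (moll \<eta>) w x - w x\<bar> \<partial>lborel) \<le> ennreal e" if \<eta>: "0 < \<eta>" "\<eta> < d" for \<eta>
  proof -
    let ?m = "moll \<eta> :: real^'n \<Rightarrow> real"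
    have [measurable]: "?m \<in> borel_measurable borel" using moll_test[OF \<eta>(1)] by (rule test_functions_borel)
    have mn: "0 \<le> ?m y" for y by (rule moll_nonneg[OF \<eta>(1)])
    have im: "integrable lborel ?m" using moll_test[OF \<eta>(1)] by (rule test_functions_integrable)
    have pt: "ennreal \<bar>conv ?m w x - w x\<bar> \<le> (\<integral>\<^sup>+y. ennreal (?m y) * ennreal \<bar>w (x + y) - w x\<bar> \<partial>lborel)" for x
    proof -
      obtain C where C: "\<And>x. \<bar>?m x\<bar> \<le> C" using test_functions_bounded[OF moll_test[OF \<eta>(1)]] by blast
      have ws: "integrable lborel (\<lambda>y. w (x + y))"
        using integrable_lborel_shift[of w x] w by (simp add: add.commute)
      have i1: "integrable lborel (\<lambda>y. ?m y * w (x + y))"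
        using C by (intro integrable_mult_bounded[OF ws]) auto
      have eq: "conv ?m w x - w x = (\<integral>y. ?m y * (w (x + y) - w x) \<partial>lborel)"
        using i1 im moll_integral[OF \<eta>(1), where 'n='n] \<eta> by (simp add: conv_moll_eq right_diff_distrib)
      have i2: "integrable lborel (\<lambda>y. ?m y * (w (x + y) - w x))"
        using i1 im by (simp add: right_diff_distrib)
      have "ennreal \<bar>conv ?m w x - w x\<bar> \<le> (\<integral>\<^sup>+y. norm (?m y * (w (x + y) - w x)) \<partial>lborel)"
        unfolding eq using integral_norm_bound_ennreal[OF i2] by simp
      also have "\<dots> = (\<integral>\<^sup>+y. ennreal (?m y) * ennreal \<bar>w (x + y) - w x\<bar> \<partial>lborel)"
        using mn by (intro nn_integral_cong) (simp add: abs_mult ennreal_mult')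
      finally show ?thesis .
    qed
    have "(\<integral>\<^sup>+x. ennreal \<bar>conv ?m w x - w x\<bar> \<partial>lborel)
        \<le> (\<integral>\<^sup>+x. \<integral>\<^sup>+y. ennreal (?m y) * ennreal \<bar>w (x + y) - w x\<bar> \<partial>lborel \<partial>lborel)"
      by (intro nn_integral_mono pt)
    also have "\<dots> = (\<integral>\<^sup>+y. \<integral>\<^sup>+x. ennreal (?m y) * ennreal \<bar>w (x + y) - w x\<bar> \<partial>lborel \<partial>lborel)"
      by (rule lborel_pair.Fubini') measurable
    also have "\<dots> = (\<integral>\<^sup>+y. ennreal (?m y) * (\<integral>\<^sup>+x. ennreal \<bar>w (x + y) - w x\<bar> \<partial>lborel) \<partial>lborel)"
      by (rule nn_integral_cong, rule nn_integral_cmult) measurable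
    also have "\<dots> \<le> (\<integral>\<^sup>+y. ennreal (?m y) * ennreal e \<partial>lborel)"
    proof (rule nn_integral_mono)
      fix y :: "real^'n"
      show "ennreal (?m y) * (\<integral>\<^sup>+x. ennreal \<bar>w (x + y) - w x\<bar> \<partial>lborel) \<le> ennreal (?m y) * ennreal e"
      proof (cases "?m y = 0")
        case False
        then have "norm y < d" using moll_supp[OF \<eta>(1)] \<eta> by force
        then show ?thesis by (intro mult_left_mono d) auto
      qed simp
    qed
    also have "\<dots> = (\<integral>\<^sup>+y. ennreal (?m y) \<partial>lborel) * ennreal e" by (rule nn_integral_multc) measurable
    also have "(\<integral>\<^sup>+y. ennreal (?m y) \<partial>lborel) = 1"
      using im moll_integral[OF \<eta>(1), where 'n='n] mn by (subst nn_integral_eq_integral) auto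
    finally show ?thesis by simp
  qed
  then show ?thesis using d(1) by blast
qed

text \<open>
  Near a compact subset \<open>K\<close> the mollifier centred at a point of \<open>K\<close> is a test function, so the mollifications of \<open>w\<close>
  vanish on \<open>K\<close>; they converge to \<open>w\<close> in \<open>L\<^sup>1\<close>.
\<close>

lemma fundamental_lemma:
  fixes w :: "real^'n \<Rightarrow> real"
  assumes wm[measurable]: "w \<in> borel_measurable borel" and \<Omega>: "open \<Omega>"
    and loc: "\<And>K. compact K \<Longrightarrow> K \<subseteq> \<Omega> \<Longrightarrow> integrable lborel (\<lambda>x. indicator K x * w x)"
    and zero: "\<And>\<phi>. \<phi> \<in> test_functions \<Omega> \<Longrightarrow> (\<integral>x. w x * \<phi> x \<partial>lborel) = 0"
  shows "AE x in lborel. x \<in> \<Omega> \<longrightarrow> w x = 0"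
proof -
  have main: "AE x in lborel. x \<in> K \<longrightarrow> w x = 0" if K: "compact K" "K \<subseteq> \<Omega>" for K
  proof -
    have Kb[measurable]: "K \<in> sets borel" using K by (auto simp: borel_compact)
    obtain d where d: "d > 0" "(\<Union>x\<in>K. cball x d) \<subseteq> \<Omega>"
      using compact_subset_open_imp_cball_epsilon_subset[OF K(1) \<Omega> K(2)] by metis
    let ?K = "(\<lambda>(x, y). x + y) ` (K \<times> cball 0 d)"
    have cK: "compact ?K"
      by (rule compact_continuous_image[OF _ compact_Times[OF K(1) compact_cball]])
        (simp add: split_beta' continuous_on_add continuous_on_fst continuous_on_snd)
    have sK: "?K \<subseteq> \<Omega>" using d(2) by (force simp: dist_norm subset_iff)
    have [measurable]: "?K \<in> sets borel" using cK by (rule borel_compact)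
    let ?w = "\<lambda>x. indicator ?K x * w x"
    have wi: "integrable lborel ?w" by (rule loc[OF cK sK])
    have le: "(\<integral>\<^sup>+x. ennreal \<bar>w x\<bar> * indicator K x \<partial>lborel) \<le> 0 + ennreal e" if e: "e > 0" for e
    proof -
      obtain d' where d': "d' > 0" "\<And>\<eta>. 0 < \<eta> \<Longrightarrow> \<eta> < d' \<Longrightarrow> (\<integral>\<^sup>+x. ennreal \<bar>conv (moll \<eta>) ?w x - ?w x\<bar> \<partial>lborel) \<le> ennreal e"
        using mollify_L1[OF wi e] by blast
      define \<eta> where "\<eta> = min d d' / 2"
      have \<eta>: "0 < \<eta>" "\<eta> < d'" "\<eta> < d" using d d' by (auto simp: \<eta>_def)
      have "conv (moll \<eta>) ?w x = 0" if x: "x \<in> K" for x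
      proof -
        have in_K: "y \<in> ?K" if "moll \<eta> (x - y) \<noteq> 0" for y
        proof -
          have "norm (y - x) \<le> d" using moll_supp[OF \<eta>(1) that] \<eta> by (simp add: norm_minus_commute)
          then have "(\<lambda>(x, y). x + y) (x, y - x) \<in> ?K" using x by (intro imageI) auto
          then show ?thesis by simp
        qed
        have "conv (moll \<eta>) ?w x = (\<integral>y. w y * moll \<eta> (x - y) \<partial>lborel)"
          unfolding conv_def using in_K by (intro Bochner_Integration.integral_cong) (auto simp: indicator_def)
        also have "(\<lambda>y. moll \<eta> (x - y)) = (\<lambda>y. (1 / bump_mass TYPE('n) \<eta>) * bump \<eta> x y)"
          by (simp add: moll_def bump_shift[of \<eta> x] bump_uminus[of \<eta> "x - _", symmetric])
        also have "(\<integral>y. w y * ((1 / bump_mass TYPE('n) \<eta>) * bump \<eta> x y) \<partial>lborel) = 0"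
        proof (rule zero, rule test_functions_cmult, rule bump_test[OF \<eta>(1)])
          show "cball x \<eta> \<subseteq> \<Omega>" using d(2) x \<eta> by (force simp: subset_iff)
        qed
        finally show ?thesis .
      qed
      then have "ennreal \<bar>w x\<bar> * indicator K x \<le> ennreal \<bar>conv (moll \<eta>) ?w x - ?w x\<bar>" for x
      proof (cases "x \<in> K")
        case True
        then have "(\<lambda>(x, y). x + y) (x, 0) \<in> ?K" using d(1) by (intro imageI) auto
        then show ?thesis using \<open>\<And>x. x \<in> K \<Longrightarrow> conv (moll \<eta>) ?w x = 0\<close>[OF True] True by simp
      qed simp
      then have "(\<integral>\<^sup>+x. ennreal \<bar>w x\<bar> * indicator K x \<partial>lborel) \<le> (\<integral>\<^sup>+x. ennreal \<bar>conv (moll \<eta>) ?w x - ?w x\<bar> \<partial>lborel)"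
        by (rule nn_integral_mono)
      then show ?thesis using d'(2)[OF \<eta>(1,2)] by simp
    qed
    have "(\<integral>\<^sup>+x. ennreal \<bar>w x\<bar> * indicator K x \<partial>lborel) \<le> 0"
      by (rule ennreal_le_epsilon) (rule le)
    then have "(\<integral>\<^sup>+x. ennreal \<bar>w x\<bar> * indicator K x \<partial>lborel) = 0" by simp
    then have "AE x in lborel. ennreal \<bar>w x\<bar> * indicator K x = 0"
      by (subst (asm) nn_integral_0_iff_AE) auto
    then show ?thesis by eventually_elim (auto simp: indicator_def)
  qed
  obtain C :: "nat \<Rightarrow> (real^'n) set" where C: "\<And>n. compact (C n)" "\<And>n. C n \<subseteq> \<Omega>" "\<Union>(range C) = \<Omega>"
    using open_Union_compact_subsets[OF \<Omega>] by metis
  have "AE x in lborel. \<forall>n. x \<in> C n \<longrightarrow> w x = 0" unfolding AE_all_countable using main C by blast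
  then show ?thesis by eventually_elim (use C(3) in blast)
qed

section \<open>Increments and the Dirichlet integral\<close>

text \<open>
  Lagrange's diagonalisation. A vector \<open>w\<close> splits the form into \<open>((A w) \<bullet> x)\<^sup>2 / ((A w) \<bullet> w)\<close> and a form that depends
  only on the projection of \<open>x\<close> to the complement orthogonal to \<open>A w\<close>; the induction is over the dimension.
\<close>

lemma positive_form_sum_of_squares:
  fixes A :: "real^'n^'n"
  assumes sym: "transpose A = A" and pos: "\<And>\<xi>. \<xi> \<noteq> 0 \<Longrightarrow> (A *v \<xi>) \<bullet> \<xi> > 0"
  obtains vs :: "(real^'n) list" where "\<And>\<xi>. (A *v \<xi>) \<bullet> \<xi> = (\<Sum>v\<leftarrow>vs. (v \<bullet> \<xi>)\<^sup>2)"
proof -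
  have symB: "(A *v x) \<bullet> y = (A *v y) \<bullet> x" for x y
    by (metis dot_lmul_matrix inner_commute sym transpose_matrix_vector)
  have "\<exists>vs :: (real^'n) list. \<forall>x\<in>S. (A *v x) \<bullet> x = (\<Sum>v\<leftarrow>vs. (v \<bullet> x)\<^sup>2)" if "subspace S" for S :: "(real^'n) set"
    using that
  proof (induction "dim S" arbitrary: S rule: less_induct)
    case less
    show ?case
    proof (cases "S \<subseteq> {0}")
      case True
      then show ?thesis by (intro exI[of _ "[]"]) auto
    next
      case False
      then obtain w where w: "w \<in> S" "w \<noteq> 0" by auto
      define a where "a = (A *v w) \<bullet> w"
      have a: "a > 0" unfolding a_def by (rule pos[OF w(2)])
      define S' where "S' = {x\<in>S. (A *v w) \<bullet> x = 0}"
      have sS': "subspace S'" using less.prems unfolding S'_def subspace_def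
        by (auto simp: inner_add_right)
      have "w \<notin> S'" using a by (simp add: S'_def a_def)
      then have "S' \<subset> S" using w(1) unfolding S'_def by blast
      then have "dim S' < dim S"
        by (intro dim_psubset) (simp add: span_eq_iff[THEN iffD2, OF less.prems] span_eq_iff[THEN iffD2, OF sS'])
      from less.hyps[OF this sS'] obtain vs :: "(real^'n) list"
        where vs: "\<And>x. x \<in> S' \<Longrightarrow> (A *v x) \<bullet> x = (\<Sum>v\<leftarrow>vs. (v \<bullet> x)\<^sup>2)" by auto
      let ?vs = "((1 / sqrt a) *\<^sub>R (A *v w)) # map (\<lambda>v. v - ((v \<bullet> w) / a) *\<^sub>R (A *v w)) vs"
      have "(A *v x) \<bullet> x = (\<Sum>v\<leftarrow>?vs. (v \<bullet> x)\<^sup>2)" if x: "x \<in> S" for x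
      proof -
        define c where "c = ((A *v w) \<bullet> x) / a"
        define x' where "x' = x - c *\<^sub>R w"
        have x'S: "x' \<in> S'" using x w less.prems a
          by (auto simp: S'_def x'_def c_def a_def inner_diff_right subspace_diff subspace_scale)
        have xeq: "x = x' + c *\<^sub>R w" by (simp add: x'_def)
        have "(A *v x) \<bullet> x = (A *v x') \<bullet> x' + c\<^sup>2 * a"
          using x'S symB[of x' w]
          by (subst (1 2) xeq) (simp add: matrix_vector_right_distrib matrix_vector_mult_scaleR inner_add_left
              inner_add_right S'_def a_def power2_eq_square)
        also have "\<dots> = (\<Sum>v\<leftarrow>vs. (v \<bullet> x')\<^sup>2) + ((1 / sqrt a) *\<^sub>R (A *v w) \<bullet> x)\<^sup>2"
          using vs[OF x'S] a by (simp add: c_def power_divide power2_eq_square[of a])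
        also have "(\<Sum>v\<leftarrow>vs. (v \<bullet> x')\<^sup>2) = (\<Sum>v\<leftarrow>map (\<lambda>v. v - ((v \<bullet> w) / a) *\<^sub>R (A *v w)) vs. (v \<bullet> x)\<^sup>2)"
          by (simp add: o_def x'_def c_def inner_diff_left inner_diff_right mult.commute)
        finally show ?thesis by simp
      qed
      then show ?thesis by blast
    qed
  qed
  from this[OF subspace_UNIV] show ?thesis using that by auto
qed

lemma grad_continuous: "f \<in> test_functions \<Omega> \<Longrightarrow> continuous_on S (grad f)"
  unfolding grad_def[abs_def] by (intro continuous_on_vec_lambda test_functions_continuous[OF test_functions_partial])

lemma grad_borel: "f \<in> test_functions \<Omega> \<Longrightarrow> grad f \<in> borel_measurable borel"
  by (intro borel_measurable_continuous_onI grad_continuous)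

lemma grad_outside: "x \<notin> supp f \<Longrightarrow> grad f x = 0"
  by (simp add: grad_def partial_outside_supp vec_eq_iff)

lemma test_bL2: assumes f: "f \<in> test_functions \<Omega>" shows "bL2 f"
proof -
  obtain C where C: "\<And>x. \<bar>f x\<bar> \<le> C" using test_functions_bounded[OF f] by blast
  have "integrable lborel (\<lambda>x. (f x)\<^sup>2)"
    using test_functions_integrable[OF test_functions_mult[OF f f]] by (simp add: power2_eq_square)
  then show ?thesis unfolding bL2_def using test_functions_borel[OF f] C by auto
qed

lemma test_difference_quotient:
  assumes f: "f \<in> test_functions \<Omega>" and s: "s \<longlonglongrightarrow> 0" "\<And>j::nat. s j > 0"
  shows "(\<lambda>j. ((f (x + s j *\<^sub>R z) - f x) / s j)) \<longlonglongrightarrow> grad f x \<bullet> z"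
proof -
  obtain L where L: "L > 0" "\<And>x v. \<bar>f (x + v) - f x - grad f x \<bullet> v\<bar> \<le> L * (norm v)\<^sup>2"
    using test_functions_taylor[OF f] by blast
  have "(\<lambda>j. (f (x + s j *\<^sub>R z) - f x) / s j - grad f x \<bullet> z) \<longlonglongrightarrow> 0"
  proof (rule Lim_null_comparison)
    show "\<forall>\<^sub>F j in sequentially. norm ((f (x + s j *\<^sub>R z) - f x) / s j - grad f x \<bullet> z) \<le> s j * (L * (norm z)\<^sup>2)"
    proof (rule always_eventually, rule allI)
      fix j
      have "norm ((f (x + s j *\<^sub>R z) - f x) / s j - grad f x \<bullet> z) = \<bar>f (x + s j *\<^sub>R z) - f x - grad f x \<bullet> (s j *\<^sub>R z)\<bar> / s j"
        using s(2)[of j] by (simp add: field_simps abs_divide)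
      also have "\<dots> \<le> (L * (norm (s j *\<^sub>R z))\<^sup>2) / s j"
        using s(2)[of j] L(2)[of x "s j *\<^sub>R z"] by (intro divide_right_mono) auto
      also have "\<dots> = s j * (L * (norm z)\<^sup>2)" using s(2)[of j] by (simp add: power_mult_distrib power2_eq_square)
      finally show "norm ((f (x + s j *\<^sub>R z) - f x) / s j - grad f x \<bullet> z) \<le> s j * (L * (norm z)\<^sup>2)" .
    qed
    show "(\<lambda>j. s j * (L * (norm z)\<^sup>2)) \<longlonglongrightarrow> 0" using tendsto_mult_left_zero[OF s(1)] by simp
  qed
  then show ?thesis by (simp add: LIM_zero_iff)
qed

lemma nn_integral_shift_double:
  fixes f :: "'a::euclidean_space \<Rightarrow> real"
  assumes [measurable]: "f \<in> borel_measurable borel"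
  shows "(\<integral>\<^sup>+x. ennreal ((f (x + 2 *\<^sub>R z) - f x)\<^sup>2) \<partial>lborel) \<le> 4 * (\<integral>\<^sup>+x. ennreal ((f (x + z) - f x)\<^sup>2) \<partial>lborel)"
proof -
  let ?g = "\<lambda>x. ennreal ((f (x + z) - f x)\<^sup>2)"
  have pt: "ennreal ((f (x + 2 *\<^sub>R z) - f x)\<^sup>2) \<le> 2 * ?g (x + z) + 2 * ?g x" for x
  proof -
    have "(f (x + 2 *\<^sub>R z) - f x)\<^sup>2 \<le> 2 * (f (x + z + z) - f (x + z))\<^sup>2 + 2 * (f (x + z) - f x)\<^sup>2"
      using sum_squares_bound[of "f (x + z + z) - f (x + z)" "f (x + z) - f x"]
      by (simp add: scaleR_2 add.assoc power2_eq_square algebra_simps)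
    from ennreal_leI[OF this] show ?thesis by (simp add: ennreal_mult')
  qed
  have g1: "(\<integral>\<^sup>+x. ?g (x + z) \<partial>lborel) = (\<integral>\<^sup>+x. ?g x \<partial>lborel)"
    by (rule nn_integral_lborel_shift) measurable
  have "(\<integral>\<^sup>+x. ennreal ((f (x + 2 *\<^sub>R z) - f x)\<^sup>2) \<partial>lborel) \<le> (\<integral>\<^sup>+x. 2 * ?g (x + z) + 2 * ?g x \<partial>lborel)"
    by (intro nn_integral_mono pt)
  also have "\<dots> = 2 * (\<integral>\<^sup>+x. ?g (x + z) \<partial>lborel) + 2 * (\<integral>\<^sup>+x. ?g x \<partial>lborel)"
    by (simp add: nn_integral_add nn_integral_cmult)
  also have "\<dots> = 4 * (\<integral>\<^sup>+x. ?g x \<partial>lborel)" unfolding g1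
    by (simp add: distrib_right[symmetric])
  finally show ?thesis .
qed

text \<open>
  Write \<open>D z\<close> for the left-hand side. An increment over \<open>z\<close> is the sum of two increments over \<open>z / 2\<close>, so \<open>D z \<le> 4 D (z / 2)\<close>.
  Hence \<open>4 ^ j D (z / 2 ^ j)\<close> increases with \<open>j\<close>, and its limit is the integral of the squared directional
  derivative.
\<close>

lemma nn_integral_shift_le_grad:
  assumes f: "f \<in> test_functions \<Omega>"
  shows "(\<integral>\<^sup>+x. ennreal ((f (x + z) - f x)\<^sup>2) \<partial>lborel) \<le> (\<integral>\<^sup>+x. ennreal ((grad f x \<bullet> z)\<^sup>2) \<partial>lborel)"
proof -
  have [measurable]: "f \<in> borel_measurable borel" using f by (rule test_functions_borel)
  have [measurable]: "grad f \<in> borel_measurable borel" using f by (rule grad_borel)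
  let ?D = "\<lambda>z. (\<integral>\<^sup>+x. ennreal ((f (x + z) - f x)\<^sup>2) \<partial>lborel)"
  define s :: "nat \<Rightarrow> real" where "s j = (1/2) ^ j" for j
  have s: "s \<longlonglongrightarrow> 0" "\<And>j. s j > 0" unfolding s_def by (auto intro: LIMSEQ_power_zero)
  let ?u = "\<lambda>j x. ennreal (((f (x + s j *\<^sub>R z) - f x) / s j)\<^sup>2)"
  have sc: "(\<integral>\<^sup>+x. ?u j x \<partial>lborel) = ennreal (4 ^ j) * ?D (s j *\<^sub>R z)" for j
  proof -
    have "1 / (s j)\<^sup>2 = 4 ^ j"
      by (simp add: s_def power_divide power_mult[symmetric] power_mult_distrib[symmetric])
        (metis mult.commute power_mult power2_eq_square numeral_times_numeral semiring_norm(12,13) mult_2)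
    then have "((f (x + s j *\<^sub>R z) - f x) / s j)\<^sup>2 = 4 ^ j * (f (x + s j *\<^sub>R z) - f x)\<^sup>2" for x
      by (simp add: power_divide) (metis mult.commute times_divide_eq_left mult_1 divide_inverse)
    then show ?thesis by (simp add: ennreal_mult' nn_integral_cmult)
  qed
  have ge: "?D z \<le> ennreal (4 ^ j) * ?D (s j *\<^sub>R z)" for j
  proof (induction j)
    case 0
    then show ?case by (simp add: s_def)
  next
    case (Suc j)
    have "?D (s j *\<^sub>R z) \<le> 4 * ?D (s (Suc j) *\<^sub>R z)"
      using nn_integral_shift_double[of f "s (Suc j) *\<^sub>R z"] by (simp add: s_def)
    then have "ennreal (4 ^ j) * ?D (s j *\<^sub>R z) \<le> ennreal (4 ^ j) * (4 * ?D (s (Suc j) *\<^sub>R z))"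
      by (intro mult_left_mono) auto
    also have "\<dots> = ennreal (4 ^ Suc j) * ?D (s (Suc j) *\<^sub>R z)"
      by (simp add: ennreal_mult' mult_ac)
    finally show ?case using Suc by (rule order_trans[rotated])
  qed
  obtain L where L: "L > 0" "\<And>x y. \<bar>f x - f y\<bar> \<le> L * norm (x - y)" using test_functions_lipschitz[OF f] by blast
  obtain R where R: "R > 0" "supp f \<subseteq> ball 0 R"
    using compact_imp_bounded[OF test_functions_supp(1)[OF f]] bounded_subset_ballD by blast
  have out: "f y = 0" if "norm y \<ge> R" for y
  proof (rule test_functions_supp(3)[OF f])
    show "y \<notin> supp f"
    proof
      assume "y \<in> supp f"
      then have "y \<in> ball 0 R" using R(2) by (rule subsetD[rotated])
      then show False using that by simp
    qed
  qed
  let ?B = "cball (0 :: real^'a) (R + norm z)"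
  have [measurable]: "?B \<in> sets borel" by simp
  let ?w = "\<lambda>x. ennreal ((L * norm z)\<^sup>2) * indicator ?B x"
  have "(\<lambda>j. \<integral>\<^sup>+x. ?u j x \<partial>lborel) \<longlonglongrightarrow> (\<integral>\<^sup>+x. ennreal ((grad f x \<bullet> z)\<^sup>2) \<partial>lborel)"
  proof (rule nn_integral_dominated_convergence[where w="?w"])
    show "(\<integral>\<^sup>+x. ?w x \<partial>lborel) < \<infinity>"
      using emeasure_compact_finite[OF compact_cball, of "0 :: real^'a" "R + norm z"]
      by (subst nn_integral_cmult) (auto simp: ennreal_mult_less_top intro!: borel_measurable_indicator)
    show "AE x in lborel. (\<lambda>j. ?u j x) \<longlonglongrightarrow> ennreal ((grad f x \<bullet> z)\<^sup>2)"
      by (intro AE_I2 tendsto_ennrealI tendsto_power test_difference_quotient[OF f s])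
    fix j
    show "AE x in lborel. ?u j x \<le> ?w x"
    proof (rule AE_I2)
      fix x :: "real^'a"
      have sz: "norm (s j *\<^sub>R z) \<le> norm z" using power_le_one[of "1/2 :: real" j]
        by (auto simp: s_def intro: mult_left_le_one_le)
      show "?u j x \<le> ?w x"
      proof (cases "x \<in> ?B")
        case True
        have "\<bar>(f (x + s j *\<^sub>R z) - f x) / s j\<bar> \<le> \<bar>L * norm z\<bar>"
          using L(2)[of "x + s j *\<^sub>R z" x] s(2)[of j] L(1) by (simp add: field_simps abs_divide)
        then have "((f (x + s j *\<^sub>R z) - f x) / s j)\<^sup>2 \<le> (L * norm z)\<^sup>2" by (rule abs_le_square_iff[THEN iffD1])
        then show ?thesis using True by (simp add: ennreal_leI)
      next
        case False
        then have "norm x > R + norm z" by simp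
        then have "norm x \<ge> R" "norm (x + s j *\<^sub>R z) \<ge> R"
          using norm_triangle_ineq2[of x "- (s j *\<^sub>R z)"] sz norm_ge_zero[of z] by (simp_all, linarith+)
        then show ?thesis using out by simp
      qed
    qed
  qed (measurable)
  moreover have "?D z \<le> (\<integral>\<^sup>+x. ?u j x \<partial>lborel)" for j using ge[of j] unfolding sc .
  ultimately show ?thesis by (intro LIMSEQ_le_const) auto
qed

locale heat_vec = heat vs for vs :: "(real^'n) list"
begin

text \<open>
  With \<open>vs\<close> as in the final theorem, twice the quadratic form of the matrix.
\<close>

definition S :: "real^'n \<Rightarrow> real" where "S \<xi> = (\<Sum>v\<leftarrow>vs. (v \<bullet> \<xi>)\<^sup>2)"

lemma S_nonneg: "0 \<le> S \<xi>" unfolding S_def by (intro sum_list_nonneg) auto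

lemma S_continuous: "continuous_on UNIV S"
proof -
  have "continuous_on UNIV (\<lambda>\<xi>. \<Sum>v\<leftarrow>ws. (v \<bullet> \<xi>)\<^sup>2)" for ws :: "(real^'n) list"
    by (induction ws) (auto intro!: continuous_intros)
  then show ?thesis by (simp add: S_def[abs_def])
qed

lemma S_grad_integrable: assumes f: "f \<in> test_functions \<Omega>" shows "integrable lborel (\<lambda>x. S (grad f x))"
proof -
  have c: "continuous_on UNIV (\<lambda>x. S (grad f x))"
    using continuous_on_compose2[OF S_continuous grad_continuous[OF f, of UNIV]] by simp
  have z: "S (grad f x) = 0" if "x \<notin> supp f" for x
  proof -
    have "(\<Sum>v\<leftarrow>ws. (v \<bullet> (0::real^'n))\<^sup>2) = 0" for ws by (induction ws) auto
    then show ?thesis using grad_outside[OF that] by (simp add: S_def)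
  qed
  have cK: "compact ((\<lambda>x. S (grad f x)) ` supp f)"
    using continuous_on_subset[OF c] by (intro compact_continuous_image test_functions_supp(1)[OF f]) auto
  then obtain C where C: "\<And>x. x \<in> supp f \<Longrightarrow> \<bar>S (grad f x)\<bar> \<le> C"
    using compact_imp_bounded[OF cK] unfolding bounded_iff by auto
  have "\<bar>S (grad f x)\<bar> \<le> \<bar>C\<bar>" for x
  proof (cases "x \<in> supp f")
    case True
    then show ?thesis using C[OF True] by linarith
  qed (simp add: z)
  then show ?thesis
    by (rule integrable_bounded_compact[OF borel_measurable_continuous_onI[OF c] _ test_functions_supp(1)[OF f] z])
qed

text \<open>
  The mean of \<open>(grad f x \<bullet> z)\<^sup>2\<close> over \<open>z\<close> distributed by \<open>N t\<close> is \<open>t S (grad f x)\<close>.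
\<close>

lemma E_test_le: assumes f: "f \<in> test_functions \<Omega>" and t: "t \<ge> 0"
  shows "2 * E t f \<le> t * (\<integral>x. S (grad f x) \<partial>lborel)"
proof -
  have [measurable]: "f \<in> borel_measurable borel" using f by (rule test_functions_borel)
  have [measurable]: "grad f \<in> borel_measurable borel" using f by (rule grad_borel)
  have "ennreal (2 * E t f) = (\<integral>\<^sup>+z. \<integral>\<^sup>+x. ennreal ((f (x + z) - f x)\<^sup>2) \<partial>lborel \<partial>N t)"
    by (rule nn_integral_E[OF test_bL2[OF f], symmetric])
  also have "\<dots> \<le> (\<integral>\<^sup>+z. \<integral>\<^sup>+x. ennreal ((grad f x \<bullet> z)\<^sup>2) \<partial>lborel \<partial>N t)"
    by (intro nn_integral_mono nn_integral_shift_le_grad[OF f])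
  also have "\<dots> = (\<integral>\<^sup>+x. \<integral>\<^sup>+z. ennreal ((grad f x \<bullet> z)\<^sup>2) \<partial>N t \<partial>lborel)"
    by (rule LN.Fubini') measurable
  also have "\<dots> = (\<integral>\<^sup>+x. ennreal (t * S (grad f x)) \<partial>lborel)"
  proof (rule nn_integral_cong)
    fix x
    show "(\<integral>\<^sup>+z. ennreal ((grad f x \<bullet> z)\<^sup>2) \<partial>N t) = ennreal (t * S (grad f x))"
      using nn_integral_N_inner_sq[OF t, of "grad f x"] unfolding S_def by (simp only: inner_commute[of "grad f x"])
  qed
  also have "\<dots> = ennreal (t * (\<integral>x. S (grad f x) \<partial>lborel))"
    using S_grad_integrable[OF f] t S_nonneg by (subst nn_integral_eq_integral) auto
  finally show ?thesis using t S_nonneg by (simp add: ennreal_le_iff integral_nonneg_AE)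
qed

text \<open>
  The converse of the previous bound in the limit, by Fatou's lemma. It suffices to control the energy along dyadic times.
\<close>

lemma S_grad_le_liminf:
  assumes f: "f \<in> test_functions \<Omega>" and le: "\<And>j. j \<ge> J \<Longrightarrow> E (1 / 2 ^ j) f \<le> c / 2 ^ j"
  shows "(\<integral>x. S (grad f x) \<partial>lborel) \<le> 2 * c"
proof -
  have [measurable]: "f \<in> borel_measurable borel" using f by (rule test_functions_borel)
  have [measurable]: "grad f \<in> borel_measurable borel" using f by (rule grad_borel)
  have c: "0 \<le> c" using le[of J] E_nonneg[OF test_bL2[OF f], of "1 / 2 ^ J"] 
    by (simp add: zero_le_divide_iff order_trans)
      (metis divide_less_0_iff not_le order_trans zero_less_numeral zero_less_power)
  define s :: "nat \<Rightarrow> real" where "s j = sqrt (1 / 2 ^ (j + J))" for j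
  have s0: "s \<longlonglongrightarrow> 0"
  proof -
    have "(\<lambda>j. (1/2 :: real) ^ (j + J)) \<longlonglongrightarrow> 0" by (rule LIMSEQ_ignore_initial_segment) (rule LIMSEQ_power_zero, simp)
    from tendsto_real_sqrt[OF this] show ?thesis by (simp add: s_def[abs_def] power_divide)
  qed
  have sp: "s j > 0" for j by (simp add: s_def)
  have s2: "(s j)\<^sup>2 = 1 / 2 ^ (j + J)" for j by (simp add: s_def)
  let ?M = "gauss vs \<Otimes>\<^sub>M (lborel :: (real^'n) measure)"
  let ?u = "\<lambda>j p. ennreal (((f (snd p + s j *\<^sub>R fst p) - f (snd p)) / s j)\<^sup>2)"
  have ub: "(\<integral>\<^sup>+p. ?u j p \<partial>?M) \<le> ennreal (2 * c)" for j
  proof -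
    have "(\<integral>\<^sup>+p. ?u j p \<partial>?M) = (\<integral>\<^sup>+z. \<integral>\<^sup>+x. ennreal (((f (x + s j *\<^sub>R z) - f x) / s j)\<^sup>2) \<partial>lborel \<partial>gauss vs)"
      by (subst lborel.nn_integral_fst[symmetric]) auto
    also have "\<dots> = (\<integral>\<^sup>+z. \<integral>\<^sup>+x. ennreal (2 ^ (j + J)) * ennreal ((f (x + s j *\<^sub>R z) - f x)\<^sup>2) \<partial>lborel \<partial>gauss vs)"
    proof -
      have "ennreal (((f (x + s j *\<^sub>R z) - f x) / s j)\<^sup>2) = ennreal (2 ^ (j + J)) * ennreal ((f (x + s j *\<^sub>R z) - f x)\<^sup>2)" for x z
        by (subst ennreal_mult[symmetric]) (auto simp: power_divide s2)
      then show ?thesis by simp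
    qed
    also have "\<dots> = ennreal (2 ^ (j + J)) * (\<integral>\<^sup>+z. \<integral>\<^sup>+x. ennreal ((f (x + s j *\<^sub>R z) - f x)\<^sup>2) \<partial>lborel \<partial>gauss vs)"
      by (simp add: nn_integral_cmult)
    also have "(\<integral>\<^sup>+z. \<integral>\<^sup>+x. ennreal ((f (x + s j *\<^sub>R z) - f x)\<^sup>2) \<partial>lborel \<partial>gauss vs)
      = (\<integral>\<^sup>+z. \<integral>\<^sup>+x. ennreal ((f (x + z) - f x)\<^sup>2) \<partial>lborel \<partial>N (1 / 2 ^ (j + J)))"
      unfolding s_def by (rule nn_integral_N[symmetric]) measurable
    also have "\<dots> = ennreal (2 * E (1 / 2 ^ (j + J)) f)" by (rule nn_integral_E[OF test_bL2[OF f]])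
    also have "ennreal (2 ^ (j + J)) * \<dots> \<le> ennreal (2 ^ (j + J)) * ennreal (2 * (c / 2 ^ (j + J)))"
      using le[of "j + J"] by (intro mult_left_mono ennreal_leI) auto
    also have "\<dots> = ennreal (2 * c)" using c by (simp add: ennreal_mult[symmetric])
    finally show ?thesis .
  qed
  have lim: "liminf (\<lambda>j. ?u j p) = ennreal ((grad f (snd p) \<bullet> fst p)\<^sup>2)" for p
    by (intro lim_imp_Liminf tendsto_ennrealI tendsto_power test_difference_quotient[OF f s0 sp]) simp
  have "ennreal (\<integral>x. S (grad f x) \<partial>lborel) = (\<integral>\<^sup>+x. ennreal (S (grad f x)) \<partial>lborel)"
    using S_grad_integrable[OF f] S_nonneg by (subst nn_integral_eq_integral) auto
  also have "\<dots> = (\<integral>\<^sup>+x. \<integral>\<^sup>+z. ennreal ((grad f x \<bullet> z)\<^sup>2) \<partial>gauss vs \<partial>lborel)"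
  proof (rule nn_integral_cong)
    fix x
    show "ennreal (S (grad f x)) = (\<integral>\<^sup>+z. ennreal ((grad f x \<bullet> z)\<^sup>2) \<partial>gauss vs)"
      using nn_integral_gauss_inner_sq[of vs "grad f x"] unfolding S_def by (simp only: inner_commute[of "grad f x"])
  qed
  also have "\<dots> = (\<integral>\<^sup>+z. \<integral>\<^sup>+x. ennreal ((grad f x \<bullet> z)\<^sup>2) \<partial>lborel \<partial>gauss vs)"
  proof -
    interpret pg: pair_sigma_finite "lborel :: (real^'n) measure" "gauss vs" ..
    show ?thesis by (rule pg.Fubini'[symmetric]) measurable
  qed
  also have "\<dots> = (\<integral>\<^sup>+p. ennreal ((grad f (snd p) \<bullet> fst p)\<^sup>2) \<partial>?M)"
    by (subst lborel.nn_integral_fst[symmetric]) auto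
  also have "\<dots> = (\<integral>\<^sup>+p. liminf (\<lambda>j. ?u j p) \<partial>?M)" unfolding lim ..
  also have "\<dots> \<le> liminf (\<lambda>j. \<integral>\<^sup>+p. ?u j p \<partial>?M)" by (rule nn_integral_liminf) measurable
  also have "\<dots> \<le> liminf (\<lambda>j. ennreal (2 * c))" by (intro Liminf_mono always_eventually allI ub)
  also have "\<dots> = ennreal (2 * c)" by (simp add: Liminf_const)
  finally show ?thesis using c by (simp add: ennreal_le_iff)
qed

text \<open>
  The mollification is an average of translates, translates have the same energy, and squaring is convex.
\<close>

lemma E_conv_le:
  assumes w: "bL2 w" "integrable lborel w" and e: "e > 0" and h: "bL2 (conv (moll e) w)"
  shows "E t (conv (moll e) w) \<le> E t w"
proof -
  let ?m = "moll e :: real^'n \<Rightarrow> real" and ?h = "conv (moll e) w"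
  have [measurable]: "w \<in> borel_measurable borel" using w(1) by (rule bL2_measurable)
  have [measurable]: "?h \<in> borel_measurable borel" using h by (rule bL2_measurable)
  have [measurable]: "?m \<in> borel_measurable borel" using moll_test[OF e] by (rule test_functions_borel)
  have mi: "integrable lborel ?m" using moll_test[OF e] by (rule test_functions_integrable)
  have mn: "0 \<le> ?m y" for y by (rule moll_nonneg[OF e])
  have m1: "(\<integral>y. ?m y \<partial>lborel) = 1" by (rule moll_integral[OF e])
  obtain C where C: "\<And>x. \<bar>w x\<bar> \<le> C" using bL2_bounded[OF w(1)] by blast
  have pt: "ennreal ((?h (x + z) - ?h x)\<^sup>2) \<le> (\<integral>\<^sup>+y. ennreal (?m y) * ennreal ((w (x + y + z) - w (x + y))\<^sup>2) \<partial>lborel)" for x z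
  proof -
    let ?u = "\<lambda>y. w (x + y + z) - w (x + y)"
    have ub: "\<bar>?u y\<bar> \<le> 2 * C" for y using C[of "x + y + z"] C[of "x + y"] by linarith
    have b1: "integrable lborel (\<lambda>y. g y * ?m y)" if "g \<in> borel_measurable borel" "\<And>y. \<bar>g y\<bar> \<le> D" for g D
      by (rule integrable_mult_bounded[OF mi that])
    have iw: "integrable lborel (\<lambda>y. w (x + y + z) * ?m y)" "integrable lborel (\<lambda>y. w (x + y) * ?m y)"
      by (rule b1[of _ C]; use C in simp)+
    have u2b: "\<bar>(?u y)\<^sup>2\<bar> \<le> (2 * C)\<^sup>2" for y
      using power_mono[OF ub[of y] abs_ge_zero, of 2] by simp
    have iu: "integrable lborel (\<lambda>y. ?u y * ?m y)" by (rule b1[of _ "2 * C"]) (use ub in auto)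
    have iu2: "integrable lborel (\<lambda>y. (?u y)\<^sup>2 * ?m y)" by (rule b1[of _ "(2 * C)\<^sup>2"]) (use u2b in auto)
    let ?a = "\<integral>y. ?u y * ?m y \<partial>lborel"
    have a: "?h (x + z) - ?h x = ?a"
    proof -
      have "?h (x + z) = (\<integral>y. w (x + y + z) * ?m y \<partial>lborel)"
        by (simp add: conv_moll_eq[OF _ e] mult.commute add_ac)
      moreover have "?h x = (\<integral>y. w (x + y) * ?m y \<partial>lborel)"
        by (simp add: conv_moll_eq[OF _ e] mult.commute)
      ultimately show ?thesis using iw by (simp add: left_diff_distrib)
    qed
    have "0 \<le> (\<integral>y. (?u y - ?a)\<^sup>2 * ?m y \<partial>lborel)" using mn by (intro integral_nonneg_AE) auto
    also have "(\<lambda>y. (?u y - ?a)\<^sup>2 * ?m y) = (\<lambda>y. (?u y)\<^sup>2 * ?m y - 2 * ?a * (?u y * ?m y) + ?a\<^sup>2 * ?m y)"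
    proof (rule ext)
      have id: "(u - a)\<^sup>2 * m = u\<^sup>2 * m - 2 * a * (u * m) + a\<^sup>2 * m" for u a m :: real
        by (simp add: power2_diff algebra_simps)
      show "(?u y - ?a)\<^sup>2 * ?m y = (?u y)\<^sup>2 * ?m y - 2 * ?a * (?u y * ?m y) + ?a\<^sup>2 * ?m y" for y by (rule id)
    qed
    also have "(\<integral>y. (?u y)\<^sup>2 * ?m y - 2 * ?a * (?u y * ?m y) + ?a\<^sup>2 * ?m y \<partial>lborel)
       = (\<integral>y. (?u y)\<^sup>2 * ?m y \<partial>lborel) - 2 * ?a * ?a + ?a\<^sup>2 * 1"
      using iu iu2 mi m1 by simp
    finally have "?a\<^sup>2 \<le> (\<integral>y. (?u y)\<^sup>2 * ?m y \<partial>lborel)" by (simp add: power2_eq_square)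
    then have "ennreal (?a\<^sup>2) \<le> (\<integral>\<^sup>+y. ennreal ((?u y)\<^sup>2 * ?m y) \<partial>lborel)"
      using iu2 mn by (subst nn_integral_eq_integral) (auto intro: ennreal_leI)
    then show ?thesis unfolding a using mn by (simp add: ennreal_mult' mult.commute)
  qed
  have sh: "(\<integral>\<^sup>+x. ennreal ((w (x + y + z) - w (x + y))\<^sup>2) \<partial>lborel) = (\<integral>\<^sup>+x. ennreal ((w (x + z) - w x)\<^sup>2) \<partial>lborel)" for y z
    by (rule nn_integral_lborel_shift[of "\<lambda>x. ennreal ((w (x + z) - w x)\<^sup>2)" y]) measurable
  have mnn: "(\<integral>\<^sup>+y. ennreal (?m y) \<partial>lborel) = 1"
    using mi m1 mn by (subst nn_integral_eq_integral) auto
  have "ennreal (2 * E t ?h) = (\<integral>\<^sup>+z. \<integral>\<^sup>+x. ennreal ((?h (x + z) - ?h x)\<^sup>2) \<partial>lborel \<partial>N t)"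
    by (rule nn_integral_E[OF h, symmetric])
  also have "\<dots> \<le> (\<integral>\<^sup>+z. \<integral>\<^sup>+x. \<integral>\<^sup>+y. ennreal (?m y) * ennreal ((w (x + y + z) - w (x + y))\<^sup>2) \<partial>lborel \<partial>lborel \<partial>N t)"
    by (intro nn_integral_mono pt)
  also have "\<dots> = (\<integral>\<^sup>+z. \<integral>\<^sup>+y. \<integral>\<^sup>+x. ennreal (?m y) * ennreal ((w (x + y + z) - w (x + y))\<^sup>2) \<partial>lborel \<partial>lborel \<partial>N t)"
    by (rule nn_integral_cong, rule lborel_pair.Fubini') measurable
  also have "\<dots> = (\<integral>\<^sup>+z. \<integral>\<^sup>+y. ennreal (?m y) * (\<integral>\<^sup>+x. ennreal ((w (x + z) - w x)\<^sup>2) \<partial>lborel) \<partial>lborel \<partial>N t)"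
    by (simp add: nn_integral_cmult sh)
  also have "\<dots> = (\<integral>\<^sup>+z. \<integral>\<^sup>+x. ennreal ((w (x + z) - w x)\<^sup>2) \<partial>lborel \<partial>N t)"
    by (simp add: nn_integral_multc mnn)
  also have "\<dots> = ennreal (2 * E t w)" by (rule nn_integral_E[OF w(1)])
  finally show ?thesis using E_nonneg[OF w(1)] by (simp add: ennreal_le_iff)
qed

lemma compact_neighbourhood:
  fixes K :: "(real^'n) set"
  assumes "compact K" "open \<Omega>" "K \<subseteq> \<Omega>"
  obtains d K' where "d > 0" "compact K'" "K \<subseteq> K'" "K' \<subseteq> \<Omega>" "\<And>x y. x \<in> K \<Longrightarrow> norm (y - x) \<le> d \<Longrightarrow> y \<in> K'"
proof -
  obtain d where d: "d > 0" "(\<Union>x\<in>K. cball x d) \<subseteq> \<Omega>"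
    using compact_subset_open_imp_cball_epsilon_subset[OF assms] by metis
  let ?K = "(\<lambda>p. fst p + snd p) ` (K \<times> cball 0 d)"
  have "compact ?K"
    by (rule compact_continuous_image[OF _ compact_Times[OF assms(1) compact_cball]]) (intro continuous_intros)
  moreover have in': "y \<in> ?K" if "x \<in> K" "norm (y - x) \<le> d" for x y
    using that by (intro image_eqI[of _ _ "(x, y - x)"]) auto
  moreover have "K \<subseteq> ?K" using in' d(1) by force
  moreover have "?K \<subseteq> \<Omega>"
  proof
    fix y assume "y \<in> ?K"
    then obtain x u where "x \<in> K" "norm u \<le> d" "y = x + u" by auto
    then have "y \<in> cball x d" by (simp add: dist_norm)
    then show "y \<in> \<Omega>" using d(2) \<open>x \<in> K\<close> by blast
  qed
  ultimately show ?thesis using d(1) that[of d ?K] by blast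
qed

text \<open>
  The mollifications \<open>h\<close> of \<open>w\<close> are test functions in \<open>\<Omega>\<close>, their energies are at most those of \<open>w\<close>, so that
  the integral of \<open>S (grad h)\<close> is at most \<open>2 c\<close>; the terms without derivatives converge, since \<open>V\<close> is
  bounded near \<open>K\<close>.
\<close>

lemma rayleigh_bound_extend:
  fixes V :: "real^'n \<Rightarrow> real"
  assumes V[measurable]: "V \<in> borel_measurable borel" and Vc: "continuous_on \<Omega> V" and \<Omega>: "open \<Omega>"
    and ray: "\<And>\<phi>. \<phi> \<in> test_functions \<Omega> \<Longrightarrow>
        lam * ip \<phi> \<phi> \<le> (1/2) * (\<integral>x. S (grad \<phi> x) \<partial>lborel) + (\<integral>x. V x * (\<phi> x)\<^sup>2 \<partial>lborel)"
    and w: "bL2 w" and K: "compact K" "K \<subseteq> \<Omega>" "\<And>x. x \<notin> K \<Longrightarrow> w x = 0"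
    and E: "\<And>j. j \<ge> J \<Longrightarrow> E (1 / 2 ^ j) w \<le> c / 2 ^ j"
  shows "lam * ip w w \<le> c + (\<integral>x. V x * (w x)\<^sup>2 \<partial>lborel)"
proof (rule field_le_epsilon)
  fix \<epsilon> :: real assume \<epsilon>: "\<epsilon> > 0"
  have [measurable]: "w \<in> borel_measurable borel" using w by (rule bL2_measurable)
  obtain C where C: "C > 0" "\<And>x. \<bar>w x\<bar> \<le> C" using bL2_bounded[OF w] by blast
  have wi: "integrable lborel w" by (rule integrable_bounded_compact[OF _ C(2) K(1,3)]) measurable
  obtain d K' where d: "d > 0" "compact K'" "K \<subseteq> K'" "K' \<subseteq> \<Omega>" "\<And>x y. x \<in> K \<Longrightarrow> norm (y - x) \<le> d \<Longrightarrow> y \<in> K'"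
    using compact_neighbourhood[OF K(1) \<Omega> K(2)] by blast
  have [measurable]: "K' \<in> sets borel" using d(2) by (rule borel_compact)
  have VK': "compact (V ` K')" using continuous_on_subset[OF Vc d(4)] d(2) by (rule compact_continuous_image)
  obtain M0 where M0: "\<And>x. x \<in> K' \<Longrightarrow> \<bar>V x\<bar> \<le> M0"
    using compact_imp_bounded[OF VK'] unfolding bounded_iff by auto
  define M where "M = \<bar>M0\<bar> + \<bar>lam\<bar> + 1"
  have M0': "M > 0" unfolding M_def by linarith
  have M1: "\<bar>V x - lam\<bar> \<le> M" "\<bar>V x\<bar> \<le> M" if "x \<in> K'" for x
    using M0[OF that] abs_triangle_ineq4[of "V x" lam] abs_ge_self[of M0] unfolding M_def by linarith+
  note M = M0' M1
  define \<delta> where "\<delta> = \<epsilon> / (2 * C * M)"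
  have \<delta>: "\<delta> > 0" using \<epsilon> C M by (simp add: \<delta>_def)
  obtain d' where d': "d' > 0" "\<And>\<eta>. 0 < \<eta> \<Longrightarrow> \<eta> < d' \<Longrightarrow> (\<integral>\<^sup>+x. ennreal \<bar>conv (moll \<eta>) w x - w x\<bar> \<partial>lborel) \<le> ennreal \<delta>"
    using mollify_L1[OF wi \<delta>] by blast
  define \<eta> where "\<eta> = min d d' / 2"
  have \<eta>: "0 < \<eta>" "\<eta> < d'" "\<eta> < d" using d d' by (auto simp: \<eta>_def)
  let ?h = "conv (moll \<eta>) w"
  have ht: "?h \<in> test_functions \<Omega>"
  proof (rule conv_test[OF wi K(1,3) \<eta>(1)])
    fix x y assume "x \<in> K" "norm (y - x) \<le> \<eta>"
    then have "y \<in> K'" using \<eta>(3) by (intro d(5)[of x]) auto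
    then show "y \<in> \<Omega>" using d(4) by blast
  qed
  have h: "bL2 ?h" by (rule test_bL2[OF ht])
  have [measurable]: "?h \<in> borel_measurable borel" using h by (rule bL2_measurable)
  have hK: "?h x = 0" if "x \<notin> K'" for x
  proof -
    have "moll \<eta> (x - y) * w y = 0" for y
    proof (rule ccontr)
      assume "moll \<eta> (x - y) * w y \<noteq> 0"
      then have "y \<in> K" "norm (x - y) < \<eta>" using K(3) moll_supp[OF \<eta>(1)] by auto
      then have "x \<in> K'" using \<eta> by (intro d(5)[of y]) auto
      then show False using that by simp
    qed
    then have "(\<lambda>y. moll \<eta> (x - y) * w y) = (\<lambda>_. 0)" by (rule ext)
    then show ?thesis by (simp only: conv_def integral_zero)
  qed
  have wK: "w x = 0" if "x \<notin> K'" for x using that d(3) by (intro K(3)) auto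
  have hC: "\<bar>?h x\<bar> \<le> C" for x
  proof -
    let ?m = "moll \<eta> :: real^'n \<Rightarrow> real"
    have mi: "integrable lborel ?m" using moll_test[OF \<eta>(1)] by (rule test_functions_integrable)
    have mn: "0 \<le> ?m y" for y by (rule moll_nonneg[OF \<eta>(1)])
    have i: "integrable lborel (\<lambda>y. w (x + y) * ?m y)"
      by (rule integrable_mult_bounded[OF mi, of _ C]) (use C in auto)
    have "\<bar>?h x\<bar> = \<bar>\<integral>y. w (x + y) * ?m y \<partial>lborel\<bar>" by (simp add: conv_moll_eq[OF _ \<eta>(1)] mult.commute)
    also have "\<dots> \<le> (\<integral>y. \<bar>w (x + y) * ?m y\<bar> \<partial>lborel)" by (rule integral_abs_bound)
    also have "\<dots> \<le> (\<integral>y. C * ?m y \<partial>lborel)"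
      using mi C mn by (intro integral_mono integrable_abs i integrable_mult_right) (auto simp: abs_mult intro!: mult_mono)
    also have "\<dots> = C" using moll_integral[OF \<eta>(1), where 'n='n] by simp
    finally show ?thesis .
  qed
  let ?U = "\<lambda>x. (V x - lam) * indicator K' x"
  have Uint: "integrable lborel (\<lambda>x. ?U x * (g x)\<^sup>2)" "integrable lborel (\<lambda>x. V x * (g x)\<^sup>2)"
    and Ueq: "(\<integral>x. ?U x * (g x)\<^sup>2 \<partial>lborel) = (\<integral>x. V x * (g x)\<^sup>2 \<partial>lborel) - lam * ip g g"
    if g: "bL2 g" and gK: "\<And>x. x \<notin> K' \<Longrightarrow> g x = 0" for g
  proof -
    have [measurable]: "g \<in> borel_measurable borel" using g by (rule bL2_measurable)
    have b: "integrable lborel (\<lambda>x. (V x * indicator K' x) * (g x)\<^sup>2)"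
      by (rule integrable_mult_bounded[OF bL2_sq[OF g], of _ M]) (use M in \<open>auto simp: indicator_def\<close>)
    have e: "(\<lambda>x. (V x * indicator K' x) * (g x)\<^sup>2) = (\<lambda>x. V x * (g x)\<^sup>2)"
      using gK by (auto simp: fun_eq_iff indicator_def)
    show i2: "integrable lborel (\<lambda>x. V x * (g x)\<^sup>2)" using b unfolding e .
    have e': "(\<lambda>x. ?U x * (g x)\<^sup>2) = (\<lambda>x. V x * (g x)\<^sup>2 - lam * (g x)\<^sup>2)"
      using gK by (auto simp: fun_eq_iff indicator_def algebra_simps)
    show "integrable lborel (\<lambda>x. ?U x * (g x)\<^sup>2)" unfolding e' using i2 bL2_sq[OF g] by auto
    show "(\<integral>x. ?U x * (g x)\<^sup>2 \<partial>lborel) = (\<integral>x. V x * (g x)\<^sup>2 \<partial>lborel) - lam * ip g g"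
      unfolding e' ip_self using i2 bL2_sq[OF g] by simp
  qed
  have Sh: "(\<integral>x. S (grad ?h x) \<partial>lborel) \<le> 2 * c"
    by (rule S_grad_le_liminf[OF ht, of J]) (rule order_trans[OF E_conv_le[OF w wi \<eta>(1) h] E])
  have "0 \<le> c + (\<integral>x. ?U x * (?h x)\<^sup>2 \<partial>lborel)"
    using ray[OF ht] Sh Ueq[OF h hK] by simp
  also have "(\<integral>x. ?U x * (?h x)\<^sup>2 \<partial>lborel) \<le> (\<integral>x. ?U x * (w x)\<^sup>2 \<partial>lborel) + \<epsilon>"
  proof -
    have hw: "integrable lborel (\<lambda>x. ?h x - w x)" using wi test_functions_integrable[OF ht] by auto
    have I: "(\<integral>x. \<bar>?h x - w x\<bar> \<partial>lborel) \<le> \<delta>"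
    proof -
      have "ennreal (\<integral>x. \<bar>?h x - w x\<bar> \<partial>lborel) \<le> ennreal \<delta>"
        using d'(2)[OF \<eta>(1,2)] hw by (subst nn_integral_eq_integral[symmetric]) auto
      then show ?thesis using \<delta> by (simp add: ennreal_le_iff)
    qed
    have "(\<integral>x. ?U x * (?h x)\<^sup>2 \<partial>lborel) - (\<integral>x. ?U x * (w x)\<^sup>2 \<partial>lborel)
       = (\<integral>x. ?U x * (?h x)\<^sup>2 - ?U x * (w x)\<^sup>2 \<partial>lborel)"
      using Uint(1)[OF h hK] Uint(1)[OF w wK] by simp
    also have "\<dots> \<le> (\<integral>x. (M * (2 * C)) * \<bar>?h x - w x\<bar> \<partial>lborel)"
    proof (rule integral_mono)
      show "integrable lborel (\<lambda>x. ?U x * (?h x)\<^sup>2 - ?U x * (w x)\<^sup>2)"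
        using Uint(1)[OF h hK] Uint(1)[OF w wK] by simp
      show "integrable lborel (\<lambda>x. (M * (2 * C)) * \<bar>?h x - w x\<bar>)" using hw by auto
      fix x
      have "?U x * (?h x)\<^sup>2 - ?U x * (w x)\<^sup>2 = ?U x * ((?h x + w x) * (?h x - w x))"
        by (simp add: power2_eq_square algebra_simps)
      also have "\<dots> \<le> \<bar>?U x\<bar> * (\<bar>?h x + w x\<bar> * \<bar>?h x - w x\<bar>)"
        by (metis abs_ge_self abs_mult)
      also have "\<dots> \<le> M * ((2 * C) * \<bar>?h x - w x\<bar>)"
        using M hC[of x] C(2)[of x] C(1) abs_triangle_ineq[of "?h x" "w x"]
        by (intro mult_mono) (auto simp: indicator_def)
      finally show "?U x * (?h x)\<^sup>2 - ?U x * (w x)\<^sup>2 \<le> (M * (2 * C)) * \<bar>?h x - w x\<bar>" by (simp add: mult.assoc)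
    qed
    also have "\<dots> = (M * (2 * C)) * (\<integral>x. \<bar>?h x - w x\<bar> \<partial>lborel)" by simp
    also have "\<dots> \<le> (M * (2 * C)) * \<delta>" using I M C by (intro mult_left_mono) auto
    also have "\<dots> = \<epsilon>" using M C by (simp add: \<delta>_def)
    finally show ?thesis by simp
  qed
  finally show "lam * ip w w \<le> c + (\<integral>x. V x * (w x)\<^sup>2 \<partial>lborel) + \<epsilon>"
    using Ueq[OF w wK] by simp
qed

end

section \<open>Upper bound for one time step\<close>

lemma square_sum_le_weighted: "\<eta> > 0 \<Longrightarrow> (a + b)\<^sup>2 \<le> (1 + \<eta>) * a\<^sup>2 + (1 + 1 / \<eta>) * (b::real)\<^sup>2"
proof -
  assume \<eta>: "\<eta> > 0"
  have "0 \<le> (\<eta> * a - b)\<^sup>2 / \<eta>" using \<eta> by simp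
  also have "\<dots> = \<eta> * a\<^sup>2 - 2 * (a * b) + b\<^sup>2 / \<eta>" using \<eta> by (simp add: power2_eq_square field_simps)
  finally show ?thesis by (simp add: power2_eq_square algebra_simps)
qed

text \<open>
  The inequality \<open>le\<close> is the first-order form of the exponential bound: with
  \<open>u = t lam / (1 + \<eta>)\<close> it gives \<open>W (1 + u) \<le> (1 + t \<kappa>) F\<close>, and \<open>1 + u\<close> is at least \<open>exp (u - u\<^sup>2)\<close>.
\<close>

lemma exp_upper_from_rayleigh:
  fixes W F t \<eta> lam \<kappa> :: real
  assumes W: "0 \<le> W" "0 \<le> F" and t: "t > 0" and \<eta>: "\<eta> > 0" and lam: "lam \<ge> 0" and \<kappa>: "\<kappa> \<ge> 0"
    and le: "lam * W \<le> (1 + \<eta>) * ((F - W) / t) + \<kappa> * F"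
    and small: "\<kappa> + t * lam\<^sup>2 + lam * \<eta> \<le> \<epsilon>" "t * lam \<le> 1"
  shows "W \<le> exp (- (t * (lam - \<epsilon>))) * F"
proof -
  define u where "u = t * lam / (1 + \<eta>)"
  have u0: "u \<ge> 0" using t lam \<eta> by (simp add: u_def)
  have utl: "u \<le> t * lam"
  proof -
    have "t * lam * 1 \<le> t * lam * (1 + \<eta>)" using t lam \<eta> by (intro mult_left_mono) auto
    then show ?thesis using \<eta> by (simp add: u_def divide_le_eq)
  qed
  have u1: "u \<le> 1" using utl small(2) by linarith
  have ueq: "u * (1 + \<eta>) = t * lam" using \<eta> by (simp add: u_def)
  have ul: "u \<ge> t * lam - t * (lam * \<eta>)"
  proof -
    have "t * lam - u = u * \<eta>" using ueq by (simp add: algebra_simps)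
    also have "\<dots> \<le> (t * lam) * \<eta>" using utl \<eta> by (intro mult_right_mono) auto
    finally show ?thesis by (simp add: algebra_simps)
  qed
  have "t * (lam * W) \<le> (1 + \<eta>) * (F - W) + t * \<kappa> * F"
  proof -
    have "t * ((1 + \<eta>) * ((F - W) / t) + \<kappa> * F) = (1 + \<eta>) * (F - W) + t * \<kappa> * F"
      using t by (simp add: field_simps)
    then show ?thesis using mult_left_mono[OF le, of t] t by simp
  qed
  then have "(1 + \<eta>) * (W * (1 + u)) \<le> (1 + \<eta>) * F + t * \<kappa> * F"
    using arg_cong[OF ueq, of "\<lambda>x. x * W"] by (simp add: algebra_simps)
  also have "\<dots> \<le> (1 + \<eta>) * ((1 + t * \<kappa>) * F)"
    using mult_nonneg_nonneg[of \<eta> "t * \<kappa> * F"] \<eta> t \<kappa> W(2) by (simp add: algebra_simps)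
  finally have 1: "W * (1 + u) \<le> (1 + t * \<kappa>) * F" using \<eta> by (simp add: mult_le_cancel_left)
  have "exp (u - u\<^sup>2) \<le> 1 + u"
    using ln_one_plus_pos_lower_bound[OF u0 u1] u0 by (simp add: ln_ge_iff)
  then have "W * exp (u - u\<^sup>2) \<le> W * (1 + u)" using W by (intro mult_left_mono) auto
  also note 1
  also have "(1 + t * \<kappa>) * F \<le> exp (t * \<kappa>) * F" using W by (intro mult_right_mono exp_ge_add_one_self) auto
  finally have "W * exp (u - u\<^sup>2) * exp (- (u - u\<^sup>2)) \<le> exp (t * \<kappa>) * F * exp (- (u - u\<^sup>2))"
    by (intro mult_right_mono) auto
  then have "W \<le> exp (t * \<kappa> - (u - u\<^sup>2)) * F"
    by (simp add: mult.assoc exp_add[symmetric] exp_diff mult_ac exp_minus field_simps)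
  also have "\<dots> \<le> exp (- (t * (lam - \<epsilon>))) * F"
  proof (intro mult_right_mono W)
    have "u\<^sup>2 \<le> (t * lam)\<^sup>2" using utl u0 by (intro power_mono)
    also have "\<dots> = t * (t * lam\<^sup>2)" by (simp add: power2_eq_square)
    finally have "t * \<kappa> - (u - u\<^sup>2) \<le> t * \<kappa> - t * lam + t * (lam * \<eta>) + t * (t * lam\<^sup>2)" using ul by linarith
    also have "\<dots> = t * (\<kappa> + t * lam\<^sup>2 + lam * \<eta>) - t * lam" by (simp add: algebra_simps)
    also have "\<dots> \<le> t * \<epsilon> - t * lam" using small(1) t by (simp add: mult_left_mono)
    finally show "exp (t * \<kappa> - (u - u\<^sup>2)) \<le> exp (- (t * (lam - \<epsilon>)))" by (simp add: algebra_simps)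
  qed
  finally show ?thesis .
qed

lemma exp_lower_bound_linear:
  fixes y \<rho> :: real assumes "0 \<le> y" "\<rho> \<le> y - y\<^sup>2" shows "exp (- y) \<le> 1 - \<rho>"
proof -
  have "1 \<le> (1 + y) * (1 - y + y\<^sup>2)" using assms(1) by (simp add: power2_eq_square algebra_simps)
  moreover have "1 + y \<le> exp y" by (rule exp_ge_add_one_self)
  moreover have p: "0 \<le> 1 - y + y\<^sup>2"
  proof -
    have "2 * y \<le> 1 + y\<^sup>2" using sum_squares_bound[of 1 y] by simp
    then show ?thesis using zero_le_power2[of y] by linarith
  qed
  ultimately have "1 \<le> exp y * (1 - y + y\<^sup>2)" by (meson mult_right_mono order_trans)
  then have "exp (- y) \<le> 1 - y + y\<^sup>2" by (simp add: exp_minus field_simps)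
  then show ?thesis using assms(2) by linarith
qed

text \<open>
  The function \<open>ct\<close> equals \<open>1\<close> up to distance \<open>2 \<delta>\<close> from \<open>K\<close> and vanishes beyond distance \<open>3 \<delta>\<close>. Its increments vanish when \<open>x\<close> is
  within distance \<open>\<delta>\<close> of \<open>K\<close> and the jump \<open>z\<close> is at most \<open>\<delta>\<close>; \<open>far\<close> is the set of the other points \<open>x\<close>.
\<close>

lemma cutoff_exists:
  fixes K :: "'a::euclidean_space set"
  assumes K: "compact K" "K \<noteq> {}" and \<delta>: "\<delta> > 0"
    and K': "\<And>x y. x \<in> K \<Longrightarrow> norm (y - x) \<le> 3 * \<delta> \<Longrightarrow> y \<in> K'"
  obtains ct :: "'a \<Rightarrow> real" and far where "ct \<in> borel_measurable borel" "far \<in> sets borel"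
    "\<And>x. 0 \<le> ct x" "\<And>x. ct x \<le> 1" "\<And>x. x \<notin> K' \<Longrightarrow> ct x = 0" "\<And>x. x \<notin> far \<Longrightarrow> ct x = 1" "K \<inter> far = {}"
    "\<And>x z. (ct (x + z) - ct x)\<^sup>2 \<le> ((norm z)\<^sup>2 / \<delta>\<^sup>2) * (indicator far x + indicator {z. norm z > \<delta>} z)"
proof -
  define d where "d x = infdist x K" for x
  define ct where "ct x = max 0 (min 1 (3 - d x / \<delta>))" for x
  define far where "far = {x. d x > \<delta>}"
  have dc: "continuous_on UNIV d" unfolding d_def by (intro continuous_on_infdist continuous_on_id)
  have lip: "\<bar>d (x + z) - d x\<bar> \<le> norm z" for x z
    using infdist_triangle[of "x + z" K x] infdist_triangle[of x K "x + z"] by (simp add: d_def dist_norm)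
  have [measurable]: "d \<in> borel_measurable borel" by (rule borel_measurable_continuous_onI[OF dc])
  have one: "ct x = 1" if "d x \<le> 2 * \<delta>" for x using that \<delta> by (simp add: ct_def field_simps)
  show ?thesis
  proof (rule that[of ct far])
    show "ct \<in> borel_measurable borel" unfolding ct_def by measurable
    show "far \<in> sets borel" unfolding far_def by measurable
    show "0 \<le> ct x" "ct x \<le> 1" for x by (auto simp: ct_def)
    show "ct x = 0" if "x \<notin> K'" for x
    proof -
      obtain y where y: "y \<in> K" "infdist x K = dist x y"
        using infdist_attains_inf[of K x] K compact_imp_closed by auto
      have "\<not> norm (x - y) \<le> 3 * \<delta>" using K'[OF y(1)] that by blast
      then have "d x > 3 * \<delta>" by (simp add: d_def y(2) dist_norm)
      then show ?thesis using \<delta> by (simp add: ct_def field_simps)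
    qed
    show "ct x = 1" if "x \<notin> far" for x using that \<delta> by (intro one) (auto simp: far_def)
    show "K \<inter> far = {}" using \<delta> by (auto simp: far_def d_def)
    fix x z
    show "(ct (x + z) - ct x)\<^sup>2 \<le> ((norm z)\<^sup>2 / \<delta>\<^sup>2) * (indicator far x + indicator {z. norm z > \<delta>} z)"
    proof (cases "x \<in> far \<or> norm z > \<delta>")
      case True
      have "\<bar>ct (x + z) - ct x\<bar> \<le> \<bar>d (x + z) / \<delta> - d x / \<delta>\<bar>" by (auto simp: ct_def)
      also have "\<dots> = \<bar>d (x + z) - d x\<bar> / \<delta>" using \<delta> by (simp add: diff_divide_distrib[symmetric])
      also have "\<dots> \<le> norm z / \<delta>" using lip \<delta> by (intro divide_right_mono) auto
      finally have "(ct (x + z) - ct x)\<^sup>2 \<le> (norm z / \<delta>)\<^sup>2"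
        using \<delta> by (simp add: abs_le_square_iff[symmetric])
      also have "\<dots> \<le> ((norm z)\<^sup>2 / \<delta>\<^sup>2) * (indicator far x + indicator {z. norm z > \<delta>} z)"
      proof -
        have "1 \<le> indicator far x + (indicator {z. norm z > \<delta>} z :: real)" using True by (auto simp: indicator_def)
        from mult_left_mono[OF this, of "(norm z)\<^sup>2 / \<delta>\<^sup>2"] show ?thesis by (simp add: power_divide)
      qed
      finally show ?thesis .
    next
      case False
      then have "d x \<le> \<delta>" "norm z \<le> \<delta>" by (auto simp: far_def)
      then have "d x \<le> 2 * \<delta>" "d (x + z) \<le> 2 * \<delta>" using lip[of x z] \<delta> by linarith+
      then show ?thesis by (simp add: one)
    qed
  qed
qed

lemma log_conc_mult:
  fixes f g h f' g' h' :: "'a::real_vector \<Rightarrow> real"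
  assumes "log_conc r f g h" "log_conc r f' g' h'"
    and nn: "\<And>x. 0 \<le> f x" "\<And>x. 0 \<le> g x" "\<And>x. 0 \<le> h x" "\<And>x. 0 \<le> f' x" "\<And>x. 0 \<le> g' x"
  shows "log_conc r (\<lambda>x. f x * f' x) (\<lambda>x. g x * g' x) (\<lambda>x. h x * h' x)"
  unfolding log_conc_def
proof (intro allI)
  fix x y :: 'a
  let ?z = "(1 - r) *\<^sub>R x + r *\<^sub>R y"
  have "(f x * f' x) powr (1 - r) * (g y * g' y) powr r
      = (f x powr (1 - r) * g y powr r) * (f' x powr (1 - r) * g' y powr r)"
    using nn by (simp add: powr_mult)
  also have "\<dots> \<le> h ?z * h' ?z"
    using assms(1,2) nn by (intro mult_mono) (auto simp: log_conc_def)
  finally show "(f x * f' x) powr (1 - r) * (g y * g' y) powr r \<le> h ?z * h' ?z" .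
qed

context heat_vec
begin

text \<open>
  The product rule for increments,
  \<open>ct (x + z) w (x + z) - ct x w x = ct (x + z) (w (x + z) - w x) + w x (ct (x + z) - ct x)\<close>.
  The last term lives at points far from \<open>K\<close>, where \<open>w\<close> will be small, and at long jumps, which are rare.
\<close>

lemma E_cutoff_le:
  assumes w: "bL2 w" and ct[measurable]: "ct \<in> borel_measurable borel" and far[measurable]: "far \<in> sets borel"
    and ctb: "\<And>x. 0 \<le> ct x" "\<And>x. ct x \<le> 1" and \<delta>: "\<delta> > 0" and \<eta>: "\<eta> > 0" and s: "s \<ge> 0" and \<tau>: "\<tau> \<ge> 0"
    and ctl: "\<And>x z. (ct (x + z) - ct x)\<^sup>2 \<le> ((norm z)\<^sup>2 / \<delta>\<^sup>2) * (indicator far x + indicator {z. norm z > \<delta>} z)"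
    and tail: "(\<integral>\<^sup>+z. ennreal ((norm z)\<^sup>2) * indicator {z. norm z > \<delta>} z \<partial>N s) \<le> ennreal (s * \<tau>)"
  shows "E s (\<lambda>x. ct x * w x) \<le> (1 + \<eta>) * E s w
     + (1 + 1 / \<eta>) * (s / (2 * \<delta>\<^sup>2)) * (m2 * (\<integral>x. indicator far x * (w x)\<^sup>2 \<partial>lborel) + \<tau> * ip w w)"
proof -
  have [measurable]: "w \<in> borel_measurable borel" using w by (rule bL2_measurable)
  have ctw: "bL2 (\<lambda>x. ct x * w x)" by (rule bL2_mult_bounded[OF w ct, of 1]) (use ctb in auto)
  let ?Fa = "\<integral>x. indicator far x * (w x)\<^sup>2 \<partial>lborel"
  have Fai: "integrable lborel (\<lambda>x. indicator far x * (w x)\<^sup>2)"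
    by (rule integrable_mult_bounded[OF bL2_sq[OF w], of _ 1]) (auto simp: indicator_def)
  have Fan: "?Fa \<ge> 0" by (intro integral_nonneg_AE) auto
  have Fann: "(\<integral>\<^sup>+x. ennreal (indicator far x * (w x)\<^sup>2) \<partial>lborel) = ennreal ?Fa"
    using Fai by (intro nn_integral_eq_integral) auto
  let ?c = "(1 + 1 / \<eta>) / \<delta>\<^sup>2"
  have c: "?c \<ge> 0" using \<eta> by simp
  let ?i = "indicator {z. norm z > \<delta>} :: real^'n \<Rightarrow> real"
  have pt: "ennreal ((ct (x + z) * w (x + z) - ct x * w x)\<^sup>2) \<le> ennreal (1 + \<eta>) * ennreal ((w (x + z) - w x)\<^sup>2)
     + ennreal (?c * (norm z)\<^sup>2) * (ennreal (indicator far x * (w x)\<^sup>2) + ennreal (?i z) * ennreal ((w x)\<^sup>2))" for x z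
  proof -
    have "(ct (x + z) * w (x + z) - ct x * w x)\<^sup>2 = (ct (x + z) * (w (x + z) - w x) + w x * (ct (x + z) - ct x))\<^sup>2"
      by (simp add: algebra_simps)
    also have "\<dots> \<le> (1 + \<eta>) * (ct (x + z) * (w (x + z) - w x))\<^sup>2 + (1 + 1 / \<eta>) * (w x * (ct (x + z) - ct x))\<^sup>2"
      by (rule square_sum_le_weighted[OF \<eta>])
    also have "\<dots> \<le> (1 + \<eta>) * (w (x + z) - w x)\<^sup>2
        + (1 + 1 / \<eta>) * ((w x)\<^sup>2 * (((norm z)\<^sup>2 / \<delta>\<^sup>2) * (indicator far x + ?i z)))"
    proof (intro add_mono mult_left_mono)
      have "(ct (x + z))\<^sup>2 \<le> 1" using ctb[of "x + z"] by (simp add: power_le_one)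
      then show "(ct (x + z) * (w (x + z) - w x))\<^sup>2 \<le> (w (x + z) - w x)\<^sup>2"
        by (simp add: power_mult_distrib mult_left_le_one_le)
      show "(w x * (ct (x + z) - ct x))\<^sup>2 \<le> (w x)\<^sup>2 * (((norm z)\<^sup>2 / \<delta>\<^sup>2) * (indicator far x + ?i z))"
        unfolding power_mult_distrib by (rule mult_left_mono[OF ctl zero_le_power2])
    qed (use \<eta> in auto)
    also have "\<dots> = (1 + \<eta>) * (w (x + z) - w x)\<^sup>2 + (?c * (norm z)\<^sup>2) * (indicator far x * (w x)\<^sup>2 + ?i z * (w x)\<^sup>2)"
      using \<delta> by (simp add: field_simps)
    finally have le: "(ct (x + z) * w (x + z) - ct x * w x)\<^sup>2 \<le> (1 + \<eta>) * (w (x + z) - w x)\<^sup>2 + (?c * (norm z)\<^sup>2) * (indicator far x * (w x)\<^sup>2 + ?i z * (w x)\<^sup>2)" .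
    have n1: "0 \<le> (1 + \<eta>) * (w (x + z) - w x)\<^sup>2" using \<eta> by simp
    have n2: "0 \<le> ?c * (norm z)\<^sup>2" by (rule mult_nonneg_nonneg[OF c zero_le_power2])
    have n3: "0 \<le> indicator far x * (w x)\<^sup>2" "0 \<le> ?i z * (w x)\<^sup>2" "0 \<le> 1 + \<eta>" using \<eta> by auto
    show ?thesis
      using ennreal_leI[OF le]
      by (simp only: ennreal_plus[OF n1 mult_nonneg_nonneg[OF n2 add_nonneg_nonneg[OF n3(1,2)]]]
          ennreal_mult'[OF n3(3)] ennreal_mult'[OF n2] ennreal_plus[OF n3(1,2)] ennreal_mult'[OF indicator_pos_le])
  qed
  have inner: "(\<integral>\<^sup>+x. ennreal (1 + \<eta>) * ennreal ((w (x + z) - w x)\<^sup>2)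
     + ennreal (?c * (norm z)\<^sup>2) * (ennreal (indicator far x * (w x)\<^sup>2) + ennreal (?i z) * ennreal ((w x)\<^sup>2)) \<partial>lborel)
    = ennreal (1 + \<eta>) * (\<integral>\<^sup>+x. ennreal ((w (x + z) - w x)\<^sup>2) \<partial>lborel)
      + ennreal (?c * (norm z)\<^sup>2) * (ennreal ?Fa + ennreal (?i z) * ennreal (ip w w))" for z
    by (simp add: nn_integral_add nn_integral_cmult Fann nn_integral_ip[OF w])
  have zsplit: "ennreal (?c * (norm z)\<^sup>2) * (ennreal ?Fa + ennreal (?i z) * ennreal (ip w w))
     = ennreal (?c * ?Fa) * ennreal ((norm z)\<^sup>2) + ennreal (?c * ip w w) * (ennreal ((norm z)\<^sup>2) * indicator {z. norm z > \<delta>} z)" for z :: "real^'n"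
  proof -
    have gen: "ennreal (c * n) * (ennreal A + ennreal i * ennreal B) = ennreal (c * A) * ennreal n + ennreal (c * B) * (ennreal n * I)"
      if "c \<ge> 0" "(i = 0 \<and> I = 0) \<or> (i = 1 \<and> I = 1)" for c n A i B :: real and I :: ennreal
    proof -
      have e: "ennreal (c * n) = ennreal c * ennreal n" "ennreal (c * A) = ennreal c * ennreal A"
        "ennreal (c * B) = ennreal c * ennreal B" using that(1) by (simp_all add: ennreal_mult')
      show ?thesis unfolding e using that(2) by (auto simp: distrib_left mult_ac)
    qed
    show ?thesis by (rule gen[OF c]) (auto simp: indicator_def)
  qed
  have "ennreal (2 * E s (\<lambda>x. ct x * w x))
      = (\<integral>\<^sup>+z. \<integral>\<^sup>+x. ennreal ((ct (x + z) * w (x + z) - ct x * w x)\<^sup>2) \<partial>lborel \<partial>N s)"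
    by (rule nn_integral_E[OF ctw, symmetric])
  also have "\<dots> \<le> (\<integral>\<^sup>+z. ennreal (1 + \<eta>) * (\<integral>\<^sup>+x. ennreal ((w (x + z) - w x)\<^sup>2) \<partial>lborel)
      + (ennreal (?c * ?Fa) * ennreal ((norm z)\<^sup>2) + ennreal (?c * ip w w) * (ennreal ((norm z)\<^sup>2) * indicator {z. norm z > \<delta>} z)) \<partial>N s)"
    unfolding zsplit[symmetric] inner[symmetric] by (intro nn_integral_mono pt)
  also have "\<dots> = ennreal (1 + \<eta>) * (\<integral>\<^sup>+z. \<integral>\<^sup>+x. ennreal ((w (x + z) - w x)\<^sup>2) \<partial>lborel \<partial>N s)
      + (ennreal (?c * ?Fa) * (\<integral>\<^sup>+z. ennreal ((norm z)\<^sup>2) \<partial>N s)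
      + ennreal (?c * ip w w) * (\<integral>\<^sup>+z. ennreal ((norm z)\<^sup>2) * indicator {z. norm z > \<delta>} z \<partial>N s))"
    by (simp add: nn_integral_add nn_integral_cmult)
  also have "\<dots> \<le> ennreal (1 + \<eta>) * ennreal (2 * E s w)
      + (ennreal (?c * ?Fa) * ennreal (s * m2) + ennreal (?c * ip w w) * ennreal (s * \<tau>))"
    unfolding nn_integral_E[OF w] nn_integral_N_norm_sq[OF s]
    by (intro add_mono mult_left_mono tail order_refl) auto
  also have "\<dots> = ennreal ((1 + \<eta>) * (2 * E s w) + (?c * ?Fa * (s * m2) + ?c * ip w w * (s * \<tau>)))"
    using \<eta> c Fan ip_nonneg[of w] s \<tau> m2_nonneg E_nonneg[OF w]
    by (simp add: ennreal_mult[symmetric] ennreal_plus[symmetric] del: ennreal_plus)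
  finally have "2 * E s (\<lambda>x. ct x * w x) \<le> (1 + \<eta>) * (2 * E s w) + (?c * ?Fa * (s * m2) + ?c * ip w w * (s * \<tau>))"
    using \<eta> c Fan ip_nonneg[of w] s \<tau> m2_nonneg E_nonneg[OF w]
    by (subst (asm) ennreal_le_iff) auto
  moreover have "?c * ?Fa * (s * m2) + ?c * ip w w * (s * \<tau>) = 2 * ((1 + 1 / \<eta>) * (s / (2 * \<delta>\<^sup>2)) * (m2 * ?Fa + \<tau> * ip w w))"
    using \<delta> by (simp add: field_simps)
  ultimately show ?thesis by linarith
qed

text \<open>
  Half a step of multiplication by \<open>exp (- t V)\<close>, with infinite potential outside \<open>K\<close>.
\<close>

definition weight :: "(real^'n) set \<Rightarrow> (real^'n \<Rightarrow> real) \<Rightarrow> real \<Rightarrow> real^'n \<Rightarrow> real" where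
  "weight K V t x = indicator K x * exp (- (t * V x / 2))"

lemma weight_props:
  assumes [measurable]: "V \<in> borel_measurable borel" "K \<in> sets borel" and V: "\<And>x. x \<in> K \<Longrightarrow> 0 \<le> V x" and t: "t \<ge> 0"
  shows weight_borel[measurable]: "weight K V t \<in> borel_measurable borel"
    and weight_nonneg: "0 \<le> weight K V t x" and weight_le_1: "weight K V t x \<le> 1"
    and weight_outside: "x \<notin> K \<Longrightarrow> weight K V t x = 0"
proof -
  show "weight K V t \<in> borel_measurable borel" unfolding weight_def[abs_def] by measurable
  show "0 \<le> weight K V t x" "x \<notin> K \<Longrightarrow> weight K V t x = 0" by (auto simp: weight_def)
  show "weight K V t x \<le> 1" using V t by (auto simp: weight_def indicator_def)
qed

text \<open>
  Let \<open>g\<close> be the weighted function and \<open>w = P (t / 2) g\<close>, so that \<open>ip w w = ip g g - E t g\<close>. By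
  \<open>E_smoothing\<close>, the energy of \<open>w\<close> per unit of time is at all smaller scales at most \<open>E t g / t\<close>, and the assumed
  Rayleigh bound would give the claim to first order in \<open>t\<close> if \<open>w\<close> had compact support. A cut-off provides
  the support. It is affordable because either \<open>E t g\<close> is so large that the claim holds trivially, or
  \<open>g - w\<close> is small in \<open>L\<^sup>2\<close>, and then so is \<open>w\<close> away from \<open>K\<close>.
\<close>

lemma step_upper:
  fixes V :: "real^'n \<Rightarrow> real"
  assumes V[measurable]: "V \<in> borel_measurable borel" and Vc: "continuous_on \<Omega> V" and \<Omega>: "open \<Omega>"
    and Vnn: "\<And>x. x \<in> \<Omega> \<Longrightarrow> 0 \<le> V x" and K: "compact K" "K \<subseteq> \<Omega>" "K \<noteq> {}" and lam: "lam \<ge> 0"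
    and ray: "\<And>w c K J. bL2 w \<Longrightarrow> compact K \<Longrightarrow> K \<subseteq> \<Omega> \<Longrightarrow> (\<And>x. x \<notin> K \<Longrightarrow> w x = 0) \<Longrightarrow>
       (\<And>j. j \<ge> J \<Longrightarrow> E (1 / 2 ^ j) w \<le> c / 2 ^ j) \<Longrightarrow> lam * ip w w \<le> c + (\<integral>x. V x * (w x)\<^sup>2 \<partial>lborel)"
    and \<epsilon>: "\<epsilon> > 0"
  shows "\<exists>k0::nat. \<forall>k\<ge>k0. \<forall>f. bL2 f \<longrightarrow>
     ip (P (1 / 2 ^ k / 2) (\<lambda>x. weight K V (1 / 2 ^ k) x * f x)) (P (1 / 2 ^ k / 2) (\<lambda>x. weight K V (1 / 2 ^ k) x * f x))
       \<le> exp (- ((1 / 2 ^ k) * (lam - \<epsilon>))) * ip f f"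
proof -
  obtain d K' where d: "d > 0" "compact K'" "K \<subseteq> K'" "K' \<subseteq> \<Omega>" "\<And>x y. x \<in> K \<Longrightarrow> norm (y - x) \<le> d \<Longrightarrow> y \<in> K'"
    using compact_neighbourhood[OF K(1) \<Omega> K(2)] by blast
  have Kb[measurable]: "K \<in> sets borel" "K' \<in> sets borel" using K(1) d(2) by (auto intro: borel_compact)
  have VK': "compact (V ` K')" using continuous_on_subset[OF Vc d(4)] d(2) by (rule compact_continuous_image)
  obtain M0 where M0: "\<And>x. x \<in> K' \<Longrightarrow> \<bar>V x\<bar> \<le> M0"
    using compact_imp_bounded[OF VK'] unfolding bounded_iff by auto
  define M where "M = \<bar>M0\<bar>"
  have M: "M \<ge> 0" "\<And>x. x \<in> K' \<Longrightarrow> V x \<le> M" using M0 unfolding M_def by (auto, fastforce)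
  have V0: "\<And>x. x \<in> K' \<Longrightarrow> 0 \<le> V x" using Vnn d(4) by blast
  have V0K: "\<And>x. x \<in> K \<Longrightarrow> 0 \<le> V x" using V0 d(3) by blast
  define \<delta> where "\<delta> = d / 3"
  have \<delta>: "\<delta> > 0" using d by (simp add: \<delta>_def)
  obtain ct :: "real^'n \<Rightarrow> real" and far where ct: "ct \<in> borel_measurable borel" "far \<in> sets borel"
    "\<And>x. 0 \<le> ct x" "\<And>x. ct x \<le> 1" "\<And>x. x \<notin> K' \<Longrightarrow> ct x = 0" "\<And>x. x \<notin> far \<Longrightarrow> ct x = 1" "K \<inter> far = {}"
    "\<And>x z. (ct (x + z) - ct x)\<^sup>2 \<le> ((norm z)\<^sup>2 / \<delta>\<^sup>2) * (indicator far x + indicator {z. norm z > \<delta>} z)"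
    by (rule cutoff_exists[OF K(1,3) \<delta>, of K']) (use d(5) in \<open>simp add: \<delta>_def\<close>, blast)
  note [measurable] = ct(1,2)
  (* The factor 1 + eta of the cut-off and the long jumps, controlled by tau, cost epsilon / 4 each;
     the other error terms vanish with t. *)
  define \<eta> where "\<eta> = \<epsilon> / (4 * (lam + 1))"
  have \<eta>: "\<eta> > 0" using \<epsilon> lam by (simp add: \<eta>_def)
  have lam\<eta>: "lam * \<eta> \<le> \<epsilon> / 4" using \<epsilon> lam by (simp add: \<eta>_def field_simps)
  define a where "a = (1 + 1 / \<eta>) / (2 * \<delta>\<^sup>2)"
  have a: "a > 0" using \<eta> \<delta> unfolding a_def by (intro divide_pos_pos add_pos_pos) auto
  define \<tau> where "\<tau> = \<epsilon> / (4 * a)"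
  have \<tau>: "\<tau> > 0" "a * \<tau> = \<epsilon> / 4" using \<epsilon> a by (auto simp: \<tau>_def)
  obtain T where T: "T > 0" "\<And>t. 0 < t \<Longrightarrow> t \<le> T \<Longrightarrow>
     (\<integral>\<^sup>+z. ennreal ((norm z)\<^sup>2) * indicator {z. norm z > \<delta>} z \<partial>N t) \<le> ennreal (t * \<tau>)"
    using N_tail[OF \<delta> \<tau>(1)] by blast
  define \<kappa> where "\<kappa> t = a * (m2 * (2 * t * lam) + \<tau>) + 2 * t * lam\<^sup>2 + 2 * M * sqrt (2 * t * lam)" for t
  have hlim: "(\<lambda>k::nat. 1 / 2 ^ k :: real) \<longlonglongrightarrow> 0"
    using LIMSEQ_power_zero[of "1/2 :: real"] by (simp add: power_divide)
  have "(\<lambda>k. \<kappa> (1 / 2 ^ k) + (1 / 2 ^ k) * lam\<^sup>2) \<longlonglongrightarrow> (a * (m2 * (2 * 0 * lam) + \<tau>) + 2 * 0 * lam\<^sup>2 + 2 * M * sqrt (2 * 0 * lam)) + 0 * lam\<^sup>2"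
    unfolding \<kappa>_def by (intro tendsto_intros hlim)
  then have "(\<lambda>k. \<kappa> (1 / 2 ^ k) + (1 / 2 ^ k) * lam\<^sup>2) \<longlonglongrightarrow> \<epsilon> / 4" using \<tau>(2) by simp
  then have ev1: "\<forall>\<^sub>F k in sequentially. \<kappa> (1 / 2 ^ k) + (1 / 2 ^ k) * lam\<^sup>2 < \<epsilon> / 2"
    using \<epsilon> by (intro order_tendstoD(2)[of _ "\<epsilon> / 4"]) auto
  have ev2: "\<forall>\<^sub>F k in sequentially. (1 / 2 ^ k :: real) < T" using hlim T(1) by (rule order_tendstoD)
  have "(\<lambda>k. (1 / 2 ^ k :: real) * lam) \<longlonglongrightarrow> 0 * lam" by (intro tendsto_intros hlim)
  then have ev3: "\<forall>\<^sub>F k in sequentially. (1 / 2 ^ k :: real) * lam < 1" by (intro order_tendstoD(2)[of _ 0]) auto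
  from ev1 ev2 ev3 have "\<forall>\<^sub>F k in sequentially. \<kappa> (1 / 2 ^ k) + (1 / 2 ^ k) * lam\<^sup>2 < \<epsilon> / 2 \<and> (1 / 2 ^ k :: real) < T \<and> (1 / 2 ^ k :: real) * lam < 1"
    by eventually_elim auto
  then obtain k0 where k0: "\<And>k. k \<ge> k0 \<Longrightarrow> \<kappa> (1 / 2 ^ k) + (1 / 2 ^ k) * lam\<^sup>2 < \<epsilon> / 2"
    "\<And>k. k \<ge> k0 \<Longrightarrow> (1 / 2 ^ k :: real) < T" "\<And>k. k \<ge> k0 \<Longrightarrow> (1 / 2 ^ k :: real) * lam < 1"
    unfolding eventually_sequentially by blast
  show ?thesis
  proof (intro exI[of _ k0] allI impI)
    fix k and f :: "real^'n \<Rightarrow> real" assume k: "k \<ge> k0" and f: "bL2 f"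
    define t :: real where "t = 1 / 2 ^ k"
    have t: "t > 0" "t < T" "t * lam < 1" "\<kappa> t + t * lam\<^sup>2 < \<epsilon> / 2" using k0 k by (auto simp: t_def)
    have \<kappa>0: "\<kappa> t \<ge> 0" unfolding \<kappa>_def using a \<tau> t lam M m2_nonneg by (intro add_nonneg_nonneg mult_nonneg_nonneg) auto
    have wp: "weight K V t \<in> borel_measurable borel" "\<And>x. 0 \<le> weight K V t x" "\<And>x. weight K V t x \<le> 1"
        "\<And>x. x \<notin> K \<Longrightarrow> weight K V t x = 0"
      using weight_props[OF V Kb(1), of t] V0K t(1) by auto
    note [measurable] = wp(1)
    define g where "g x = weight K V t x * f x" for x
    have g: "bL2 g" unfolding g_def[abs_def] by (rule bL2_mult_bounded[OF f wp(1), of 1]) (use wp in auto)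
    have gK: "g x = 0" if "x \<notin> K" for x using wp(4)[OF that] by (simp add: g_def)
    define w where "w = P (t / 2) g"
    have w: "bL2 w" unfolding w_def by (rule bL2_P[OF g])
    have fm[measurable]: "f \<in> borel_measurable borel" "g \<in> borel_measurable borel" "w \<in> borel_measurable borel"
      using f g w by (auto intro: bL2_measurable)
    define F where "F = ip f f" define G where "G = ip g g" define W where "W = ip w w"
    have nn: "F \<ge> 0" "G \<ge> 0" "W \<ge> 0" by (auto simp: F_def G_def W_def ip_nonneg)
    have EtG: "E t g = G - W" unfolding E_def W_def w_def G_def using ip_P_half[OF g, of t] t by simp
    have Vgi: "integrable lborel (\<lambda>x. V x * (g x)\<^sup>2)"
    proof -
      have "integrable lborel (\<lambda>x. (V x * indicator K x) * (g x)\<^sup>2)"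
        by (rule integrable_mult_bounded[OF bL2_sq[OF g], of _ M]) (use M V0 d(3) in \<open>auto simp: indicator_def\<close>)
      also have "(\<lambda>x. (V x * indicator K x) * (g x)\<^sup>2) = (\<lambda>x. V x * (g x)\<^sup>2)"
        using gK by (auto simp: fun_eq_iff indicator_def)
      finally show ?thesis .
    qed
    define I where "I = (\<integral>x. V x * (g x)\<^sup>2 \<partial>lborel)"
    have I0: "I \<ge> 0" unfolding I_def
    proof (intro integral_nonneg_AE AE_I2)
      show "0 \<le> V x * (g x)\<^sup>2" for x using gK[of x] V0K[of x] by (cases "x \<in> K") auto
    qed
    have GF: "G + t * I \<le> F"
    proof -
      have "G + t * I = (\<integral>x. (g x)\<^sup>2 + t * (V x * (g x)\<^sup>2) \<partial>lborel)"
        unfolding G_def I_def ip_self using bL2_sq[OF g] Vgi by simp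
      also have "\<dots> \<le> (\<integral>x. (f x)\<^sup>2 \<partial>lborel)"
      proof (rule integral_mono)
        fix x
        show "(g x)\<^sup>2 + t * (V x * (g x)\<^sup>2) \<le> (f x)\<^sup>2"
        proof (cases "x \<in> K")
          case True
          have "(g x)\<^sup>2 = exp (- (t * V x)) * (f x)\<^sup>2"
            using True by (simp add: g_def weight_def power_mult_distrib power2_eq_square[of "exp _"] exp_add[symmetric])
          then have "(g x)\<^sup>2 + t * (V x * (g x)\<^sup>2) = (exp (- (t * V x)) * (1 + t * V x)) * (f x)\<^sup>2"
            by (simp add: algebra_simps)
          also have "\<dots> \<le> 1 * (f x)\<^sup>2"
          proof (intro mult_right_mono)
            have "exp (- (t * V x)) * (1 + t * V x) \<le> exp (- (t * V x)) * exp (t * V x)"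
              by (intro mult_left_mono exp_ge_add_one_self) auto
            then show "exp (- (t * V x)) * (1 + t * V x) \<le> 1" by (simp add: exp_minus)
          qed simp
          finally show ?thesis by simp
        qed (simp add: gK)
      qed (use bL2_sq[OF g] bL2_sq[OF f] Vgi in auto)
      finally show ?thesis by (simp add: F_def ip_self)
    qed
    have "W \<le> exp (- (t * (lam - \<epsilon>))) * F"
    (* If the energy is large, then W = G - E t g is already small enough. *)
    proof (cases "E t g \<ge> t * lam * F")
      case True
      have "0 \<le> t * I" using I0 t(1) by simp
      then have "W \<le> F - t * lam * F" using True EtG GF by linarith
      then have "W \<le> (1 + - (t * lam)) * F" by (simp add: algebra_simps)
      also have "\<dots> \<le> exp (- (t * lam)) * F" using nn by (intro mult_right_mono exp_ge_add_one_self)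
      also have "\<dots> \<le> exp (- (t * (lam - \<epsilon>))) * F" using nn t \<epsilon> by (intro mult_right_mono) (auto simp: algebra_simps)
      finally show ?thesis .
    next
      case False
      then have Es: "E t g \<le> t * lam * F" by simp
      define D where "D x = g x - w x" for x
      have D: "bL2 D" unfolding D_def[abs_def] by (rule bL2_diff[OF g w])
      have [measurable]: "D \<in> borel_measurable borel" using D by (rule bL2_measurable)
      have DD: "ip D D \<le> 2 * t * lam * F"
      proof -
        have "ip D D \<le> 2 * E (t / 2) g" unfolding D_def[abs_def] w_def using t by (intro ip_diff_P_le[OF g]) auto
        also have "\<dots> \<le> 2 * E t g" using E_half_le[OF g, of t] t by simp
        finally show ?thesis using Es by simp
      qed
      let ?Fa = "\<integral>x. indicator far x * (w x)\<^sup>2 \<partial>lborel"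
      have Fai: "integrable lborel (\<lambda>x. indicator far x * (w x)\<^sup>2)"
        by (rule integrable_mult_bounded[OF bL2_sq[OF w], of _ 1]) (auto simp: indicator_def)
      have Fa: "?Fa \<le> 2 * t * lam * F"
      proof -
        have "?Fa \<le> (\<integral>x. (D x)\<^sup>2 \<partial>lborel)"
        proof (rule integral_mono[OF Fai bL2_sq[OF D]])
          fix x show "indicator far x * (w x)\<^sup>2 \<le> (D x)\<^sup>2"
          proof (cases "x \<in> far")
            case True
            then have "x \<notin> K" using ct(7) by blast
            then show ?thesis using True gK by (simp add: D_def)
          qed simp
        qed
        then show ?thesis using DD by (simp add: ip_self)
      qed
      have WF: "W \<le> F" and GF': "G \<le> F"
      proof -
        have "0 \<le> t * I" using I0 t(1) by simp
        then show "W \<le> F" "G \<le> F" using EtG E_nonneg[OF g, of t] GF by linarith+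
      qed
      define u where "u x = ct x * w x" for x
      have u: "bL2 u" unfolding u_def[abs_def] by (rule bL2_mult_bounded[OF w ct(1), of 1]) (use ct(3,4) in auto)
      have [measurable]: "u \<in> borel_measurable borel" using u by (rule bL2_measurable)
      have uK: "u x = 0" if "x \<notin> K'" for x using ct(5)[OF that] by (simp add: u_def)
      define c where "c = (1 + \<eta>) * (E t g / t) + a * (m2 * (2 * t * lam * F) + \<tau> * F)"
      have Eu: "E (1 / 2 ^ j) u \<le> c / 2 ^ j" if j: "j \<ge> k" for j
      proof -
        define s :: real where "s = 1 / 2 ^ j"
        have st: "s = t / 2 ^ (j - k)" using j by (simp add: s_def t_def power_diff)
        have s1: "s \<le> t" unfolding s_def t_def using j by (intro divide_left_mono power_increasing) auto
        have s: "s > 0" "s \<le> t" "s \<le> T" using s1 t(2) by (auto simp: s_def)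
        have Ew: "E s w \<le> s * (E t g / t)"
          using E_smoothing[OF g less_imp_le[OF t(1)], of "j - k"] t(1) unfolding st w_def by (simp add: field_simps)
        have "E s u \<le> (1 + \<eta>) * E s w + (1 + 1 / \<eta>) * (s / (2 * \<delta>\<^sup>2)) * (m2 * ?Fa + \<tau> * ip w w)"
          unfolding u_def[abs_def]
          by (rule E_cutoff_le[OF w ct(1,2,3,4) \<delta> \<eta> _ _ ct(8) T(2)[OF s(1,3)]]) (use s \<tau> in auto)
        also have "(1 + 1 / \<eta>) * (s / (2 * \<delta>\<^sup>2)) = s * a" by (simp add: a_def)
        also have "(1 + \<eta>) * E s w + s * a * (m2 * ?Fa + \<tau> * ip w w)
           \<le> (1 + \<eta>) * (s * (E t g / t)) + s * a * (m2 * (2 * t * lam * F) + \<tau> * F)"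
          using Ew \<eta> s a \<tau> m2_nonneg Fa WF
          by (intro add_mono mult_left_mono) (auto simp: W_def)
        also have "\<dots> = s * c" by (simp add: c_def algebra_simps)
        finally show ?thesis by (simp add: s_def)
      qed
      have R: "lam * ip u u \<le> c + (\<integral>x. V x * (u x)\<^sup>2 \<partial>lborel)"
        by (rule ray[OF u d(2,4) uK Eu])
      have uu: "W - 2 * t * lam * F \<le> ip u u"
      proof -
        have "W - ?Fa = (\<integral>x. (w x)\<^sup>2 - indicator far x * (w x)\<^sup>2 \<partial>lborel)"
          using bL2_sq[OF w] Fai by (simp add: W_def ip_self)
        also have "\<dots> \<le> (\<integral>x. (u x)\<^sup>2 \<partial>lborel)"
        proof (rule integral_mono)
          fix x show "(w x)\<^sup>2 - indicator far x * (w x)\<^sup>2 \<le> (u x)\<^sup>2"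
            using ct(6)[of x] by (cases "x \<in> far") (auto simp: u_def)
        qed (use bL2_sq[OF w] bL2_sq[OF u] Fai in auto)
        finally show ?thesis using Fa by (simp add: ip_self)
      qed
      have Vu: "(\<integral>x. V x * (u x)\<^sup>2 \<partial>lborel) \<le> I + M * (2 * sqrt (2 * t * lam) * F)"
      proof -
        let ?a = "\<lambda>x. \<bar>D x\<bar>" and ?b = "\<lambda>x. \<bar>w x + g x\<bar>"
        have ab: "bL2 ?a" "bL2 ?b"
          using D bL2_add[OF w g] by (auto intro!: bL2_bound[of D ?a 1] bL2_bound[of "\<lambda>x. w x + g x" ?b 1])
        have Vui: "integrable lborel (\<lambda>x. V x * (u x)\<^sup>2)"
        proof -
          have "integrable lborel (\<lambda>x. (V x * indicator K' x) * (u x)\<^sup>2)"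
            by (rule integrable_mult_bounded[OF bL2_sq[OF u], of _ M]) (use M V0 in \<open>auto simp: indicator_def\<close>)
          also have "(\<lambda>x. (V x * indicator K' x) * (u x)\<^sup>2) = (\<lambda>x. V x * (u x)\<^sup>2)"
            using uK by (auto simp: fun_eq_iff indicator_def)
          finally show ?thesis .
        qed
        have "(\<integral>x. V x * (u x)\<^sup>2 \<partial>lborel) \<le> (\<integral>x. V x * (g x)\<^sup>2 + M * (?a x * ?b x) \<partial>lborel)"
        proof (rule integral_mono[OF Vui])
          show "integrable lborel (\<lambda>x. V x * (g x)\<^sup>2 + M * (?a x * ?b x))"
            using Vgi bL2_integrable_mult[OF ab] by auto
          fix x
          show "V x * (u x)\<^sup>2 \<le> V x * (g x)\<^sup>2 + M * (?a x * ?b x)"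
          proof (cases "x \<in> K'")
            case True
            have "(u x)\<^sup>2 \<le> (w x)\<^sup>2" using ct(3,4)[of x] by (simp add: u_def power_mult_distrib mult_left_le_one_le power_le_one)
            then have "V x * (u x)\<^sup>2 \<le> V x * (w x)\<^sup>2" using V0[OF True] by (intro mult_left_mono)
            also have "\<dots> = V x * (g x)\<^sup>2 + V x * (- D x * (w x + g x))" by (simp add: D_def power2_eq_square algebra_simps)
            also have "V x * (- D x * (w x + g x)) \<le> V x * (?a x * ?b x)"
              using V0[OF True] by (intro mult_left_mono) (auto simp: abs_mult[symmetric] intro: order_trans[OF _ abs_ge_minus_self])
            also have "\<dots> \<le> M * (?a x * ?b x)" using M(2)[OF True] by (intro mult_right_mono) auto
            finally show ?thesis by simp
          next
            case False
            then have "x \<notin> K" using d(3) by blast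
            then show ?thesis using uK[OF False] gK M by simp
          qed
        qed
        also have "\<dots> = I + M * ip ?a ?b"
          using Vgi bL2_integrable_mult[OF ab] by (simp add: I_def ip_def)
        also have "\<dots> \<le> I + M * (2 * sqrt (2 * t * lam) * F)"
        proof -
          have "ip ?a ?b \<le> sqrt (ip ?a ?a) * sqrt (ip ?b ?b)" using ip_abs_le[OF ab] by linarith
          also have "\<dots> \<le> sqrt (2 * t * lam * F) * sqrt (4 * F)"
          proof (intro mult_mono real_sqrt_le_mono)
            show "ip ?a ?a \<le> 2 * t * lam * F" using DD by (simp add: ip_self)
            have "ip ?b ?b = ip (\<lambda>x. w x + g x) (\<lambda>x. w x + g x)" by (simp add: ip_self)
            also have "\<dots> = W + 2 * ip w g + G"
              using w g by (simp add: ip_add_left ip_add_right bL2_add ip_commute[of g w] W_def G_def)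
            also have "\<dots> \<le> 2 * W + 2 * G" using ip_amgm[OF w g, of 1] by (simp add: W_def G_def)
            finally show "ip ?b ?b \<le> 4 * F" using WF GF' by simp
          qed (use nn t lam in \<open>auto simp: ip_nonneg\<close>)
          also have "\<dots> = 2 * sqrt (2 * t * lam) * F"
            using nn by (simp add: real_sqrt_mult)
          finally show ?thesis using M(1) by (simp add: mult_left_mono)
        qed
        finally show ?thesis .
      qed
      have "lam * (W - 2 * t * lam * F) \<le> lam * ip u u" using uu lam by (rule mult_left_mono)
      with R Vu have 1: "lam * (W - 2 * t * lam * F) \<le> c + (I + M * (2 * sqrt (2 * t * lam) * F))" by linarith
      have "1 * I \<le> (1 + \<eta>) * I" using I0 \<eta> by (intro mult_right_mono) auto
      then have "(1 + \<eta>) * (E t g / t) + I \<le> (1 + \<eta>) * (E t g / t + I)" by (simp only: distrib_left[of "1 + \<eta>"])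
      also have "\<dots> \<le> (1 + \<eta>) * ((F - W) / t)"
      proof (intro mult_left_mono)
        have "E t g + t * I \<le> F - W" using EtG GF by simp
        then have "(E t g + t * I) / t \<le> (F - W) / t" using t(1) by (simp add: divide_right_mono)
        then show "E t g / t + I \<le> (F - W) / t" using t(1) by (simp add: add_divide_distrib)
      qed (use \<eta> in auto)
      finally have 2: "(1 + \<eta>) * (E t g / t) + I \<le> (1 + \<eta>) * ((F - W) / t)" .
      have "lam * W \<le> (1 + \<eta>) * ((F - W) / t) + \<kappa> t * F"
      proof -
        have "\<kappa> t * F = a * (m2 * (2 * t * lam * F) + \<tau> * F) + lam * (2 * t * lam * F) + M * (2 * sqrt (2 * t * lam) * F)"
          by (simp add: \<kappa>_def algebra_simps power2_eq_square)
        then show ?thesis using 1 2 by (simp add: c_def right_diff_distrib)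
      qed
      then show ?thesis
        using nn t \<eta> lam \<kappa>0 lam\<eta> \<epsilon> by (intro exp_upper_from_rayleigh[of W F t \<eta> lam "\<kappa> t"]) auto
    qed
    then show "ip (P (1 / 2 ^ k / 2) (\<lambda>x. weight K V (1 / 2 ^ k) x * f x)) (P (1 / 2 ^ k / 2) (\<lambda>x. weight K V (1 / 2 ^ k) x * f x))
       \<le> exp (- ((1 / 2 ^ k) * (lam - \<epsilon>))) * ip f f"
      unfolding W_def w_def F_def g_def[abs_def] t_def .
  qed
qed

end

section \<open>Lower bound for one time step\<close>

context heat_vec
begin

text \<open>
  To first order in \<open>t\<close> the weighted function is \<open>v - t V v / 2\<close>, so the quadratic form is at least
  \<open>ip v v - E t v - t \<integral> V v\<^sup>2\<close> up to an error caused by \<open>v - P t v\<close>, which is of order \<open>t\<^sup>3\<^sup>/\<^sup>2\<close>.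
\<close>

lemma step_lower:
  fixes V v :: "real^'n \<Rightarrow> real"
  assumes V[measurable]: "V \<in> borel_measurable borel" and K: "compact K"
    and VK: "\<And>x. x \<in> K \<Longrightarrow> 0 \<le> V x" "\<And>x. x \<in> K \<Longrightarrow> V x \<le> M"
    and v: "bL2 v" "\<And>x. 0 \<le> v x" "\<And>x. x \<notin> K \<Longrightarrow> v x = 0" and pos: "ip v v > 0"
    and E: "\<And>j. j \<ge> J \<Longrightarrow> E (1 / 2 ^ j) v \<le> c / 2 ^ j"
    and ray: "c + (\<integral>x. V x * (v x)\<^sup>2 \<partial>lborel) \<le> \<mu> * ip v v" and \<epsilon>: "\<epsilon> > 0"
  shows "\<exists>k0::nat. \<forall>k\<ge>k0. exp (- ((1 / 2 ^ k) * (\<mu> + \<epsilon>))) * ip v v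
     \<le> ip (\<lambda>x. weight K V (1 / 2 ^ k) x * v x) (P (1 / 2 ^ k) (\<lambda>x. weight K V (1 / 2 ^ k) x * v x))"
proof -
  have Kb[measurable]: "K \<in> sets borel" using K by (rule borel_compact)
  have [measurable]: "v \<in> borel_measurable borel" using v(1) by (rule bL2_measurable)
  define X where "X = ip v v"
  define Vv where "Vv x = (indicator K x * V x) * v x" for x
  have Vv: "bL2 Vv" unfolding Vv_def[abs_def]
    by (rule bL2_mult_bounded[OF v(1), of _ "\<bar>M\<bar>"]) (use VK in \<open>auto simp: indicator_def intro: order_trans[OF _ abs_ge_self]\<close>)
  have Vveq: "Vv x = V x * v x" for x using v(3)[of x] by (cases "x \<in> K") (auto simp: Vv_def)
  define I where "I = (\<integral>x. V x * (v x)\<^sup>2 \<partial>lborel)"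
  have I: "ip Vv v = I" unfolding I_def ip_def Vveq by (simp add: power2_eq_square mult.assoc)
  have I0: "I \<ge> 0" unfolding I_def
  proof (intro integral_nonneg_AE AE_I2)
    show "0 \<le> V x * (v x)\<^sup>2" for x using VK(1)[of x] v(3)[of x] by (cases "x \<in> K") auto
  qed
  have c0: "c \<ge> 0"
  proof -
    have "0 \<le> c / 2 ^ J" using E[of J] E_nonneg[OF v(1), of "1 / 2 ^ J"] by linarith
    then have "0 \<le> (c / 2 ^ J) * 2 ^ J" by (intro mult_nonneg_nonneg) auto
    then show ?thesis by simp
  qed
  have \<mu>0: "\<mu> \<ge> 0"
  proof -
    have "0 \<le> \<mu> * X" using ray c0 I0 by (simp add: X_def I_def)
    then show ?thesis using pos by (simp add: X_def zero_le_mult_iff)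
  qed
  define B where "B = sqrt (ip Vv Vv) / X"
  have B0: "B \<ge> 0" using pos by (simp add: B_def X_def ip_nonneg)
  have hlim: "(\<lambda>k::nat. 1 / 2 ^ k :: real) \<longlonglongrightarrow> 0"
    using LIMSEQ_power_zero[of "1/2 :: real"] by (simp add: power_divide)
  have "(\<lambda>k. B * sqrt (2 * ((1 / 2 ^ k) * c)) + (1 / 2 ^ k) * (\<mu> + \<epsilon>)\<^sup>2) \<longlonglongrightarrow> B * sqrt (2 * (0 * c)) + 0 * (\<mu> + \<epsilon>)\<^sup>2"
    by (intro tendsto_intros hlim)
  then have "(\<lambda>k. B * sqrt (2 * ((1 / 2 ^ k) * c)) + (1 / 2 ^ k) * (\<mu> + \<epsilon>)\<^sup>2) \<longlonglongrightarrow> 0" by simp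
  then have "\<forall>\<^sub>F k in sequentially. B * sqrt (2 * ((1 / 2 ^ k) * c)) + (1 / 2 ^ k) * (\<mu> + \<epsilon>)\<^sup>2 < \<epsilon>"
    using \<epsilon> by (rule order_tendstoD)
  then obtain k1 where k1: "\<And>k. k \<ge> k1 \<Longrightarrow> B * sqrt (2 * ((1 / 2 ^ k) * c)) + (1 / 2 ^ k) * (\<mu> + \<epsilon>)\<^sup>2 < \<epsilon>"
    unfolding eventually_sequentially by blast
  show ?thesis
  proof (intro exI[of _ "max k1 J"] allI impI)
    fix k assume k: "k \<ge> max k1 J"
    define t :: real where "t = 1 / 2 ^ k"
    have t: "t > 0" by (simp add: t_def)
    have Et: "E t v \<le> t * c" using E[of k] k by (simp add: t_def)
    have small: "B * sqrt (2 * (t * c)) + t * (\<mu> + \<epsilon>)\<^sup>2 < \<epsilon>" using k1[of k] k by (simp add: t_def)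
    have wp: "weight K V t \<in> borel_measurable borel" "\<And>x. 0 \<le> weight K V t x" "\<And>x. weight K V t x \<le> 1"
      using weight_props[OF V Kb, of t] VK(1) t by auto
    note [measurable] = wp(1)
    let ?g = "\<lambda>x. weight K V t x * v x"
    have g: "bL2 ?g" by (rule bL2_mult_bounded[OF v(1) wp(1), of 1]) (use wp in auto)
    note i1 = integrable_LN_shift[OF v(1) v(1), of t] and i2 = integrable_LN_shift[OF Vv v(1), of t]
      and i3 = integrable_LN_shift[OF v(1) Vv, of t] and i4 = integrable_LN_shift[OF g g, of t]
    let ?M = "lborel \<Otimes>\<^sub>M N t"
    have "ip v (P t v) - (t / 2) * (ip Vv (P t v) + ip v (P t Vv))
       = (\<integral>p. (case p of (x, z) \<Rightarrow> v x * v (x + z)) - (t / 2) * ((case p of (x, z) \<Rightarrow> Vv x * v (x + z)) + (case p of (x, z) \<Rightarrow> v x * Vv (x + z))) \<partial>?M)"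
      unfolding ip_P_eq[OF v(1) v(1)] ip_P_eq[OF Vv v(1)] ip_P_eq[OF v(1) Vv] using i1 i2 i3 by simp
    also have "\<dots> \<le> (\<integral>p. (case p of (x, z) \<Rightarrow> ?g x * ?g (x + z)) \<partial>?M)"
    proof (rule integral_mono)
      show "integrable ?M (\<lambda>p. (case p of (x, z) \<Rightarrow> v x * v (x + z)) - (t / 2) * ((case p of (x, z) \<Rightarrow> Vv x * v (x + z)) + (case p of (x, z) \<Rightarrow> v x * Vv (x + z))))"
        using i1 i2 i3 by simp
      show "integrable ?M (\<lambda>p. case p of (x, z) \<Rightarrow> ?g x * ?g (x + z))" by (rule i4)
      fix p :: "(real^'n) \<times> (real^'n)"
      obtain x z where p: "p = (x, z)" by (cases p)
      show "(case p of (x, z) \<Rightarrow> v x * v (x + z)) - (t / 2) * ((case p of (x, z) \<Rightarrow> Vv x * v (x + z)) + (case p of (x, z) \<Rightarrow> v x * Vv (x + z)))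
        \<le> (case p of (x, z) \<Rightarrow> ?g x * ?g (x + z))"
      proof (cases "x \<in> K \<and> x + z \<in> K")
        case True
        let ?y = "t * V x / 2 + t * V (x + z) / 2"
        have "(1 + - ?y) * (v x * v (x + z)) \<le> exp (- ?y) * (v x * v (x + z))"
          by (intro mult_right_mono exp_ge_add_one_self) (simp add: v(2))
        also have "exp (- ?y) = exp (- (t * V x / 2)) * exp (- (t * V (x + z) / 2))"
          by (simp add: exp_add[symmetric])
        finally show ?thesis using True by (simp add: p Vveq weight_def algebra_simps)
      next
        case False
        then have "v x = 0 \<or> v (x + z) = 0" using v(3) by blast
        then show ?thesis by (auto simp: p Vveq)
      qed
    qed
    also have "\<dots> = ip ?g (P t ?g)" by (rule ip_P_eq[OF g g, symmetric])
    finally have lo: "ip v (P t v) - (t / 2) * (ip Vv (P t v) + ip v (P t Vv)) \<le> ip ?g (P t ?g)" .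
    have sym: "ip v (P t Vv) = ip Vv (P t v)" using ip_P_sym[OF v(1) Vv, of t] by (simp add: ip_commute)
    have Pv: "bL2 (P t v)" by (rule bL2_P[OF v(1)])
    have "\<bar>ip Vv (\<lambda>x. v x - P t v x)\<bar> \<le> sqrt (ip Vv Vv) * sqrt (ip (\<lambda>x. v x - P t v x) (\<lambda>x. v x - P t v x))"
      by (rule ip_abs_le[OF Vv bL2_diff[OF v(1) Pv]])
    also have "\<dots> \<le> sqrt (ip Vv Vv) * sqrt (2 * (t * c))"
      using ip_diff_P_le[OF v(1), of t] Et t by (intro mult_left_mono real_sqrt_le_mono) (auto simp: ip_nonneg)
    finally have "ip Vv (P t v) \<le> I + X * B * sqrt (2 * (t * c))"
      using Vv v(1) Pv pos by (simp add: ip_diff_right I B_def X_def)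
    then have "t * ip Vv (P t v) \<le> t * (I + X * B * sqrt (2 * (t * c)))" using t by (intro mult_left_mono) auto
    moreover have "ip v (P t v) \<ge> X - t * c" using Et by (simp add: E_def X_def)
    ultimately have "X - t * c - t * (I + X * B * sqrt (2 * (t * c))) \<le> ip ?g (P t ?g)"
      using lo unfolding sym by simp
    moreover have "t * (c + I) \<le> t * (\<mu> * X)" using ray t by (intro mult_left_mono) (auto simp: I_def X_def)
    ultimately have 1: "(1 - t * (\<mu> + B * sqrt (2 * (t * c)))) * X \<le> ip ?g (P t ?g)"
      by (simp add: algebra_simps)
    have "exp (- (t * (\<mu> + \<epsilon>))) \<le> 1 - t * (\<mu> + B * sqrt (2 * (t * c)))"
    proof (rule exp_lower_bound_linear)
      show "0 \<le> t * (\<mu> + \<epsilon>)" using t \<mu>0 \<epsilon> by simp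
      have "t * (B * sqrt (2 * (t * c)) + t * (\<mu> + \<epsilon>)\<^sup>2) \<le> t * \<epsilon>" using small t by (intro mult_left_mono) auto
      then show "t * (\<mu> + B * sqrt (2 * (t * c))) \<le> t * (\<mu> + \<epsilon>) - (t * (\<mu> + \<epsilon>))\<^sup>2"
        by (simp add: power2_eq_square algebra_simps)
    qed
    then have "exp (- (t * (\<mu> + \<epsilon>))) * X \<le> (1 - t * (\<mu> + B * sqrt (2 * (t * c)))) * X"
      using pos by (intro mult_right_mono) (auto simp: X_def)
    then show "exp (- ((1 / 2 ^ k) * (\<mu> + \<epsilon>))) * ip v v
       \<le> ip (\<lambda>x. weight K V (1 / 2 ^ k) x * v x) (P (1 / 2 ^ k) (\<lambda>x. weight K V (1 / 2 ^ k) x * v x))"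
      using 1 unfolding X_def t_def by linarith
  qed
qed

section \<open>Iterated steps\<close>

text \<open>
  The symmetric splitting of one time step; with \<open>e = weight K V t\<close> it approximates \<open>exp (- t H)\<close> on \<open>K\<close>.
\<close>

definition step :: "real \<Rightarrow> (real^'n \<Rightarrow> real) \<Rightarrow> (real^'n \<Rightarrow> real) \<Rightarrow> real^'n \<Rightarrow> real" where
  "step t e f x = e x * P t (\<lambda>y. e y * f y) x"

lemma step_eq: "step t e f = (\<lambda>x. e x * P t (\<lambda>y. e y * f y) x)"
  by (rule ext) (rule step_def)

text \<open>
  Common to the weights, to indicator functions of compact sets and to all functions that
  iterated steps produce from them.
\<close>

definition weightlike :: "(real^'n) set \<Rightarrow> (real^'n \<Rightarrow> real) \<Rightarrow> bool" where
  "weightlike K e \<longleftrightarrow> compact K \<and> e \<in> borel_measurable borel \<and> (\<forall>x. 0 \<le> e x \<and> e x \<le> 1) \<and> (\<forall>x. x \<notin> K \<longrightarrow> e x = 0)"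

lemma weightlike_bL2: assumes "weightlike K e" shows "bL2 e"
proof -
  have "integrable lborel (\<lambda>x. (e x)\<^sup>2)"
    by (rule integrable_bounded_compact[of _ 1 K]) (use assms in \<open>auto simp: weightlike_def power_le_one\<close>)
  then show ?thesis using assms unfolding bL2_def weightlike_def by (auto intro!: exI[of _ 1])
qed

lemma weightlike_mult_bL2: assumes e: "weightlike K e" and f: "bL2 f" shows "bL2 (\<lambda>x. e x * f x)"
  by (rule bL2_mult_bounded[OF f, of _ 1]) (use e in \<open>auto simp: weightlike_def\<close>)

lemma step_bL2: assumes e: "weightlike K e" and f: "bL2 f" shows "bL2 (step t e f)"
  unfolding step_def[abs_def] by (intro weightlike_mult_bL2[OF e] bL2_P f)

lemma ip_step: assumes e: "weightlike K e" and f: "bL2 f" "bL2 g" and t: "t \<ge> 0"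
  shows "ip f (step t e g) = ip (P (t / 2) (\<lambda>x. e x * f x)) (P (t / 2) (\<lambda>x. e x * g x))"
proof -
  have b: "bL2 (\<lambda>x. e x * f x)" "bL2 (\<lambda>x. e x * g x)" using weightlike_mult_bL2[OF e] f by auto
  have "ip f (step t e g) = ip (\<lambda>x. e x * f x) (P t (\<lambda>x. e x * g x))" by (simp add: ip_def step_def mult_ac)
  also have "\<dots> = ip (\<lambda>x. e x * f x) (P (t / 2) (P (t / 2) (\<lambda>x. e x * g x)))" using t b by (simp add: P_P)
  also have "\<dots> = ip (P (t / 2) (\<lambda>x. e x * f x)) (P (t / 2) (\<lambda>x. e x * g x))" by (rule ip_P_sym[OF b(1) bL2_P[OF b(2)]])
  finally show ?thesis .
qed

lemma step_sym: assumes e: "weightlike K e" and f: "bL2 f" "bL2 g" and t: "t \<ge> 0"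
  shows "ip f (step t e g) = ip (step t e f) g"
  using ip_step[OF e f t] ip_step[OF e f(2,1) t] by (simp add: ip_commute)

lemma step_power_bL2: assumes e: "weightlike K e" and f: "bL2 f" shows "bL2 ((step t e ^^ n) f)"
  by (induction n) (auto intro: f step_bL2[OF e])

lemma step_power_sym: assumes e: "weightlike K e" and f: "bL2 f" "bL2 g" and t: "t \<ge> 0"
  shows "ip f ((step t e ^^ n) g) = ip ((step t e ^^ n) f) g"
  using f
proof (induction n arbitrary: f)
  case (Suc n)
  have "ip f ((step t e ^^ Suc n) g) = ip (step t e f) ((step t e ^^ n) g)"
    using step_sym[OF e Suc.prems(1) step_power_bL2[OF e Suc.prems(2)] t] by simp
  also have "\<dots> = ip ((step t e ^^ n) (step t e f)) g"
    by (rule Suc.IH[OF step_bL2[OF e Suc.prems(1)] Suc.prems(2)])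
  also have "(step t e ^^ n) (step t e f) = (step t e ^^ Suc n) f" by (simp only: funpow_Suc_right o_apply)
  finally show ?case .
qed simp

text \<open>
  The operator is \<open>B\<^sup>* B\<close> for \<open>B f = P (t / 2) (e f)\<close>, so the bound \<open>q\<close> for its quadratic form bounds its norm.
\<close>

lemma step_power_norm_le:
  assumes e: "weightlike K e" and t: "t \<ge> 0" and q: "q \<ge> 0"
    and le: "\<And>f. bL2 f \<Longrightarrow> ip (P (t / 2) (\<lambda>x. e x * f x)) (P (t / 2) (\<lambda>x. e x * f x)) \<le> q * ip f f"
    and f: "bL2 f"
  shows "sqrt (ip ((step t e ^^ n) f) ((step t e ^^ n) f)) \<le> q ^ n * sqrt (ip f f)"
proof (induction n)
  case (Suc n)
  let ?f = "(step t e ^^ n) f" and ?g = "(step t e ^^ Suc n) f"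
  have b: "bL2 ?f" "bL2 ?g" by (intro step_power_bL2[OF e] f)+
  let ?F = "sqrt (ip ?f ?f)" and ?G = "sqrt (ip ?g ?g)"
  have s: "?F * ?F = ip ?f ?f" "?G * ?G = ip ?g ?g" by (auto simp: ip_nonneg)
  have "ip ?g ?g = ip ?g (step t e ?f)" by simp
  also have "\<dots> = ip (P (t / 2) (\<lambda>x. e x * ?g x)) (P (t / 2) (\<lambda>x. e x * ?f x))" by (rule ip_step[OF e b(2,1) t])
  also have "\<dots> \<le> sqrt (ip (P (t / 2) (\<lambda>x. e x * ?g x)) (P (t / 2) (\<lambda>x. e x * ?g x)))
      * sqrt (ip (P (t / 2) (\<lambda>x. e x * ?f x)) (P (t / 2) (\<lambda>x. e x * ?f x)))"
    using ip_abs_le[OF bL2_P[OF weightlike_mult_bL2[OF e b(2)]] bL2_P[OF weightlike_mult_bL2[OF e b(1)]], of "t/2" "t/2"] by linarith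
  also have "\<dots> \<le> sqrt (q * ip ?g ?g) * sqrt (q * ip ?f ?f)"
    by (intro mult_mono real_sqrt_le_mono le b) (auto simp: ip_nonneg q)
  also have "\<dots> = q * ?F * ?G" using q by (simp add: real_sqrt_mult)
  finally have GG: "?G * ?G \<le> q * ?F * ?G" unfolding s .
  have gen: "G \<le> H" if "G * G \<le> H * G" "0 \<le> G" "0 \<le> H" for G H :: real
    using that by (cases "G = 0") auto
  have "?G \<le> q * ?F"
    by (rule gen[OF GG real_sqrt_ge_zero[OF ip_nonneg] mult_nonneg_nonneg[OF q real_sqrt_ge_zero[OF ip_nonneg]]])
  also have "\<dots> \<le> q * (q ^ n * sqrt (ip f f))" using Suc q by (rule mult_left_mono)
  finally show ?case by simp
qed simp

text \<open>
  By symmetry and Cauchy-Schwarz, \<open>\<langle>v, T\<^sup>n v\<rangle>\<^sup>2 \<le> \<langle>v, v\<rangle> \<langle>v, T\<^sup>2\<^sup>n v\<rangle>\<close>; doubling reaches the powers of two.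
\<close>

lemma step_power_lower:
  assumes e: "weightlike K e" and t: "t \<ge> 0" and v: "bL2 v" "ip v v > 0" and p: "p \<ge> 0"
    and le: "p * ip v v \<le> ip v (step t e v)"
  shows "p ^ (2 ^ j) * ip v v \<le> ip v ((step t e ^^ (2 ^ j)) v)"
proof (induction j)
  case 0
  then show ?case using le by simp
next
  case (Suc j)
  let ?m = "2 ^ j :: nat" let ?w = "(step t e ^^ ?m) v"
  have w: "bL2 ?w" by (rule step_power_bL2[OF e v(1)])
  have "(p ^ ?m * ip v v)\<^sup>2 \<le> (ip v ?w)\<^sup>2" using Suc p ip_nonneg[of v] by (intro power_mono) auto
  also have "\<dots> \<le> ip v v * ip ?w ?w" by (rule ip_cauchy_schwarz[OF v(1) w])
  finally have "ip v v * (p ^ (2 * ?m) * ip v v) \<le> ip v v * ip ?w ?w"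
    by (simp add: power_mult_distrib power2_eq_square power_mult[symmetric] power_add[symmetric] mult_2 mult_ac)
  then have "p ^ (2 * ?m) * ip v v \<le> ip ?w ?w" using v(2) by simp
  also have "ip ?w ?w = ip v ((step t e ^^ ?m) ?w)" by (rule step_power_sym[OF e v(1) w t, symmetric])
  also have "(step t e ^^ ?m) ?w = (step t e ^^ (2 * ?m)) v" by (simp add: mult_2 funpow_add)
  finally show ?case by simp
qed

lemma step_mono:
  assumes e: "weightlike K e" and f: "bL2 f" "bL2 g" and le: "\<And>x. f x \<le> g x"
  shows "step t e f x \<le> step t e g x"
proof -
  have e0: "0 \<le> e y" for y using e by (auto simp: weightlike_def)
  have "P t (\<lambda>y. e y * f y) x \<le> P t (\<lambda>y. e y * g y) x" unfolding P_def
    by (intro integral_mono bL2_integrable_N[OF weightlike_mult_bL2[OF e f(1)]]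
        bL2_integrable_N[OF weightlike_mult_bL2[OF e f(2)]] mult_left_mono le e0)
  then show ?thesis unfolding step_def using e0 by (intro mult_left_mono)
qed

lemma step_cmult: "step t e (\<lambda>x. c * f x) = (\<lambda>x. c * step t e f x)"
proof -
  have "(\<lambda>y. e y * (c * f y)) = (\<lambda>y. c * (e y * f y))" by (simp add: mult.left_commute)
  then show ?thesis unfolding step_def[abs_def] by (simp add: P_cmult mult.left_commute)
qed

lemma step_power_mono:
  assumes e: "weightlike K e" and f: "bL2 f" "bL2 g" and le: "\<And>x. f x \<le> c * g x"
  shows "(step t e ^^ n) f x \<le> c * (step t e ^^ n) g x"
proof (induction n arbitrary: x)
  case 0
  then show ?case using le by simp
next
  case (Suc n)
  have "step t e ((step t e ^^ n) f) x \<le> step t e (\<lambda>x. c * (step t e ^^ n) g x) x"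
    by (rule step_mono[OF e step_power_bL2[OF e f(1)] bL2_cmult[OF step_power_bL2[OF e f(2)]] Suc])
  then show ?case by (simp add: step_cmult)
qed

lemma step_power_weightlike:
  assumes e: "weightlike K e" and f: "weightlike K f"
  shows "weightlike K ((step t e ^^ n) f)"
proof (induction n)
  case 0
  then show ?case using f by simp
next
  case (Suc n)
  let ?f = "(step t e ^^ n) f"
  have [measurable]: "e \<in> borel_measurable borel" "?f \<in> borel_measurable borel" using e Suc by (auto simp: weightlike_def)
  have b: "0 \<le> e x * ?f x" "e x * ?f x \<le> 1" for x using e Suc by (auto simp: weightlike_def mult_le_one)
  have Pb: "0 \<le> P t (\<lambda>y. e y * ?f y) x" "P t (\<lambda>y. e y * ?f y) x \<le> 1" for x
    using P_bounds[of "\<lambda>y. e y * ?f y" 0 1 t x] b by auto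
  have "step t e ?f \<in> borel_measurable borel" unfolding step_eq[of t e ?f] by measurable
  moreover have "0 \<le> step t e ?f x \<and> step t e ?f x \<le> 1" for x
    using e Pb[of x] by (auto simp: step_def weightlike_def mult_le_one)
  moreover have "step t e ?f x = 0" if "x \<notin> K" for x using e that by (auto simp: step_def weightlike_def)
  ultimately show ?case using e by (simp add: weightlike_def)
qed

text \<open>
  A step consists of two multiplications and a Gaussian convolution, and each preserves the relation.
\<close>

lemma step_power_log_conc:
  assumes r: "0 < r" "r < 1" and e: "weightlike K0 e0" "weightlike K1 e1" "weightlike K2 e2" and le: "log_conc r e0 e1 e2"
    and f: "weightlike K0 f0" "weightlike K1 f1" "weightlike K2 f2" and lf: "log_conc r f0 f1 f2"
  shows "log_conc r ((step t e0 ^^ n) f0) ((step t e1 ^^ n) f1) ((step t e2 ^^ n) f2)"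
proof (induction n)
  case 0
  then show ?case using lf by simp
next
  case (Suc n)
  let ?f0 = "(step t e0 ^^ n) f0" and ?f1 = "(step t e1 ^^ n) f1" and ?f2 = "(step t e2 ^^ n) f2"
  have w: "weightlike K0 ?f0" "weightlike K1 ?f1" "weightlike K2 ?f2" using e f by (auto intro: step_power_weightlike)
  have [measurable]: "e0 \<in> borel_measurable borel" "e1 \<in> borel_measurable borel" "e2 \<in> borel_measurable borel"
    "?f0 \<in> borel_measurable borel" "?f1 \<in> borel_measurable borel" "?f2 \<in> borel_measurable borel"
    using e w by (auto simp: weightlike_def)
  have en: "0 \<le> e0 x" "0 \<le> e1 x" "0 \<le> e2 x" "0 \<le> ?f0 x" "0 \<le> ?f1 x" "0 \<le> ?f2 x" for x
    using e w by (auto simp: weightlike_def)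
  have e1': "e0 x * ?f0 x \<le> 1" "e1 x * ?f1 x \<le> 1" "e2 x * ?f2 x \<le> 1" for x
    using e w by (auto simp: weightlike_def mult_le_one)
  have 1: "log_conc r (\<lambda>x. e0 x * ?f0 x) (\<lambda>x. e1 x * ?f1 x) (\<lambda>x. e2 x * ?f2 x)"
    by (rule log_conc_mult[OF le Suc en(1-5)])
  have 2: "log_conc r (P t (\<lambda>x. e0 x * ?f0 x)) (P t (\<lambda>x. e1 x * ?f1 x)) (P t (\<lambda>x. e2 x * ?f2 x))"
    by (rule log_conc_P[OF r, where C=1]) (use en e1' 1 in auto)
  have Pn: "0 \<le> P t (\<lambda>x. e0 x * ?f0 x) x" "0 \<le> P t (\<lambda>x. e1 x * ?f1 x) x" for x
    using P_bounds(1)[of "\<lambda>x. e0 x * ?f0 x" 0 1 t x] P_bounds(1)[of "\<lambda>x. e1 x * ?f1 x" 0 1 t x] en e1' by auto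
  show ?case using log_conc_mult[OF le 2 en(1-3) Pn] 
    unfolding funpow.simps o_apply step_eq[of t e0 ?f0] step_eq[of t e1 ?f1] step_eq[of t e2 ?f2] .
qed

lemma indicator_weightlike: "compact K \<Longrightarrow> weightlike K (indicator K)"
  by (auto simp: weightlike_def intro!: borel_measurable_indicator borel_compact)

lemma weight_weightlike:
  assumes "V \<in> borel_measurable borel" "compact K" "\<And>x. x \<in> K \<Longrightarrow> 0 \<le> V x" "t \<ge> 0"
  shows "weightlike K (weight K V t)"
  using weight_props[OF assms(1) borel_compact[OF assms(2)], of t] assms unfolding weightlike_def by auto

text \<open>
  The step operator is monotone and \<open>v \<le> C 1\<^sub>K\<close>, so the mass of the iterated indicator function dominates the quadratic form at \<open>v\<close>.
\<close>

lemma step_mass_lower: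
  assumes e: "weightlike K e" and t: "t \<ge> 0" and v: "bL2 v" "ip v v > 0" "\<And>x. 0 \<le> v x" "\<And>x. x \<notin> K \<Longrightarrow> v x = 0" and p: "p \<ge> 0"
    and le: "p * ip v v \<le> ip v (step t e v)" and C: "C > 0" "\<And>x. v x \<le> C"
  shows "p ^ (2 ^ j) * (ip v v / C\<^sup>2) \<le> integral\<^sup>L lborel ((step t e ^^ (2 ^ j)) (indicator K))"
proof -
  have K: "compact K" using e by (simp add: weightlike_def)
  let ?T = "step t e ^^ (2 ^ j)" let ?i = "indicator K :: real^'n \<Rightarrow> real"
  have i: "bL2 ?i" by (rule weightlike_bL2[OF indicator_weightlike[OF K]])
  have Ti: "weightlike K (?T ?i)" by (rule step_power_weightlike[OF e indicator_weightlike[OF K]])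
  have Tii: "integrable lborel (?T ?i)"
    by (rule integrable_bounded_compact[of _ 1 K]) (use Ti K in \<open>auto simp: weightlike_def\<close>)
  have vi: "v x \<le> C * ?i x" for x using C(2)[of x] v(4)[of x] by (cases "x \<in> K") auto
  have "p ^ (2 ^ j) * ip v v \<le> ip v (?T v)" by (rule step_power_lower[OF e t v(1,2) p le])
  also have "\<dots> \<le> (\<integral>x. C\<^sup>2 * ?T ?i x \<partial>lborel)" unfolding ip_def
  proof (rule integral_mono)
    show "integrable lborel (\<lambda>x. v x * ?T v x)" by (rule bL2_integrable_mult[OF v(1) step_power_bL2[OF e v(1)]])
    show "integrable lborel (\<lambda>x. C\<^sup>2 * ?T ?i x)" using Tii by simp
    fix x
    have "?T v x \<le> C * ?T ?i x" by (rule step_power_mono[OF e v(1) i vi])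
    then have "v x * ?T v x \<le> v x * (C * ?T ?i x)" using v(3) by (intro mult_left_mono)
    also have "\<dots> \<le> C * (C * ?T ?i x)" using C Ti by (intro mult_right_mono) (auto simp: weightlike_def)
    finally show "v x * ?T v x \<le> C\<^sup>2 * ?T ?i x" by (simp add: power2_eq_square mult.assoc)
  qed
  also have "\<dots> = C\<^sup>2 * integral\<^sup>L lborel (?T ?i)" by simp
  finally show ?thesis using C(1) by (simp add: field_simps)
qed

text \<open>
  The iterated function is supported in \<open>K\<close>, so its mass is its inner product with the indicator function of \<open>K\<close>.
\<close>

lemma step_mass_upper:
  assumes e: "weightlike K e" and t: "t \<ge> 0" and q: "q \<ge> 0"
    and le: "\<And>f. bL2 f \<Longrightarrow> ip (P (t / 2) (\<lambda>x. e x * f x)) (P (t / 2) (\<lambda>x. e x * f x)) \<le> q * ip f f"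
  shows "integral\<^sup>L lborel ((step t e ^^ n) (indicator K)) \<le> q ^ n * measure lborel K"
proof -
  have K: "compact K" using e by (simp add: weightlike_def)
  let ?T = "step t e ^^ n" let ?i = "indicator K :: real^'n \<Rightarrow> real"
  have i: "bL2 ?i" by (rule weightlike_bL2[OF indicator_weightlike[OF K]])
  have Ti: "weightlike K (?T ?i)" by (rule step_power_weightlike[OF e indicator_weightlike[OF K]])
  have ii: "ip ?i ?i = measure lborel K"
  proof -
    have "(\<lambda>x. ?i x * ?i x) = ?i" by (auto simp: indicator_def)
    then show ?thesis using K by (simp add: ip_def borel_compact)
  qed
  have "integral\<^sup>L lborel (?T ?i) = ip ?i (?T ?i)" unfolding ip_def
    using Ti by (intro Bochner_Integration.integral_cong) (auto simp: weightlike_def indicator_def)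
  also have "\<dots> \<le> sqrt (ip ?i ?i) * sqrt (ip (?T ?i) (?T ?i))"
    using ip_abs_le[OF i weightlike_bL2[OF Ti]] by linarith
  also have "\<dots> \<le> sqrt (ip ?i ?i) * (q ^ n * sqrt (ip ?i ?i))"
  proof (rule mult_left_mono)
    show "sqrt (ip (?T ?i) (?T ?i)) \<le> q ^ n * sqrt (ip ?i ?i)"
      by (rule step_power_norm_le) (fact e t q le i)+
  qed (simp add: ip_nonneg)
  also have "\<dots> = q ^ n * (sqrt (ip ?i ?i) * sqrt (ip ?i ?i))" by simp
  also have "sqrt (ip ?i ?i) * sqrt (ip ?i ?i) = measure lborel K" using ip_nonneg[of ?i] by (simp add: ii)
  finally show ?thesis .
qed

text \<open>
  For small fixed \<open>t\<close> the Prekopa-Leindler inequality for the masses after \<open>n = 2 ^ j\<close> steps reads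
  \<open>exp (- n t ((1 - r) \<mu>0 + r \<mu>1 + \<epsilon>)) const \<le> exp (- n t (lam - \<epsilon>)) const\<close>, and \<open>j\<close> tends to infinity.
\<close>

lemma nonlocal_brunn_minkowski:
  fixes V v0 v1 :: "real^'n \<Rightarrow> real"
  assumes r: "0 < r" "r < 1"
    and V[measurable]: "V \<in> borel_measurable borel" and Vc: "continuous_on \<Omega> V" and \<Omega>: "open \<Omega>"
    and Vnn: "\<And>x. x \<in> \<Omega> \<Longrightarrow> 0 \<le> V x"
    and ray: "\<And>w c K J. bL2 w \<Longrightarrow> compact K \<Longrightarrow> K \<subseteq> \<Omega> \<Longrightarrow> (\<And>x. x \<notin> K \<Longrightarrow> w x = 0) \<Longrightarrow>
       (\<And>j. j \<ge> J \<Longrightarrow> E (1 / 2 ^ j) w \<le> c / 2 ^ j) \<Longrightarrow> lam * ip w w \<le> c + (\<integral>x. V x * (w x)\<^sup>2 \<partial>lborel)"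
    and K0: "compact K0" "\<And>x. x \<in> K0 \<Longrightarrow> 0 \<le> V x" "\<And>x. x \<in> K0 \<Longrightarrow> V x \<le> M"
    and K1: "compact K1" "\<And>x. x \<in> K1 \<Longrightarrow> 0 \<le> V x" "\<And>x. x \<in> K1 \<Longrightarrow> V x \<le> M"
    and conv: "\<And>x y. x \<in> K0 \<Longrightarrow> y \<in> K1 \<Longrightarrow> (1 - r) *\<^sub>R x + r *\<^sub>R y \<in> \<Omega> \<and>
         V ((1 - r) *\<^sub>R x + r *\<^sub>R y) \<le> (1 - r) * V x + r * V y"
    and v0: "bL2 v0" "ip v0 v0 > 0" "\<And>x. 0 \<le> v0 x" "\<And>x. x \<notin> K0 \<Longrightarrow> v0 x = 0"
      "\<And>j. j \<ge> J0 \<Longrightarrow> E (1 / 2 ^ j) v0 \<le> c0 / 2 ^ j" "c0 + (\<integral>x. V x * (v0 x)\<^sup>2 \<partial>lborel) \<le> \<mu>0 * ip v0 v0"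
    and v1: "bL2 v1" "ip v1 v1 > 0" "\<And>x. 0 \<le> v1 x" "\<And>x. x \<notin> K1 \<Longrightarrow> v1 x = 0"
      "\<And>j. j \<ge> J1 \<Longrightarrow> E (1 / 2 ^ j) v1 \<le> c1 / 2 ^ j" "c1 + (\<integral>x. V x * (v1 x)\<^sup>2 \<partial>lborel) \<le> \<mu>1 * ip v1 v1"
  shows "lam \<le> (1 - r) * \<mu>0 + r * \<mu>1"
proof -
  (* Only lam >= 0 needs the argument, since the bounds mu are nonnegative. *)
  have \<mu>nn: "0 \<le> \<mu>" if "bL2 v" "ip v v > 0" "\<And>x. x \<notin> K \<Longrightarrow> v x = 0" "\<And>x. x \<in> K \<Longrightarrow> 0 \<le> V x"
      "\<And>j. j \<ge> J \<Longrightarrow> E (1 / 2 ^ j) v \<le> c / 2 ^ j" "c + (\<integral>x. V x * (v x)\<^sup>2 \<partial>lborel) \<le> \<mu> * ip v v"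
    for v :: "real^'n \<Rightarrow> real" and K J c \<mu>
  proof -
    have "0 \<le> c / 2 ^ J" using that(5)[of J] E_nonneg[OF that(1), of "1 / 2 ^ J"] by linarith
    then have "0 \<le> (c / 2 ^ J) * 2 ^ J" by (intro mult_nonneg_nonneg) auto
    then have "0 \<le> c" by simp
    moreover have "0 \<le> (\<integral>x. V x * (v x)\<^sup>2 \<partial>lborel)"
    proof (intro integral_nonneg_AE AE_I2)
      show "0 \<le> V x * (v x)\<^sup>2" for x using that(3,4)[of x] by (cases "x \<in> K") auto
    qed
    ultimately have "0 \<le> \<mu> * ip v v" using that(6) by linarith
    then show ?thesis using that(2) by (simp add: zero_le_mult_iff)
  qed
  have \<mu>s0: "\<mu>0 \<ge> 0" by (rule \<mu>nn) (fact v0 K0)+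
  have \<mu>s1: "\<mu>1 \<ge> 0" by (rule \<mu>nn) (fact v1 K1)+
  note \<mu>s = \<mu>s0 \<mu>s1
  show ?thesis
  proof (cases "lam \<ge> 0")
    case False
    then show ?thesis using \<mu>s r by (smt (verit) mult_nonneg_nonneg)
  next
    case lam: True
    have ne: "K \<noteq> {}" if "ip v v > 0" "\<And>x. x \<notin> K \<Longrightarrow> v x = 0" for v :: "real^'n \<Rightarrow> real" and K
    proof
      assume "K = {}"
      then have "v = (\<lambda>_. 0)" using that(2) by auto
      then show False using that(1) by (simp add: ip_def)
    qed
    have K0ne: "K0 \<noteq> {}" by (rule ne) (fact v0)+
    have K1ne: "K1 \<noteq> {}" by (rule ne) (fact v1)+
    define K where "K = (\<lambda>p. (1 - r) *\<^sub>R fst p + r *\<^sub>R snd p) ` (K0 \<times> K1)"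
    have K: "compact K" unfolding K_def
      by (intro compact_continuous_image compact_Times K0 K1 continuous_intros)
    have K\<Omega>: "K \<subseteq> \<Omega>" using conv by (auto simp: K_def)
    have Kne: "K \<noteq> {}" using K0ne K1ne by (auto simp: K_def)
    have inK: "(1 - r) *\<^sub>R x + r *\<^sub>R y \<in> K" if "x \<in> K0" "y \<in> K1" for x y
      unfolding K_def using that by (intro image_eqI[of _ _ "(x, y)"]) auto
    have KV: "\<And>x. x \<in> K \<Longrightarrow> 0 \<le> V x" using Vnn K\<Omega> by blast
    obtain C0 where C0: "C0 > 0" "\<And>x. \<bar>v0 x\<bar> \<le> C0" using bL2_bounded[OF v0(1)] by blast
    obtain C1 where C1: "C1 > 0" "\<And>x. \<bar>v1 x\<bar> \<le> C1" using bL2_bounded[OF v1(1)] by blast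
    have key: "lam - \<epsilon> \<le> (1 - r) * (\<mu>0 + \<epsilon>) + r * (\<mu>1 + \<epsilon>)" if \<epsilon>: "\<epsilon> > 0" for \<epsilon>
    proof -
      have "\<exists>k0::nat. \<forall>k\<ge>k0. \<forall>f. bL2 f \<longrightarrow>
         ip (P (1 / 2 ^ k / 2) (\<lambda>x. weight K V (1 / 2 ^ k) x * f x)) (P (1 / 2 ^ k / 2) (\<lambda>x. weight K V (1 / 2 ^ k) x * f x))
         \<le> exp (- ((1 / 2 ^ k) * (lam - \<epsilon>))) * ip f f"
        by (rule step_upper) (fact V Vc \<Omega> Vnn K K\<Omega> Kne lam ray \<epsilon>)+
      then obtain ka where ka: "\<And>k f. k \<ge> ka \<Longrightarrow> bL2 f \<Longrightarrow>
         ip (P (1 / 2 ^ k / 2) (\<lambda>x. weight K V (1 / 2 ^ k) x * f x)) (P (1 / 2 ^ k / 2) (\<lambda>x. weight K V (1 / 2 ^ k) x * f x))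
         \<le> exp (- ((1 / 2 ^ k) * (lam - \<epsilon>))) * ip f f"
        by blast
      obtain kb where kb: "\<And>k. k \<ge> kb \<Longrightarrow> exp (- ((1 / 2 ^ k) * (\<mu>0 + \<epsilon>))) * ip v0 v0
         \<le> ip (\<lambda>x. weight K0 V (1 / 2 ^ k) x * v0 x) (P (1 / 2 ^ k) (\<lambda>x. weight K0 V (1 / 2 ^ k) x * v0 x))"
      proof -
        have "\<exists>k0::nat. \<forall>k\<ge>k0. exp (- ((1 / 2 ^ k) * (\<mu>0 + \<epsilon>))) * ip v0 v0
         \<le> ip (\<lambda>x. weight K0 V (1 / 2 ^ k) x * v0 x) (P (1 / 2 ^ k) (\<lambda>x. weight K0 V (1 / 2 ^ k) x * v0 x))"
          by (rule step_lower[where M=M and J=J0 and c=c0]) (fact V K0 v0 \<epsilon>)+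
        then show ?thesis using that by blast
      qed
      obtain kc where kc: "\<And>k. k \<ge> kc \<Longrightarrow> exp (- ((1 / 2 ^ k) * (\<mu>1 + \<epsilon>))) * ip v1 v1
         \<le> ip (\<lambda>x. weight K1 V (1 / 2 ^ k) x * v1 x) (P (1 / 2 ^ k) (\<lambda>x. weight K1 V (1 / 2 ^ k) x * v1 x))"
      proof -
        have "\<exists>k0::nat. \<forall>k\<ge>k0. exp (- ((1 / 2 ^ k) * (\<mu>1 + \<epsilon>))) * ip v1 v1
         \<le> ip (\<lambda>x. weight K1 V (1 / 2 ^ k) x * v1 x) (P (1 / 2 ^ k) (\<lambda>x. weight K1 V (1 / 2 ^ k) x * v1 x))"
          by (rule step_lower[where M=M and J=J1 and c=c1]) (fact V K1 v1 \<epsilon>)+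
        then show ?thesis using that by blast
      qed
      define k where "k = max ka (max kb kc)"
      define t :: real where "t = 1 / 2 ^ k"
      have t: "t > 0" by (simp add: t_def)
      define e0 where "e0 = weight K0 V t" define e1 where "e1 = weight K1 V t" define e where "e = weight K V t"
      have we: "weightlike K0 e0" "weightlike K1 e1" "weightlike K e"
        unfolding e0_def e1_def e_def
        by (rule weight_weightlike[OF V]; use K0 K1 K KV t in simp)+
      note wi = indicator_weightlike[OF K0(1)] indicator_weightlike[OF K1(1)] indicator_weightlike[OF K]
      define p0 where "p0 = exp (- (t * (\<mu>0 + \<epsilon>)))" define p1 where "p1 = exp (- (t * (\<mu>1 + \<epsilon>)))"
      define q where "q = exp (- (t * (lam - \<epsilon>)))"
      have p: "p0 \<ge> 0" "p1 \<ge> 0" "q \<ge> 0" by (auto simp: p0_def p1_def q_def)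
      have s0: "p0 * ip v0 v0 \<le> ip v0 (step t e0 v0)"
        using kb[of k] by (simp add: k_def p0_def t_def e0_def step_def[abs_def] ip_def mult_ac)
      have s1: "p1 * ip v1 v1 \<le> ip v1 (step t e1 v1)"
        using kc[of k] by (simp add: k_def p1_def t_def e1_def step_def[abs_def] ip_def mult_ac)
      have su: "ip (P (t / 2) (\<lambda>x. e x * f x)) (P (t / 2) (\<lambda>x. e x * f x)) \<le> q * ip f f" if "bL2 f" for f
        using ka[of k f] that by (simp add: k_def q_def t_def e_def)
      have li: "log_conc r (indicator K0) (indicator K1) (indicator K :: real^'n \<Rightarrow> real)"
        using inK r by (auto simp: log_conc_def indicator_def)
      have le: "log_conc r e0 e1 e" unfolding log_conc_def
      proof (intro allI)
        fix x y :: "real^'n"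
        let ?z = "(1 - r) *\<^sub>R x + r *\<^sub>R y"
        show "e0 x powr (1 - r) * e1 y powr r \<le> e ?z"
        proof (cases "x \<in> K0 \<and> y \<in> K1")
          case True
          then have z: "?z \<in> K" using inK by blast
          have "e0 x powr (1 - r) * e1 y powr r = exp ((1 - r) * (- (t * V x / 2)) + r * (- (t * V y / 2)))"
          proof -
            have "e0 x powr (1 - r) = exp ((1 - r) * (- (t * V x / 2)))" "e1 y powr r = exp (r * (- (t * V y / 2)))"
              using True by (simp_all add: e0_def e1_def weight_def powr_def)
            then show ?thesis by (simp only: exp_add)
          qed
          also have "\<dots> \<le> exp (- (t * V ?z / 2))"
          proof -
            have "V ?z \<le> (1 - r) * V x + r * V y" using conv True by blast
            then have "(t / 2) * V ?z \<le> (t / 2) * ((1 - r) * V x + r * V y)" using t by (intro mult_left_mono) auto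
            then show ?thesis by (simp add: algebra_simps)
          qed
          also have "\<dots> = e ?z" using z by (simp add: e_def weight_def)
          finally show ?thesis .
        next
          case False
          then have "e0 x = 0 \<or> e1 y = 0" by (auto simp: e0_def e1_def weight_def)
          moreover have "0 \<le> e ?z" using we(3) by (auto simp: weightlike_def)
          ultimately show ?thesis by auto
        qed
      qed
      define A where "A = (ip v0 v0 / C0\<^sup>2) powr (1 - r) * (ip v1 v1 / C1\<^sup>2) powr r"
      have A: "A > 0" using v0(2) v1(2) C0(1) C1(1) by (simp add: A_def)
      define b where "b = (1 - r) * (\<mu>0 + \<epsilon>) + r * (\<mu>1 + \<epsilon>)"
      have main: "exp (- (t * b)) ^ (2 ^ j) * A \<le> q ^ (2 ^ j) * measure lborel K" for j :: nat
      proof -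
        let ?n = "2 ^ j :: nat"
        let ?f0 = "(step t e0 ^^ ?n) (indicator K0)" and ?f1 = "(step t e1 ^^ ?n) (indicator K1)"
          and ?f2 = "(step t e ^^ ?n) (indicator K)"
        have w: "weightlike K0 ?f0" "weightlike K1 ?f1" "weightlike K ?f2"
          using step_power_weightlike[OF we(1) wi(1)] step_power_weightlike[OF we(2) wi(2)] step_power_weightlike[OF we(3) wi(3)] by auto
        obtain R where R: "\<And>x. x \<in> K0 \<union> K1 \<union> K \<Longrightarrow> norm x \<le> R"
          using compact_imp_bounded[OF compact_Un[OF compact_Un[OF K0(1) K1(1)] K]] unfolding bounded_iff by auto
        have PL: "integral\<^sup>L lborel ?f0 powr (1 - r) * integral\<^sup>L lborel ?f1 powr r \<le> integral\<^sup>L lborel ?f2"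
        proof (rule prekopa_leindler[OF r, where C=1 and R=R])
          show "?f0 x powr (1 - r) * ?f1 y powr r \<le> ?f2 ((1 - r) *\<^sub>R x + r *\<^sub>R y)" for x y
            using step_power_log_conc[OF r we le wi li, where t=t and n="?n"] by (auto simp: log_conc_def)
          show "norm x \<le> R" if "?f0 x \<noteq> 0" for x using w(1) that R by (auto simp: weightlike_def)
          show "norm x \<le> R" if "?f1 x \<noteq> 0" for x using w(2) that R by (auto simp: weightlike_def)
          show "norm x \<le> R" if "?f2 x \<noteq> 0" for x using w(3) that R by (auto simp: weightlike_def)
        qed (use w in \<open>auto simp: weightlike_def\<close>)
        have C: "v0 x \<le> C0" "v1 x \<le> C1" for x using C0(2)[of x] C1(2)[of x] by linarith+
        have l0: "p0 ^ ?n * (ip v0 v0 / C0\<^sup>2) \<le> integral\<^sup>L lborel ?f0"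
          by (rule step_mass_lower) (fact we(1) less_imp_le[OF t] v0 p(1) s0 C0(1) C(1))+
        have l1: "p1 ^ ?n * (ip v1 v1 / C1\<^sup>2) \<le> integral\<^sup>L lborel ?f1"
          by (rule step_mass_lower) (fact we(2) less_imp_le[OF t] v1 p(2) s1 C1(1) C(2))+
        have u: "integral\<^sup>L lborel ?f2 \<le> q ^ ?n * measure lborel K"
          by (rule step_mass_upper) (fact we(3) less_imp_le[OF t] p(3) su)+
        have pb: "p0 powr (1 - r) * p1 powr r = exp (- (t * b))"
          by (simp add: p0_def p1_def powr_def exp_add[symmetric] b_def algebra_simps)
        have pw: "(p0 ^ ?n) powr (1 - r) * (p1 ^ ?n) powr r = exp (- (t * b)) ^ ?n"
          unfolding pb[symmetric] using p
          by (simp add: power_mult_distrib powr_power mult.commute) (simp add: p0_def p1_def powr_realpow[symmetric] powr_powr mult.commute)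
        have "exp (- (t * b)) ^ ?n * A = (p0 ^ ?n * (ip v0 v0 / C0\<^sup>2)) powr (1 - r) * (p1 ^ ?n * (ip v1 v1 / C1\<^sup>2)) powr r"
          unfolding pw[symmetric] A_def powr_mult[of "_ ^ _"] by (simp only: mult_ac)
        also have "\<dots> \<le> integral\<^sup>L lborel ?f0 powr (1 - r) * integral\<^sup>L lborel ?f1 powr r"
          using l0 l1 r p v0(2) v1(2) by (intro mult_mono powr_mono2) auto
        also have "\<dots> \<le> q ^ ?n * measure lborel K" using PL u by linarith
        finally show ?thesis .
      qed
      (* Otherwise the left-hand side of main exceeds the right-hand side by a factor that grows with j. *)
      have "lam - \<epsilon> \<le> b"
      proof (rule ccontr)
        assume "\<not> lam - \<epsilon> \<le> b"
        define g where "g = t * (lam - \<epsilon> - b)"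
        have g: "g > 0" using t \<open>\<not> lam - \<epsilon> \<le> b\<close> by (simp add: g_def)
        obtain j :: nat where j: "measure lborel K / (A * g) < 2 ^ j" using real_arch_pow[of 2] by auto
        let ?n = "2 ^ j :: nat"
        have qn: "q ^ ?n = exp (- (t * b)) ^ ?n * exp (- g) ^ ?n"
          unfolding power_mult_distrib[symmetric] by (simp add: q_def g_def exp_add[symmetric] algebra_simps)
        have "exp (- (t * b)) ^ ?n * A \<le> exp (- (t * b)) ^ ?n * (exp (- g) ^ ?n * measure lborel K)"
          using main[of j] unfolding qn by (simp add: mult.assoc)
        then have "A \<le> exp (- g) ^ ?n * measure lborel K" by (simp add: mult_le_cancel_left)
        then have "A * exp (real ?n * g) \<le> measure lborel K"
          by (simp add: exp_of_nat_mult[symmetric] exp_minus field_simps)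
        moreover have "A * (real ?n * g) \<le> A * exp (real ?n * g)"
          using A exp_ge_add_one_self[of "real ?n * g"] by (intro mult_left_mono) linarith+
        ultimately have "A * (real ?n * g) \<le> measure lborel K" by linarith
        then show False using j A g by (simp add: divide_less_eq mult_ac)
      qed
      then show ?thesis by (simp add: b_def)
    qed
    show ?thesis
    proof (rule field_le_epsilon)
      fix \<epsilon> :: real assume "\<epsilon> > 0"
      have e: "(1 - r) * (\<mu>0 + \<epsilon> / 2) + r * (\<mu>1 + \<epsilon> / 2) = (1 - r) * \<mu>0 + r * \<mu>1 + \<epsilon> / 2"
        by (simp add: field_simps)
      show "lam \<le> (1 - r) * \<mu>0 + r * \<mu>1 + \<epsilon>"
        using key[of "\<epsilon> / 2"] \<open>\<epsilon> > 0\<close> unfolding e by simp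
    qed
  qed
qed

end

section \<open>Borel representatives\<close>

text \<open>
  Elements of \<open>L\<^sup>2(\<Omega>)\<close> are Lebesgue measurable and arbitrary outside \<open>\<Omega>\<close>. A Borel measurable
  representative that vanishes outside \<open>\<Omega>\<close> turns integrals over \<open>\<Omega>\<close> into integrals over the whole space with
  respect to \<open>lborel\<close>.
\<close>

definition rep :: "(real^'n) set \<Rightarrow> (real^'n \<Rightarrow> real) \<Rightarrow> (real^'n \<Rightarrow> real) \<Rightarrow> bool" where
  "rep \<Omega> f g \<longleftrightarrow> f \<in> borel_measurable (lebesgue_on \<Omega>) \<and> g \<in> borel_measurable borel \<and> (\<forall>x. x \<notin> \<Omega> \<longrightarrow> g x = 0) \<and>
     (AE x in lborel. x \<in> \<Omega> \<longrightarrow> f x = g x)"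

lemma AE_lebesgue_on_iff:
  assumes "\<Omega> \<in> sets borel" shows "(AE x in lebesgue_on \<Omega>. Q x) \<longleftrightarrow> (AE x in lborel. x \<in> \<Omega> \<longrightarrow> Q x)"
  using assms by (subst AE_restrict_space_iff) (auto simp: AE_completion_iff)

lemma borel_lebesgue_on: "f \<in> borel_measurable borel \<Longrightarrow> f \<in> borel_measurable (lebesgue_on \<Omega>)"
  by (intro measurable_restrict_space1 measurable_completion) simp

lemma ex_rep:
  assumes \<Omega>: "\<Omega> \<in> sets borel" and f: "f \<in> borel_measurable (lebesgue_on \<Omega>)"
  shows "\<exists>g. rep \<Omega> f g"
proof -
  have "(\<lambda>x. indicator \<Omega> x *\<^sub>R f x) \<in> borel_measurable lebesgue"
    using f \<Omega> by (subst (asm) borel_measurable_restrict_space_iff) auto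
  from completion_ex_borel_measurable_real[OF this]
  obtain g where g: "g \<in> borel_measurable borel" "AE x in lborel. indicator \<Omega> x *\<^sub>R f x = g x" by auto
  have "rep \<Omega> f (\<lambda>x. indicator \<Omega> x * g x)" unfolding rep_def
  proof (intro conjI)
    show "(\<lambda>x. indicator \<Omega> x * g x) \<in> borel_measurable borel" using g(1) \<Omega> by simp
    show "AE x in lborel. x \<in> \<Omega> \<longrightarrow> f x = indicator \<Omega> x * g x" using g(2) by eventually_elim auto
  qed (use f in auto)
  then show ?thesis by blast
qed

lemma rep_AE: "rep \<Omega> f g \<Longrightarrow> AE x in lborel. x \<in> \<Omega> \<longrightarrow> f x = g x" by (simp add: rep_def)
lemma rep_outside: "rep \<Omega> f g \<Longrightarrow> x \<notin> \<Omega> \<Longrightarrow> g x = 0" by (simp add: rep_def)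
lemma rep_borel: "rep \<Omega> f g \<Longrightarrow> g \<in> borel_measurable borel" by (simp add: rep_def)

lemma rep_integral:
  assumes \<Omega>: "\<Omega> \<in> sets borel" and r: "rep \<Omega> f g"
  shows "(\<integral>x. f x \<partial>lebesgue_on \<Omega>) = (\<integral>x. g x \<partial>lborel)"
    and "integrable (lebesgue_on \<Omega>) f \<longleftrightarrow> integrable lborel g"
proof -
  have [measurable]: "g \<in> borel_measurable borel" using r by (rule rep_borel)
  have gl: "g \<in> borel_measurable (lebesgue_on \<Omega>)" by (rule borel_lebesgue_on) measurable
  have fl: "f \<in> borel_measurable (lebesgue_on \<Omega>)" using r by (simp add: rep_def)
  have ae: "AE x in lebesgue_on \<Omega>. f x = g x" using rep_AE[OF r] \<Omega> by (simp add: AE_lebesgue_on_iff)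
  have ind: "(\<lambda>x. indicator \<Omega> x *\<^sub>R g x) = g" using rep_outside[OF r] by (auto simp: fun_eq_iff indicator_def)
  have \<Omega>l: "\<Omega> \<inter> space lebesgue \<in> sets lebesgue" using \<Omega> by simp
  have "(\<integral>x. f x \<partial>lebesgue_on \<Omega>) = (\<integral>x. g x \<partial>lebesgue_on \<Omega>)" by (rule integral_cong_AE[OF fl gl ae])
  also have "\<dots> = (\<integral>x. g x \<partial>lebesgue)" using integral_restrict_space[OF \<Omega>l, of g] unfolding ind .
  also have "\<dots> = (\<integral>x. g x \<partial>lborel)" by (rule integral_completion) simp
  finally show "(\<integral>x. f x \<partial>lebesgue_on \<Omega>) = (\<integral>x. g x \<partial>lborel)" .
  have "integrable (lebesgue_on \<Omega>) f \<longleftrightarrow> integrable (lebesgue_on \<Omega>) g" by (rule integrable_cong_AE[OF fl gl ae])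
  also have "\<dots> \<longleftrightarrow> integrable lebesgue g" using integrable_restrict_space[OF \<Omega>l, of g] unfolding ind .
  also have "\<dots> \<longleftrightarrow> integrable lborel g" by (rule integrable_completion) simp
  finally show "integrable (lebesgue_on \<Omega>) f \<longleftrightarrow> integrable lborel g" .
qed

lemma rep_mult: "rep \<Omega> f g \<Longrightarrow> rep \<Omega> f' g' \<Longrightarrow> rep \<Omega> (\<lambda>x. f x * f' x) (\<lambda>x. g x * g' x)"
  unfolding rep_def by (auto elim: eventually_elim2)

lemma rep_add: "rep \<Omega> f g \<Longrightarrow> rep \<Omega> f' g' \<Longrightarrow> rep \<Omega> (\<lambda>x. f x + f' x) (\<lambda>x. g x + g' x)"
  unfolding rep_def by (auto elim: eventually_elim2)

lemma rep_diff: "rep \<Omega> f g \<Longrightarrow> rep \<Omega> f' g' \<Longrightarrow> rep \<Omega> (\<lambda>x. f x - f' x) (\<lambda>x. g x - g' x)"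
  unfolding rep_def by (auto elim: eventually_elim2)

lemma rep_zero: "rep \<Omega> (\<lambda>x. 0) (\<lambda>x. 0)" unfolding rep_def by auto

lemma rep_sum: "finite I \<Longrightarrow> (\<And>i. i \<in> I \<Longrightarrow> rep \<Omega> (f i) (g i)) \<Longrightarrow> rep \<Omega> (\<lambda>x. \<Sum>i\<in>I. f i x) (\<lambda>x. \<Sum>i\<in>I. g i x)"
  by (induction I rule: finite_induct) (auto intro: rep_add rep_zero)

lemma rep_cmult: "rep \<Omega> f g \<Longrightarrow> rep \<Omega> (\<lambda>x. c * f x) (\<lambda>x. c * g x)"
  unfolding rep_def by (auto elim: eventually_mono)

lemma rep_sq: "rep \<Omega> f g \<Longrightarrow> rep \<Omega> (\<lambda>x. (f x)\<^sup>2) (\<lambda>x. (g x)\<^sup>2)"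
  using rep_mult[of \<Omega> f g f g] by (simp add: power2_eq_square)

lemma rep_test: assumes \<phi>: "\<phi> \<in> test_functions \<Omega>" shows "rep \<Omega> \<phi> \<phi>"
proof -
  have "\<phi> x = 0" if "x \<notin> \<Omega>" for x
    using test_functions_supp(3)[OF \<phi>] test_functions_supp(2)[OF \<phi>] that by blast
  moreover note b = test_functions_borel[OF \<phi>]
  ultimately show ?thesis unfolding rep_def using borel_lebesgue_on[OF b] by simp
qed

lemma rep_cong_AE: "rep \<Omega> f g \<Longrightarrow> f' \<in> borel_measurable (lebesgue_on \<Omega>) \<Longrightarrow>
    AE x in lborel. x \<in> \<Omega> \<longrightarrow> f' x = f x \<Longrightarrow> rep \<Omega> f' g"
  unfolding rep_def by (auto elim: eventually_elim2)

lemma L2_rep: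
  assumes \<Omega>: "\<Omega> \<in> sets borel" and f: "f \<in> L2 \<Omega>"
  obtains g where "rep \<Omega> f g" "integrable lborel (\<lambda>x. (g x)\<^sup>2)"
proof -
  obtain g where g: "rep \<Omega> f g" using ex_rep[OF \<Omega>] f by (auto simp: L2_def)
  then have "integrable lborel (\<lambda>x. (g x)\<^sup>2)"
    using rep_integral(2)[OF \<Omega> rep_sq[OF g]] f by (auto simp: L2_def)
  then show ?thesis using that g by blast
qed

lemma L2_iff_rep:
  assumes \<Omega>: "\<Omega> \<in> sets borel" and g: "rep \<Omega> f g"
  shows "f \<in> L2 \<Omega> \<longleftrightarrow> integrable lborel (\<lambda>x. (g x)\<^sup>2)"
  using rep_integral(2)[OF \<Omega> rep_sq[OF g]] g by (auto simp: L2_def rep_def)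

lemma integrable_mult_L2:
  fixes f g :: "'a::euclidean_space \<Rightarrow> real"
  assumes [measurable]: "f \<in> borel_measurable borel" "g \<in> borel_measurable borel"
    and "integrable lborel (\<lambda>x. (f x)\<^sup>2)" "integrable lborel (\<lambda>x. (g x)\<^sup>2)"
  shows "integrable lborel (\<lambda>x. f x * g x)"
proof (rule Bochner_Integration.integrable_bound[OF Bochner_Integration.integrable_add[OF assms(3,4)]])
  show "AE x in lborel. norm (f x * g x) \<le> norm ((f x)\<^sup>2 + (g x)\<^sup>2)"
    by (intro AE_I2) (auto intro!: order_trans[OF abs_mult_le_sum_squares])
qed measurable

lemma integrable_diff_sq:
  fixes f g :: "'a::euclidean_space \<Rightarrow> real"
  assumes "f \<in> borel_measurable borel" "g \<in> borel_measurable borel"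
    and "integrable lborel (\<lambda>x. (f x)\<^sup>2)" "integrable lborel (\<lambda>x. (g x)\<^sup>2)"
  shows "integrable lborel (\<lambda>x. (f x - g x)\<^sup>2)"
proof -
  have "integrable lborel (\<lambda>x. (f x)\<^sup>2 + (g x)\<^sup>2 - 2 * (f x * g x))"
    using integrable_mult_L2[OF assms] assms(3,4) by simp
  then show ?thesis by (simp add: power2_diff mult.assoc)
qed

lemma test_sq_integrable: "\<phi> \<in> test_functions \<Omega> \<Longrightarrow> integrable lborel (\<lambda>x. (\<phi> x)\<^sup>2)"
  using bL2_sq[OF test_bL2] .

section \<open>Weak gradients\<close>

definition vector_rep :: "(real^'n) set \<Rightarrow> (real^'n \<Rightarrow> real^'n) \<Rightarrow> (real^'n \<Rightarrow> real^'n) \<Rightarrow> bool" where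
  "vector_rep \<Omega> G H \<longleftrightarrow> (\<forall>i. rep \<Omega> (\<lambda>x. G x $ i) (\<lambda>x. H x $ i))"

lemma vector_rep_AE: assumes "vector_rep \<Omega> G H" shows "AE x in lborel. x \<in> \<Omega> \<longrightarrow> G x = H x"
proof -
  have "AE x in lborel. \<forall>i. x \<in> \<Omega> \<longrightarrow> G x $ i = H x $ i"
    unfolding AE_all_countable using assms by (auto simp: vector_rep_def rep_def)
  then show ?thesis by eventually_elim (auto simp: vec_eq_iff)
qed

text \<open>
  The difference of two weak gradients is orthogonal to all test functions.
\<close>

lemma weak_gradient_unique:
  assumes \<Omega>: "open \<Omega>" and G: "is_weak_gradient \<Omega> u G" and H: "is_weak_gradient \<Omega> u H"
  shows "AE x in lborel. x \<in> \<Omega> \<longrightarrow> G x = H x"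
proof -
  have \<Omega>b: "\<Omega> \<in> sets borel" using \<Omega> by simp
  have "AE x in lborel. x \<in> \<Omega> \<longrightarrow> G x $ i = H x $ i" for i
  proof -
    have "(\<lambda>x. G x $ i) \<in> L2 \<Omega>" "(\<lambda>x. H x $ i) \<in> L2 \<Omega>" using G H by (auto simp: is_weak_gradient_def)
    then obtain g h where g: "rep \<Omega> (\<lambda>x. G x $ i) g" "integrable lborel (\<lambda>x. (g x)\<^sup>2)"
      and h: "rep \<Omega> (\<lambda>x. H x $ i) h" "integrable lborel (\<lambda>x. (h x)\<^sup>2)"
      using L2_rep[OF \<Omega>b] by metis
    have gb[measurable]: "g \<in> borel_measurable borel" and hb[measurable]: "h \<in> borel_measurable borel"
      using g(1) h(1) by (auto intro: rep_borel)
    have "AE x in lborel. x \<in> \<Omega> \<longrightarrow> g x - h x = 0"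
    proof (rule fundamental_lemma[OF _ \<Omega>])
      show "(\<lambda>x. g x - h x) \<in> borel_measurable borel" by measurable
      show "integrable lborel (\<lambda>x. indicator K x * (g x - h x))" if K: "compact K" "K \<subseteq> \<Omega>" for K
      proof (rule integrable_mult_L2[OF _ _ _ integrable_diff_sq[OF gb hb g(2) h(2)]])
        show "indicator K \<in> borel_measurable (borel :: (real^'a) measure)"
          using K by (intro borel_measurable_indicator borel_compact)
        have "integrable lborel (indicator K :: real^'a \<Rightarrow> real)"
          using K emeasure_compact_finite[OF K(1)] by (intro integrable_real_indicator) (auto simp: borel_compact)
        moreover have "(\<lambda>x. (indicator K x)\<^sup>2) = (indicator K :: real^'a \<Rightarrow> real)" by (auto simp: indicator_def)
        ultimately show "integrable lborel (\<lambda>x. (indicator K (x::real^'a) :: real)\<^sup>2)" by simp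
      qed measurable
      fix \<phi> assume \<phi>: "\<phi> \<in> test_functions \<Omega>"
      have \<phi>b: "\<phi> \<in> borel_measurable borel" using \<phi> by (rule test_functions_borel)
      note \<phi>i = test_sq_integrable[OF \<phi>]
      have "(\<integral>x. G x $ i * \<phi> x \<partial>lebesgue_on \<Omega>) = (\<integral>x. H x $ i * \<phi> x \<partial>lebesgue_on \<Omega>)"
      proof -
        have "- (\<integral>x. G x $ i * \<phi> x \<partial>lebesgue_on \<Omega>) = - (\<integral>x. H x $ i * \<phi> x \<partial>lebesgue_on \<Omega>)"
          using G H \<phi> unfolding is_weak_gradient_def by simp
        then show ?thesis by simp
      qed
      then have "(\<integral>x. g x * \<phi> x \<partial>lborel) = (\<integral>x. h x * \<phi> x \<partial>lborel)"
        using rep_integral(1)[OF \<Omega>b rep_mult[OF g(1) rep_test[OF \<phi>]]] rep_integral(1)[OF \<Omega>b rep_mult[OF h(1) rep_test[OF \<phi>]]] by simp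
      then show "(\<integral>x. (g x - h x) * \<phi> x \<partial>lborel) = 0"
        using integrable_mult_L2[OF gb \<phi>b g(2) \<phi>i] integrable_mult_L2[OF hb \<phi>b h(2) \<phi>i]
        by (simp add: left_diff_distrib)
    qed
    with rep_AE[OF g(1)] rep_AE[OF h(1)] show ?thesis by eventually_elim auto
  qed
  then have "AE x in lborel. \<forall>i. x \<in> \<Omega> \<longrightarrow> G x $ i = H x $ i" unfolding AE_all_countable by blast
  then show ?thesis by eventually_elim (auto simp: vec_eq_iff)
qed

lemma is_weak_gradient_weak_gradient: "is_weak_gradient \<Omega> u G \<Longrightarrow> is_weak_gradient \<Omega> u (weak_gradient \<Omega> u)"
  unfolding weak_gradient_def by (rule someI[where P="is_weak_gradient \<Omega> u"])

text \<open>
  Together with uniqueness this identifies the chosen weak gradient of a test function with the classical gradient almost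
  everywhere.
\<close>

lemma weak_gradient_test:
  assumes \<Omega>: "open \<Omega>" and \<phi>: "\<phi> \<in> test_functions \<Omega>"
  shows "is_weak_gradient \<Omega> \<phi> (grad \<phi>)"
proof -
  have \<Omega>b: "\<Omega> \<in> sets borel" using \<Omega> by simp
  have gi: "(\<lambda>x. grad \<phi> x $ i) = partial i \<phi>" for i by (simp add: grad_def)
  show ?thesis unfolding is_weak_gradient_def gi
  proof (intro conjI allI ballI)
    show "partial i \<phi> \<in> L2 \<Omega>" for i
      using L2_iff_rep[OF \<Omega>b rep_test[OF test_functions_partial[OF \<phi>]]] test_sq_integrable[OF test_functions_partial[OF \<phi>]] by blast
    fix \<psi> i assume \<psi>: "\<psi> \<in> test_functions \<Omega>"
    show "(\<integral>x. \<phi> x * partial i \<psi> x \<partial>lebesgue_on \<Omega>) = - (\<integral>x. grad \<phi> x $ i * \<psi> x \<partial>lebesgue_on \<Omega>)"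
      using integration_by_parts_test[OF \<phi> \<psi>, of i]
        rep_integral(1)[OF \<Omega>b rep_mult[OF rep_test[OF \<phi>] rep_test[OF test_functions_partial[OF \<psi>]]]]
        rep_integral(1)[OF \<Omega>b rep_mult[OF rep_test[OF test_functions_partial[OF \<phi>]] rep_test[OF \<psi>]]]
      by (simp add: grad_def)
  qed
qed

text \<open>
  This relates the distance in \<open>H1_norm\<close>, which is defined by the weak gradient of the difference, to the
  difference of the gradients.
\<close>

lemma weak_gradient_diff_test:
  assumes \<Omega>: "open \<Omega>" and u: "u \<in> L2 \<Omega>" "is_weak_gradient \<Omega> u G" and \<phi>: "\<phi> \<in> test_functions \<Omega>"
  shows "is_weak_gradient \<Omega> (\<lambda>x. u x - \<phi> x) (\<lambda>x. G x - grad \<phi> x)"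
proof -
  have \<Omega>b: "\<Omega> \<in> sets borel" using \<Omega> by simp
  obtain v where v: "rep \<Omega> u v" "integrable lborel (\<lambda>x. (v x)\<^sup>2)" using L2_rep[OF \<Omega>b u(1)] by blast
  have vb: "v \<in> borel_measurable borel" using v(1) by (rule rep_borel)
  note \<phi>w = weak_gradient_test[OF \<Omega> \<phi>]
  show ?thesis unfolding is_weak_gradient_def
  proof (intro conjI allI ballI)
    fix i
    have Gi: "(\<lambda>x. G x $ i) \<in> L2 \<Omega>" using u(2) by (simp add: is_weak_gradient_def)
    obtain g where g: "rep \<Omega> (\<lambda>x. G x $ i) g" "integrable lborel (\<lambda>x. (g x)\<^sup>2)" using L2_rep[OF \<Omega>b Gi] by blast
    have gb: "g \<in> borel_measurable borel" using g(1) by (rule rep_borel)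
    note pt = test_functions_partial[OF \<phi>, of i]
    have rd: "rep \<Omega> (\<lambda>x. (G x - grad \<phi> x) $ i) (\<lambda>x. g x - partial i \<phi> x)"
      using rep_diff[OF g(1) rep_test[OF pt]] by (simp add: grad_def)
    show "(\<lambda>x. (G x - grad \<phi> x) $ i) \<in> L2 \<Omega>"
      unfolding L2_iff_rep[OF \<Omega>b rd]
      by (rule integrable_diff_sq[OF gb test_functions_borel[OF pt] g(2) test_sq_integrable[OF pt]])
    fix \<psi> assume \<psi>: "\<psi> \<in> test_functions \<Omega>"
    note pp = test_functions_partial[OF \<psi>, of i]
    have b: "\<phi> \<in> borel_measurable borel" "\<psi> \<in> borel_measurable borel" "partial i \<psi> \<in> borel_measurable borel" "partial i \<phi> \<in> borel_measurable borel"
      using \<phi> \<psi> pt pp by (auto intro: test_functions_borel)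
    have "(\<integral>x. (u x - \<phi> x) * partial i \<psi> x \<partial>lebesgue_on \<Omega>) = (\<integral>x. (v x - \<phi> x) * partial i \<psi> x \<partial>lborel)"
      by (rule rep_integral(1)[OF \<Omega>b rep_mult[OF rep_diff[OF v(1) rep_test[OF \<phi>]] rep_test[OF pp]]])
    also have "\<dots> = (\<integral>x. v x * partial i \<psi> x \<partial>lborel) - (\<integral>x. \<phi> x * partial i \<psi> x \<partial>lborel)"
      using integrable_mult_L2[OF vb b(3) v(2) test_sq_integrable[OF pp]] integrable_mult_L2[OF b(1,3) test_sq_integrable[OF \<phi>] test_sq_integrable[OF pp]]
      by (simp add: left_diff_distrib)
    also have "(\<integral>x. v x * partial i \<psi> x \<partial>lborel) = (\<integral>x. u x * partial i \<psi> x \<partial>lebesgue_on \<Omega>)"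
      by (rule rep_integral(1)[OF \<Omega>b rep_mult[OF v(1) rep_test[OF pp]], symmetric])
    also have "\<dots> = - (\<integral>x. G x $ i * \<psi> x \<partial>lebesgue_on \<Omega>)" using u(2) \<psi> by (simp add: is_weak_gradient_def)
    also have "(\<integral>x. G x $ i * \<psi> x \<partial>lebesgue_on \<Omega>) = (\<integral>x. g x * \<psi> x \<partial>lborel)"
      by (rule rep_integral(1)[OF \<Omega>b rep_mult[OF g(1) rep_test[OF \<psi>]]])
    also have "(\<integral>x. \<phi> x * partial i \<psi> x \<partial>lborel) = - (\<integral>x. partial i \<phi> x * \<psi> x \<partial>lborel)"
      by (rule integration_by_parts_test[OF \<phi> \<psi>])
    also have "- (\<integral>x. g x * \<psi> x \<partial>lborel) - - (\<integral>x. partial i \<phi> x * \<psi> x \<partial>lborel) = - (\<integral>x. (g x - partial i \<phi> x) * \<psi> x \<partial>lborel)"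
      using integrable_mult_L2[OF gb b(2) g(2) test_sq_integrable[OF \<psi>]] integrable_mult_L2[OF b(4,2) test_sq_integrable[OF pt] test_sq_integrable[OF \<psi>]]
      by (simp add: left_diff_distrib)
    also have "(\<integral>x. (g x - partial i \<phi> x) * \<psi> x \<partial>lborel) = (\<integral>x. (G x - grad \<phi> x) $ i * \<psi> x \<partial>lebesgue_on \<Omega>)"
      by (rule rep_integral(1)[OF \<Omega>b rep_mult[OF rd rep_test[OF \<psi>]], symmetric])
    finally show "(\<integral>x. (u x - \<phi> x) * partial i \<psi> x \<partial>lebesgue_on \<Omega>) = - (\<integral>x. (G x - grad \<phi> x) $ i * \<psi> x \<partial>lebesgue_on \<Omega>)" .
  qed
qed

lemma weak_gradient_vector_rep:
  assumes \<Omega>: "open \<Omega>" and G: "is_weak_gradient \<Omega> u G"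
  obtains H where "vector_rep \<Omega> (weak_gradient \<Omega> u) H" "\<And>i. integrable lborel (\<lambda>x. (H x $ i)\<^sup>2)"
    "AE x in lborel. x \<in> \<Omega> \<longrightarrow> G x = H x"
proof -
  have \<Omega>b: "\<Omega> \<in> sets borel" using \<Omega> by simp
  note W = is_weak_gradient_weak_gradient[OF G]
  have "\<exists>h. rep \<Omega> (\<lambda>x. weak_gradient \<Omega> u x $ i) h \<and> integrable lborel (\<lambda>x. (h x)\<^sup>2)" for i
    using W L2_rep[OF \<Omega>b, of "\<lambda>x. weak_gradient \<Omega> u x $ i"] unfolding is_weak_gradient_def by metis
  then obtain h where h: "\<And>i. rep \<Omega> (\<lambda>x. weak_gradient \<Omega> u x $ i) (h i)" "\<And>i. integrable lborel (\<lambda>x. (h i x)\<^sup>2)" by metis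
  let ?H = "\<lambda>x. \<chi> i. h i x"
  have g: "vector_rep \<Omega> (weak_gradient \<Omega> u) ?H" using h by (simp add: vector_rep_def)
  have "AE x in lborel. x \<in> \<Omega> \<longrightarrow> G x = ?H x"
    using weak_gradient_unique[OF \<Omega> G W] vector_rep_AE[OF g] by eventually_elim auto
  then show ?thesis using that[of ?H] g h(2) by simp
qed

lemma norm_sq_eq_sum:
  fixes v :: "real^'n" shows "(norm v)\<^sup>2 = (\<Sum>i\<in>UNIV. (v $ i)\<^sup>2)"
  unfolding power2_norm_eq_inner by (simp add: inner_vec_def power2_eq_square)

lemma vector_rep_norm_sq: assumes "vector_rep \<Omega> G H" shows "rep \<Omega> (\<lambda>x. (norm (G x))\<^sup>2) (\<lambda>x. (norm (H x))\<^sup>2)"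
  unfolding norm_sq_eq_sum by (rule rep_sum) (use assms in \<open>auto intro: rep_sq simp: vector_rep_def\<close>)

lemma vector_rep_form:
  fixes A :: "real^'n^'n"
  assumes "vector_rep \<Omega> G H" shows "rep \<Omega> (\<lambda>x. (A *v G x) \<bullet> G x) (\<lambda>x. (A *v H x) \<bullet> H x)"
proof -
  have n: "(A *v v) \<bullet> v = (\<Sum>i\<in>UNIV. (\<Sum>j\<in>UNIV. A $ i $ j * v $ j) * v $ i)" for v :: "real^'n"
    by (simp add: inner_vec_def matrix_vector_mult_def)
  show ?thesis unfolding n
    by (intro rep_sum rep_mult rep_cmult) (use assms in \<open>auto simp: vector_rep_def\<close>)
qed

lemma H1_norm_rep:
  assumes \<Omega>: "open \<Omega>" and u: "rep \<Omega> u v" and g: "vector_rep \<Omega> (weak_gradient \<Omega> u) H"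
  shows "(H1_norm \<Omega> u)\<^sup>2 = (\<integral>x. (v x)\<^sup>2 \<partial>lborel) + (\<integral>x. (norm (H x))\<^sup>2 \<partial>lborel)"
proof -
  have \<Omega>b: "\<Omega> \<in> sets borel" using \<Omega> by simp
  have "0 \<le> (\<integral>x. (v x)\<^sup>2 \<partial>lborel)" "0 \<le> (\<integral>x. (norm (H x))\<^sup>2 \<partial>lborel)" by (auto intro!: integral_nonneg_AE)
  then show ?thesis unfolding H1_norm_def rep_integral(1)[OF \<Omega>b rep_sq[OF u]] rep_integral(1)[OF \<Omega>b vector_rep_norm_sq[OF g]]
    by (subst real_sqrt_pow2) auto
qed

lemma L2_norm_rep:
  assumes \<Omega>: "open \<Omega>" and u: "rep \<Omega> u v" shows "(L2_norm \<Omega> u)\<^sup>2 = (\<integral>x. (v x)\<^sup>2 \<partial>lborel)"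
proof -
  have \<Omega>b: "\<Omega> \<in> sets borel" using \<Omega> by simp
  have "0 \<le> (\<integral>x. (v x)\<^sup>2 \<partial>lborel)" by (auto intro!: integral_nonneg_AE)
  then show ?thesis unfolding L2_norm_def rep_integral(1)[OF \<Omega>b rep_sq[OF u]] by simp
qed

lemma weak_gradient_test_vector_rep:
  assumes \<Omega>: "open \<Omega>" and \<phi>: "\<phi> \<in> test_functions \<Omega>"
  shows "vector_rep \<Omega> (weak_gradient \<Omega> \<phi>) (grad \<phi>)"
proof -
  note W = is_weak_gradient_weak_gradient[OF weak_gradient_test[OF \<Omega> \<phi>]]
  have ae: "AE x in lborel. x \<in> \<Omega> \<longrightarrow> weak_gradient \<Omega> \<phi> x = grad \<phi> x"
    by (rule weak_gradient_unique[OF \<Omega> W weak_gradient_test[OF \<Omega> \<phi>]])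
  show ?thesis unfolding vector_rep_def
  proof
    fix i
    have r: "rep \<Omega> (\<lambda>x. grad \<phi> x $ i) (\<lambda>x. grad \<phi> x $ i)"
      using rep_test[OF test_functions_partial[OF \<phi>, of i]] by (simp add: grad_def)
    show "rep \<Omega> (\<lambda>x. weak_gradient \<Omega> \<phi> x $ i) (\<lambda>x. grad \<phi> x $ i)"
    proof (rule rep_cong_AE[OF r])
      show "(\<lambda>x. weak_gradient \<Omega> \<phi> x $ i) \<in> borel_measurable (lebesgue_on \<Omega>)"
        using W by (auto simp: is_weak_gradient_def L2_def)
      show "AE x in lborel. x \<in> \<Omega> \<longrightarrow> weak_gradient \<Omega> \<phi> x $ i = grad \<phi> x $ i" using ae by eventually_elim auto
    qed
  qed
qed

lemma test_in_H1_0: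
  fixes \<phi> :: "real^'n \<Rightarrow> real"
  assumes \<Omega>: "open \<Omega>" and \<phi>: "\<phi> \<in> test_functions \<Omega>" shows "\<phi> \<in> H1_0 \<Omega>"
proof -
  have \<Omega>b: "\<Omega> \<in> sets borel" using \<Omega> by simp
  have L: "\<phi> \<in> L2 \<Omega>" using L2_iff_rep[OF \<Omega>b rep_test[OF \<phi>]] test_sq_integrable[OF \<phi>] by blast
  have H: "\<phi> \<in> H1 \<Omega>" using L weak_gradient_test[OF \<Omega> \<phi>] by (auto simp: H1_def)
  have z: "(\<lambda>x. 0) \<in> test_functions \<Omega>" using test_functions_cmult[OF \<phi>, of 0] by simp
  have "(H1_norm \<Omega> (\<lambda>x. 0))\<^sup>2 = (\<integral>x. 0\<^sup>2 \<partial>(lborel :: (real^'n) measure)) + (\<integral>x. (norm (grad (\<lambda>x::real^'n. 0) x))\<^sup>2 \<partial>lborel)"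
    by (rule H1_norm_rep[OF \<Omega> rep_zero weak_gradient_test_vector_rep[OF \<Omega> z]])
  also have "grad (\<lambda>x. 0) = (\<lambda>x::real^'n. 0)"
    by (auto simp: grad_def fun_eq_iff vec_eq_iff partial_eq[OF has_derivative_const])
  finally have "H1_norm \<Omega> (\<lambda>x. 0) = 0" by simp
  then show ?thesis using H \<phi> unfolding H1_0_def by (auto intro!: bexI[of _ \<phi>])
qed

section \<open>Compactly supported trial functions\<close>

lemma divide_mult_cancel_right: "x > 0 \<Longrightarrow> d / (k * x) * x = d / (k::real)" by simp

context heat_vec
begin

text \<open>
  Split \<open>a = f + (a - f)\<close>. The energy of the difference is at most twice its squared norm, and only the case
  \<open>E t f \<le> E t a\<close> needs an argument, in which the factor \<open>1 + \<theta>\<close> costs at most \<open>\<theta> E t a\<close>.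
\<close>

lemma E_lower_semicontinuous:
  assumes a: "bL2 a" and d: "d > 0"
  shows "\<exists>\<eta>>0. \<forall>f. bL2 f \<longrightarrow> ip (\<lambda>x. a x - f x) (\<lambda>x. a x - f x) \<le> \<eta> \<longrightarrow> E t a \<le> E t f + d"
proof -
  define \<theta> where "\<theta> = d / (2 * (E t a + 1))"
  have Ea: "0 \<le> E t a" by (rule E_nonneg[OF a])
  have \<theta>: "\<theta> > 0" using Ea d by (simp add: \<theta>_def)
  define \<eta> where "\<eta> = d / (4 * (1 + 1 / \<theta>))"
  have \<eta>: "\<eta> > 0" using \<theta> d unfolding \<eta>_def by (intro divide_pos_pos mult_pos_pos add_pos_pos) auto
  have \<eta>2: "(1 + 1 / \<theta>) * (2 * \<eta>) = d / 2"
  proof -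
    have "1 + 1 / \<theta> \<noteq> 0" using \<theta> by (smt (verit) divide_pos_pos)
    moreover have "q * (2 * (d / (4 * q))) = d / 2" if "q \<noteq> 0" for q using that by simp
    ultimately show ?thesis unfolding \<eta>_def by blast
  qed
  have "E t a \<le> E t f + d" if f: "bL2 f" and le: "ip (\<lambda>x. a x - f x) (\<lambda>x. a x - f x) \<le> \<eta>" for f
  proof (cases "E t a \<le> E t f")
    case True then show ?thesis using d by linarith
  next
    case False
    have b: "bL2 (\<lambda>x. a x - f x)" by (rule bL2_diff[OF a f])
    have "E t (\<lambda>x. f x + (a x - f x)) \<le> (1 + \<theta>) * E t f + (1 + 1 / \<theta>) * E t (\<lambda>x. a x - f x)"
      by (rule E_add_le[OF f b \<theta>])
    then have 1: "E t a \<le> (1 + \<theta>) * E t f + (1 + 1 / \<theta>) * E t (\<lambda>x. a x - f x)" by simp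
    have "(1 + 1 / \<theta>) * E t (\<lambda>x. a x - f x) \<le> (1 + 1 / \<theta>) * (2 * \<eta>)"
      using E_le_2[OF b, of t] le \<theta> by (intro mult_left_mono) (auto intro: add_nonneg_nonneg)
    moreover have "\<theta> * E t f \<le> \<theta> * (E t a + 1)" using False \<theta> by (intro mult_left_mono) auto
    moreover have "\<theta> * (E t a + 1) = d / 2" unfolding \<theta>_def using Ea by (intro divide_mult_cancel_right) linarith
    ultimately have "E t a \<le> E t f + d / 2 + d / 2" using 1 \<eta>2 by (simp add: distrib_right)
    then show ?thesis by simp
  qed
  then show ?thesis using \<eta> by blast
qed

lemma S_le: "S \<xi> \<le> (\<Sum>v\<leftarrow>vs. (norm v)\<^sup>2) * (norm \<xi>)\<^sup>2"
proof -
  have "(v \<bullet> \<xi>)\<^sup>2 \<le> (norm v)\<^sup>2 * (norm \<xi>)\<^sup>2" for v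
    using Cauchy_Schwarz_ineq[of v \<xi>] by (simp add: power2_norm_eq_inner)
  then have "S \<xi> \<le> (\<Sum>v\<leftarrow>vs. (norm v)\<^sup>2 * (norm \<xi>)\<^sup>2)" unfolding S_def by (intro sum_list_mono)
  then show ?thesis by (simp add: sum_list_mult_const)
qed

lemma S_add_le:
  assumes "c > 0" shows "S (\<xi> + \<zeta>) \<le> (1 + c) * S \<xi> + (1 + 1 / c) * S \<zeta>"
proof -
  have "S (\<xi> + \<zeta>) \<le> (\<Sum>v\<leftarrow>vs. (1 + c) * (v \<bullet> \<xi>)\<^sup>2 + (1 + 1 / c) * (v \<bullet> \<zeta>)\<^sup>2)"
    unfolding S_def inner_add_right by (intro sum_list_mono square_sum_le_weighted assms)
  then show ?thesis by (simp add: S_def sum_list_addf sum_list_const_mult)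
qed

lemma S_measurable:
  fixes G :: "real^'n \<Rightarrow> real^'n"
  assumes [measurable]: "G \<in> borel_measurable borel" shows "(\<lambda>x. S (G x)) \<in> borel_measurable borel"
proof -
  have "S \<in> borel_measurable borel" by (rule borel_measurable_continuous_onI[OF S_continuous])
  then show ?thesis by measurable
qed

lemma S_integrable:
  fixes G :: "real^'n \<Rightarrow> real^'n"
  assumes m: "G \<in> borel_measurable borel" and i: "integrable lborel (\<lambda>x. (norm (G x))\<^sup>2)"
  shows "integrable lborel (\<lambda>x. S (G x))"
proof (rule Bochner_Integration.integrable_bound)
  show "integrable lborel (\<lambda>x. (\<Sum>v\<leftarrow>vs. (norm v)\<^sup>2) * (norm (G x))\<^sup>2)" using i by simp
  show "AE x in lborel. norm (S (G x)) \<le> norm ((\<Sum>v\<leftarrow>vs. (norm v)\<^sup>2) * (norm (G x))\<^sup>2)"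
    using S_le S_nonneg by (intro AE_I2) (metis abs_of_nonneg order_trans real_norm_def abs_ge_self)
qed (use S_measurable[OF m] in simp)

lemma S_integral_stable:
  fixes G :: "real^'n \<Rightarrow> real^'n"
  assumes m: "G \<in> borel_measurable borel" and i: "integrable lborel (\<lambda>x. (norm (G x))\<^sup>2)" and d: "d > 0"
  shows "\<exists>\<eta>>0. \<forall>H. H \<in> borel_measurable borel \<longrightarrow> integrable lborel (\<lambda>x. (norm (G x - H x))\<^sup>2) \<longrightarrow>
     (\<integral>x. (norm (G x - H x))\<^sup>2 \<partial>lborel) \<le> \<eta> \<longrightarrow> (\<integral>x. S (H x) \<partial>lborel) \<le> (\<integral>x. S (G x) \<partial>lborel) + d"
proof -
  define a where "a = (\<integral>x. S (G x) \<partial>lborel)"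
  define C where "C = (\<Sum>v\<leftarrow>vs. (norm v)\<^sup>2)"
  have a: "0 \<le> a" unfolding a_def by (intro integral_nonneg_AE AE_I2 S_nonneg)
  have C: "0 \<le> C" unfolding C_def by (intro sum_list_nonneg) auto
  define \<theta> where "\<theta> = d / (2 * (a + 1))"
  have \<theta>: "\<theta> > 0" using a d by (simp add: \<theta>_def)
  define k where "k = (1 + 1 / \<theta>) * (C + 1)"
  have k: "k > 0" using \<theta> C unfolding k_def by (intro mult_pos_pos add_pos_pos add_nonneg_pos) auto
  have "(\<integral>x. S (H x) \<partial>lborel) \<le> a + d"
    if H: "H \<in> borel_measurable borel" and iH: "integrable lborel (\<lambda>x. (norm (G x - H x))\<^sup>2)"
      and le: "(\<integral>x. (norm (G x - H x))\<^sup>2 \<partial>lborel) \<le> d / (2 * k)" for H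
  proof -
    have [measurable]: "G \<in> borel_measurable borel" "H \<in> borel_measurable borel" using m H by auto
    have "(\<integral>x. S (H x) \<partial>lborel) \<le> (\<integral>x. (1 + \<theta>) * S (G x) + k * (norm (G x - H x))\<^sup>2 \<partial>lborel)"
    proof (rule integral_mono_AE')
      show "integrable lborel (\<lambda>x. (1 + \<theta>) * S (G x) + k * (norm (G x - H x))\<^sup>2)"
        using S_integrable[OF m i] iH by simp
      show "AE x in lborel. S (H x) \<le> (1 + \<theta>) * S (G x) + k * (norm (G x - H x))\<^sup>2"
      proof (intro AE_I2)
        fix x
        have "S (H x) \<le> (1 + \<theta>) * S (G x) + (1 + 1 / \<theta>) * S (H x - G x)"
          using S_add_le[OF \<theta>, of "G x" "H x - G x"] by simp
        also have "(1 + 1 / \<theta>) * S (H x - G x) \<le> (1 + 1 / \<theta>) * (C * (norm (G x - H x))\<^sup>2)"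
          using S_le[of "H x - G x"] \<theta> by (intro mult_left_mono) (auto simp: C_def norm_minus_commute intro: add_nonneg_nonneg)
        also have "\<dots> \<le> k * (norm (G x - H x))\<^sup>2"
        proof -
          have "(1 + 1 / \<theta>) * C \<le> k" unfolding k_def using \<theta> by (intro mult_left_mono) (auto intro: add_nonneg_nonneg)
          from mult_right_mono[OF this, of "(norm (G x - H x))\<^sup>2"] show ?thesis by (simp add: mult.assoc)
        qed
        finally show "S (H x) \<le> (1 + \<theta>) * S (G x) + k * (norm (G x - H x))\<^sup>2" by simp
      qed
    qed (use S_nonneg \<theta> k in \<open>auto intro!: AE_I2 add_nonneg_nonneg mult_nonneg_nonneg\<close>)
    also have "\<dots> = (1 + \<theta>) * a + k * (\<integral>x. (norm (G x - H x))\<^sup>2 \<partial>lborel)"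
      using S_integrable[OF m i] iH by (simp add: a_def)
    also have "\<dots> \<le> (1 + \<theta>) * a + k * (d / (2 * k))" using le k by (intro add_left_mono mult_left_mono) auto
    also have "\<dots> = a + \<theta> * a + d / 2" using k by (simp add: distrib_right)
    also have "\<theta> * a \<le> \<theta> * (a + 1)" using \<theta> by (intro mult_left_mono) auto
    also have "\<theta> * (a + 1) = d / 2" unfolding \<theta>_def using a by (intro divide_mult_cancel_right) linarith
    finally show ?thesis by simp
  qed
  moreover have "d / (2 * k) > 0" using d k by simp
  ultimately show ?thesis unfolding a_def by blast
qed

lemma truncated_mass:
  fixes v :: "real^'n \<Rightarrow> real"
  assumes [measurable]: "v \<in> borel_measurable borel" and i: "integrable lborel (\<lambda>x. (v x)\<^sup>2)" and d: "d > 0"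
  shows "\<exists>N::nat. (\<integral>x. (v x)\<^sup>2 \<partial>lborel) - d < (\<integral>x. (min \<bar>v x\<bar> (real N))\<^sup>2 \<partial>lborel)"
proof -
  have "(\<lambda>N. \<integral>x. (min \<bar>v x\<bar> (real N))\<^sup>2 \<partial>lborel) \<longlonglongrightarrow> (\<integral>x. (v x)\<^sup>2 \<partial>lborel)"
  proof (rule integral_dominated_convergence[where w="\<lambda>x. (v x)\<^sup>2"])
    show "AE x in lborel. (\<lambda>N. (min \<bar>v x\<bar> (real N))\<^sup>2) \<longlonglongrightarrow> (v x)\<^sup>2"
    proof (intro AE_I2)
      fix x
      have "eventually (\<lambda>N. \<bar>v x\<bar> \<le> real N) sequentially"
        by (metis eventually_at_top_linorder nat_ceiling_le_eq)
      then have "eventually (\<lambda>N. (v x)\<^sup>2 = (min \<bar>v x\<bar> (real N))\<^sup>2) sequentially"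
        by eventually_elim (simp add: min_def)
      then show "(\<lambda>N. (min \<bar>v x\<bar> (real N))\<^sup>2) \<longlonglongrightarrow> (v x)\<^sup>2"
        by (rule Lim_transform_eventually[OF tendsto_const])
    qed
    show "AE x in lborel. norm ((min \<bar>v x\<bar> (real N))\<^sup>2) \<le> (v x)\<^sup>2" for N
      by (intro AE_I2) (simp add: abs_le_square_iff[symmetric])
  qed (use i in auto)
  then have "eventually (\<lambda>N. (\<integral>x. (v x)\<^sup>2 \<partial>lborel) - d < (\<integral>x. (min \<bar>v x\<bar> (real N))\<^sup>2 \<partial>lborel)) sequentially"
    by (rule order_tendstoD) (use d in simp)
  then show ?thesis by (auto simp: eventually_sequentially)
qed

text \<open>
  Let \<open>a\<close> be \<open>\<bar>v\<bar>\<close> truncated at height \<open>N\<close> and \<open>b\<close> the same for a test function \<open>\<phi>\<close> close to \<open>v\<close>; put \<open>w = min a b\<close> and \<open>u = max a b\<close>.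
  Support and size of \<open>w\<close> are clear. For the energies at time \<open>1 / 2 ^ j\<close>, scaled by \<open>2 ^ j\<close>, submodularity gives
  \<open>e\<^sub>j(w) \<le> e\<^sub>j(a) + e\<^sub>j(b) - e\<^sub>j(u)\<close>. Here \<open>e\<^sub>j(b)\<close> is at most half the integral of \<open>S (grad \<phi>)\<close>, which is close to half
  that of \<open>S G\<close>; it remains to see that \<open>e\<^sub>j(u)\<close> is not much smaller than \<open>e\<^sub>j(a)\<close>. The numbers \<open>e\<^sub>j(a)\<close> increase and are bounded, so some
  \<open>J\<close> satisfies \<open>e\<^sub>j(a) \<le> e\<^sub>J(a) + d / 3\<close> for all \<open>j\<close>. After \<open>J\<close> is fixed, \<open>\<phi>\<close> is chosen so close to \<open>v\<close> that
  \<open>e\<^sub>J(u) \<ge> e\<^sub>J(a) - d / 3\<close>, and \<open>e\<^sub>j(u) \<ge> e\<^sub>J(u)\<close> for \<open>j \<ge> J\<close>.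
\<close>

lemma trial_function:
  fixes v :: "real^'n \<Rightarrow> real" and G :: "real^'n \<Rightarrow> real^'n"
  assumes vm[measurable]: "v \<in> borel_measurable borel" and vi: "integrable lborel (\<lambda>x. (v x)\<^sup>2)"
    and Gm[measurable]: "G \<in> borel_measurable borel" and Gi: "integrable lborel (\<lambda>x. (norm (G x))\<^sup>2)"
    and approx: "\<And>\<eta>. \<eta> > 0 \<Longrightarrow> \<exists>\<phi>\<in>test_functions \<Omega>. (\<integral>x. (v x - \<phi> x)\<^sup>2 \<partial>lborel) \<le> \<eta> \<and>
       integrable lborel (\<lambda>x. (norm (G x - grad \<phi> x))\<^sup>2) \<and> (\<integral>x. (norm (G x - grad \<phi> x))\<^sup>2 \<partial>lborel) \<le> \<eta>"
    and d: "d > 0"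
  obtains w K J where "bL2 w" "\<And>x. 0 \<le> w x" "\<And>x. w x \<le> \<bar>v x\<bar>" "compact K" "K \<subseteq> \<Omega>" "\<And>x. x \<notin> K \<Longrightarrow> w x = 0"
    "(\<integral>x. (v x)\<^sup>2 \<partial>lborel) - d \<le> ip w w" "\<And>j. j \<ge> J \<Longrightarrow> E (1 / 2 ^ j) w \<le> ((1/2) * (\<integral>x. S (G x) \<partial>lborel) + d) / 2 ^ j"
proof -
  define a0 where "a0 = (1/2) * (\<integral>x. S (G x) \<partial>lborel)"
  define U where "U = (\<integral>x. (v x)\<^sup>2 \<partial>lborel)"
  have U: "0 \<le> U" unfolding U_def by (intro integral_nonneg_AE AE_I2) auto
  obtain N :: nat where N: "U - d / 2 < (\<integral>x. (min \<bar>v x\<bar> (real N))\<^sup>2 \<partial>lborel)"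
    using truncated_mass[OF vm vi, of "d / 2"] d unfolding U_def by auto
  define tr where "tr s = min \<bar>s\<bar> (real N)" for s :: real
  have tr_m[measurable]: "tr \<in> borel_measurable borel" unfolding tr_def[abs_def] by measurable
  have tr: "0 \<le> tr s" "tr s \<le> \<bar>s\<bar>" "tr s \<le> real N" "\<bar>tr s - tr s'\<bar> \<le> \<bar>s - s'\<bar>" for s s'
    by (auto simp: tr_def min_def)
  define a where "a x = tr (v x)" for x
  have am[measurable]: "a \<in> borel_measurable borel" unfolding a_def[abs_def] by measurable
  have a: "bL2 a" unfolding bL2_def
  proof (intro conjI exI allI)
    show "\<bar>a x\<bar> \<le> real N" for x using tr(1,3)[of "v x"] by (simp add: a_def)
    show "integrable lborel (\<lambda>x. (a x)\<^sup>2)"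
      by (rule Bochner_Integration.integrable_bound[OF vi])
        (use tr(1,2) in \<open>auto simp: a_def abs_le_square_iff[symmetric]\<close>)
  qed (rule am)
  have aa: "U - d / 2 < ip a a" using N by (simp add: ip_self a_def tr_def)
  have aU: "ip a a \<le> U" unfolding ip_self U_def
    by (rule integral_mono[OF bL2_sq[OF a] vi]) (use tr(1,2) in \<open>auto simp: a_def abs_le_square_iff[symmetric]\<close>)
  have tr_test: "bL2 (\<lambda>x. tr (\<phi> x))" if \<phi>: "\<phi> \<in> test_functions \<Omega>" for \<phi>
  proof -
    have [measurable]: "\<phi> \<in> borel_measurable borel" using \<phi> by (rule test_functions_borel)
    show ?thesis by (rule bL2_bound[OF test_bL2[OF \<phi>], where c=1]) (use tr(1,2) in auto)
  qed
  have tr_E: "E (1 / 2 ^ j) (\<lambda>x. tr (\<phi> x)) \<le> (1/2) * (\<integral>x. S (grad \<phi> x) \<partial>lborel) / 2 ^ j" if \<phi>: "\<phi> \<in> test_functions \<Omega>" for \<phi> and j :: nat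
  proof -
    have "E (1 / 2 ^ j) (\<lambda>x. tr (\<phi> x)) \<le> E (1 / 2 ^ j) \<phi>"
      by (rule E_contraction[OF test_bL2[OF \<phi>] tr_test[OF \<phi>] tr(4)])
    moreover have "2 * E (1 / 2 ^ j) \<phi> \<le> 1 / 2 ^ j * (\<integral>x. S (grad \<phi> x) \<partial>lborel)" by (rule E_test_le[OF \<phi>]) simp
    ultimately show ?thesis by simp
  qed
  have tr_diff: "ip (\<lambda>x. a x - tr (\<phi> x)) (\<lambda>x. a x - tr (\<phi> x)) \<le> (\<integral>x. (v x - \<phi> x)\<^sup>2 \<partial>lborel)" if \<phi>: "\<phi> \<in> test_functions \<Omega>" for \<phi>
    unfolding ip_self
  proof (rule integral_mono[OF bL2_sq[OF bL2_diff[OF a tr_test[OF \<phi>]]]])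
    show "integrable lborel (\<lambda>x. (v x - \<phi> x)\<^sup>2)"
      by (rule integrable_diff_sq[OF vm test_functions_borel[OF \<phi>] vi test_sq_integrable[OF \<phi>]])
    show "(a x - tr (\<phi> x))\<^sup>2 \<le> (v x - \<phi> x)\<^sup>2" for x
      using tr(4)[of "v x" "\<phi> x"] by (simp add: a_def abs_le_square_iff[symmetric])
  qed
  have approx2: "\<exists>\<phi>\<in>test_functions \<Omega>. ip (\<lambda>x. a x - tr (\<phi> x)) (\<lambda>x. a x - tr (\<phi> x)) \<le> \<eta> \<and>
      (1/2) * (\<integral>x. S (grad \<phi> x) \<partial>lborel) \<le> a0 + e" if \<eta>: "\<eta> > 0" and e: "e > 0" for \<eta> e
  proof -
    obtain \<eta>' where \<eta>': "\<eta>' > 0" "\<And>H. H \<in> borel_measurable borel \<Longrightarrow> integrable lborel (\<lambda>x. (norm (G x - H x))\<^sup>2) \<Longrightarrow>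
     (\<integral>x. (norm (G x - H x))\<^sup>2 \<partial>lborel) \<le> \<eta>' \<Longrightarrow> (\<integral>x. S (H x) \<partial>lborel) \<le> (\<integral>x. S (G x) \<partial>lborel) + e"
      using S_integral_stable[OF Gm Gi e] by blast
    obtain \<phi> where \<phi>: "\<phi> \<in> test_functions \<Omega>" "(\<integral>x. (v x - \<phi> x)\<^sup>2 \<partial>lborel) \<le> min \<eta> \<eta>'"
       "integrable lborel (\<lambda>x. (norm (G x - grad \<phi> x))\<^sup>2)" "(\<integral>x. (norm (G x - grad \<phi> x))\<^sup>2 \<partial>lborel) \<le> min \<eta> \<eta>'"
      using approx[of "min \<eta> \<eta>'"] \<eta> \<eta>'(1) by auto
    have "(\<integral>x. S (grad \<phi> x) \<partial>lborel) \<le> (\<integral>x. S (G x) \<partial>lborel) + e"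
      by (rule \<eta>'(2)[OF grad_borel[OF \<phi>(1)] \<phi>(3)]) (use \<phi>(4) in simp)
    then have "(1/2) * (\<integral>x. S (grad \<phi> x) \<partial>lborel) \<le> a0 + e" using e by (simp add: a0_def)
    moreover have "ip (\<lambda>x. a x - tr (\<phi> x)) (\<lambda>x. a x - tr (\<phi> x)) \<le> \<eta>" using tr_diff[OF \<phi>(1)] \<phi>(2) by simp
    ultimately show ?thesis using \<phi>(1) by blast
  qed
  define e where "e j = 2 ^ j * E (1 / 2 ^ j) a" for j :: nat
  (* Lower semicontinuity at a fixed time, along test functions that approximate v. *)
  have e_le: "e j \<le> a0" for j
  proof (rule field_le_epsilon)
    fix \<epsilon> :: real assume \<epsilon>: "\<epsilon> > 0"
    then have \<epsilon>': "\<epsilon> / 2 / 2 ^ j > 0" by simp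
    obtain \<eta> where \<eta>: "\<eta> > 0" "\<And>f. bL2 f \<Longrightarrow> ip (\<lambda>x. a x - f x) (\<lambda>x. a x - f x) \<le> \<eta> \<Longrightarrow> E (1 / 2 ^ j) a \<le> E (1 / 2 ^ j) f + \<epsilon> / 2 / 2 ^ j"
      using E_lower_semicontinuous[OF a \<epsilon>'] by blast
    obtain \<phi> where \<phi>: "\<phi> \<in> test_functions \<Omega>" "ip (\<lambda>x. a x - tr (\<phi> x)) (\<lambda>x. a x - tr (\<phi> x)) \<le> \<eta>"
        "(1/2) * (\<integral>x. S (grad \<phi> x) \<partial>lborel) \<le> a0 + \<epsilon> / 2" using approx2[OF \<eta>(1), of "\<epsilon> / 2"] \<epsilon> by auto
    have "E (1 / 2 ^ j) a \<le> (1/2) * (\<integral>x. S (grad \<phi> x) \<partial>lborel) / 2 ^ j + \<epsilon> / 2 / 2 ^ j"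
      using \<eta>(2)[OF tr_test[OF \<phi>(1)] \<phi>(2)] tr_E[OF \<phi>(1), of j] by linarith
    also have "\<dots> \<le> (a0 + \<epsilon> / 2) / 2 ^ j + \<epsilon> / 2 / 2 ^ j"
      using \<phi>(3) by (intro add_right_mono divide_right_mono) auto
    also have "\<dots> = (a0 + \<epsilon>) / 2 ^ j" by (simp add: add_divide_distrib)
    finally show "e j \<le> a0 + \<epsilon>" by (simp add: e_def pos_le_divide_eq mult.commute)
  qed
  (* Halving the time does not decrease the energy per unit of time. *)
  have e_mono: "2 ^ j * E (1 / 2 ^ j) f \<le> 2 ^ (j + i) * E (1 / 2 ^ (j + i)) f" if f: "bL2 f" for f and i j :: nat
  proof (induction i)
    case (Suc i)
    have "E (2 * (1 / 2 ^ Suc (j + i))) f \<le> 2 * E (1 / 2 ^ Suc (j + i)) f" by (rule E_double_le[OF f]) simp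
    then have "E (1 / 2 ^ (j + i)) f \<le> 2 * E (1 / 2 ^ Suc (j + i)) f" by simp
    then have "2 ^ (j + i) * E (1 / 2 ^ (j + i)) f \<le> 2 ^ (j + i) * (2 * E (1 / 2 ^ Suc (j + i)) f)" by (intro mult_left_mono) auto
    also have "\<dots> = 2 ^ (j + Suc i) * E (1 / 2 ^ (j + Suc i)) f" by simp
    finally show ?case using Suc by linarith
  qed simp
  have e_bdd: "bdd_above (range e)" using e_le by (intro bdd_aboveI[of _ a0]) auto
  define d3 where "d3 = d / 3"
  have d3: "d3 > 0" using d by (simp add: d3_def)
  obtain J where J: "(SUP j. e j) - d3 < e J" using less_cSupD[of "range e" "(SUP j. e j) - d3"] d3 by auto
  have e_sup: "e j \<le> (SUP j. e j)" for j using e_bdd by (rule cSUP_upper2[of _ _ j]) auto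
  have "d3 / 2 ^ J > 0" using d3 by simp
  from E_lower_semicontinuous[OF a this, of "1 / 2 ^ J"]
  obtain \<eta>1 where \<eta>1: "\<eta>1 > 0" "\<And>f. bL2 f \<Longrightarrow> ip (\<lambda>x. a x - f x) (\<lambda>x. a x - f x) \<le> \<eta>1 \<Longrightarrow> E (1 / 2 ^ J) a \<le> E (1 / 2 ^ J) f + d3 / 2 ^ J"
    by blast
  define s where "s = d / (4 * (U + 1))"
  have s: "s > 0" using d U by (simp add: s_def)
  define \<eta> where "\<eta> = min \<eta>1 (s * (d / 4))"
  have \<eta>: "\<eta> > 0" using \<eta>1(1) s d by (simp add: \<eta>_def)
  obtain \<phi> where \<phi>: "\<phi> \<in> test_functions \<Omega>" "ip (\<lambda>x. a x - tr (\<phi> x)) (\<lambda>x. a x - tr (\<phi> x)) \<le> \<eta>"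
        "(1/2) * (\<integral>x. S (grad \<phi> x) \<partial>lborel) \<le> a0 + d3" using approx2[OF \<eta> d3] by auto
  define b where "b x = tr (\<phi> x)" for x
  have b: "bL2 b" unfolding b_def[abs_def] by (rule tr_test[OF \<phi>(1)])
  have ab: "ip (\<lambda>x. a x - b x) (\<lambda>x. a x - b x) \<le> \<eta>" using \<phi>(2) by (simp add: b_def)
  define w where "w x = min (a x) (b x)" for x
  define u where "u x = max (a x) (b x)" for x
  have w: "bL2 w" unfolding w_def[abs_def] by (rule bL2_min[OF a b])
  have u: "bL2 u" unfolding u_def[abs_def] by (rule bL2_max[OF a b])
  show ?thesis
  proof (rule that[of w "supp \<phi>" J])
    show "bL2 w" by (rule w)
    show "0 \<le> w x" "w x \<le> \<bar>v x\<bar>" for x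
      using tr(1)[of "v x"] tr(1)[of "\<phi> x"] tr(2)[of "v x"] by (auto simp: w_def a_def b_def)
    show "compact (supp \<phi>)" "supp \<phi> \<subseteq> \<Omega>" using test_functions_supp(1,2)[OF \<phi>(1)] by auto
    show "w x = 0" if "x \<notin> supp \<phi>" for x
      using test_functions_supp(3)[OF \<phi>(1) that] tr(1)[of "v x"] by (simp add: w_def a_def b_def tr_def)
    show "(\<integral>x. (v x)\<^sup>2 \<partial>lborel) - d \<le> ip w w"
    proof -
      (* The minimum loses at most a - b, and the mixed term is absorbed with weight s. *)
      have pw: "(1 - s) * (a x)\<^sup>2 - (a x - b x)\<^sup>2 / s \<le> (w x)\<^sup>2" for x
      proof (cases "b x \<le> a x")
        case True
        have "0 \<le> (s * a x - (a x - b x))\<^sup>2 / s" using s by simp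
        also have "\<dots> = s * (a x)\<^sup>2 - 2 * a x * (a x - b x) + (a x - b x)\<^sup>2 / s"
          using s by (simp add: field_simps power2_eq_square)
        finally have "(1 - s) * (a x)\<^sup>2 - (a x - b x)\<^sup>2 / s \<le> (a x)\<^sup>2 - 2 * a x * (a x - b x)" by (simp add: left_diff_distrib)
        also have "\<dots> \<le> (b x)\<^sup>2" using zero_le_power2[of "a x - b x"] by (simp add: power2_eq_square algebra_simps)
        finally show ?thesis using True by (simp add: w_def)
      next
        case False
        have "(1 - s) * (a x)\<^sup>2 \<le> 1 * (a x)\<^sup>2" using s by (intro mult_right_mono) auto
        moreover have "0 \<le> (a x - b x)\<^sup>2 / s" using s by simp
        ultimately show ?thesis using False by (simp add: w_def)
      qed
      have i: "integrable lborel (\<lambda>x. (a x - b x)\<^sup>2)" by (rule bL2_sq[OF bL2_diff[OF a b]])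
      have "(\<integral>x. (1 - s) * (a x)\<^sup>2 - (a x - b x)\<^sup>2 / s \<partial>lborel) \<le> ip w w"
        unfolding ip_self by (rule integral_mono[OF _ bL2_sq[OF w] pw]) (use bL2_sq[OF a] i in simp)
      also have "(\<integral>x. (1 - s) * (a x)\<^sup>2 - (a x - b x)\<^sup>2 / s \<partial>lborel) = (1 - s) * ip a a - ip (\<lambda>x. a x - b x) (\<lambda>x. a x - b x) / s"
        using bL2_sq[OF a] i by (simp add: ip_self)
      finally have 1: "ip a a - s * ip a a - ip (\<lambda>x. a x - b x) (\<lambda>x. a x - b x) / s \<le> ip w w" by (simp add: left_diff_distrib)
      have "ip (\<lambda>x. a x - b x) (\<lambda>x. a x - b x) / s \<le> d / 4"
        using ab s by (simp add: \<eta>_def pos_divide_le_eq mult.commute)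
      moreover have "s * ip a a \<le> s * (U + 1)" using aU s by (intro mult_left_mono) auto
      moreover have "s * (U + 1) = d / 4" unfolding s_def using U by (intro divide_mult_cancel_right) linarith
      ultimately show ?thesis using 1 aa by (simp add: U_def)
    qed
    show "E (1 / 2 ^ j) w \<le> ((1/2) * (\<integral>x. S (G x) \<partial>lborel) + d) / 2 ^ j" if j: "j \<ge> J" for j
    proof -
      have "ip (\<lambda>x. a x - u x) (\<lambda>x. a x - u x) \<le> ip (\<lambda>x. a x - b x) (\<lambda>x. a x - b x)"
        unfolding ip_self
      proof (rule integral_mono[OF bL2_sq[OF bL2_diff[OF a u]] bL2_sq[OF bL2_diff[OF a b]]])
        show "(a x - u x)\<^sup>2 \<le> (a x - b x)\<^sup>2" for x by (simp add: u_def max_def)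
      qed
      then have "ip (\<lambda>x. a x - u x) (\<lambda>x. a x - u x) \<le> \<eta>1" using ab by (simp add: \<eta>_def)
      from \<eta>1(2)[OF u this] have "2 ^ J * E (1 / 2 ^ J) a \<le> 2 ^ J * (E (1 / 2 ^ J) u + d3 / 2 ^ J)" by (intro mult_left_mono) auto
      then have "e J \<le> 2 ^ J * E (1 / 2 ^ J) u + d3" by (simp add: e_def distrib_left)
      also have "2 ^ J * E (1 / 2 ^ J) u \<le> 2 ^ j * E (1 / 2 ^ j) u" using e_mono[OF u, of J "j - J"] j by simp
      finally have uJ: "e J - d3 \<le> 2 ^ j * E (1 / 2 ^ j) u" by simp
      have "2 ^ j * (E (1 / 2 ^ j) w + E (1 / 2 ^ j) u) \<le> 2 ^ j * (E (1 / 2 ^ j) a + E (1 / 2 ^ j) b)"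
        using E_min_max[OF a b, of "1 / 2 ^ j"] by (intro mult_left_mono) (auto simp: w_def[abs_def] u_def[abs_def])
      moreover have "2 ^ j * E (1 / 2 ^ j) b \<le> 2 ^ j * ((1/2) * (\<integral>x. S (grad \<phi> x) \<partial>lborel) / 2 ^ j)"
        unfolding b_def[abs_def] by (intro mult_left_mono tr_E[OF \<phi>(1)]) simp
      ultimately have "2 ^ j * E (1 / 2 ^ j) w \<le> e j + (a0 + d3) - 2 ^ j * E (1 / 2 ^ j) u"
        using \<phi>(3) by (simp add: e_def distrib_left)
      also have "\<dots> \<le> a0 + d" using uJ J e_sup[of j] unfolding d3_def by linarith
      finally have "E (1 / 2 ^ j) w * 2 ^ j \<le> (1/2) * (\<integral>x. S (G x) \<partial>lborel) + d" by (simp add: a0_def mult.commute)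
      then show ?thesis by (subst pos_le_divide_eq) auto
    qed
  qed
qed

end

section \<open>The Rayleigh quotient\<close>

lemma vector_rep_borel: "vector_rep \<Omega> G H \<Longrightarrow> H \<in> borel_measurable borel"
  unfolding vector_rep_def rep_def by (subst borel_measurable_euclidean_space) (auto simp: Basis_vec_def inner_axis)

lemma norm_sq_integrable:
  fixes H :: "real^'n \<Rightarrow> real^'n"
  assumes "\<And>i. integrable lborel (\<lambda>x. (H x $ i)\<^sup>2)" shows "integrable lborel (\<lambda>x. (norm (H x))\<^sup>2)"
  unfolding norm_sq_eq_sum by (intro Bochner_Integration.integrable_sum assms)

text \<open>
  The definition of \<open>H1_0\<close> in terms of Borel representatives.
\<close>

lemma H1_0_approx:
  assumes \<Omega>: "open \<Omega>" and u: "u \<in> H1_0 \<Omega>" and v: "rep \<Omega> u v" and G: "vector_rep \<Omega> (weak_gradient \<Omega> u) G" and \<eta>: "\<eta> > 0"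
  shows "\<exists>\<phi>\<in>test_functions \<Omega>. (\<integral>x. (v x - \<phi> x)\<^sup>2 \<partial>lborel) \<le> \<eta> \<and>
     integrable lborel (\<lambda>x. (norm (G x - grad \<phi> x))\<^sup>2) \<and> (\<integral>x. (norm (G x - grad \<phi> x))\<^sup>2 \<partial>lborel) \<le> \<eta>"
proof -
  obtain W where uL: "u \<in> L2 \<Omega>" and W: "is_weak_gradient \<Omega> u W" using u by (auto simp: H1_0_def H1_def)
  note wg = is_weak_gradient_weak_gradient[OF W]
  have "\<exists>\<phi>\<in>test_functions \<Omega>. H1_norm \<Omega> (\<lambda>x. u x - \<phi> x) < sqrt \<eta>"
    using u \<eta> unfolding H1_0_def by simp
  then obtain \<phi> where \<phi>: "\<phi> \<in> test_functions \<Omega>" "H1_norm \<Omega> (\<lambda>x. u x - \<phi> x) < sqrt \<eta>" by blast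
  obtain H where H: "vector_rep \<Omega> (weak_gradient \<Omega> (\<lambda>x. u x - \<phi> x)) H" "\<And>i. integrable lborel (\<lambda>x. (H x $ i)\<^sup>2)"
    "AE x in lborel. x \<in> \<Omega> \<longrightarrow> weak_gradient \<Omega> u x - grad \<phi> x = H x"
    using weak_gradient_vector_rep[OF \<Omega> weak_gradient_diff_test[OF \<Omega> uL wg \<phi>(1)]] by blast
  have out: "H x = G x - grad \<phi> x" if x: "x \<notin> \<Omega>" for x
  proof -
    have "x \<notin> supp \<phi>" using x test_functions_supp(2)[OF \<phi>(1)] by blast
    then have "grad \<phi> x = 0" by (rule grad_outside)
    moreover have "H x $ i = 0" "G x $ i = 0" for i using H(1) G x rep_outside unfolding vector_rep_def by metis+
    ultimately show ?thesis by (simp add: vec_eq_iff)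
  qed
  have ae: "AE x in lborel. H x = G x - grad \<phi> x"
    using H(3) vector_rep_AE[OF G] by eventually_elim (metis out)
  note Gb = vector_rep_borel[OF G] and Hb = vector_rep_borel[OF H(1)] and gb = grad_borel[OF \<phi>(1)]
  have Hi: "integrable lborel (\<lambda>x. (norm (H x))\<^sup>2)" by (rule norm_sq_integrable[OF H(2)])
  have ae2: "AE x in lborel. (norm (H x))\<^sup>2 = (norm (G x - grad \<phi> x))\<^sup>2" using ae by eventually_elim simp
  have i: "integrable lborel (\<lambda>x. (norm (G x - grad \<phi> x))\<^sup>2)"
    using Hi by (subst (asm) integrable_cong_AE[OF _ _ ae2]) (use Gb Hb gb in measurable)
  have eq: "(\<integral>x. (norm (H x))\<^sup>2 \<partial>lborel) = (\<integral>x. (norm (G x - grad \<phi> x))\<^sup>2 \<partial>lborel)"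
    by (rule integral_cong_AE[OF _ _ ae2]) (use Gb Hb gb in measurable)
  have "(H1_norm \<Omega> (\<lambda>x. u x - \<phi> x))\<^sup>2 = (\<integral>x. (v x - \<phi> x)\<^sup>2 \<partial>lborel) + (\<integral>x. (norm (H x))\<^sup>2 \<partial>lborel)"
    by (rule H1_norm_rep[OF \<Omega> rep_diff[OF v rep_test[OF \<phi>(1)]] H(1)])
  moreover have "(H1_norm \<Omega> (\<lambda>x. u x - \<phi> x))\<^sup>2 \<le> \<eta>"
  proof -
    have "0 \<le> H1_norm \<Omega> (\<lambda>x. u x - \<phi> x)" unfolding H1_norm_def
      by (intro real_sqrt_ge_zero add_nonneg_nonneg integral_nonneg_AE) auto
    then have "(H1_norm \<Omega> (\<lambda>x. u x - \<phi> x))\<^sup>2 \<le> (sqrt \<eta>)\<^sup>2" using \<phi>(2) by (intro power_mono) auto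
    then show ?thesis using \<eta> by simp
  qed
  moreover have "0 \<le> (\<integral>x. (v x - \<phi> x)\<^sup>2 \<partial>lborel)" "0 \<le> (\<integral>x. (norm (H x))\<^sup>2 \<partial>lborel)" by (auto intro!: integral_nonneg_AE)
  ultimately have "(\<integral>x. (v x - \<phi> x)\<^sup>2 \<partial>lborel) \<le> \<eta>" "(\<integral>x. (norm (G x - grad \<phi> x))\<^sup>2 \<partial>lborel) \<le> \<eta>"
    using eq by linarith+
  then show ?thesis using \<phi>(1) i by blast
qed

text \<open>
  The setting in which the Rayleigh quotient is well behaved: a continuous potential bounded below on a non-empty
  open set. The factor \<open>2\<close> makes the generator of the Gaussian semigroup equal to \<open>div (A \<nabla>)\<close>.
\<close>

locale schroedinger_form = heat_vec vs for vs :: "(real^'n) list" +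
  fixes A :: "real^'n^'n" and V :: "real^'n \<Rightarrow> real" and \<Omega> :: "(real^'n) set" and M :: real
  assumes S_form: "\<And>\<xi>. S \<xi> = 2 * ((A *v \<xi>) \<bullet> \<xi>)"
    and \<Omega>_open: "open \<Omega>" and \<Omega>_nonempty: "\<Omega> \<noteq> {}" and V_cont: "continuous_on \<Omega> V"
    and M_nonneg: "0 \<le> M" and V_ge: "\<And>x. x \<in> \<Omega> \<Longrightarrow> - M \<le> V x"
begin

definition W :: "real^'n \<Rightarrow> real" where "W x = indicator \<Omega> x * V x"

lemma W_ge: "- M \<le> W x" using V_ge[of x] M_nonneg by (auto simp: W_def indicator_def)

lemma \<Omega>_borel: "\<Omega> \<in> sets borel" using \<Omega>_open by simp

lemma W_borel[measurable]: "W \<in> borel_measurable borel"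
  using borel_measurable_continuous_on_indicator[OF \<Omega>_borel V_cont] by (simp add: W_def[abs_def])

lemma V_rep: "rep \<Omega> V W" unfolding rep_def
proof (intro conjI)
  have "V \<in> borel_measurable (lebesgue_on \<Omega>) \<longleftrightarrow> W \<in> borel_measurable (lebesgue_on \<Omega>)"
    by (rule measurable_cong) (simp add: W_def)
  then show "V \<in> borel_measurable (lebesgue_on \<Omega>)" using borel_lebesgue_on[OF W_borel] by simp
qed (auto simp: W_def W_borel intro: W_borel)

lemma sqrt_V_rep: "rep \<Omega> (\<lambda>x. sqrt (pos_part V x)) (\<lambda>x. sqrt (max (W x) 0))" unfolding rep_def pos_part_def
proof (intro conjI)
  have [measurable]: "V \<in> borel_measurable (lebesgue_on \<Omega>)" using V_rep by (simp add: rep_def)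
  show "(\<lambda>x. sqrt (max (V x) 0)) \<in> borel_measurable (lebesgue_on \<Omega>)" by measurable
  show "(\<lambda>x. sqrt (max (W x) 0)) \<in> borel_measurable borel" by measurable
qed (auto simp: W_def)

lemma weighted_rep:
  assumes "rep \<Omega> u v" shows "(\<lambda>x. sqrt (pos_part V x) * u x) \<in> L2 \<Omega> \<longleftrightarrow> integrable lborel (\<lambda>x. max (W x) 0 * (v x)\<^sup>2)"
  using L2_iff_rep[OF \<Omega>_borel rep_mult[OF sqrt_V_rep assms]] by (simp add: power_mult_distrib)

lemma W_sq_integrable:
  assumes v[measurable]: "v \<in> borel_measurable borel" and i: "integrable lborel (\<lambda>x. (v x)\<^sup>2)"
    and w: "integrable lborel (\<lambda>x. max (W x) 0 * (v x)\<^sup>2)"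
  shows "integrable lborel (\<lambda>x. W x * (v x)\<^sup>2)"
proof (rule Bochner_Integration.integrable_bound)
  show "integrable lborel (\<lambda>x. max (W x) 0 * (v x)\<^sup>2 + M * (v x)\<^sup>2)" using w i by simp
  show "AE x in lborel. norm (W x * (v x)\<^sup>2) \<le> norm (max (W x) 0 * (v x)\<^sup>2 + M * (v x)\<^sup>2)"
  proof (intro AE_I2)
    fix x
    have "\<bar>W x\<bar> \<le> max (W x) 0 + M" using W_ge[of x] M_nonneg by (auto simp: max_def abs_if)
    from mult_right_mono[OF this, of "(v x)\<^sup>2"]
    show "norm (W x * (v x)\<^sup>2) \<le> norm (max (W x) 0 * (v x)\<^sup>2 + M * (v x)\<^sup>2)"
      using M_nonneg by (simp add: abs_mult distrib_right)
  qed
qed measurable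

lemma form_domain_rep:
  assumes u: "u \<in> form_domain V \<Omega>"
  obtains v G where "rep \<Omega> u v" "v \<in> borel_measurable borel" "integrable lborel (\<lambda>x. (v x)\<^sup>2)"
    "vector_rep \<Omega> (weak_gradient \<Omega> u) G" "G \<in> borel_measurable borel" "integrable lborel (\<lambda>x. (norm (G x))\<^sup>2)"
    "integrable lborel (\<lambda>x. W x * (v x)\<^sup>2)"
proof -
  obtain F where uL: "u \<in> L2 \<Omega>" and F: "is_weak_gradient \<Omega> u F" using u by (auto simp: form_domain_def H1_0_def H1_def)
  obtain v where v: "rep \<Omega> u v" "integrable lborel (\<lambda>x. (v x)\<^sup>2)" using L2_rep[OF \<Omega>_borel uL] by blast
  obtain G where G: "vector_rep \<Omega> (weak_gradient \<Omega> u) G" "\<And>i. integrable lborel (\<lambda>x. (G x $ i)\<^sup>2)"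
    using weak_gradient_vector_rep[OF \<Omega>_open F] by blast
  have "(\<lambda>x. sqrt (pos_part V x) * u x) \<in> L2 \<Omega>" using u by (auto simp: form_domain_def L2_weighted_def)
  then have "integrable lborel (\<lambda>x. W x * (v x)\<^sup>2)"
    using weighted_rep[OF v(1)] W_sq_integrable[OF rep_borel[OF v(1)] v(2)] by blast
  then show ?thesis using that[OF v(1) rep_borel[OF v(1)] v(2) G(1) vector_rep_borel[OF G(1)] norm_sq_integrable[OF G(2)]] by blast
qed

lemma quad_form_rep:
  assumes "rep \<Omega> u v" "vector_rep \<Omega> (weak_gradient \<Omega> u) G"
  shows "quad_form A V \<Omega> u = (1/2) * (\<integral>x. S (G x) \<partial>lborel) + (\<integral>x. W x * (v x)\<^sup>2 \<partial>lborel)"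
  unfolding quad_form_def rep_integral(1)[OF \<Omega>_borel vector_rep_form[OF assms(2)]]
    rep_integral(1)[OF \<Omega>_borel rep_mult[OF V_rep rep_sq[OF assms(1)]]]
  by (simp add: S_form)

lemma quad_form_ge:
  assumes u: "u \<in> form_domain V \<Omega>" shows "- M * (L2_norm \<Omega> u)\<^sup>2 \<le> quad_form A V \<Omega> u"
proof -
  obtain v G where v: "rep \<Omega> u v" "v \<in> borel_measurable borel" "integrable lborel (\<lambda>x. (v x)\<^sup>2)"
    "vector_rep \<Omega> (weak_gradient \<Omega> u) G" "G \<in> borel_measurable borel" "integrable lborel (\<lambda>x. (norm (G x))\<^sup>2)"
    "integrable lborel (\<lambda>x. W x * (v x)\<^sup>2)" using form_domain_rep[OF u] by blast
  have "(\<integral>x. - M * (v x)\<^sup>2 \<partial>lborel) \<le> (\<integral>x. W x * (v x)\<^sup>2 \<partial>lborel)"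
  proof (rule integral_mono[OF _ v(7)])
    show "- M * (v x)\<^sup>2 \<le> W x * (v x)\<^sup>2" for x using W_ge by (intro mult_right_mono) auto
  qed (use v(3) in simp)
  moreover have "0 \<le> (\<integral>x. S (G x) \<partial>lborel)" by (intro integral_nonneg_AE AE_I2 S_nonneg)
  ultimately show ?thesis unfolding quad_form_rep[OF v(1,4)] L2_norm_rep[OF \<Omega>_open v(1)] by simp
qed

abbreviation "quotients \<equiv> {quad_form A V \<Omega> u / (L2_norm \<Omega> u)\<^sup>2 | u.
           u \<in> form_domain V \<Omega> \<and> \<not> (AE x in lebesgue_on \<Omega>. u x = 0)}"

text \<open>
  A vanishing norm would make the quotient \<open>0\<close>; this is where the sign of \<open>M\<close> enters.
\<close>

lemma quotients_ge: assumes "q \<in> quotients" shows "- M \<le> q"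
proof -
  obtain u where u: "u \<in> form_domain V \<Omega>" "q = quad_form A V \<Omega> u / (L2_norm \<Omega> u)\<^sup>2" using assms by blast
  show ?thesis
  proof (cases "L2_norm \<Omega> u = 0")
    case False
    then have "(L2_norm \<Omega> u)\<^sup>2 > 0" by simp
    from pos_le_divide_eq[OF this] quad_form_ge[OF u(1)] show ?thesis unfolding u(2) by blast
  qed (use M_nonneg u(2) in simp)
qed

lemma AE_zero_iff:
  assumes v: "rep \<Omega> u v" "integrable lborel (\<lambda>x. (v x)\<^sup>2)"
  shows "(AE x in lebesgue_on \<Omega>. u x = 0) \<longleftrightarrow> (\<integral>x. (v x)\<^sup>2 \<partial>lborel) = 0"
proof -
  have "(\<integral>x. (v x)\<^sup>2 \<partial>lborel) = 0 \<longleftrightarrow> (AE x in lborel. v x = 0)"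
    using integral_nonneg_eq_0_iff_AE[OF v(2)] by simp
  also have "\<dots> \<longleftrightarrow> (AE x in lborel. x \<in> \<Omega> \<longrightarrow> u x = 0)"
  proof
    assume "AE x in lborel. v x = 0"
    with rep_AE[OF v(1)] show "AE x in lborel. x \<in> \<Omega> \<longrightarrow> u x = 0" by eventually_elim auto
  next
    assume "AE x in lborel. x \<in> \<Omega> \<longrightarrow> u x = 0"
    with rep_AE[OF v(1)] show "AE x in lborel. v x = 0"
    proof eventually_elim
      case (elim x) then show ?case using rep_outside[OF v(1), of x] by (cases "x \<in> \<Omega>") auto
    qed
  qed
  finally show ?thesis by (simp add: AE_lebesgue_on_iff[OF \<Omega>_borel])
qed

abbreviation "lam1 \<equiv> first_eigenvalue A V \<Omega>"

lemma lam1_le: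
  assumes u: "u \<in> form_domain V \<Omega>" shows "lam1 * (L2_norm \<Omega> u)\<^sup>2 \<le> quad_form A V \<Omega> u"
proof (cases "L2_norm \<Omega> u = 0")
  case True then show ?thesis using quad_form_ge[OF u] by simp
next
  case False
  obtain v where v: "rep \<Omega> u v" "integrable lborel (\<lambda>x. (v x)\<^sup>2)" using form_domain_rep[OF u] by metis
  have "\<not> (AE x in lebesgue_on \<Omega>. u x = 0)" 
    unfolding AE_zero_iff[OF v] L2_norm_rep[OF \<Omega>_open v(1), symmetric] using False by simp
  then have q: "quad_form A V \<Omega> u / (L2_norm \<Omega> u)\<^sup>2 \<in> quotients" using u by blast
  have "lam1 \<le> quad_form A V \<Omega> u / (L2_norm \<Omega> u)\<^sup>2" unfolding first_eigenvalue_def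
    by (rule cInf_lower[OF q bdd_belowI]) (rule quotients_ge)
  moreover have "(L2_norm \<Omega> u)\<^sup>2 > 0" using False by simp
  ultimately show ?thesis by (simp add: pos_le_divide_eq)
qed

lemma test_form_domain:
  assumes \<phi>: "\<phi> \<in> test_functions \<Omega>" shows "\<phi> \<in> form_domain V \<Omega>"
proof -
  have L: "\<phi> \<in> L2 \<Omega>" using L2_iff_rep[OF \<Omega>_borel rep_test[OF \<phi>]] test_sq_integrable[OF \<phi>] by blast
  have [measurable]: "\<phi> \<in> borel_measurable borel" using \<phi> by (rule test_functions_borel)
  have "compact (V ` supp \<phi>)"
    using test_functions_supp(1,2)[OF \<phi>] V_cont by (intro compact_continuous_image) (auto intro: continuous_on_subset)
  then obtain B where B: "\<And>x. x \<in> supp \<phi> \<Longrightarrow> \<bar>V x\<bar> \<le> B" using compact_imp_bounded[of "V ` supp \<phi>"] unfolding bounded_real by blast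
  have "integrable lborel (\<lambda>x. max (W x) 0 * (\<phi> x)\<^sup>2)"
  proof (rule Bochner_Integration.integrable_bound)
    show "integrable lborel (\<lambda>x. B * (\<phi> x)\<^sup>2)" using test_sq_integrable[OF \<phi>] by simp
    show "AE x in lborel. norm (max (W x) 0 * (\<phi> x)\<^sup>2) \<le> norm (B * (\<phi> x)\<^sup>2)"
    proof (intro AE_I2)
      fix x show "norm (max (W x) 0 * (\<phi> x)\<^sup>2) \<le> norm (B * (\<phi> x)\<^sup>2)"
      proof (cases "x \<in> supp \<phi>")
        case True
        have "\<bar>max (W x) 0\<bar> \<le> \<bar>B\<bar>" using B[OF True] by (auto simp: W_def indicator_def max_def)
        then show ?thesis by (simp add: abs_mult mult_right_mono)
      next
        case False
        have "\<phi> x = 0" by (rule test_functions_supp(3)[OF \<phi> False])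
        then show ?thesis by simp
      qed
    qed
  qed measurable
  then have "(\<lambda>x. sqrt (pos_part V x) * \<phi> x) \<in> L2 \<Omega>" unfolding weighted_rep[OF rep_test[OF \<phi>]] .
  then show ?thesis using test_in_H1_0[OF \<Omega>_open \<phi>] L unfolding form_domain_def L2_weighted_def by simp
qed

lemma rayleigh_test:
  assumes \<phi>: "\<phi> \<in> test_functions \<Omega>"
  shows "lam1 * ip \<phi> \<phi> \<le> (1/2) * (\<integral>x. S (grad \<phi> x) \<partial>lborel) + (\<integral>x. W x * (\<phi> x)\<^sup>2 \<partial>lborel)"
  using lam1_le[OF test_form_domain[OF \<phi>]]
  unfolding quad_form_rep[OF rep_test[OF \<phi>] weak_gradient_test_vector_rep[OF \<Omega>_open \<phi>]] L2_norm_rep[OF \<Omega>_open rep_test[OF \<phi>]] ip_self .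

lemma quotients_nonempty: "quotients \<noteq> {}"
proof -
  obtain x0 e where e: "e > 0" "cball x0 e \<subseteq> \<Omega>" using \<Omega>_open \<Omega>_nonempty open_contains_cball by blast
  note \<phi> = bump_test[OF e]
  have "bump_mass TYPE('n) e = (\<integral>x. bump e 0 (x + (- x0)) \<partial>lborel)"
    unfolding bump_mass_def by (rule integral_lborel_shift[symmetric]) (rule test_functions_borel[OF bump_test_UNIV[OF e(1)]])
  also have "\<dots> = (\<integral>x. bump e x0 x \<partial>lborel)" by (subst (2) bump_shift) simp
  finally have "(\<integral>x. bump e x0 x \<partial>lborel) \<noteq> 0" using bump_mass_pos[OF e(1), where 'n='n] by simp
  have "(\<integral>x. (bump e x0 x)\<^sup>2 \<partial>lborel) \<noteq> 0"
  proof
    assume "(\<integral>x. (bump e x0 x)\<^sup>2 \<partial>lborel) = 0"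
    then have "AE x in lborel. bump e x0 x = 0" using integral_nonneg_eq_0_iff_AE[OF test_sq_integrable[OF \<phi>]] by simp
    then have "(\<integral>x. bump e x0 x \<partial>lborel) = 0" by (rule integral_eq_zero_AE)
    then show False using \<open>(\<integral>x. bump e x0 x \<partial>lborel) \<noteq> 0\<close> by simp
  qed
  then have "\<not> (AE x in lebesgue_on \<Omega>. bump e x0 x = 0)"
    using AE_zero_iff[OF rep_test[OF \<phi>] test_sq_integrable[OF \<phi>]] by simp
  then show ?thesis using test_form_domain[OF \<phi>] by blast
qed

text \<open>
  An almost optimal element of the form domain, replaced by a bounded function with compact support.
  Since the shifted potential is nonnegative and \<open>w \<le> \<bar>v\<bar>\<close>, the potential term does not increase.
\<close>

lemma lam1_trial:
  assumes \<epsilon>: "\<epsilon> > 0"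
  obtains w K c J where "bL2 w" "ip w w > 0" "\<And>x. 0 \<le> w x" "compact K" "K \<subseteq> \<Omega>" "\<And>x. x \<notin> K \<Longrightarrow> w x = 0"
    "\<And>j. j \<ge> J \<Longrightarrow> E (1 / 2 ^ j) w \<le> c / 2 ^ j"
    "c + (\<integral>x. (W x + M) * (w x)\<^sup>2 \<partial>lborel) \<le> (lam1 + M + \<epsilon>) * ip w w"
proof -
  have "Inf quotients < lam1 + \<epsilon> / 2" using \<epsilon> by (simp add: first_eigenvalue_def)
  from cInf_lessD[OF quotients_nonempty this]
  obtain u where u: "u \<in> form_domain V \<Omega>" "\<not> (AE x in lebesgue_on \<Omega>. u x = 0)"
    "quad_form A V \<Omega> u / (L2_norm \<Omega> u)\<^sup>2 < lam1 + \<epsilon> / 2" by blast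
  obtain v G where v: "rep \<Omega> u v" "v \<in> borel_measurable borel" "integrable lborel (\<lambda>x. (v x)\<^sup>2)"
    "vector_rep \<Omega> (weak_gradient \<Omega> u) G" "G \<in> borel_measurable borel" "integrable lborel (\<lambda>x. (norm (G x))\<^sup>2)"
    "integrable lborel (\<lambda>x. W x * (v x)\<^sup>2)" using form_domain_rep[OF u(1)] by blast
  define U where "U = (\<integral>x. (v x)\<^sup>2 \<partial>lborel)"
  define a where "a = (1/2) * (\<integral>x. S (G x) \<partial>lborel)"
  define B where "B = (\<integral>x. (W x + M) * (v x)\<^sup>2 \<partial>lborel)"
  define \<Lambda> where "\<Lambda> = lam1 + M"
  have "0 \<le> U" unfolding U_def by (intro integral_nonneg_AE AE_I2) auto
  then have U: "U > 0" using u(2) AE_zero_iff[OF v(1,3)] by (auto simp: U_def less_le)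
  have Bi: "integrable lborel (\<lambda>x. (W x + M) * (v x)\<^sup>2)" using v(3,7) by (simp add: distrib_right)
  have B: "B = (\<integral>x. W x * (v x)\<^sup>2 \<partial>lborel) + M * U" unfolding B_def U_def using v(3,7) by (simp add: distrib_right)
  have "quad_form A V \<Omega> u < (lam1 + \<epsilon> / 2) * U"
    using u(3) U unfolding L2_norm_rep[OF \<Omega>_open v(1)] U_def by (simp add: pos_divide_less_eq)
  then have lt: "a + B < (\<Lambda> + \<epsilon> / 2) * U" unfolding quad_form_rep[OF v(1,4)] B a_def \<Lambda>_def by (simp add: distrib_right)
  have \<Lambda>: "0 \<le> \<Lambda>" unfolding \<Lambda>_def first_eigenvalue_def
    using cInf_greatest[OF quotients_nonempty quotients_ge] by linarith
  (* With this d the losses d in the energy and in the norm use up the gap epsilon / 2 exactly. *)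
  define d where "d = (\<epsilon> / 2) * U / (1 + \<Lambda> + \<epsilon>)"
  have pos: "1 + \<Lambda> + \<epsilon> > 0" using \<Lambda> \<epsilon> by linarith
  have d: "d > 0" using \<epsilon> U pos by (simp add: d_def)
  have d2: "d + (\<Lambda> + \<epsilon>) * d = (\<epsilon> / 2) * U"
  proof -
    have "d * (1 + \<Lambda> + \<epsilon>) = (\<epsilon> / 2) * U" unfolding d_def using divide_mult_cancel_right[OF pos, of "(\<epsilon> / 2) * U" 1] unfolding mult_1 div_by_1 .
    then show ?thesis by (simp add: algebra_simps)
  qed
  have dU: "d < U"
  proof -
    have "\<epsilon> * d \<le> (\<Lambda> + \<epsilon>) * d" using \<Lambda> d by (intro mult_right_mono) auto
    then have "\<epsilon> * d < \<epsilon> * U" using d2 d mult_pos_pos[OF \<epsilon> U] by linarith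
    then show ?thesis using \<epsilon> by simp
  qed
  have uH: "u \<in> H1_0 \<Omega>" using u(1) by (simp add: form_domain_def)
  obtain w K J where w: "bL2 w" "\<And>x. 0 \<le> w x" "\<And>x. w x \<le> \<bar>v x\<bar>" "compact K" "K \<subseteq> \<Omega>" "\<And>x. x \<notin> K \<Longrightarrow> w x = 0"
    "U - d \<le> ip w w" "\<And>j. j \<ge> J \<Longrightarrow> E (1 / 2 ^ j) w \<le> (a + d) / 2 ^ j"
    using trial_function[OF v(2,3,5,6) H1_0_approx[OF \<Omega>_open uH v(1,4)] d] unfolding U_def a_def by blast
  have "(\<integral>x. (W x + M) * (w x)\<^sup>2 \<partial>lborel) \<le> B" unfolding B_def
  proof (rule integral_mono_AE'[OF Bi])
    have p: "0 \<le> W x + M" for x using W_ge[of x] by linarith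
    show "AE x in lborel. (W x + M) * (w x)\<^sup>2 \<le> (W x + M) * (v x)\<^sup>2"
      using p w(2,3) by (intro AE_I2 mult_left_mono) (auto simp: abs_le_square_iff[symmetric])
    show "AE x in lborel. 0 \<le> (W x + M) * (v x)\<^sup>2" using p by simp
  qed
  then have "a + d + (\<integral>x. (W x + M) * (w x)\<^sup>2 \<partial>lborel) \<le> (\<Lambda> + \<epsilon> / 2) * U + d" using lt by linarith
  also have "\<dots> = (\<Lambda> + \<epsilon>) * (U - d)" using d2 by (simp add: algebra_simps)
  also have "\<dots> \<le> (\<Lambda> + \<epsilon>) * ip w w" using w(7) \<Lambda> \<epsilon> by (intro mult_left_mono) auto
  finally have fin: "a + d + (\<integral>x. (W x + M) * (w x)\<^sup>2 \<partial>lborel) \<le> (lam1 + M + \<epsilon>) * ip w w" by (simp add: \<Lambda>_def)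
  have "ip w w > 0" using w(7) dU by linarith
  then show ?thesis using that[of w K J "a + d"] w fin by blast
qed

text \<open>
  The Rayleigh bound of the first eigenvalue, in the form in which \<open>nonlocal_brunn_minkowski\<close> uses it. The potential \<open>V'\<close>
  is shared by the three domains.
\<close>

lemma lam1_extend:
  assumes V': "V' \<in> borel_measurable borel" "\<And>x. x \<in> \<Omega> \<Longrightarrow> V' x = V x + M"
    and w: "bL2 w" and K: "compact K" "K \<subseteq> \<Omega>" "\<And>x. x \<notin> K \<Longrightarrow> w x = 0"
    and E: "\<And>j. j \<ge> J \<Longrightarrow> E (1 / 2 ^ j) w \<le> c / 2 ^ j"
  shows "(lam1 + M) * ip w w \<le> c + (\<integral>x. V' x * (w x)\<^sup>2 \<partial>lborel)"
proof (rule rayleigh_bound_extend[OF V'(1) _ \<Omega>_open])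
  show "continuous_on \<Omega> V'"
    using continuous_on_add[OF V_cont continuous_on_const[of \<Omega> M]] by (subst continuous_on_cong[OF refl V'(2)])
  show "(lam1 + M) * ip \<phi> \<phi> \<le> (1/2) * (\<integral>x. S (grad \<phi> x) \<partial>lborel) + (\<integral>x. V' x * (\<phi> x)\<^sup>2 \<partial>lborel)"
    if \<phi>: "\<phi> \<in> test_functions \<Omega>" for \<phi>
  proof -
    have z: "\<phi> x = 0" if "x \<notin> \<Omega>" for x using rep_outside[OF rep_test[OF \<phi>] that] .
    have "(\<lambda>x. V' x * (\<phi> x)\<^sup>2) = (\<lambda>x. W x * (\<phi> x)\<^sup>2 + M * (\<phi> x)\<^sup>2)"
    proof
      show "V' x * (\<phi> x)\<^sup>2 = W x * (\<phi> x)\<^sup>2 + M * (\<phi> x)\<^sup>2" for x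
        using V'(2)[of x] z[of x] by (cases "x \<in> \<Omega>") (auto simp: W_def distrib_right)
    qed
    moreover have "integrable lborel (\<lambda>x. W x * (\<phi> x)\<^sup>2)"
      using W_sq_integrable[OF test_functions_borel[OF \<phi>] test_sq_integrable[OF \<phi>]] weighted_rep[OF rep_test[OF \<phi>]]
        test_form_domain[OF \<phi>] by (auto simp: form_domain_def L2_weighted_def)
    ultimately have "(\<integral>x. V' x * (\<phi> x)\<^sup>2 \<partial>lborel) = (\<integral>x. W x * (\<phi> x)\<^sup>2 \<partial>lborel) + M * ip \<phi> \<phi>"
      using test_sq_integrable[OF \<phi>] by (simp add: ip_self)
    then show ?thesis using rayleigh_test[OF \<phi>] by (simp add: distrib_right)
  qed
qed (fact w K E)+

end

section \<open>Convex potentials and Minkowski interpolation\<close>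

text \<open>
  Fix a ball in \<open>\<Omega>\<close> on which \<open>V \<le> B\<close>. For \<open>x\<close> in \<open>\<Omega>\<close>, the midpoints between \<open>x\<close> and the points of the ball form a ball of half the
  radius on which \<open>V \<le> (V x + B) / 2\<close>. Its volume does not depend on \<open>x\<close>, so a very negative \<open>V x\<close> would make the integral of
  \<open>exp (- V)\<close> too large.
\<close>

lemma convex_bounded_below_if_exp_integrable:
  fixes V :: "'a::euclidean_space \<Rightarrow> real"
  assumes V: "convex_on \<Omega> V" and \<Omega>: "open \<Omega>" and i: "integrable (lebesgue_on \<Omega>) (\<lambda>x. exp (- V x))"
  shows "\<exists>M\<ge>0. \<forall>x\<in>\<Omega>. - M \<le> V x"
proof (cases "\<Omega> = {}")
  case False
  have \<Omega>b: "\<Omega> \<in> sets lebesgue" using \<Omega> by simp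
  obtain x0 \<rho> where \<rho>: "\<rho> > 0" "cball x0 \<rho> \<subseteq> \<Omega>" using \<Omega> False open_contains_cball by blast
  have "compact (V ` cball x0 \<rho>)"
    using continuous_on_subset[OF convex_on_continuous[OF \<Omega> V] \<rho>(2)] by (intro compact_continuous_image) auto
  then obtain B where B: "\<And>x. x \<in> cball x0 \<rho> \<Longrightarrow> \<bar>V x\<bar> \<le> B"
    using compact_imp_bounded[of "V ` cball x0 \<rho>"] unfolding bounded_real by blast
  define I where "I = (\<integral>x. exp (- V x) \<partial>lebesgue_on \<Omega>)"
  define m where "m = unit_ball_vol (DIM('a)) * (\<rho> / 2) ^ DIM('a)"
  have mc: "measure lebesgue (ball c (\<rho> / 2)) = m" for c :: 'a
    using \<rho>(1) content_ball[of "\<rho> / 2" c] by (simp add: m_def)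
  have m: "m > 0" using mc[of x0] content_ball_pos[of "\<rho> / 2" x0] \<rho>(1) by simp
  have I: "0 \<le> I" unfolding I_def by (intro integral_nonneg_AE AE_I2) auto
  have "- (B + 2 * (I / m)) \<le> V x" if x: "x \<in> \<Omega>" for x
  proof -
    define D where "D = ball ((1/2) *\<^sub>R (x + x0)) (\<rho> / 2)"
    define k where "k = exp (- ((V x + B) / 2))"
    have half: "y \<in> \<Omega>" "V y \<le> (V x + B) / 2" if y: "y \<in> D" for y
    proof -
      define z where "z = 2 *\<^sub>R y - x"
      have "z - x0 = 2 *\<^sub>R (y - (1/2) *\<^sub>R (x + x0))" by (simp add: z_def algebra_simps)
      then have "norm (z - x0) = 2 * norm (y - (1/2) *\<^sub>R (x + x0))" by simp
      also have "\<dots> < \<rho>" using y by (simp add: D_def dist_norm norm_minus_commute)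
      finally have z: "z \<in> cball x0 \<rho>" by (simp add: dist_norm norm_minus_commute)
      then have z\<Omega>: "z \<in> \<Omega>" using \<rho>(2) by blast
      have y2: "y = (1 - 1/2) *\<^sub>R x + (1/2) *\<^sub>R z" by (simp add: z_def algebra_simps)
      have "V y \<le> (1 - 1/2) * V x + (1/2) * V z" unfolding y2 by (rule convex_onD[OF V _ _ x z\<Omega>]) auto
      then show "V y \<le> (V x + B) / 2" using B[OF z] by simp
      show "y \<in> \<Omega>" unfolding y2 using convex_on_imp_convex[OF V] x z\<Omega> by (intro convexD_alt) auto
    qed
    have D\<Omega>: "D \<subseteq> \<Omega>" using half(1) by blast
    have Ds: "D \<in> sets (lebesgue_on \<Omega>)" using D\<Omega> \<Omega>b by (simp add: sets_restrict_space_iff D_def)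
    have mD: "measure (lebesgue_on \<Omega>) D = m"
      using measure_restrict_space[of \<Omega> lebesgue D] \<Omega>b D\<Omega> mc by (simp add: D_def)
    have eD: "emeasure (lebesgue_on \<Omega>) D < \<infinity>"
      using emeasure_restrict_space[of \<Omega> lebesgue D] \<Omega>b D\<Omega> emeasure_lborel_ball_finite by (simp add: D_def)
    have iD: "integrable (lebesgue_on \<Omega>) (\<lambda>y. k * indicator D y)"
      using Ds eD by (intro integrable_mult_right integrable_real_indicator) auto
    have "(\<integral>y. k * indicator D y \<partial>lebesgue_on \<Omega>) \<le> I" unfolding I_def
    proof (rule integral_mono[OF iD i])
      show "k * indicator D y \<le> exp (- V y)" for y
        using half(2)[of y] by (auto simp: indicator_def k_def)
    qed
    moreover have eq: "(\<integral>y. k * indicator D y \<partial>lebesgue_on \<Omega>) = k * m" using mD D\<Omega> by (simp add: Int_absorb2)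
    ultimately have "k * m \<le> I" unfolding eq by blast
    then have "k \<le> I / m" using m by (simp add: pos_le_divide_eq)
    moreover have "1 + - ((V x + B) / 2) \<le> k" unfolding k_def by (rule exp_ge_add_one_self)
    ultimately have "- ((V x + B) / 2) \<le> I / m" by linarith
    then show ?thesis by (simp add: field_simps)
  qed
  moreover have "0 \<le> B + 2 * (I / m)" using B[of x0] \<rho>(1) I m by (intro add_nonneg_nonneg) auto
  ultimately show ?thesis by blast
qed auto

lemma minkowski_interp_endpoints:
  "\<Omega>1 \<noteq> {} \<Longrightarrow> minkowski_interp \<Omega>0 \<Omega>1 0 = \<Omega>0" "\<Omega>0 \<noteq> {} \<Longrightarrow> minkowski_interp \<Omega>0 \<Omega>1 1 = \<Omega>1"
  by (auto simp: minkowski_interp_def)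

lemma open_minkowski_interp:
  assumes "open \<Omega>0" "open \<Omega>1" shows "open (minkowski_interp \<Omega>0 \<Omega>1 r)"
proof (cases "r = 0")
  case True
  show ?thesis
  proof (cases "\<Omega>1 = {}")
    case False
    then show ?thesis using True minkowski_interp_endpoints(1)[OF False] assms(1) by simp
  qed (simp add: minkowski_interp_def)
next
  case False
  have "minkowski_interp \<Omega>0 \<Omega>1 r = (\<Union>x\<in>\<Omega>0. (\<lambda>y. (1 - r) *\<^sub>R x + r *\<^sub>R y) ` \<Omega>1)"
    unfolding minkowski_interp_def by blast
  moreover have "open (\<Union>x\<in>\<Omega>0. (\<lambda>y. (1 - r) *\<^sub>R x + r *\<^sub>R y) ` \<Omega>1)"
    by (intro open_UN ballI open_affinity assms False)
  ultimately show ?thesis by (simp only:)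
qed

lemma convex_minkowski_interp:
  fixes \<Omega>0 \<Omega>1 :: "(real^'n) set"
  assumes "convex \<Omega>0" "convex \<Omega>1" shows "convex (minkowski_interp \<Omega>0 \<Omega>1 r)"
proof -
  let ?f = "\<lambda>p :: (real^'n) \<times> (real^'n). (1 - r) *\<^sub>R fst p + r *\<^sub>R snd p"
  have eq: "minkowski_interp \<Omega>0 \<Omega>1 r = ?f ` (\<Omega>0 \<times> \<Omega>1)"
    unfolding minkowski_interp_def by (rule set_eqI, simp add: image_iff Bex_def) blast
  have "linear ?f" by (rule linearI) (auto simp: algebra_simps)
  then show ?thesis unfolding eq by (rule convex_linear_image) (rule convex_Times[OF assms])
qed

section \<open>The Brunn-Minkowski inequality for the first eigenvalue\<close>

theorem theorem1p2:
  fixes A :: "real^'n^'n" and a1 :: real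
    and \<Omega>0 \<Omega>1 :: "(real^'n) set" and V :: "real^'n \<Rightarrow> real"
  assumes "transpose A = A"
    and "a1 > 0" and "\<And>\<xi>. (A *v \<xi>) \<bullet> \<xi> \<ge> a1 * (norm \<xi>)\<^sup>2"
    and "\<Omega>0 \<noteq> {}" and "open \<Omega>0" and "convex \<Omega>0"
    and "\<Omega>1 \<noteq> {}" and "open \<Omega>1" and "convex \<Omega>1"
    and "convex_on (\<Union>r\<in>{0..1}. minkowski_interp \<Omega>0 \<Omega>1 r) V"
    and "\<And>r. r \<in> {0..1} \<Longrightarrow> kato_decomposable (minkowski_interp \<Omega>0 \<Omega>1 r) V"
    and "\<And>r t. r \<in> {0..1} \<Longrightarrow> t > 0 \<Longrightarrow>
           integrable (lebesgue_on (minkowski_interp \<Omega>0 \<Omega>1 r)) (\<lambda>x. exp (- t * V x))"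
  shows "\<forall>r\<in>{0..1}. first_eigenvalue A V (minkowski_interp \<Omega>0 \<Omega>1 r)
           \<le> (1 - r) * first_eigenvalue A V \<Omega>0 + r * first_eigenvalue A V \<Omega>1"
proof
  fix r :: real assume r: "r \<in> {0..1}"
  let ?O = "minkowski_interp \<Omega>0 \<Omega>1"
  define U where "U = (\<Union>r\<in>{0..1}. ?O r)"
  have O01: "?O 0 = \<Omega>0" "?O 1 = \<Omega>1" using minkowski_interp_endpoints assms(4,7) by blast+
  have V: "convex_on U V" using assms(10) by (simp add: U_def)
  have O_U: "?O s \<subseteq> U" if "s \<in> {0..1}" for s using that by (auto simp: U_def)
  have O_open: "open (?O s)" for s by (rule open_minkowski_interp[OF assms(5,8)])
  have U_open: "open U" unfolding U_def using O_open by blast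
  have V_cont: "continuous_on U V" by (rule convex_on_continuous[OF U_open V])
  have O_nonempty: "?O s \<noteq> {}" for s using assms(4,7) by (auto simp: minkowski_interp_def)
  have bound: "\<exists>M\<ge>0. \<forall>x\<in>?O s. - M \<le> V x" if s: "s \<in> {0..1}" for s
  proof (rule convex_bounded_below_if_exp_integrable)
    show "convex_on (?O s) V" using convex_on_subset[OF V O_U[OF s]] convex_minkowski_interp[OF assms(6,9)] by blast
    show "integrable (lebesgue_on (?O s)) (\<lambda>x. exp (- V x))" using assms(12)[OF s, of 1] by simp
  qed (rule O_open)
  show "first_eigenvalue A V (?O r) \<le> (1 - r) * first_eigenvalue A V \<Omega>0 + r * first_eigenvalue A V \<Omega>1"
  proof (cases "r = 0 \<or> r = 1")
    case True then show ?thesis using O01 by auto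
  next
    case False
    then have r01: "0 < r" "r < 1" using r by auto
    obtain M0 M1 Mr where M: "0 \<le> M0" "\<And>x. x \<in> ?O 0 \<Longrightarrow> - M0 \<le> V x" "0 \<le> M1" "\<And>x. x \<in> ?O 1 \<Longrightarrow> - M1 \<le> V x"
      "0 \<le> Mr" "\<And>x. x \<in> ?O r \<Longrightarrow> - Mr \<le> V x"
      using bound[of 0] bound[of 1] bound[OF r] by auto
    (* One shift that makes the potential nonnegative on all three domains. *)
    define M where "M = M0 + M1 + Mr"
    have A_pos: "(A *v \<xi>) \<bullet> \<xi> > 0" if "\<xi> \<noteq> 0" for \<xi>
    proof -
      have "0 < a1 * (norm \<xi>)\<^sup>2" using assms(2) that by simp
      then show ?thesis using assms(3)[of \<xi>] by linarith
    qed
    obtain us :: "(real^'n) list" where us: "\<And>\<xi>. (A *v \<xi>) \<bullet> \<xi> = (\<Sum>v\<leftarrow>us. (v \<bullet> \<xi>)\<^sup>2)"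
      using positive_form_sum_of_squares[OF assms(1) A_pos] by blast
    (* The factor sqrt 2 accounts for the factor 1/2 in the generator of the Gaussian semigroup. *)
    define vs where "vs = map (\<lambda>v. sqrt 2 *\<^sub>R v) us"
    interpret heat_vec vs .
    have S_A: "S \<xi> = 2 * ((A *v \<xi>) \<bullet> \<xi>)" for \<xi>
      unfolding S_def us by (simp add: vs_def comp_def power_mult_distrib sum_list_const_mult)
    have form: "schroedinger_form vs A V (?O s) M" if "s \<in> {0, 1, r}" for s
    proof
      show "S \<xi> = 2 * ((A *v \<xi>) \<bullet> \<xi>)" for \<xi> by (rule S_A)
      have s: "s \<in> {0..1}" using that r by auto
      show "continuous_on (?O s) V" by (rule continuous_on_subset[OF V_cont O_U[OF s]])
      show "- M \<le> V x" if x: "x \<in> ?O s" for x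
        using \<open>s \<in> {0, 1, r}\<close> M x unfolding M_def by fastforce
    qed (use O_open O_nonempty M in \<open>auto simp: M_def\<close>)
    interpret F0: schroedinger_form vs A V \<Omega>0 M using form[of 0] O01 by simp
    interpret F1: schroedinger_form vs A V \<Omega>1 M using form[of 1] O01 by simp
    interpret Fr: schroedinger_form vs A V "?O r" M using form[of r] by simp
    (* Extension by 0 outside U makes the shifted potential Borel measurable on the whole space. *)
    define V' where "V' x = indicator U x * (V x + M)" for x
    have V'_borel: "V' \<in> borel_measurable borel"
      using borel_measurable_continuous_on_indicator[of U "\<lambda>x. V x + M"] U_open V_cont
      by (simp add: V'_def[abs_def] continuous_on_add)
    have V'_U: "V' x = V x + M" if "x \<in> U" for x using that by (simp add: V'_def)
    have V'_cont: "continuous_on (?O r) V'"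
      using continuous_on_add[OF Fr.V_cont continuous_on_const[of _ M]] O_U[OF r] V'_U
      by (subst continuous_on_cong[OF refl, where g="\<lambda>x. V x + M"]) auto
    have sub: "\<Omega>0 \<subseteq> U" "\<Omega>1 \<subseteq> U" using O_U[of 0] O_U[of 1] O01 by auto
    have V'_nonneg: "0 \<le> V' x" if "x \<in> \<Omega>0 \<or> x \<in> \<Omega>1 \<or> x \<in> ?O r" for x
      using that F0.V_ge[of x] F1.V_ge[of x] Fr.V_ge[of x] by (auto simp: V'_def indicator_def)
    show ?thesis
    proof (rule field_le_epsilon)
      fix \<epsilon> :: real assume \<epsilon>: "\<epsilon> > 0"
      obtain w0 K0 c0 J0 where w0: "bL2 w0" "ip w0 w0 > 0" "\<And>x. 0 \<le> w0 x" "compact K0" "K0 \<subseteq> \<Omega>0" "\<And>x. x \<notin> K0 \<Longrightarrow> w0 x = 0"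
        "\<And>j. j \<ge> J0 \<Longrightarrow> E (1 / 2 ^ j) w0 \<le> c0 / 2 ^ j"
        "c0 + (\<integral>x. (F0.W x + M) * (w0 x)\<^sup>2 \<partial>lborel) \<le> (F0.lam1 + M + \<epsilon>) * ip w0 w0"
        by (rule F0.lam1_trial[OF \<epsilon>]) blast
      obtain w1 K1 c1 J1 where w1: "bL2 w1" "ip w1 w1 > 0" "\<And>x. 0 \<le> w1 x" "compact K1" "K1 \<subseteq> \<Omega>1" "\<And>x. x \<notin> K1 \<Longrightarrow> w1 x = 0"
        "\<And>j. j \<ge> J1 \<Longrightarrow> E (1 / 2 ^ j) w1 \<le> c1 / 2 ^ j"
        "c1 + (\<integral>x. (F1.W x + M) * (w1 x)\<^sup>2 \<partial>lborel) \<le> (F1.lam1 + M + \<epsilon>) * ip w1 w1"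
        by (rule F1.lam1_trial[OF \<epsilon>]) blast
      have eq0: "(\<lambda>x. (F0.W x + M) * (w0 x)\<^sup>2) = (\<lambda>x. V' x * (w0 x)\<^sup>2)"
      proof
        fix x show "(F0.W x + M) * (w0 x)\<^sup>2 = V' x * (w0 x)\<^sup>2"
          using w0(5) w0(6)[of x] sub(1) V'_U[of x] by (cases "x \<in> K0") (auto simp: F0.W_def subset_iff)
      qed
      have eq1: "(\<lambda>x. (F1.W x + M) * (w1 x)\<^sup>2) = (\<lambda>x. V' x * (w1 x)\<^sup>2)"
      proof
        fix x show "(F1.W x + M) * (w1 x)\<^sup>2 = V' x * (w1 x)\<^sup>2"
          using w1(5) w1(6)[of x] sub(2) V'_U[of x] by (cases "x \<in> K1") (auto simp: F1.W_def subset_iff)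
      qed
      have "compact (V ` (K0 \<union> K1))"
        using w0(4,5) w1(4,5) sub by (intro compact_continuous_image continuous_on_subset[OF V_cont] compact_Un) auto
      then obtain B where B: "\<And>x. x \<in> K0 \<union> K1 \<Longrightarrow> \<bar>V x\<bar> \<le> B"
        using compact_imp_bounded[of "V ` (K0 \<union> K1)"] unfolding bounded_real by blast
      have V'_le: "V' x \<le> B + M" if "x \<in> K0 \<union> K1" for x
      proof -
        have "x \<in> U" using that w0(5) w1(5) sub by blast
        then show ?thesis using B[OF that] V'_U[of x] by simp
      qed
      have conv: "(1 - r) *\<^sub>R x + r *\<^sub>R y \<in> ?O r \<and> V' ((1 - r) *\<^sub>R x + r *\<^sub>R y) \<le> (1 - r) * V' x + r * V' y"
        if x: "x \<in> K0" and y: "y \<in> K1" for x y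
      proof -
        have xy: "x \<in> \<Omega>0" "y \<in> \<Omega>1" using x y w0(5) w1(5) by auto
        then have xyU: "x \<in> U" "y \<in> U" using sub by auto
        have z: "(1 - r) *\<^sub>R x + r *\<^sub>R y \<in> ?O r" unfolding minkowski_interp_def using xy by blast
        then have zU: "(1 - r) *\<^sub>R x + r *\<^sub>R y \<in> U" using O_U[OF r] by blast
        have "V ((1 - r) *\<^sub>R x + r *\<^sub>R y) \<le> (1 - r) * V x + r * V y"
          by (rule convex_onD[OF V _ _ xyU]) (use r01 in auto)
        then show ?thesis using z unfolding V'_U[OF zU] V'_U[OF xyU(1)] V'_U[OF xyU(2)] by (simp add: algebra_simps)
      qed
      have "Fr.lam1 + M \<le> (1 - r) * (F0.lam1 + M + \<epsilon>) + r * (F1.lam1 + M + \<epsilon>)"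
      proof (rule nonlocal_brunn_minkowski[OF r01 V'_borel V'_cont O_open])
        show "0 \<le> V' x" if "x \<in> ?O r" for x using V'_nonneg that by blast
        show "(Fr.lam1 + M) * ip w w \<le> c + (\<integral>x. V' x * (w x)\<^sup>2 \<partial>lborel)"
          if w: "bL2 w" and K: "compact K" "K \<subseteq> ?O r" "\<And>x. x \<notin> K \<Longrightarrow> w x = 0"
            and E: "\<And>j. j \<ge> J \<Longrightarrow> E (1 / 2 ^ j) w \<le> c / 2 ^ j" for w c K J
        proof (rule Fr.lam1_extend[OF V'_borel _ w K E])
          show "V' x = V x + M" if "x \<in> ?O r" for x using V'_U O_U[OF r] that by blast
        qed
        show "0 \<le> V' x" "V' x \<le> B + M" if "x \<in> K0" for x using V'_nonneg[of x] V'_le[of x] w0(5) that by auto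
        show "0 \<le> V' x" "V' x \<le> B + M" if "x \<in> K1" for x using V'_nonneg[of x] V'_le[of x] w1(5) that by auto
        show "c0 + (\<integral>x. V' x * (w0 x)\<^sup>2 \<partial>lborel) \<le> (F0.lam1 + M + \<epsilon>) * ip w0 w0" using w0(8) unfolding eq0 .
        show "c1 + (\<integral>x. V' x * (w1 x)\<^sup>2 \<partial>lborel) \<le> (F1.lam1 + M + \<epsilon>) * ip w1 w1" using w1(8) unfolding eq1 .
      qed (fact conv w0 w1)+
      then show "first_eigenvalue A V (?O r) \<le> (1 - r) * first_eigenvalue A V \<Omega>0 + r * first_eigenvalue A V \<Omega>1 + \<epsilon>"
        by (simp add: algebra_simps)
    qed
  qed
qed

end
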